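(* Let $G$ be a profinite or discrete group with no non-trivial finite normal subgroups, let $p$ be a prime, and let $H$ be a subgroup of $G$ of finite index such that: (i) $O^p(H)=1$; (ii) every maximal subgroup of $H$ of finite index is just infinite; (iii) $H$ is not of quaternionic type. Then $G$ is hereditarily just infinite.
   Context: All groups are topological groups (here profinite or discrete); subgroups are required to be closed. A group $G$ is residually finite if the intersection of all its normal subgroups of finite index is trivial. $G$ is just infinite if it is infinite, residually finite, and every non-trivial normal subgroup of $G$ has finite index. $G$ is hereditarily just infinite if every finite index subgroup of $G$, including $G$ itself, is just infinite. For a prime $p$, $O^p(G)$ denotes the intersection of all normal subgroups of $G$ of index a power of $p$. Quaternionic type: let $\mathrm{Q}_{16}$ be the generalised quaternion group of order $16$. It has a faithful irreducible $4$-dimensional representation over $\mathbb{Q}_2$ (unique up to equivalence). A (just infinite pro-$2$) group $G$ is of quaternionic type if it has an open normal subgroup $A \cong \mathbb{Z}_2^4$ such that $G/A \cong \mathrm{Q}_{16}$ and $G/A$ acts faithfully on $A$ by conjugation, so that $A \otimes_{\mathbb{Z}_2} \mathbb{Q}_2$ is this $4$-dimensional representation.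
   Formalization: The formal statement additionally assumes that G is non-trivial: for G = H = 1 all hypotheses hold (condition (ii) vacuously), but G is finite and hence not just infinite. *)

theory Defs
  imports
    "HOL-Analysis.Analysis"
    "HOL-Algebra.Algebra"
    "HOL-Computational_Algebra.Primes"
begin

section \<open>Topological groups\<close>

locale topological_group = group G for G :: "('a, 'b) monoid_scheme" (structure) +
  fixes T :: "'a topology"
  assumes topspace_eq: "topspace T = carrier G"
    and continuous_mult: "continuous_map (prod_topology T T) T (\<lambda>(x, y). x \<otimes> y)"
    and continuous_inv: "continuous_map T T (\<lambda>x. inv x)"

definition discrete_group :: "('a, 'b) monoid_scheme \<Rightarrow> 'a topology \<Rightarrow> bool" where
  "discrete_group G T \<longleftrightarrow> topological_group G T \<and> T = discrete_topology (carrier G)"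

definition totally_disconnected_space :: "'a topology \<Rightarrow> bool" where
  "totally_disconnected_space T \<longleftrightarrow> (\<forall>x\<in>topspace T. connected_component_of_set T x = {x})"

definition profinite_group :: "('a, 'b) monoid_scheme \<Rightarrow> 'a topology \<Rightarrow> bool" where
  "profinite_group G T \<longleftrightarrow> topological_group G T \<and>
     compact_space T \<and> Hausdorff_space T \<and> totally_disconnected_space T"

text \<open>A subgroup \<open>H\<close> of \<open>(G, T)\<close>, regarded as a topological group, is
  \<open>(G\<lparr>carrier := H\<rparr>, subtopology T H)\<close>. Only closed subgroups are considered.\<close>

definition closed_subgroup :: "'a set \<Rightarrow> ('a, 'b) monoid_scheme \<Rightarrow> 'a topology \<Rightarrow> bool" where
  "closed_subgroup H G T \<longleftrightarrow> subgroup H G \<and> closedin T H"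

definition closed_normal_subgroup :: "'a set \<Rightarrow> ('a, 'b) monoid_scheme \<Rightarrow> 'a topology \<Rightarrow> bool" where
  "closed_normal_subgroup N G T \<longleftrightarrow> N \<lhd> G \<and> closedin T N"

definition finite_index :: "'a set \<Rightarrow> ('a, 'b) monoid_scheme \<Rightarrow> bool" where
  "finite_index H G \<longleftrightarrow> finite (rcosets\<^bsub>G\<^esub> H)"

definition maximal_subgroup :: "'a set \<Rightarrow> ('a, 'b) monoid_scheme \<Rightarrow> 'a topology \<Rightarrow> bool" where
  "maximal_subgroup M G T \<longleftrightarrow> closed_subgroup M G T \<and> M \<noteq> carrier G \<and>
     (\<forall>K. closed_subgroup K G T \<and> M \<subseteq> K \<longrightarrow> K = M \<or> K = carrier G)"

section \<open>Just infinite groups\<close>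

definition residually_finite :: "('a, 'b) monoid_scheme \<Rightarrow> 'a topology \<Rightarrow> bool" where
  "residually_finite G T \<longleftrightarrow>
     \<Inter>{N. closed_normal_subgroup N G T \<and> finite_index N G} = {\<one>\<^bsub>G\<^esub>}"

definition just_infinite :: "('a, 'b) monoid_scheme \<Rightarrow> 'a topology \<Rightarrow> bool" where
  "just_infinite G T \<longleftrightarrow> infinite (carrier G) \<and> residually_finite G T \<and>
     (\<forall>N. closed_normal_subgroup N G T \<and> N \<noteq> {\<one>\<^bsub>G\<^esub>} \<longrightarrow> finite_index N G)"

definition hereditarily_just_infinite :: "('a, 'b) monoid_scheme \<Rightarrow> 'a topology \<Rightarrow> bool" where
  "hereditarily_just_infinite G T \<longleftrightarrow>
     (\<forall>H. closed_subgroup H G T \<and> finite_index H G \<longrightarrow>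
        just_infinite (G\<lparr>carrier := H\<rparr>) (subtopology T H))"

text \<open>The subgroup $O^p(G)$. The condition \<open>card (rcosets N) = p ^ k\<close> implies finite index
  when \<open>p > 0\<close>, as infinite sets have \<open>card\<close> zero.\<close>

definition p_residual :: "nat \<Rightarrow> ('a, 'b) monoid_scheme \<Rightarrow> 'a topology \<Rightarrow> 'a set" where
  "p_residual p G T =
     \<Inter>{N. closed_normal_subgroup N G T \<and> (\<exists>k. card (rcosets\<^bsub>G\<^esub> N) = p ^ k)}"

definition pro_p_group :: "nat \<Rightarrow> ('a, 'b) monoid_scheme \<Rightarrow> 'a topology \<Rightarrow> bool" where
  "pro_p_group p G T \<longleftrightarrow> profinite_group G T \<and>
     (\<forall>N. N \<lhd> G \<and> openin T N \<longrightarrow> (\<exists>k. card (rcosets\<^bsub>G\<^esub> N) = p ^ k))"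

section \<open>Groups of quaternionic type\<close>

text \<open>The additive group of the \<open>p\<close>-adic integers, as the inverse limit of the groups
  $\mathbb{Z}/p^n$: coherent sequences of residues, with the topology induced from the product of
  the discrete topologies.\<close>

definition padic_int_carrier :: "nat \<Rightarrow> (nat \<Rightarrow> int) set" where
  "padic_int_carrier p =
     {x. (\<forall>n. x n \<in> carrier (integer_mod_group (p ^ n))) \<and>
         (\<forall>n. x (Suc n) mod int (p ^ n) = x n)}"

definition padic_int_group :: "nat \<Rightarrow> (nat \<Rightarrow> int) monoid" where
  "padic_int_group p =
     (product_group UNIV (\<lambda>n. integer_mod_group (p ^ n)))\<lparr>carrier := padic_int_carrier p\<rparr>"

definition padic_int_topology :: "nat \<Rightarrow> (nat \<Rightarrow> int) topology" where
  "padic_int_topology p =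
     subtopology
       (product_topology (\<lambda>n. discrete_topology (carrier (integer_mod_group (p ^ n)))) UNIV)
       (padic_int_carrier p)"

text \<open>The generalised quaternion group of order 16,
  $\langle x, y \mid x^8 = 1,\ y^2 = x^4,\ y^{-1} x y = x^{-1} \rangle$;
  the pair \<open>(i, j)\<close> stands for $x^i y^j$ with \<open>0 \<le> i < 8\<close> and \<open>0 \<le> j < 2\<close>. The summand \<open>4 * j * l\<close>
  below accounts for the relation $y^2 = x^4$.\<close>

definition Q16 :: "(int \<times> int) monoid" where
  "Q16 = \<lparr>carrier = {0..<8} \<times> {0..<2},
          mult = (\<lambda>(i, j) (k, l). ((i + (if j = 0 then k else - k) + 4 * j * l) mod 8, (j + l) mod 2)),
          one = (0, 0)\<rparr>"

text \<open>Faithfulness of the conjugation action of \<open>G/A\<close> on \<open>A\<close> says that an element of \<open>G\<close>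
  centralising \<open>A\<close> lies in \<open>A\<close>. No condition on the representation $A \otimes \mathbb{Q}_2$ is
  needed: a faithful 4-dimensional representation of the generalised quaternion group of order 16
  over $\mathbb{Q}_2$ is necessarily the irreducible one.\<close>

definition quaternionic_type :: "('a, 'b) monoid_scheme \<Rightarrow> 'a topology \<Rightarrow> bool" where
  "quaternionic_type G T \<longleftrightarrow> just_infinite G T \<and> pro_p_group 2 G T \<and>
     (\<exists>A. A \<lhd> G \<and> openin T A \<and>
        (\<exists>f. f \<in> iso (G\<lparr>carrier := A\<rparr>) (product_group {..<4::nat} (\<lambda>_. padic_int_group 2)) \<and>
             homeomorphic_map (subtopology T A)
               (product_topology (\<lambda>_. padic_int_topology 2) {..<4::nat}) f) \<and>
        (G Mod A) \<cong> Q16 \<and>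
        (\<forall>g\<in>carrier G. (\<forall>a\<in>A. g \<otimes>\<^bsub>G\<^esub> a \<otimes>\<^bsub>G\<^esub> inv\<^bsub>G\<^esub> g = a) \<longrightarrow> g \<in> A))"

section \<open>Sanity checks for the concrete groups\<close>

lemma topspace_padic_int_topology: "topspace (padic_int_topology p) = carrier (padic_int_group p)"
  by (auto simp: padic_int_topology_def padic_int_group_def padic_int_carrier_def PiE_def)

lemma subgroup_padic_int_carrier:
  assumes "p > 0"
  shows "subgroup (padic_int_carrier p) (product_group UNIV (\<lambda>n. integer_mod_group (p ^ n)))"
proof -
  interpret G: group "product_group UNIV (\<lambda>n. integer_mod_group (p ^ n))"
    by simp
  have red: "(a mod int (p ^ Suc n)) mod int (p ^ n) = a mod int (p ^ n)" for a n
    by (rule mod_mod_cancel) simp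
  show ?thesis
  proof (rule G.subgroupI)
    show "padic_int_carrier p \<subseteq> carrier (product_group UNIV (\<lambda>n. integer_mod_group (p ^ n)))"
      by (auto simp: padic_int_carrier_def)
    have "(\<lambda>_. 0) \<in> padic_int_carrier p"
      by (simp add: padic_int_carrier_def)
    then show "padic_int_carrier p \<noteq> {}" by blast
  next
    fix x assume x: "x \<in> padic_int_carrier p"
    then have xn: "x n \<in> carrier (integer_mod_group (p ^ n))" for n
      by (simp add: padic_int_carrier_def)
    have eq: "x (Suc n) mod int (p ^ n) = x n" for n
      using x by (simp add: padic_int_carrier_def)
    have inv: "inv\<^bsub>product_group UNIV (\<lambda>n. integer_mod_group (p ^ n))\<^esub> x
                 = (\<lambda>n. (- x n) mod int (p ^ n))"
      using xn by (subst inv_product_group) auto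
    have "((- x (Suc n)) mod int (p ^ Suc n)) mod int (p ^ n) = (- x n) mod int (p ^ n)" for n
      using mod_minus_eq[of "x (Suc n)" "int (p ^ n)"] by (simp only: red eq)
    then show "inv\<^bsub>product_group UNIV (\<lambda>n. integer_mod_group (p ^ n))\<^esub> x \<in> padic_int_carrier p"
      using assms unfolding inv padic_int_carrier_def
      by (auto simp: carrier_integer_mod_group simp del: power_Suc of_nat_power)
  next
    fix x y assume x: "x \<in> padic_int_carrier p" and y: "y \<in> padic_int_carrier p"
    have eq: "x (Suc n) mod int (p ^ n) = x n" "y (Suc n) mod int (p ^ n) = y n" for n
      using x y by (auto simp: padic_int_carrier_def)
    have "((x (Suc n) + y (Suc n)) mod int (p ^ Suc n)) mod int (p ^ n)
            = (x n + y n) mod int (p ^ n)" for n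
      using mod_add_eq[of "x (Suc n)" "int (p ^ n)" "y (Suc n)"] by (simp only: red eq)
    then show "x \<otimes>\<^bsub>product_group UNIV (\<lambda>n. integer_mod_group (p ^ n))\<^esub> y \<in> padic_int_carrier p"
      using assms unfolding padic_int_carrier_def
      by (auto simp: carrier_integer_mod_group simp del: power_Suc of_nat_power)
  qed
qed

lemma group_padic_int_group: "p > 0 \<Longrightarrow> group (padic_int_group p)"
  unfolding padic_int_group_def
  by (rule subgroup.subgroup_is_group[OF subgroup_padic_int_carrier]) auto

lemma carrier_Q16: "carrier Q16 = {0..<8} \<times> {0, 1}"
  by (auto simp: Q16_def)

lemma order_Q16: "order Q16 = 16"
  by (simp add: order_def Q16_def)

lemma group_Q16: "group Q16"
proof (rule groupI)
  show "\<one>\<^bsub>Q16\<^esub> \<in> carrier Q16" by (simp add: Q16_def)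
next
  fix x y assume "x \<in> carrier Q16" "y \<in> carrier Q16"
  then show "x \<otimes>\<^bsub>Q16\<^esub> y \<in> carrier Q16" by (auto simp: Q16_def)
next
  fix x y z assume "x \<in> carrier Q16" "y \<in> carrier Q16" "z \<in> carrier Q16"
  then obtain a i b j c k where xyz: "x = (a, i)" "y = (b, j)" "z = (c, k)"
    and "i \<in> {0, 1}" "j \<in> {0, 1}" "k \<in> {0, 1}"
    by (auto simp: carrier_Q16)
  then show "x \<otimes>\<^bsub>Q16\<^esub> y \<otimes>\<^bsub>Q16\<^esub> z = x \<otimes>\<^bsub>Q16\<^esub> (y \<otimes>\<^bsub>Q16\<^esub> z)"
    by (auto simp: Q16_def mod_simps algebra_simps) (simp_all add: mod_eq_dvd_iff, presburger+)
next
  fix x assume "x \<in> carrier Q16"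
  then show "\<one>\<^bsub>Q16\<^esub> \<otimes>\<^bsub>Q16\<^esub> x = x" by (auto simp: Q16_def)
next
  fix x assume x: "x \<in> carrier Q16"
  then obtain a i where a: "x = (a, i)" "i = 0 \<or> i = 1" by (auto simp: carrier_Q16)
  let ?y = "if i = 0 then ((- a) mod 8, 0) else ((a + 4) mod 8, 1)"
  have "?y \<in> carrier Q16" "?y \<otimes>\<^bsub>Q16\<^esub> x = \<one>\<^bsub>Q16\<^esub>"
    using x a(2) by (auto simp: Q16_def a(1) mod_simps) presburger
  then show "\<exists>y\<in>carrier Q16. y \<otimes>\<^bsub>Q16\<^esub> x = \<one>\<^bsub>Q16\<^esub>" by blast
qed

lemma Q16_relations:
  defines "x \<equiv> (1, 0)" and "y \<equiv> (0, 1)"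
  shows "x [^]\<^bsub>Q16\<^esub> (8::nat) = \<one>\<^bsub>Q16\<^esub>"
    and "y [^]\<^bsub>Q16\<^esub> (2::nat) = x [^]\<^bsub>Q16\<^esub> (4::nat)"
    and "x \<otimes>\<^bsub>Q16\<^esub> y = y \<otimes>\<^bsub>Q16\<^esub> inv\<^bsub>Q16\<^esub> x"
    and "i < 8 \<Longrightarrow> j < 2 \<Longrightarrow>
           (int i, int j) = x [^]\<^bsub>Q16\<^esub> (i::nat) \<otimes>\<^bsub>Q16\<^esub> y [^]\<^bsub>Q16\<^esub> (j::nat)"
proof -
  interpret group Q16 by (rule group_Q16)
  have px: "x [^]\<^bsub>Q16\<^esub> n = (int n mod 8, 0)" for n :: nat
    by (induction n) (auto simp: x_def Q16_def mod_simps add.commute)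
  have py: "y [^]\<^bsub>Q16\<^esub> (0::nat) = (0, 0)" "y [^]\<^bsub>Q16\<^esub> (Suc 0) = (0, 1)"
       "y [^]\<^bsub>Q16\<^esub> (2::nat) = (4, 0)"
    by (simp_all add: y_def Q16_def numeral_2_eq_2)
  have ix: "inv\<^bsub>Q16\<^esub> x = (7, 0)"
    by (rule inv_equality) (simp_all add: x_def Q16_def)
  show "x [^]\<^bsub>Q16\<^esub> (8::nat) = \<one>\<^bsub>Q16\<^esub>"
    by (simp add: px) (simp add: Q16_def)
  show "y [^]\<^bsub>Q16\<^esub> (2::nat) = x [^]\<^bsub>Q16\<^esub> (4::nat)"
    by (simp add: px py)
  show "x \<otimes>\<^bsub>Q16\<^esub> y = y \<otimes>\<^bsub>Q16\<^esub> inv\<^bsub>Q16\<^esub> x"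
    by (simp add: ix) (simp add: x_def y_def Q16_def)
  show "(int i, int j) = x [^]\<^bsub>Q16\<^esub> i \<otimes>\<^bsub>Q16\<^esub> y [^]\<^bsub>Q16\<^esub> j" if "i < 8" "j < 2"
  proof -
    have "j = 0 \<or> j = Suc 0" using that by auto
    then show ?thesis using that by (auto simp: px py) (auto simp: Q16_def y_def)
  qed
qed

end

theory Submission
  imports Defs
begin

text \<open>Since \<open>H\<close> is residually finite and its maximal subgroups of finite index are just infinite, so is
  \<open>H\<close>. Suppose first that \<open>H\<close> has no abelian normal subgroup, and let \<open>N\<close> be a normal subgroup of
  infinite index of a finite index subgroup. A nontrivial intersection \<open>B\<close> of as many conjugates of
  \<open>N\<close> as possible meets its other conjugates trivially, so it commutes with them. The normaliser of \<open>B\<close>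
  lies in a maximal subgroup \<open>M\<close>, and for \<open>g \<notin> M\<close> the conjugate of \<open>B\<close> by \<open>g\<close> centralises all
  \<open>M\<close>-conjugates of \<open>B\<close>, which is impossible in the just infinite group \<open>M\<close>.

  Otherwise \<open>H\<close> has a self-centralising torsion-free abelian normal subgroup \<open>A\<close> of finite index, and
  \<open>P = H/A\<close> is a \<open>p\<close>-group because $O^p(H) = 1$. The nontrivial subgroups of \<open>A\<close> invariant under
  \<open>P\<close> or one of its maximal subgroups have finite index. If \<open>P\<close> is cyclic, this makes every nontrivial
  subgroup of \<open>A\<close> have finite index. All other \<open>p\<close>-groups are excluded by constructing invariant
  subgroups that are too small, except for $Q_{16}$ acting on $\mathbb{Z}_2^4$, the quaternionic type.

  In the passage to \<open>G\<close>, a finite normal subgroup of a finite index subgroup consists of torsion elements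
  of the centraliser of a normal subgroup of \<open>G\<close> inside \<open>H\<close>, and these torsion elements form a
  finite normal subgroup of \<open>G\<close>.\<close>

section \<open>Finite p-groups\<close>

text \<open>Why the exception is exactly Q16 acting on a lattice of rank 4: let zeta be the root of
  unity by which the cyclic subgroup of index 2, generated by \<open>b\<close>, acts, and let
  \<open>x\<close> lie outside it. The module generated by one vector over the powers of zeta^2 has
  infinite index, so it must not be stable under \<open>x\<close>, since \<open>b^2\<close> and
  \<open>x\<close> generate a maximal subgroup. If \<open>x^2 = 1\<close>, a vector fixed by
  \<open>x\<close> is such a forbidden vector. If \<open>x^2\<close> acts as -1, one needs an
  element U with U conj(U) = 15: the map U x then has square -15, a square in the 2-adic integers,
  and its eigenvectors are forbidden. A suitable U exists in Z[zeta_8], and zeta_8 is a power of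
  zeta^2 only if \<open>b\<close> has order at least 16. The group of order 8 falls to a congruence
  modulo 4, the discrete topology to positivity of complex norms; order 16 in the compact case
  survives both. No p-adic coefficients occur. The group \<open>A\<close> is a module over Z[X], and
  statements over the p-adic integers are congruences modulo \<open>p^k A\<close> for all
  \<open>k\<close>. This treats both topologies alike; compactness enters where a limit has to
  exist.\<close>

context group
begin

definition conj_by :: "'a \<Rightarrow> 'a \<Rightarrow> 'a" where
  "conj_by g a = g \<otimes> a \<otimes> inv g"

definition cyc :: "'a \<Rightarrow> 'a set" where
  "cyc b = range (\<lambda>i::int. b [^] i)"

lemma conj_by_closed [simp]: "g \<in> carrier G \<Longrightarrow> a \<in> carrier G \<Longrightarrow> conj_by g a \<in> carrier G"
  by (simp add: conj_by_def)

lemma conj_by_mult: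
  "g \<in> carrier G \<Longrightarrow> a \<in> carrier G \<Longrightarrow> b \<in> carrier G \<Longrightarrow>
    conj_by g (a \<otimes> b) = conj_by g a \<otimes> conj_by g b"
  by (simp add: conj_by_def m_assoc inv_solve_left)

lemma conj_by_conj_by:
  "g \<in> carrier G \<Longrightarrow> h \<in> carrier G \<Longrightarrow> a \<in> carrier G \<Longrightarrow>
    conj_by g (conj_by h a) = conj_by (g \<otimes> h) a"
  by (simp add: conj_by_def m_assoc inv_mult_group)

lemma conj_by_one_left [simp]: "a \<in> carrier G \<Longrightarrow> conj_by \<one> a = a"
  by (simp add: conj_by_def)

lemma conj_by_one_right [simp]: "g \<in> carrier G \<Longrightarrow> conj_by g \<one> = \<one>"
  by (simp add: conj_by_def)

lemma conj_by_inv_left [simp]: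
  "g \<in> carrier G \<Longrightarrow> a \<in> carrier G \<Longrightarrow> conj_by (inv g) (conj_by g a) = a"
  "g \<in> carrier G \<Longrightarrow> a \<in> carrier G \<Longrightarrow> conj_by g (conj_by (inv g) a) = a"
  by (simp_all add: conj_by_conj_by)

lemma conj_by_inj:
  "g \<in> carrier G \<Longrightarrow> a \<in> carrier G \<Longrightarrow> b \<in> carrier G \<Longrightarrow> conj_by g a = conj_by g b \<Longrightarrow> a = b"
  by (metis conj_by_inv_left(1))

lemma conj_by_hom: "g \<in> carrier G \<Longrightarrow> conj_by g \<in> hom G G"
  by (simp add: hom_def conj_by_mult)

lemma conj_by_inv: "g \<in> carrier G \<Longrightarrow> a \<in> carrier G \<Longrightarrow> conj_by g (inv a) = inv (conj_by g a)"
  by (simp add: conj_by_def m_assoc inv_mult_group)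

lemma conj_by_nat_pow:
  "g \<in> carrier G \<Longrightarrow> a \<in> carrier G \<Longrightarrow> conj_by g (a [^] (n::nat)) = conj_by g a [^] n"
  by (induction n) (simp_all add: conj_by_mult)

lemma conj_by_int_pow:
  "g \<in> carrier G \<Longrightarrow> a \<in> carrier G \<Longrightarrow> conj_by g (a [^] (n::int)) = conj_by g a [^] n"
  using hom_int_pow[OF conj_by_hom] is_group by metis

lemma conj_by_eq_iff:
  "g \<in> carrier G \<Longrightarrow> a \<in> carrier G \<Longrightarrow> b \<in> carrier G \<Longrightarrow> conj_by g a = b \<longleftrightarrow> g \<otimes> a = b \<otimes> g"
  by (simp add: conj_by_def) (metis inv_solve_right m_closed)

lemma cyc_closed: "b \<in> carrier G \<Longrightarrow> cyc b \<subseteq> carrier G"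
  by (auto simp: cyc_def)

lemma cyc_I [intro]: "b [^] (i::int) \<in> cyc b"
  by (auto simp: cyc_def)

lemma subgroup_cyc: "b \<in> carrier G \<Longrightarrow> subgroup (cyc b) G"
  using generate_is_subgroup[of "{b}"] generate_pow[of b] by (simp add: cyc_def full_SetCompr_eq)

lemma self_in_cyc: "b \<in> carrier G \<Longrightarrow> b \<in> cyc b"
  using cyc_I[of b 1] by simp

lemma cyc_subset_iff: "b \<in> carrier G \<Longrightarrow> subgroup K G \<Longrightarrow> cyc b \<subseteq> K \<longleftrightarrow> b \<in> K"
  using self_in_cyc subgroup_int_pow_closed by (auto simp: cyc_def)

text \<open>The class equation inside \<open>N\<close>: the conjugacy classes with more than one
  element have size divisible by \<open>p\<close>, and so has \<open>N\<close>; hence the class of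
  the identity cannot be the only one of size 1.\<close>

lemma p_group_normal_center:
  assumes p: "Factorial_Ring.prime (p::nat)" and ord: "order G = p ^ k"
    and N: "N \<lhd> G" and nt: "N \<noteq> {\<one>}"
  obtains y where "y \<in> N" "y \<noteq> \<one>" "\<And>g. g \<in> carrier G \<Longrightarrow> g \<otimes> y = y \<otimes> g"
proof -
  note found = that
  interpret act: group_action G "carrier G" "\<lambda>g. \<lambda>h\<in>carrier G. g \<otimes> h \<otimes> inv g"
    by (rule action_by_conjugation)
  define Orb where "Orb = orbit G (\<lambda>g. \<lambda>h\<in>carrier G. g \<otimes> h \<otimes> inv g)"
  have Orb: "Orb x = {conj_by g x | g. g \<in> carrier G}" if "x \<in> carrier G" for x
    using that by (auto simp: Orb_def orbit_def conj_by_def)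
  have fin: "finite (carrier G)"
    using ord p by (metis card.infinite order_def power_not_zero prime_gt_0_nat not_gr_zero)
  have sN: "subgroup N G" by (rule normal_imp_subgroup[OF N])
  then have NG: "N \<subseteq> carrier G" by (rule subgroup.subset)
  have finN: "finite N" using fin NG finite_subset by blast
  have ON: "Orb x \<subseteq> N" if "x \<in> N" for x
    using that N NG subsetD[OF NG that] by (auto simp: Orb conj_by_def normal_inv_iff)
  have xO: "x \<in> Orb x" if "x \<in> carrier G" for x
    unfolding Orb[OF that] using conj_by_one_left[OF that] one_closed by (metis (mono_tags, lifting) mem_Collect_eq)
  have cardO: "card (Orb x) dvd p ^ k" if "x \<in> carrier G" for x
    unfolding Orb_def by (rule dvdI[OF trans[OF sym[OF ord] sym[OF act.orbit_stabilizer_theorem[OF that]]]])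
  have disj: "Orb x = Orb y" if "x \<in> N" "y \<in> N" "Orb x \<inter> Orb y \<noteq> {}" for x y
  proof -
    have "Orb x \<in> orbits G (carrier G) (\<lambda>g. \<lambda>h\<in>carrier G. g \<otimes> h \<otimes> inv g)"
      "Orb y \<in> orbits G (carrier G) (\<lambda>g. \<lambda>h\<in>carrier G. g \<otimes> h \<otimes> inv g)"
      using that NG by (auto simp: orbits_def Orb_def)
    then show ?thesis using act.disjoint_union that(3) by blast
  qed
  have "card N dvd p ^ k"
    using lagrange[OF sN] ord by (intro dvdI[of _ _ "card (rcosets N)"]) (simp add: mult.commute)
  then obtain m where m: "card N = p ^ m" using p divides_primepow_nat by blast
  have "card N \<noteq> 1"
    using nt subgroup.one_closed[OF sN] by (metis card_1_singletonE singletonD)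
  then have pN: "p dvd card N" using m by (cases m) auto
  show ?thesis
  proof (rule ccontr)
    assume neg: "\<not> thesis"
    have big: "p dvd card (Orb x)" if x: "x \<in> N" "x \<noteq> \<one>" for x
    proof -
      have xG: "x \<in> carrier G" using x NG by auto
      have "Orb x \<noteq> {x}"
      proof
        assume eq: "Orb x = {x}"
        have comm: "g \<otimes> x = x \<otimes> g" if "g \<in> carrier G" for g
        proof -
          have "conj_by g x \<in> Orb x" using Orb[OF xG] that by auto
          then have "conj_by g x = x" using eq by simp
          then show ?thesis using conj_by_eq_iff[OF that xG xG] by simp
        qed
        from found[OF x comm] neg show False by simp
      qed
      then have "card (Orb x) \<noteq> 1" using xO[OF xG] by (metis card_1_singletonE singletonD)
      moreover obtain j where "card (Orb x) = p ^ j" using cardO[OF xG] p divides_primepow_nat by blast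
      ultimately show ?thesis by (cases j) auto
    qed
    have O1: "Orb \<one> = {\<one>}" using Orb[OF one_closed] by (auto intro!: exI[of _ \<one>])
    have "N = \<Union> (Orb ` N)" using ON xO NG by blast
    moreover have "card (\<Union> (Orb ` N)) = (\<Sum>C\<in>Orb ` N. card C)"
    proof (rule card_Union_disjoint)
      show "pairwise disjnt (Orb ` N)"
      proof (intro pairwiseI, clarify)
        fix x y assume "x \<in> N" "y \<in> N" "Orb x \<noteq> Orb y"
        then show "disjnt (Orb x) (Orb y)" using disj[of x y] by (auto simp: disjnt_def)
      qed
      fix C assume "C \<in> Orb ` N"
      then have "C \<subseteq> N" using ON by auto
      then show "finite C" using finN by (rule finite_subset)
    qed
    ultimately have "card N = (\<Sum>C\<in>Orb ` N. card C)" by simp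
    also have "\<dots> = card (Orb \<one>) + (\<Sum>C\<in>Orb ` N - {Orb \<one>}. card C)"
      using finN subgroup.one_closed[OF sN] by (intro sum.remove) auto
    finally have "card N = 1 + (\<Sum>C\<in>Orb ` N - {Orb \<one>}. card C)" by (simp add: O1)
    moreover have "p dvd (\<Sum>C\<in>Orb ` N - {Orb \<one>}. card C)"
      using big by (intro dvd_sum) auto
    ultimately have "p dvd 1" using pN dvd_add_left_iff[of p _ 1] by simp
    then show False using p by simp
  qed
qed

text \<open>The centre of \<open>G Mod B\<close> meets the image of \<open>N\<close>. A lift of a
  nontrivial element there is raised to the last power of \<open>p\<close> that still leaves it
  outside \<open>B\<close>, which gives order \<open>p\<close> modulo \<open>B\<close>.\<close>

lemma p_group_central_mod:
  assumes p: "Factorial_Ring.prime (p::nat)" and ord: "order G = p ^ k"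
    and B: "B \<lhd> G" and N: "N \<lhd> G" and BN: "B \<subset> N"
  obtains y where "y \<in> N" "y \<notin> B" "y [^] p \<in> B"
    "\<And>g. g \<in> carrier G \<Longrightarrow> conj_by g y \<otimes> inv y \<in> B"
proof -
  interpret B: normal B G by (rule B)
  have sN: "subgroup N G" by (rule normal_imp_subgroup[OF N])
  then have NG: "N \<subseteq> carrier G" by (rule subgroup.subset)
  interpret Q: group "G Mod B" by (rule B.factorgroup_is_group)
  interpret h: group_hom G "G Mod B" "\<lambda>x. B #> x"
    using B.r_coset_hom_Mod by (simp add: group_hom_def group_hom_axioms_def B.factorgroup_is_group)
  have "order (G Mod B) * card B = p ^ k"
    using lagrange[OF B.subgroup_axioms] ord by (simp add: order_def FactGroup_def)
  then have "order (G Mod B) dvd p ^ k" by (intro dvdI[of _ _ "card B"]) simp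
  then obtain k' where k': "order (G Mod B) = p ^ k'" using p divides_primepow_nat by blast
  have carQ: "carrier (G Mod B) = (\<lambda>x. B #> x) ` carrier G"
    by (auto simp: FactGroup_def RCOSETS_def)
  have N': "(\<lambda>x. B #> x) ` N \<lhd> G Mod B"
  proof (subst Q.normal_inv_iff, intro conjI ballI)
    show "subgroup ((\<lambda>x. B #> x) ` N) (G Mod B)" by (rule h.subgroup_img_is_subgroup[OF sN])
    fix U Y assume "U \<in> carrier (G Mod B)" "Y \<in> (\<lambda>x. B #> x) ` N"
    then obtain g y where gy: "g \<in> carrier G" "U = B #> g" "y \<in> N" "Y = B #> y"
      using carQ by auto
    have "U \<otimes>\<^bsub>G Mod B\<^esub> Y \<otimes>\<^bsub>G Mod B\<^esub> inv\<^bsub>G Mod B\<^esub> U = B #> (g \<otimes> y \<otimes> inv g)"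
    proof -
      have "y \<in> carrier G" using gy NG by auto
      then show ?thesis using gy h.hom_mult[of "g \<otimes> y" "inv g"] h.hom_mult[of g y] h.hom_inv[of g] by simp
    qed
    moreover have "g \<otimes> y \<otimes> inv g \<in> N" using N gy by (simp add: normal_inv_iff)
    ultimately show "U \<otimes>\<^bsub>G Mod B\<^esub> Y \<otimes>\<^bsub>G Mod B\<^esub> inv\<^bsub>G Mod B\<^esub> U \<in> (\<lambda>x. B #> x) ` N" by blast
  qed
  have coset1: "B #> x = B \<longleftrightarrow> x \<in> B" if "x \<in> carrier G" for x
    using coset_join1[OF _ that B.subgroup_axioms] coset_join2[OF that B.subgroup_axioms] by blast
  have "(\<lambda>x. B #> x) ` N \<noteq> {\<one>\<^bsub>G Mod B\<^esub>}"
  proof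
    assume eq: "(\<lambda>x. B #> x) ` N = {\<one>\<^bsub>G Mod B\<^esub>}"
    obtain x where x: "x \<in> N" "x \<notin> B" using BN by blast
    then have "B #> x = B" using eq by (auto simp: FactGroup_def)
    then show False using coset1 x NG by blast
  qed
  then obtain Y where Y: "Y \<in> (\<lambda>x. B #> x) ` N" "Y \<noteq> \<one>\<^bsub>G Mod B\<^esub>"
    "\<And>U. U \<in> carrier (G Mod B) \<Longrightarrow> U \<otimes>\<^bsub>G Mod B\<^esub> Y = Y \<otimes>\<^bsub>G Mod B\<^esub> U"
    by (rule Q.p_group_normal_center[OF p k' N']) (rule that; assumption)
  then obtain y where y: "y \<in> N" "Y = B #> y" by auto
  have yG: "y \<in> carrier G" using y NG by auto
  have yB: "y \<notin> B" using Y(2) y coset1[OF yG] by (simp add: FactGroup_def)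
  have "y [^] p ^ k = \<one>" using ord yG pow_order_eq_1 by metis
  then have ex: "\<exists>j. y [^] p ^ j \<in> B" using B.one_closed by metis
  define j where "j = (LEAST j. y [^] p ^ j \<in> B)"
  have j: "y [^] p ^ j \<in> B" unfolding j_def using ex by (rule LeastI_ex)
  have "j \<noteq> 0" using j yB yG by (cases j) auto
  then obtain i where i: "j = Suc i" by (cases j) auto
  define w where "w = y [^] p ^ i"
  have wG: "w \<in> carrier G" using yG by (simp add: w_def)
  have "w \<in> N" unfolding w_def using subgroup_int_pow_closed[OF sN y(1), of "int (p ^ i)"] by (simp only: int_pow_int)
  moreover have "w \<notin> B" unfolding w_def using not_less_Least[of i "\<lambda>j. y [^] p ^ j \<in> B"] i
    by (simp add: j_def)
  moreover have "w [^] p \<in> B" using j yG by (simp add: w_def nat_pow_pow i mult.commute)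
  moreover have "conj_by g w \<otimes> inv w \<in> B" if g: "g \<in> carrier G" for g
  proof -
    have W: "B #> w = Y [^]\<^bsub>G Mod B\<^esub> (p ^ i)"
      unfolding w_def y(2) by (rule B.FactGroup_pow[OF yG, symmetric])
    have gQ: "B #> g \<in> carrier (G Mod B)" using g carQ by auto
    have YQ: "Y \<in> carrier (G Mod B)" using carQ y yG by auto
    have "Y [^]\<^bsub>G Mod B\<^esub> (p ^ i) \<otimes>\<^bsub>G Mod B\<^esub> (B #> g) = (B #> g) \<otimes>\<^bsub>G Mod B\<^esub> Y [^]\<^bsub>G Mod B\<^esub> (p ^ i)"
      using Q.group_commutes_pow[OF Y(3)[OF gQ, symmetric] YQ gQ] by simp
    then have "B #> (w \<otimes> g) = B #> (g \<otimes> w)"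
      unfolding W[symmetric] h.hom_mult[OF wG g] h.hom_mult[OF g wG] .
    then have "g \<otimes> w \<in> B #> (w \<otimes> g)"
      using rcos_self[OF _ B.subgroup_axioms, of "g \<otimes> w"] g wG by simp
    then obtain c where c: "c \<in> B" "g \<otimes> w = c \<otimes> (w \<otimes> g)" by (auto simp: r_coset_def)
    have cG: "c \<in> carrier G" using c by auto
    have "conj_by g w \<otimes> inv w = c"
      using c cG g wG by (simp add: conj_by_def m_assoc)
    then show ?thesis using c by simp
  qed
  ultimately show ?thesis by (rule that)
qed

end

section \<open>Congruences, and powers in cyclic extensions\<close>

lemma coprime_inverse_int:
  fixes a b :: int
  assumes "coprime a b"
  obtains x where "b dvd a * x - 1"
proof -
  obtain u v where "u * a + v * b = 1" using bezout_int[of a b] assms by auto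
  then have "a * u - 1 = b * (- v)" by (simp add: algebra_simps)
  then show ?thesis by (intro that dvdI)
qed

lemma int_pow_sum_eq:
  fixes l :: int
  shows "(l - 1) * (\<Sum>i<m. l ^ i) = l ^ m - 1"
  by (induction m) (simp_all add: algebra_simps)

text \<open>With \<open>l = 1 + p t\<close> and \<open>p\<close> odd, the linear terms add up to
  \<open>p t * p (p - 1) / 2\<close>, which vanishes modulo \<open>p^2\<close>. For
  \<open>p = 2\<close> the sum is \<open>1 + l\<close>, which is twice an odd number only if
  \<open>l\<close> is 1 modulo 4; this is the origin of the modulus 4.\<close>

lemma unit_cofactor_of_geometric_sum:
  fixes l :: int
  assumes p: "Factorial_Ring.prime (p::nat)" and l: "int (if p = 2 then 4 else p) dvd l - 1"
  obtains u where "(\<Sum>i<p. l ^ i) = int p * u" "coprime u (int p)"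
proof (cases "p = 2")
  case True
  with l obtain t where "l = 1 + 4 * t" by (auto simp: dvd_def algebra_simps)
  then have "(\<Sum>i<p. l ^ i) = int p * (1 + 2 * t)" using True by (simp add: numeral_2_eq_2)
  moreover have "coprime (1 + 2 * t) (int p)" using True by simp
  ultimately show ?thesis using that by blast
next
  case False
  have "odd p" using p False primes_dvd_imp_eq two_is_prime_nat by blast
  obtain t where t: "l = 1 + int p * t"
    using l False by (auto simp: dvd_def algebra_simps)
  have ex: "\<exists>r. l ^ i = 1 + int i * (int p * t) + (int p)\<^sup>2 * r" for i
  proof (induction i)
    case (Suc i)
    then obtain r where "l ^ i = 1 + int i * (int p * t) + (int p)\<^sup>2 * r" by blast
    then have "l ^ Suc i = 1 + int (Suc i) * (int p * t) + (int p)\<^sup>2 * (int i * t * t + r * l)"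
      by (simp add: t algebra_simps power2_eq_square)
    then show ?case by blast
  qed (auto intro: exI[of _ 0])
  then obtain r where r: "\<And>i. l ^ i = 1 + int i * (int p * t) + (int p)\<^sup>2 * r i" by metis
  have "2 * (\<Sum>i<p. int i) = int p * (int p - 1)"
    by (induction p) (simp_all add: algebra_simps)
  moreover obtain h where h: "p = 2 * h + 1" using \<open>odd p\<close> by (elim oddE)
  ultimately have sum: "(\<Sum>i<p. int i) = int p * int h" by simp
  have "(\<Sum>i<p. l ^ i) = int p + (\<Sum>i<p. int i) * (int p * t) + (int p)\<^sup>2 * (\<Sum>i<p. r i)"
    by (simp add: r sum.distrib sum_distrib_left sum_distrib_right)
  also have "\<dots> = int p * (1 + int p * (int h * t + (\<Sum>i<p. r i)))"
    by (simp add: sum algebra_simps power2_eq_square)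
  finally have "(\<Sum>i<p. l ^ i) = int p * (1 + int p * (int h * t + (\<Sum>i<p. r i)))" .
  moreover have "coprime (1 + int p * (int h * t + (\<Sum>i<p. r i))) (int p)"
  proof (rule coprimeI)
    fix c assume "c dvd 1 + int p * (int h * t + (\<Sum>i<p. r i))" "c dvd int p"
    then show "is_unit c" by (simp add: dvd_add_left_iff)
  qed
  ultimately show ?thesis using that by blast
qed

text \<open>Each \<open>e\<close> that moves to the right past a power of \<open>b\<close>
  multiplies its exponent by \<open>l\<close>. For \<open>m = p\<close> and suitable
  \<open>l\<close> the sum is \<open>p\<close> times a unit, so that \<open>p\<close>-th powers in
  the coset of \<open>e\<close> can be adjusted by the choice of \<open>j\<close>.\<close>

lemma (in group) conj_by_cyc_pow:
  assumes "e \<in> carrier G" "b \<in> carrier G" "conj_by e b = b [^] (l::int)"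
  shows "(b [^] (j::int) \<otimes> e) [^] (m::nat) = b [^] (j * (\<Sum>i<m. l ^ i)) \<otimes> e [^] m"
proof (induction m)
  case (Suc m)
  have sum: "(\<Sum>i<Suc m. l ^ i) = 1 + l * (\<Sum>i<m. l ^ i)"
    by (subst sum.lessThan_Suc_shift) (simp add: sum_distrib_left)
  have swap: "e \<otimes> b [^] i = b [^] (l * i) \<otimes> e" for i :: int
    using conj_by_eq_iff[of e "b [^] i" "b [^] (l * i)"] assms
    by (simp add: conj_by_int_pow int_pow_pow)
  have "(b [^] j \<otimes> e) [^] Suc m = (b [^] j \<otimes> e) \<otimes> (b [^] (j * (\<Sum>i<m. l ^ i)) \<otimes> e [^] m)"
    using assms Suc by (subst nat_pow_Suc2) simp_all
  also have "\<dots> = b [^] j \<otimes> (e \<otimes> b [^] (j * (\<Sum>i<m. l ^ i))) \<otimes> e [^] m"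
    using assms by (simp add: m_assoc)
  also have "\<dots> = (b [^] j \<otimes> b [^] (l * (j * (\<Sum>i<m. l ^ i)))) \<otimes> (e \<otimes> e [^] m)"
    using assms by (simp add: swap m_assoc)
  also have "\<dots> = b [^] (j * (\<Sum>i<Suc m. l ^ i)) \<otimes> e [^] Suc m"
    unfolding sum nat_pow_Suc2[OF assms(1)] using assms(1,2) by (simp add: int_pow_mult algebra_simps)
  finally show ?case .
qed (use assms in simp)

lemma (in group) conj_by_iterate:
  assumes "g \<in> carrier G" "b \<in> carrier G" "conj_by g b = b [^] (l::int)"
  shows "conj_by (g [^] (m::nat)) b = b [^] (l ^ m)"
proof (induction m)
  case (Suc m)
  have "conj_by (g [^] Suc m) b = conj_by (g [^] m) (conj_by g b)"
    using assms(1,2) by (simp add: conj_by_conj_by)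
  then show ?case using assms Suc by (simp add: conj_by_int_pow int_pow_pow mult.commute)
qed (use assms in simp)

lemma (in group) card_cyc: "finite (carrier G) \<Longrightarrow> b \<in> carrier G \<Longrightarrow> card (cyc b) = ord b"
  using generate_pow_card[of b] generate_pow[of b] by (simp add: cyc_def full_SetCompr_eq)

text \<open>Every alternative of the trichotomy is meant to be tested on a faithful module: a group with a
  normal subgroup \<open>\<langle>z, e\<rangle> \<cong> C\<^sub>p \<times> C\<^sub>p\<close>, a cyclic one, or a 2-group of maximal class, where the
  dihedral and semidihedral groups are recognised by a non-central involution \<open>x\<close>.\<close>

theorem (in group) finite_p_group_trichotomy:
  assumes p: "Factorial_Ring.prime (p::nat)" and ordG: "order G = p ^ k"
  obtains (elementary) z e where "z \<in> carrier G" "e \<in> carrier G" "z \<noteq> \<one>" "z [^] p = \<one>" "e [^] p = \<one>"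
      "e \<notin> cyc z" "\<And>g. g \<in> carrier G \<Longrightarrow> conj_by g z = z"
      "\<And>g. g \<in> carrier G \<Longrightarrow> \<exists>i::int. conj_by g e = z [^] i \<otimes> e"
  | (cyclic) b n where "b \<in> carrier G" "ord b = p ^ n" "carrier G = cyc b"
  | (maximal_class) b x n l where "p = 2" "n \<ge> 2" "b \<in> carrier G" "x \<in> carrier G" "ord b = 2 ^ n"
      "x \<notin> cyc b" "carrier G = cyc b \<union> (\<lambda>c. c \<otimes> x) ` cyc b"
      "odd (l::int)" "conj_by x b = b [^] l"
      "x \<otimes> x = \<one> \<or> (x \<otimes> x = b [^] ((2::int) ^ (n - 1)) \<and> conj_by x b = inv b)"
proof -
  have fin: "finite (carrier G)"
    using ordG p by (metis card.infinite order_def power_not_zero prime_gt_0_nat not_gr_zero)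
  \<comment> \<open>The element \<open>b\<close> will generate a cyclic normal subgroup of the
    largest possible order.\<close>
  define CN where "CN = {b \<in> carrier G. \<forall>g\<in>carrier G. conj_by g b \<in> cyc b}"
  have "\<one> \<in> CN" using self_in_cyc[OF one_closed] by (simp add: CN_def)
  moreover have "finite CN" using fin by (simp add: CN_def)
  ultimately have "Max (ord ` CN) \<in> ord ` CN" by (intro Max_in) auto
  then obtain b where b: "b \<in> CN" "ord b = Max (ord ` CN)" by auto
  have bmax: "ord c \<le> ord b" if "c \<in> CN" for c
    using that \<open>finite CN\<close> unfolding b(2) by (intro Max_ge) auto
  have bG: "b \<in> carrier G" using b by (simp add: CN_def)
  have "ord b dvd p ^ k" using ord_dvd_group_order[OF bG] ordG by simp
  then obtain n where n: "ord b = p ^ n" using p divides_primepow_nat by blast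
  have beq: "b [^] (i::int) = b [^] j \<longleftrightarrow> int p ^ n dvd j - i" for i j
    using int_pow_eq[OF bG] n by simp
  have b1: "b [^] (i::int) = \<one> \<longleftrightarrow> int p ^ n dvd i" for i
    using int_pow_eq_id[OF bG] n by simp
  have conjb: "\<exists>l::int. conj_by g b = b [^] l" if "g \<in> carrier G" for g
    using b that by (auto simp: CN_def cyc_def)
  define B where "B = cyc b"
  have sB: "subgroup B G" unfolding B_def by (rule subgroup_cyc[OF bG])
  have BG: "B \<subseteq> carrier G" using sB by (rule subgroup.subset)
  have conjB: "conj_by g c \<in> B" if gc: "g \<in> carrier G" "c \<in> B" for g c
  proof -
    obtain l where "conj_by g b = b [^] (l::int)" using conjb \<open>g \<in> carrier G\<close> by blast
    moreover obtain i where "c = b [^] (i::int)" using gc by (auto simp: B_def cyc_def)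
    ultimately show ?thesis using bG that by (simp add: conj_by_int_pow int_pow_pow B_def cyc_I)
  qed
  have B: "B \<lhd> G" using sB conjB by (simp add: normal_inv_iff conj_by_def)
  \<comment> \<open>This is the modulus required by \<open>unit_cofactor_of_geometric_sum\<close>,
    and \<open>P\<close> consists of the elements that act on \<open>B\<close> with an exponent 1
    modulo \<open>q\<close>. An element of \<open>P\<close> outside \<open>B\<close> leads to the
    elementary case; \<open>P = B\<close> leaves the cyclic groups and those of maximal
    class.\<close>
  define q where "q = int (if p = 2 then 4 else p)"
  define P where "P = {g \<in> carrier G. \<exists>l::int. conj_by g b = b [^] l \<and> q dvd l - 1}"
  have PI: "g \<in> P" if "g \<in> carrier G" "conj_by g b = b [^] (l::int)" "q dvd l - 1" for g l
    using that by (auto simp: P_def)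
  have sP: "subgroup P G"
  proof (rule subgroupI)
    show "P \<subseteq> carrier G" by (auto simp: P_def)
    show "P \<noteq> {}" using PI[of \<one> 1] bG by auto
  next
    fix g assume "g \<in> P"
    then obtain l where g: "g \<in> carrier G" "conj_by g b = b [^] (l::int)" "q dvd l - 1"
      by (auto simp: P_def)
    \<comment> \<open>Writing the inverse as a positive power avoids inverting \<open>l\<close>
      modulo the order of \<open>b\<close>.\<close>
    have "inv g = g [^] (p ^ k - 1)"
    proof -
      have "g [^] Suc (p ^ k - 1) = \<one>" using pow_order_eq_1[OF g(1)] ordG p
        by (metis Suc_diff_1 prime_gt_0_nat zero_less_power)
      then show ?thesis using g(1) by (simp add: inv_unique' inv_equality)
    qed
    moreover have "g [^] (p ^ k - 1) \<in> P"
    proof (rule PI)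
      show "conj_by (g [^] (p ^ k - 1)) b = b [^] (l ^ (p ^ k - 1))"
        using conj_by_iterate g bG by blast
      show "q dvd l ^ (p ^ k - 1) - 1"
        using g(3) int_pow_sum_eq[of l "p ^ k - 1"] by (metis dvd_mult2)
    qed (use g in simp)
    ultimately show "inv g \<in> P" by simp
  next
    fix g h assume "g \<in> P" "h \<in> P"
    then obtain l m where g: "g \<in> carrier G" "conj_by g b = b [^] (l::int)" "q dvd l - 1"
      and h: "h \<in> carrier G" "conj_by h b = b [^] (m::int)" "q dvd m - 1" by (auto simp: P_def)
    show "g \<otimes> h \<in> P"
    proof (rule PI)
      show "conj_by (g \<otimes> h) b = b [^] (l * m)"
        using g h bG by (simp add: conj_by_conj_by[symmetric] conj_by_int_pow int_pow_pow)
      have "l * m - 1 = (l - 1) * m + (m - 1)" by (simp add: algebra_simps)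
      then show "q dvd l * m - 1" using g h by (metis dvd_add dvd_mult2)
    qed (use g h in simp)
  qed
  have P: "P \<lhd> G"
  proof (subst normal_inv_iff, intro conjI ballI sP)
    fix h g assume h: "h \<in> carrier G" and "g \<in> P"
    then obtain l where g: "g \<in> carrier G" "conj_by g b = b [^] (l::int)" "q dvd l - 1"
      by (auto simp: P_def)
    \<comment> \<open>Exponents of automorphisms of a cyclic group multiply commutatively, so a
      conjugate of \<open>g\<close> acts with the same exponent \<open>l\<close>.\<close>
    obtain r where r: "conj_by (inv h) b = b [^] (r::int)" using conjb h by blast
    have "conj_by (h \<otimes> g \<otimes> inv h) b = conj_by h (conj_by g (conj_by (inv h) b))"
      using g h bG by (simp add: conj_by_conj_by m_assoc)
    also have "\<dots> = conj_by h (conj_by (inv h) b) [^] l"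
      using g h bG unfolding r by (simp add: conj_by_int_pow int_pow_pow mult.commute)
    finally have "conj_by (h \<otimes> g \<otimes> inv h) b = b [^] l" using h bG by simp
    then show "h \<otimes> g \<otimes> inv h \<in> P" using g h by (intro PI) auto
  qed
  have BP: "B \<subseteq> P"
  proof
    fix c assume c: "c \<in> B"
    then obtain i where "c = b [^] (i::int)" by (auto simp: B_def cyc_def)
    then have "c \<otimes> b = b \<otimes> c" using bG by (metis int_pow_1 int_pow_mult add.commute)
    then have "conj_by c b = b [^] (1::int)" using c BG bG by (subst conj_by_eq_iff) auto
    then show "c \<in> P" using c BG by (intro PI) auto
  qed
  \<comment> \<open>For \<open>n > 0\<close> this generates the subgroup of order \<open>p\<close>
    of \<open>B\<close>. It is normal of prime order in a \<open>p\<close>-group, hence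
    central.\<close>
  define z where "z = b [^] (int p ^ (n - 1))"
  have zG: "z \<in> carrier G" using bG by (simp add: z_def)
  have zpow: "z [^] (i::int) = b [^] (int p ^ (n - 1) * i)" for i
    using bG by (simp add: z_def int_pow_pow)
  have pn: "int p ^ n = int p ^ (n - 1) * int p" if "n \<noteq> 0"
    using that by (cases n) auto
  have zeq: "z [^] (i::int) = z [^] j \<longleftrightarrow> int p dvd j - i" if "n \<noteq> 0" for i j
    using beq pn[OF that] p unfolding zpow by (simp add: right_diff_distrib[symmetric])
  have z_central: "conj_by g z = z" if n0: "n \<noteq> 0" and g: "g \<in> carrier G" for g
  proof -
    have "cyc z \<lhd> G"
    proof (subst normal_inv_iff, intro conjI ballI)
      show "subgroup (cyc z) G" by (rule subgroup_cyc[OF zG])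
      fix h c assume h: "h \<in> carrier G" and c: "c \<in> cyc z"
      then obtain i where i: "c = z [^] (i::int)" by (auto simp: cyc_def)
      obtain l where l: "conj_by h b = b [^] (l::int)" using conjb h by blast
      have "conj_by h c = z [^] (l * i)"
        unfolding i zpow using h bG l by (simp add: conj_by_int_pow int_pow_pow algebra_simps)
      then show "h \<otimes> c \<otimes> inv h \<in> cyc z" by (auto simp: conj_by_def)
    qed
    moreover have "z \<noteq> \<one>"
      using zeq[OF n0, of 1 0] p zG by (auto)
    then have "cyc z \<noteq> {\<one>}" using self_in_cyc[OF zG] by blast
    ultimately obtain y where y: "y \<in> cyc z" "y \<noteq> \<one>" "\<And>g. g \<in> carrier G \<Longrightarrow> g \<otimes> y = y \<otimes> g"
      by (rule p_group_normal_center[OF p ordG]) (rule that; assumption)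
    then obtain i where i: "y = z [^] (i::int)" by (auto simp: cyc_def)
    have "\<not> int p dvd i" using y(2) zeq[OF n0, of 0 i] i zG by auto
    then have "coprime (int p) i" using p by (simp add: prime_imp_coprime)
    then obtain j where "int p dvd i * j - 1" using coprime_inverse_int coprime_commute by blast
    then have "z [^] (i * j) = z [^] (1::int)" using zeq[OF n0, of "i * j" 1]
      by (simp add: dvd_diff_commute)
    then have zy: "z = y [^] j" using i zG by (simp add: int_pow_pow)
    have yG: "y \<in> carrier G" using i zG by simp
    have "conj_by g y = y" using y(3)[OF g] conj_by_eq_iff[OF g yG yG] by simp
    then show ?thesis unfolding zy using g yG by (simp add: conj_by_int_pow)
  qed
  \<comment> \<open>Because \<open>z\<close> is fixed, every element acts on \<open>B\<close> with
    an exponent 1 modulo \<open>p\<close>.\<close>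
  have conj_unit: "int p dvd l - 1" if "n \<noteq> 0" "g \<in> carrier G" "conj_by g b = b [^] (l::int)" for g l
  proof -
    have "z [^] (1::int) = z [^] l"
      using z_central[OF that(1,2)] that bG zG unfolding z_def
      by (simp add: conj_by_int_pow int_pow_pow mult.commute)
    then show ?thesis using zeq[OF that(1)] by simp
  qed
  show ?thesis
  proof (cases "P = B")
    case False
    then have "B \<subset> P" using BP by blast
    then obtain y where y: "y \<in> P" "y \<notin> B" "y [^] p \<in> B"
      "\<And>g. g \<in> carrier G \<Longrightarrow> conj_by g y \<otimes> inv y \<in> B"
      by (rule p_group_central_mod[OF p ordG B P]) (rule that; assumption)
    obtain l where yG: "y \<in> carrier G" and l: "conj_by y b = b [^] (l::int)" "q dvd l - 1"
      using y(1) by (auto simp: P_def)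
    obtain u where u: "(\<Sum>i<p. l ^ i) = int p * u" "coprime u (int p)"
      by (rule unit_cofactor_of_geometric_sum[OF p l(2)[unfolded q_def]]) (rule that; assumption)
    obtain i where i: "y [^] p = b [^] (i::int)" using y(3) by (auto simp: B_def cyc_def)
    have conjy: "\<exists>c\<in>B. conj_by g y = c \<otimes> y" if "g \<in> carrier G" for g
    proof
      show "conj_by g y = (conj_by g y \<otimes> inv y) \<otimes> y" using that yG by (simp add: m_assoc)
    qed (use y(4) that in simp)
    \<comment> \<open>Otherwise \<open>y\<close> would generate a cyclic normal subgroup larger than
      \<open>B\<close>, against the choice of \<open>b\<close>.\<close>
    have "b \<notin> cyc y"
    proof
      assume by': "b \<in> cyc y"
      then have Bs: "B \<subseteq> cyc y"
        unfolding B_def using cyc_subset_iff[OF bG subgroup_cyc[OF yG]] by simp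
      have "y \<in> CN"
        unfolding CN_def
      proof (intro CollectI conjI ballI yG)
        fix g assume "g \<in> carrier G"
        then obtain c where "c \<in> B" "conj_by g y = c \<otimes> y" using conjy by blast
        then show "conj_by g y \<in> cyc y"
          using Bs self_in_cyc[OF yG] subgroup.m_closed[OF subgroup_cyc[OF yG]] by auto
      qed
      then have "ord y \<le> ord b" by (rule bmax)
      moreover have "B \<subset> cyc y" using Bs y(2) self_in_cyc[OF yG] by blast
      then have "card B < card (cyc y)"
        using cyc_closed[OF yG] fin by (meson finite_subset psubset_card_mono)
      ultimately show False using card_cyc[OF fin] yG bG unfolding B_def by simp
    qed
    have n0: "n \<noteq> 0"
    proof
      assume "n = 0"
      then have "b = \<one>" using n bG ord_eq_1 by simp
      then show False using \<open>b \<notin> cyc y\<close> cyc_I[of y 0] by simp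
    qed
    \<comment> \<open>If \<open>i\<close> were prime to \<open>p\<close>, then \<open>b\<close>
      would be a power of \<open>y [^] p\<close>.\<close>
    have "int p dvd i"
    proof (rule ccontr)
      assume "\<not> int p dvd i"
      then have "coprime (int p) i" using p by (simp add: prime_imp_coprime)
      then have "coprime i (int p ^ n)" by (simp add: coprime_commute)
      then obtain m where "int p ^ n dvd i * m - 1" using coprime_inverse_int by blast
      then have "b [^] (i * m) = b [^] (1::int)"
        unfolding beq by (simp add: dvd_diff_commute)
      moreover have "b [^] (i * m) = y [^] (int p * m)"
        using i yG bG by (metis int_pow_pow int_pow_int)
      ultimately show False using \<open>b \<notin> cyc y\<close> bG cyc_I[of y "int p * m"] by simp
    qed
    then obtain i' where i': "i = int p * i'" by (auto simp: dvd_def)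
    have "coprime u (int p ^ n)" using u(2) by simp
    then obtain ub where ub: "int p ^ n dvd u * ub - 1" using coprime_inverse_int by blast
    \<comment> \<open>This \<open>j\<close> solves \<open>j * p * u + p * i' = 0\<close> modulo
      \<open>p^n\<close>, so the factor \<open>b [^] j\<close> kills the \<open>p\<close>-th power
      of \<open>y\<close>.\<close>
    define j where "j = - i' * ub"
    define e where "e = b [^] j \<otimes> y"
    have eG: "e \<in> carrier G" using bG yG by (simp add: e_def)
    note ub
    moreover have "j * (\<Sum>i<p. l ^ i) + i = (u * ub - 1) * (- int p * i')"
      unfolding u(1) i' j_def by (simp add: algebra_simps)
    ultimately have "int p ^ n dvd j * (\<Sum>i<p. l ^ i) + i" by (metis dvd_mult2)
    moreover have "e [^] p = b [^] (j * (\<Sum>i<p. l ^ i) + i)"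
      unfolding e_def conj_by_cyc_pow[OF yG bG l(1)] i using bG by (simp add: int_pow_mult)
    ultimately have ep: "e [^] p = \<one>" using b1 by simp
    have eb: "conj_by e b = b [^] l"
    proof -
      have "conj_by e b = conj_by (b [^] j) (b [^] l)"
        using bG yG l by (simp add: e_def conj_by_conj_by[symmetric])
      also have "\<dots> = b [^] l"
        using bG by (simp add: conj_by_eq_iff int_pow_mult[symmetric] add.commute)
      finally show ?thesis .
    qed
    have eB: "e \<notin> B"
    proof
      assume "e \<in> B"
      moreover have "y = b [^] (- j) \<otimes> e"
        using bG yG by (simp add: e_def m_assoc[symmetric] int_pow_mult[symmetric])
      ultimately show False using y(2) sB subgroup.m_closed[OF sB] cyc_I[of b "- j"] by (auto simp: B_def)
    qed
    have zB: "cyc z \<subseteq> B"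
      using cyc_subset_iff[OF zG sB] cyc_I[of b "int p ^ (n - 1)"] by (simp add: z_def B_def)
    show ?thesis
    proof (rule elementary[OF zG eG])
      show "z \<noteq> \<one>" using zeq[OF n0, of 1 0] p zG by auto
      have "z [^] int p = \<one>" using zeq[OF n0, of "int p" 0] zG by simp
      then show "z [^] p = \<one>" by (simp add: int_pow_int)
      show "e [^] p = \<one>" by (rule ep)
      show "e \<notin> cyc z" using eB zB by blast
      show "conj_by g z = z" if "g \<in> carrier G" for g using z_central[OF n0 that] .
      show "\<exists>i::int. conj_by g e = z [^] i \<otimes> e" if g: "g \<in> carrier G" for g
      proof -
        obtain c where c: "c \<in> B" "conj_by g y = c \<otimes> y" using conjy[OF g] by blast
        have "conj_by g (b [^] j) \<in> B" using conjB[OF g] cyc_I by (simp add: B_def)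
        then have "conj_by g (b [^] j) \<otimes> c \<otimes> b [^] (- j) \<in> B"
          using c sB by (simp add: subgroup.m_closed cyc_I B_def)
        then obtain r where r: "conj_by g (b [^] j) \<otimes> c \<otimes> b [^] (- j) = b [^] (r::int)"
          by (auto simp: B_def cyc_def)
        have cG: "c \<in> carrier G" using c BG by auto
        have "conj_by g e = conj_by g (b [^] j) \<otimes> (c \<otimes> y)"
          using g bG yG c by (simp add: e_def conj_by_mult)
        also have "\<dots> = (conj_by g (b [^] j) \<otimes> c \<otimes> b [^] (- j)) \<otimes> e"
        proof -
          have "inv (b [^] j) \<otimes> (b [^] j \<otimes> y) = y" using bG yG by (simp add: m_assoc[symmetric])
          then show ?thesis using g bG yG cG by (simp add: e_def m_assoc int_pow_neg)
        qed
        finally have ge: "conj_by g e = b [^] r \<otimes> e" unfolding r .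
        \<comment> \<open>A conjugate of \<open>e\<close> also has trivial \<open>p\<close>-th
          power. This forces \<open>p * u * r = 0\<close> modulo \<open>p^n\<close>, and so
          \<open>b [^] r\<close> is a power of \<open>z\<close>.\<close>
        have "(b [^] r \<otimes> e) [^] p = \<one>"
          unfolding ge[symmetric] using g eG ep by (simp add: conj_by_nat_pow[symmetric])
        then have "b [^] (r * (\<Sum>i<p. l ^ i)) = \<one>"
          unfolding conj_by_cyc_pow[OF eG bG eb] ep using bG by simp
        then have "int p ^ (n - 1) * int p dvd r * u * int p"
          using b1 u(1) pn[OF n0] by (simp add: mult_ac)
        then have "int p ^ (n - 1) dvd r * u" using p by simp
        moreover have "coprime (int p ^ (n - 1)) u" using u(2) by (simp add: coprime_commute)
        ultimately have "int p ^ (n - 1) dvd r" by (simp add: coprime_dvd_mult_left_iff)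
        then obtain t where "r = int p ^ (n - 1) * t" by (auto simp: dvd_def)
        then show ?thesis using ge zpow by auto
      qed
    qed
  next
    case PB: True
    show ?thesis
    proof (cases "carrier G = B")
      case True
      then show ?thesis using cyclic[OF bG n] by (simp add: B_def)
    next
      case False
      then obtain x where xG: "x \<in> carrier G" and xB: "x \<notin> B" using BG by blast
      have n0: "n \<noteq> 0"
      proof
        assume "n = 0"
        then have "b = \<one>" using n bG ord_eq_1 by simp
        then have "x \<in> P" using xG by (intro PI[of x 1]) auto
        then show False using PB xB by simp
      qed
      obtain l where l: "conj_by x b = b [^] (l::int)" using conjb xG by blast
      have nq: "\<not> q dvd l - 1" using xB PB PI[OF xG l] by blast
      \<comment> \<open>All exponents are 1 modulo \<open>p\<close>, so one that is not 1 modulo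
        \<open>q\<close> requires \<open>q = 4\<close>; then \<open>l\<close> is 3 modulo 4.\<close>
      have p2: "p = 2"
        using conj_unit[OF n0 xG l] nq by (auto simp: q_def split: if_splits)
      have q4: "q = 4" by (simp add: q_def p2)
      have odd_conj: "odd m" if "g \<in> carrier G" "conj_by g b = b [^] (m::int)" for g m
        using conj_unit[OF n0 that] p2 by auto
      have n2: "n \<ge> 2"
      proof (rule ccontr)
        assume "\<not> n \<ge> 2"
        then have "n = 1" using n0 by simp
        then have "b [^] l = b [^] (1::int)" using beq[of l 1] odd_conj[OF xG l] p2 by simp
        then have "x \<in> P" using l xG by (intro PI[of x 1]) auto
        then show False using PB xB by simp
      qed
      have four: "(4::int) dvd 2 ^ n" using n2 by (metis le_imp_power_dvd power2_eq_square num_double numeral_times_numeral)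
      \<comment> \<open>Two elements outside \<open>B\<close> both act with exponent 3 modulo 4.
        Their quotient acts with exponent 1 modulo 4 and so lies in \<open>P = B\<close>: the index
        of \<open>B\<close> is 2.\<close>
      have cover: "carrier G = cyc b \<union> (\<lambda>c. c \<otimes> x) ` cyc b"
      proof (intro subset_antisym subsetI)
        fix g assume g: "g \<in> carrier G"
        show "g \<in> cyc b \<union> (\<lambda>c. c \<otimes> x) ` cyc b"
        proof (cases "g \<in> B")
          case gB: False
          obtain m where m: "conj_by g b = b [^] (m::int)" using conjb g by blast
          have nm: "\<not> 4 dvd m - 1" using gB PB PI[OF g m] q4 by auto
          obtain r where r: "conj_by (inv x) b = b [^] (r::int)" using conjb xG by blast
          have "b [^] (1::int) = conj_by (inv x) (conj_by x b)" using xG bG by simp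
          also have "\<dots> = b [^] (r * l)" using l r xG bG by (simp add: conj_by_int_pow int_pow_pow)
          finally have "(4::int) dvd r * l - 1" using beq[of 1 "r * l"] p2 four by (simp add: dvd_trans)
          moreover have "odd m" "odd l" using odd_conj m g l xG by auto
          ultimately have "4 dvd m * r - 1" using nm nq[unfolded q4]
          proof -
            have "m mod 4 = 3" using nm \<open>odd m\<close> by presburger
            moreover have "l mod 4 = 3" using nq[unfolded q4] \<open>odd l\<close> by presburger
            moreover have "r * l mod 4 = 1" using \<open>4 dvd r * l - 1\<close> by presburger
            ultimately have "(r mod 4) * 3 mod 4 = 1" by (metis mod_mult_eq mod_mod_trivial)
            then have "r mod 4 = 3" by presburger
            with \<open>m mod 4 = 3\<close> have "m * r mod 4 = (3 * 3) mod 4" by (metis mod_mult_eq)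
            then show ?thesis by presburger
          qed
          moreover have "conj_by (g \<otimes> inv x) b = b [^] (m * r)"
            using g xG bG m r by (simp add: conj_by_conj_by[symmetric] conj_by_int_pow int_pow_pow)
          ultimately have "g \<otimes> inv x \<in> P" using g xG q4 by (intro PI) auto
          moreover have "g = g \<otimes> inv x \<otimes> x" using g xG by (simp add: m_assoc)
          ultimately show ?thesis using PB by (auto simp: B_def)
        qed (simp add: B_def)
      qed (use cyc_closed[OF bG] xG in auto)
      have xx: "x \<otimes> x \<in> B"
      proof (rule ccontr)
        assume "x \<otimes> x \<notin> B"
        moreover have "x \<otimes> x \<in> cyc b \<union> (\<lambda>c. c \<otimes> x) ` cyc b"
          using m_closed[OF xG xG] unfolding cover .
        ultimately obtain c where c: "c \<in> B" "x \<otimes> x = c \<otimes> x" unfolding B_def by blast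
        then have "x = c" using xG BG by auto
        then show False using c xB by simp
      qed
      then obtain i where i: "x \<otimes> x = b [^] (i::int)" by (auto simp: B_def cyc_def)
      \<comment> \<open>Here \<open>l - 1\<close> is twice an odd \<open>t\<close>. The first claim
        follows from \<open>l^2 = 1\<close> modulo \<open>2^n\<close>, as
        \<open>x \<otimes> x\<close> is a power of \<open>b\<close>; the second from the fact that
        \<open>x\<close> commutes with its own square.\<close>
      have l2: "(2::int) ^ (n - 1) dvd l + 1" and i2: "(2::int) ^ (n - 1) dvd i"
      proof -
        obtain t where t: "l - 1 = 2 * t" using odd_conj[OF xG l] by (auto elim: oddE)
        have ct: "coprime ((2::int) ^ (n - 1)) t" using nq[unfolded q4] t by auto
        have "conj_by (x \<otimes> x) b = b [^] (l * l)"
          using xG bG l by (simp add: conj_by_conj_by[symmetric] conj_by_int_pow int_pow_pow)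
        moreover have "conj_by (x \<otimes> x) b = b"
          unfolding i using bG int_pow_mult[of b i 1] int_pow_mult[of b 1 i]
          by (simp add: conj_by_eq_iff add.commute)
        ultimately have "b [^] (1::int) = b [^] (l * l)" using bG by simp
        then have "2 ^ n dvd l * l - 1" using beq p2 by simp
        moreover have "l * l - 1 = (l + 1) * t * 2" using t by (simp add: algebra_simps)
        ultimately have "2 ^ (n - 1) * 2 dvd (l + 1) * t * 2" using pn[OF n0] p2 by simp
        then have "2 ^ (n - 1) dvd (l + 1) * t" by simp
        then show "(2::int) ^ (n - 1) dvd l + 1" using ct by (simp add: coprime_dvd_mult_left_iff)
        have "conj_by x (x \<otimes> x) = x \<otimes> x" using xG by (simp add: conj_by_def m_assoc)
        then have "b [^] (l * i) = b [^] i" unfolding i using xG bG l by (simp add: conj_by_int_pow int_pow_pow)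
        then have "2 ^ n dvd i - l * i" using beq p2 by simp
        moreover have "i - l * i = - (i * t * 2)" using t by (simp add: algebra_simps)
        ultimately have "2 ^ (n - 1) * 2 dvd i * t * 2" using pn[OF n0] p2 by simp
        then have "2 ^ (n - 1) dvd i * t" by simp
        then show "(2::int) ^ (n - 1) dvd i" using ct by (simp add: coprime_dvd_mult_left_iff)
      qed
      have half: "b [^] m = \<one> \<or> b [^] m = z" if m: "(2::int) ^ (n - 1) dvd m" for m
      proof -
        obtain t where "m = 2 ^ (n - 1) * t" using m by (auto simp: dvd_def)
        then have "b [^] m = z [^] t" using zpow p2 by simp
        moreover have "z [^] t = z [^] (0::int) \<or> z [^] t = z [^] (1::int)"
          unfolding zeq[OF n0] using p2 by (cases "even t") auto
        ultimately show ?thesis using zG by auto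
      qed
      have zz: "z \<otimes> z = \<one>"
        using zeq[OF n0, of 2 0] p2 zG int_pow_mult[of z 1 1] by simp
      consider "x \<otimes> x = \<one>" | "x \<otimes> x = z" "b [^] (l + 1) = \<one>" | "x \<otimes> x = z" "b [^] (l + 1) = z"
        using half[OF l2] half[OF i2] i by auto
      then show ?thesis
      proof cases
        case 1
        then show ?thesis
          using maximal_class[OF p2 n2 bG xG _ _ cover odd_conj[OF xG l] l] n p2 xB by (auto simp: B_def)
      next
        case 2
        have "b [^] l \<otimes> b = \<one>" using 2(2) bG by (simp add: int_pow_mult)
        then have "conj_by x b = inv b" unfolding l using bG by (metis int_pow_closed inv_equality)
        then show ?thesis
          using maximal_class[OF p2 n2 bG xG _ _ cover odd_conj[OF xG l] l] n p2 xB 2(1)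
          by (auto simp: B_def z_def)
      next
        case 3
        \<comment> \<open>In the semidihedral action with \<open>x\<close> of order 4, the square of
          \<open>b \<otimes> x\<close> is \<open>b [^] (l + 1) \<otimes> (x \<otimes> x)\<close>.
          Both factors equal the involution \<open>z\<close>, so \<open>b \<otimes> x\<close> is an
          involution outside \<open>B\<close>.\<close>
        define x' where "x' = b \<otimes> x"
        have x'G: "x' \<in> carrier G" using bG xG by (simp add: x'_def)
        have "x' \<otimes> x' = (b [^] (1::int) \<otimes> x) [^] (2::nat)"
          using bG xG by (simp add: x'_def numeral_2_eq_2)
        also have "\<dots> = b [^] (\<Sum>i<2. l ^ i) \<otimes> x [^] (2::nat)"
          using conj_by_cyc_pow[OF xG bG l, of 1 2] by simp
        also have "\<dots> = b [^] (l + 1) \<otimes> (x \<otimes> x)" using xG by (simp add: numeral_2_eq_2 add.commute)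
        finally have x'1: "x' \<otimes> x' = \<one>" using 3 zz by simp
        have "conj_by b (b [^] l) = b [^] l"
          using bG int_pow_mult[of b l 1] int_pow_mult[of b 1 l] by (simp add: conj_by_eq_iff add.commute)
        then have l': "conj_by x' b = b [^] l"
          using bG xG l by (simp add: x'_def conj_by_conj_by[symmetric])
        have bB: "b \<in> B" using self_in_cyc[OF bG] by (simp add: B_def)
        have x'B: "x' \<notin> B"
        proof
          assume "x' \<in> B"
          then have "inv b \<otimes> x' \<in> B" using sB bB by (simp add: subgroup.m_closed subgroup.m_inv_closed)
          then show False using xB bG xG by (simp add: x'_def m_assoc[symmetric])
        qed
        have "(\<lambda>c. c \<otimes> x) ` cyc b \<subseteq> (\<lambda>c. c \<otimes> x') ` cyc b"
        proof
          fix w assume "w \<in> (\<lambda>c. c \<otimes> x) ` cyc b"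
          then obtain c where c: "c \<in> B" "w = c \<otimes> x" by (auto simp: B_def)
          have cG: "c \<in> carrier G" using c BG by auto
          have "c \<otimes> inv b \<in> B" using c bB sB by (simp add: subgroup.m_closed subgroup.m_inv_closed)
          moreover have "w = (c \<otimes> inv b) \<otimes> x'"
            using cG bG xG c by (simp add: x'_def m_assoc) (simp add: m_assoc[symmetric])
          ultimately show "w \<in> (\<lambda>c. c \<otimes> x') ` cyc b" by (auto simp: B_def)
        qed
        moreover have "(\<lambda>c. c \<otimes> x') ` cyc b \<subseteq> carrier G"
          using cyc_closed[OF bG] x'G by (auto simp del: cyc_I)
        ultimately have cover': "carrier G = cyc b \<union> (\<lambda>c. c \<otimes> x') ` cyc b"
          using cover by blast
        show ?thesis
          using maximal_class[OF p2 n2 bG x'G _ _ cover' odd_conj[OF x'G l'] l'] n p2 x'B x'1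
          by (auto simp: B_def)
      qed
    qed
  qed
qed

hide_const (open) up_ring.coeff up_ring.monom Polynomials.degree ring.coeff ring.monom Polynomials.lead_coeff

section \<open>Integer polynomials\<close>

text \<open>For prime \<open>p\<close> and \<open>m = p^n\<close> this is the cyclotomic polynomial
  of order \<open>p^(n+1)\<close>.\<close>

definition gap_poly :: "nat \<Rightarrow> nat \<Rightarrow> int poly" where
  "gap_poly p m = (\<Sum>j<p. monom 1 (j * m))"

lemma gap_poly_mult: "(monom 1 m - 1) * gap_poly p m = monom 1 (p * m) - 1"
proof -
  have "monom 1 (j * m) = (monom 1 m :: int poly) ^ j" for j
    by (simp add: monom_power mult.commute)
  then show ?thesis
    unfolding gap_poly_def by (simp add: power_diff_1_eq)
qed

lemma coeff_gap_poly:
  assumes "m > 0"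
  shows "coeff (gap_poly p m) i = (if m dvd i \<and> i < p * m then 1 else 0)"
proof -
  have "coeff (gap_poly p m) i = (\<Sum>j<p. if j * m = i then 1 else 0)"
    by (simp add: gap_poly_def coeff_sum)
  also have "\<dots> = (\<Sum>j | j < p \<and> j * m = i. 1)"
    by (simp add: sum.inter_filter[symmetric])
  also have "\<dots> = (if m dvd i \<and> i < p * m then 1 else 0)"
  proof (cases "m dvd i \<and> i < p * m")
    case True
    then obtain j where j: "i = m * j" by (auto simp: dvd_def)
    then have "j < p" using True by (simp add: mult.commute)
    then have "{j. j < p \<and> j * m = i} = {j}" using j assms by auto
    then show ?thesis using True by simp
  next
    case False
    then have "{j. j < p \<and> j * m = i} = {}" using assms by auto
    then show ?thesis using False by (simp only: sum.empty if_False)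
  qed
  finally show ?thesis .
qed

lemma degree_gap_poly:
  assumes "m > 0" "p > 0"
  shows "degree (gap_poly p m) = (p - 1) * m" "lead_coeff (gap_poly p m) = 1"
proof -
  have eq: "p * m = (p - 1) * m + m" using assms by (cases p) auto
  have "coeff (gap_poly p m) ((p - 1) * m) = 1"
    using assms eq by (simp add: coeff_gap_poly)
  moreover have "degree (gap_poly p m) \<le> (p - 1) * m"
  proof (rule degree_le, intro allI impI)
    fix i assume i: "(p - 1) * m < i"
    have "\<not> (m dvd i \<and> i < p * m)"
    proof
      assume a: "m dvd i \<and> i < p * m"
      then obtain j where j: "i = m * j" by (auto simp: dvd_def)
      have "(p - 1) * m < j * m" "j * m < p * m" using i a j by (simp_all add: mult.commute)
      then have "p - 1 < j" "j < p" by simp_all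
      then show False by simp
    qed
    then show "coeff (gap_poly p m) i = 0" by (simp add: coeff_gap_poly assms)
  qed
  ultimately show *: "degree (gap_poly p m) = (p - 1) * m"
    by (metis le_antisym le_degree zero_neq_one)
  show "lead_coeff (gap_poly p m) = 1"
    unfolding * using assms eq by (simp add: coeff_gap_poly)
qed

lemma const_poly_dvd_binomial_power:
  fixes f g :: "int poly"
  assumes "Factorial_Ring.prime (p::nat)"
  shows "[:int p:] dvd (f + g) ^ p - (f ^ p + g ^ p)"
proof -
  have "(f + g) ^ p = (\<Sum>k\<le>p. of_nat (p choose k) * f ^ k * g ^ (p - k))"
    by (rule binomial_ring)
  also have "{..p} = {0, p} \<union> {0<..<p}" by auto
  also have "(\<Sum>k\<in>{0, p} \<union> {0<..<p}. of_nat (p choose k) * f ^ k * g ^ (p - k))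
      = (f ^ p + g ^ p) + (\<Sum>k\<in>{0<..<p}. of_nat (p choose k) * f ^ k * g ^ (p - k))"
    using prime_gt_0_nat[OF assms] by (subst sum.union_disjoint) auto
  finally have "(f + g) ^ p - (f ^ p + g ^ p) =
      (\<Sum>k\<in>{0<..<p}. of_nat (p choose k) * f ^ k * g ^ (p - k))" by simp
  also have "[:int p:] dvd \<dots>"
  proof (rule dvd_sum)
    fix k assume "k \<in> {0<..<p}"
    then have "p dvd (p choose k)" using assms by (intro dvd_choose_prime) auto
    then obtain c where "p choose k = p * c" by (auto simp: dvd_def)
    then have "of_nat (p choose k) = [:int p:] * [:int c:]" by (simp add: of_nat_poly)
    then have "[:int p:] dvd of_nat (p choose k)" by (rule dvdI)
    then show "[:int p:] dvd of_nat (p choose k) * f ^ k * g ^ (p - k)" by simp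
  qed
  finally show ?thesis .
qed

text \<open>The Frobenius congruence is iterated. For \<open>p = 2\<close> the sign of
  \<open>(-1)^p\<close> is wrong, but the error is a multiple of 2.\<close>

lemma const_poly_dvd_frobenius_minus_one:
  assumes p: "Factorial_Ring.prime (p::nat)"
  shows "[:int p:] dvd [:-1, 1:] ^ (p ^ n) - (monom 1 (p ^ n) - 1 :: int poly)"
proof (induction n)
  case 0
  have "[:-1, 1:] = (monom 1 1 - 1 :: int poly)" by (simp add: monom_altdef one_pCons)
  then show ?case by simp
next
  case (Suc n)
  let ?y = "monom 1 (p ^ n) :: int poly"
  have "?y ^ p = monom 1 (p ^ Suc n)"
    by (simp add: monom_power mult.commute)
  moreover have "[:int p:] dvd (?y + - 1) ^ p - (?y ^ p + (- 1) ^ p)"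
    by (rule const_poly_dvd_binomial_power[OF p])
  moreover have "[:int p:] dvd (- 1) ^ p - (- 1 :: int poly)"
  proof (cases "p = 2")
    case False
    then have "odd p" using p primes_dvd_imp_eq two_is_prime_nat by blast
    then show ?thesis by simp
  next
    case True
    have "(2 :: int poly) = [:2:]" by (simp add: numeral_poly)
    then show ?thesis using True by simp
  qed
  ultimately have "[:int p:] dvd ((?y + - 1) ^ p - (monom 1 (p ^ Suc n) + (- 1) ^ p))
      + ((- 1) ^ p - (- 1))"
    by (intro dvd_add) (simp_all only:)
  moreover have "(a + - 1) ^ p - (b + c) + (c - (- 1)) = (a - 1) ^ p - (b - 1)" for a b c :: "int poly"
    by simp
  ultimately have 1: "[:int p:] dvd (?y - 1) ^ p - (monom 1 (p ^ Suc n) - 1)"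
    by (simp only:)
  have "[:-1, 1:] ^ (p ^ n) - (?y - 1) dvd ([:-1, 1:] ^ (p ^ n)) ^ p - (?y - 1) ^ p"
    by (simp add: power_diff_sumr2)
  then have "[:int p:] dvd ([:-1, 1:] ^ (p ^ n)) ^ p - (?y - 1) ^ p"
    using Suc dvd_trans by blast
  moreover have "([:-1, 1:] ^ (p ^ n)) ^ p = ([:-1, 1:] :: int poly) ^ (p ^ Suc n)"
    by (simp add: power_mult[symmetric] mult.commute)
  ultimately have "[:int p:] dvd (([:-1, 1:] ^ (p ^ Suc n)) - (?y - 1) ^ p)
      + ((?y - 1) ^ p - (monom 1 (p ^ Suc n) - 1))"
    using 1 by (intro dvd_add) (simp_all only:)
  moreover have "(a - b) + (b - c) = a - c" for a b c :: "int poly" by simp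
  ultimately show ?case by (simp only:)
qed

text \<open>The Eisenstein property of the cyclotomic polynomial \<open>\<Phi>\<close> of order \<open>p\<^sup>n\<close> in the variable
  \<open>x - 1\<close>: the ideal \<open>(p)\<close> is the \<open>q\<close>-th power of \<open>(x - 1)\<close> modulo \<open>\<Phi>\<close>.\<close>

lemma gap_poly_eisenstein:
  fixes p n :: nat
  assumes p: "Factorial_Ring.prime (p::nat)"
  defines "q \<equiv> p ^ n * (p - 1)"
  obtains U V W where "gap_poly p (p ^ n) = [:-1, 1:] ^ q + [:int p:] * U"
    "[:int p:] = [:-1, 1:] ^ q * V + gap_poly p (p ^ n) * W"
proof -
  let ?l = "[:-1, 1:] :: int poly" and ?y = "monom 1 (p ^ n) :: int poly"
  let ?F = "gap_poly p (p ^ n)"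
  have p0: "p > 0" by (rule prime_gt_0_nat[OF p])
  have q0: "q > 0" using p prime_gt_1_nat[OF p] by (simp add: q_def)
  have lq: "?l ^ q = (?l ^ (p ^ n)) ^ (p - 1)" by (simp add: q_def power_mult)
  have prime_elem: "prime_elem [:int p:]" using p by (simp add: prime_elem_const_poly_iff)
  \<comment> \<open>Both summands on the right are multiples of \<open>p\<close> by Frobenius
    congruences, since \<open>(?y - 1) * ?F\<close> is again of the form \<open>X^m - 1\<close>. The
    factor on the left is then cancelled because \<open>[:int p:]\<close> is a prime
    element.\<close>
  have "?l ^ (p ^ n) * (?F - ?l ^ q) =
      (?l ^ (p ^ n) - (?y - 1)) * ?F + ((?y - 1) * ?F - ?l ^ (p ^ Suc n))"
  proof -
    have "?l ^ (p ^ n) * ?l ^ q = ?l ^ (p ^ Suc n)"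
      unfolding q_def power_add[symmetric] using p0 by (cases p) (simp_all add: algebra_simps)
    then show ?thesis by (simp add: algebra_simps)
  qed
  also have "[:int p:] dvd \<dots>"
  proof (rule dvd_add)
    show "[:int p:] dvd (?l ^ (p ^ n) - (?y - 1)) * ?F"
      using const_poly_dvd_frobenius_minus_one[OF p] by (rule dvd_mult2)
    have "(?y - 1) * ?F = monom 1 (p ^ Suc n) - 1" by (simp add: gap_poly_mult)
    then show "[:int p:] dvd (?y - 1) * ?F - ?l ^ (p ^ Suc n)"
      using const_poly_dvd_frobenius_minus_one[OF p, of "Suc n"]
      by (subst dvd_minus_iff[symmetric]) (simp only: minus_diff_eq)
  qed
  finally have "[:int p:] dvd ?l ^ (p ^ n) \<or> [:int p:] dvd ?F - ?l ^ q"
    by (rule prime_elem_dvd_multD[OF prime_elem])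
  moreover have "\<not> [:int p:] dvd ?l ^ (p ^ n)"
  proof
    assume "[:int p:] dvd ?l ^ (p ^ n)"
    then have "[:int p:] dvd ?l" using prime_elem prime_elem_dvd_power by blast
    then have "int p dvd 1" by (simp add: const_poly_dvd_iff_dvd_content content_def)
    then show False using p by simp
  qed
  ultimately obtain U where "?F - ?l ^ q = [:int p:] * U" by (auto elim: dvdE)
  then have U: "?F = ?l ^ q + [:int p:] * U" by (simp add: algebra_simps)
  \<comment> \<open>Evaluation at 1 shows that \<open>U\<close> is 1 modulo \<open>x - 1\<close>,
    hence a unit modulo every power of \<open>x - 1\<close>.\<close>
  have "poly ?F 1 = int p" by (simp add: gap_poly_def poly_sum poly_monom)
  then have "int p = int p * poly U 1" using arg_cong[OF U, of "\<lambda>f. poly f 1"] q0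
    by (simp add: poly_power zero_power)
  then have "poly U 1 = 1" using p0 by simp
  then have "poly (U - 1) 1 = 0" by simp
  then have "?l dvd U - 1" using poly_eq_0_iff_dvd[of "U - 1" 1] by simp
  then obtain U' where U': "U = 1 + ?l * U'" by (auto simp: dvd_def algebra_simps)
  define s where "s = - ?l * U'"
  \<comment> \<open>A truncated geometric series inverts \<open>U = 1 - s\<close> modulo the
    \<open>q\<close>-th power of \<open>x - 1\<close>.\<close>
  define S where "S = (\<Sum>i<q. s ^ i)"
  have "(1 - s) * S = 1 - s ^ q" unfolding S_def by (rule one_diff_power_eq[symmetric])
  moreover have "U = 1 - s" using U' by (simp add: s_def)
  then have "?F - ?l ^ q = [:int p:] * (1 - s)" using U by (simp only: add_diff_cancel_left')
  ultimately have "[:int p:] * (1 - s ^ q) = (?F - ?l ^ q) * S"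
    by (simp only: mult.assoc)
  moreover have "s = ?l * (- U')" by (simp add: s_def)
  then have "s ^ q = ?l ^ q * (- U') ^ q" by (simp only: power_mult_distrib)
  moreover have "P = L * (P * u - S) + F * S"
    if "P * (1 - s) = (F - L) * S" "s = L * u" for P L F S s u :: "int poly"
    using that by (simp add: algebra_simps)
  ultimately have "[:int p:] = ?l ^ q * ([:int p:] * (- U') ^ q - S) + ?F * S"
    by blast
  then show ?thesis using U that by blast
qed

lemma monic_division:
  fixes f g :: "int poly"
  assumes "lead_coeff g = 1"
  obtains s r where "f = g * s + r" "r = 0 \<or> degree r < degree g"
proof -
  obtain s r where sr: "pseudo_divmod f g = (s, r)" by fastforce
  have "g \<noteq> 0" using assms by auto
  from pseudo_divmod[OF this sr] show ?thesis using that assms by simp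
qed

lemma finite_bounded_int_polys: "finite {f :: int poly. degree f < N \<and> (\<forall>i. coeff f i \<in> {0..<M})}"
proof (rule finite_subset)
  show "finite (Poly ` {xs :: int list. set xs \<subseteq> {0..<M} \<and> length xs \<le> N})"
    by (intro finite_imageI finite_lists_length_le) simp
  show "{f :: int poly. degree f < N \<and> (\<forall>i. coeff f i \<in> {0..<M})}
      \<subseteq> Poly ` {xs. set xs \<subseteq> {0..<M} \<and> length xs \<le> N}"
  proof
    fix f :: "int poly" assume f: "f \<in> {f. degree f < N \<and> (\<forall>i. coeff f i \<in> {0..<M})}"
    have "set (coeffs f) \<subseteq> {0..<M}"
      using f by (auto simp: coeffs_def split: if_splits)
    moreover have "length (coeffs f) \<le> N"
      using f by (cases "f = 0") (auto simp: length_coeffs)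
    moreover have "f = Poly (coeffs f)" by simp
    ultimately show "f \<in> Poly ` {xs. set xs \<subseteq> {0..<M} \<and> length xs \<le> N}" by blast
  qed
qed

lemma poly_mod_coeffs:
  fixes f :: "int poly"
  assumes "M > 0"
  obtains r h where "f = r + [:M:] * h" "degree r \<le> degree f" "\<And>i. coeff r i \<in> {0..<M}"
proof
  let ?r = "map_poly (\<lambda>x. x mod M) f" and ?h = "map_poly (\<lambda>x. x div M) f"
  show "f = ?r + [:M:] * ?h"
    by (rule poly_eqI) (simp add: coeff_map_poly)
  show "degree ?r \<le> degree f"
    by (rule degree_le) (simp add: coeff_map_poly coeff_eq_0)
  show "coeff ?r i \<in> {0..<M}" for i using assms by (simp add: coeff_map_poly)
qed

text \<open>Tells a multiple of \<open>X\<close> apart from the polynomials in \<open>X^p\<close>;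
  this is how the span over \<open>b^p\<close> is seen to miss all multiples of
  \<open>b w\<close>.\<close>

lemma coeff_1_pcompose_monom:
  fixes r :: "int poly"
  assumes "p \<ge> 2"
  shows "coeff (pcompose r (monom 1 p)) 1 = 0"
  using assms by (cases r) (simp add: pcompose_pCons coeff_monom_mult coeff_pCons)

section \<open>Polynomials in an endomorphism of an abelian group\<close>

context comm_group
begin

text \<open>Horner evaluation of \<open>f\<close> at \<open>h\<close>. It makes the multiplicatively
  written group a module over Z[X]: sums of polynomials become products of group elements, products
  become compositions.\<close>

definition poly_act :: "('a \<Rightarrow> 'a) \<Rightarrow> int poly \<Rightarrow> 'a \<Rightarrow> 'a" where
  "poly_act h f a = foldr (\<lambda>c r. a [^] c \<otimes> h r) (coeffs f) \<one>"

lemma poly_act_0 [simp]: "poly_act h 0 a = \<one>"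
  by (simp add: poly_act_def)

lemma hom_endo_one [simp]: "h \<in> hom G G \<Longrightarrow> h \<one> = \<one>"
  by (rule hom_one[OF _ group_axioms group_axioms])

lemma hom_endo_closed [simp]: "h \<in> hom G G \<Longrightarrow> a \<in> carrier G \<Longrightarrow> h a \<in> carrier G"
  by (rule hom_in_carrier)

lemma poly_act_pCons:
  assumes "h \<in> hom G G" "a \<in> carrier G"
  shows "poly_act h (pCons c f) a = a [^] c \<otimes> h (poly_act h f a)"
  using assms by (cases "c = 0 \<and> f = 0") (auto simp: poly_act_def cCons_def coeffs_pCons_eq_cCons)

lemma poly_act_closed [simp]:
  assumes "h \<in> hom G G" "a \<in> carrier G"
  shows "poly_act h f a \<in> carrier G"
proof (induction f)
  case (pCons c f)
  then show ?case using assms by (simp add: poly_act_pCons hom_endo_closed)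
qed simp

lemma poly_act_const [simp]:
  "h \<in> hom G G \<Longrightarrow> a \<in> carrier G \<Longrightarrow> poly_act h [:c:] a = a [^] c"
  by (simp add: poly_act_pCons)

lemma poly_act_1 [simp]: "h \<in> hom G G \<Longrightarrow> a \<in> carrier G \<Longrightarrow> poly_act h 1 a = a"
  by (simp add: one_pCons)

lemma poly_act_add:
  assumes "h \<in> hom G G" "a \<in> carrier G"
  shows "poly_act h (f + g) a = poly_act h f a \<otimes> poly_act h g a"
proof (induction f g rule: poly_induct2)
  case (pCons c f d g)
  then show ?case
    using assms by (simp add: poly_act_pCons hom_endo_closed hom_mult int_pow_mult m_ac)
qed (use assms in simp)

lemma poly_act_distrib:
  assumes "h \<in> hom G G" "a \<in> carrier G" "b \<in> carrier G"
  shows "poly_act h f (a \<otimes> b) = poly_act h f a \<otimes> poly_act h f b"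
proof (induction f)
  case (pCons c f)
  then show ?case
    using assms by (simp add: poly_act_pCons hom_endo_closed hom_mult int_pow_distrib m_ac)
qed simp

lemma poly_act_hom: "h \<in> hom G G \<Longrightarrow> poly_act h f \<in> hom G G"
  by (intro homI) (simp_all add: poly_act_distrib)

lemma poly_act_one_right [simp]: "h \<in> hom G G \<Longrightarrow> poly_act h f \<one> = \<one>"
  by (intro hom_endo_one poly_act_hom)

lemma poly_act_int_pow:
  "h \<in> hom G G \<Longrightarrow> a \<in> carrier G \<Longrightarrow> poly_act h f (a [^] (c::int)) = poly_act h f a [^] c"
  by (rule hom_int_pow[OF poly_act_hom _ group_axioms group_axioms])

lemma poly_act_const_mult:
  assumes "h \<in> hom G G" "a \<in> carrier G"
  shows "poly_act h ([:c:] * f) a = poly_act h f a [^] c"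
proof (induction f)
  case (pCons d f)
  then show ?case
    using assms hom_int_pow[OF assms(1), of "poly_act h f a" c]
    by (simp add: poly_act_pCons hom_endo_closed int_pow_distrib int_pow_pow mult.commute is_group)
qed simp

lemma poly_act_mult:
  assumes "h \<in> hom G G" "a \<in> carrier G"
  shows "poly_act h (f * g) a = poly_act h f (poly_act h g a)"
proof (induction f)
  case (pCons c f)
  then show ?case
    using assms poly_act_const_mult[OF assms, of c g] by (simp add: poly_act_add poly_act_pCons)
qed (use assms in simp)

lemma poly_act_uminus:
  "h \<in> hom G G \<Longrightarrow> a \<in> carrier G \<Longrightarrow> poly_act h (- f) a = inv (poly_act h f a)"
  using poly_act_const_mult[of h a "-1" f] by (simp add: int_pow_neg)

lemma poly_act_diff:
  "h \<in> hom G G \<Longrightarrow> a \<in> carrier G \<Longrightarrow> poly_act h (f - g) a = poly_act h f a \<otimes> inv (poly_act h g a)"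
  using poly_act_add[of h a f "- g"] by (simp add: poly_act_uminus)

lemma funpow_hom: "h \<in> hom G G \<Longrightarrow> h ^^ n \<in> hom G G"
proof (induction n)
  case (Suc n)
  then have ih: "h ^^ n \<in> hom G G" by blast
  show ?case
    using Suc.prems hom_mult[OF ih] hom_mult[OF Suc.prems] hom_endo_closed[OF ih]
    by (intro homI) simp_all
next
  case 0
  show ?case by (rule homI) simp_all
qed

lemma poly_act_monom:
  assumes "h \<in> hom G G" "a \<in> carrier G"
  shows "poly_act h (monom 1 n) a = (h ^^ n) a"
proof (induction n)
  case (Suc n)
  then show ?case using assms hom_endo_closed[OF funpow_hom]
    by (simp add: monom_Suc poly_act_pCons)
qed (use assms in \<open>simp flip: one_poly_def\<close>)

text \<open>The two endomorphisms may differ. This covers semilinear maps, such as an element that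
  conjugates \<open>b\<close> to a power of \<open>b\<close>.\<close>

lemma hom_poly_act:
  assumes "h \<in> hom G G" "h' \<in> hom G G" "k \<in> hom G G" "a \<in> carrier G"
    and "\<And>v. v \<in> carrier G \<Longrightarrow> k (h v) = h' (k v)"
  shows "k (poly_act h f a) = poly_act h' f (k a)"
proof (induction f)
  case 0
  show ?case using assms(3) by simp
next
  case (pCons c f)
  then show ?case
    using assms hom_int_pow[OF assms(3,4)]
    by (simp add: poly_act_pCons hom_endo_closed hom_mult is_group)
qed

lemma poly_act_funpow:
  assumes "h \<in> hom G G" "a \<in> carrier G"
  shows "poly_act (h ^^ n) f a = poly_act h (pcompose f (monom 1 n)) a"
proof (induction f)
  case (pCons c f)
  then show ?case
    using assms
    by (simp add: poly_act_pCons funpow_hom pcompose_pCons poly_act_add poly_act_mult poly_act_monom)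
qed simp

lemma poly_act_cong:
  assumes "h \<in> hom G G" "h' \<in> hom G G" "a \<in> carrier G"
    and "\<And>v. v \<in> carrier G \<Longrightarrow> h v = h' v"
  shows "poly_act h f a = poly_act h' f a"
  using assms by (induction f) (simp_all add: poly_act_pCons)

declare hom_endo_one [simp del] hom_endo_closed [simp del]

end

section \<open>Powers in subgroups of finite index, and continuity in topological groups\<close>

lemma (in group) finite_index_power:
  assumes N: "subgroup N G" "finite_index N G" and a: "a \<in> carrier G"
  obtains m :: nat where "m > 0" "a [^] m \<in> N"
proof -
  have "finite ((\<lambda>i::nat. N #> a [^] i) ` UNIV)"
    by (rule finite_subset[OF _ N(2)[unfolded finite_index_def]]) (use a in \<open>auto simp: RCOSETS_def\<close>)
  then have "\<not> inj (\<lambda>i::nat. N #> a [^] i)" using finite_imageD infinite_UNIV_nat by blast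
  then obtain i j :: nat where ij: "i < j" "N #> a [^] i = N #> a [^] j"
    unfolding inj_def by (metis linorder_neqE_nat)
  then have "a [^] j \<in> N #> a [^] i" using rcos_self[OF nat_pow_closed[OF a] N(1), of j] by simp
  then obtain y where y: "y \<in> N" "a [^] j = y \<otimes> a [^] i" by (auto simp: r_coset_def)
  have yG: "y \<in> carrier G" using y(1) subgroup.subset[OF N(1)] by auto
  have "a [^] (j - i) \<otimes> a [^] i = y \<otimes> a [^] i" using y(2) ij(1) a by (simp add: nat_pow_mult)
  then have "a [^] (j - i) = y" using a yG by simp
  then show ?thesis using that[of "j - i"] ij(1) y(1) by simp
qed

lemma (in topological_group) continuous_map_group_mult:
  assumes "continuous_map S T f" "continuous_map S T g"
  shows "continuous_map S T (\<lambda>x. f x \<otimes> g x)"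
proof -
  have "continuous_map S (prod_topology T T) (\<lambda>x. (f x, g x))"
    using assms by (rule continuous_map_pairedI)
  from continuous_map_compose[OF this continuous_mult] show ?thesis by (simp add: o_def)
qed

lemma (in topological_group) continuous_map_nat_pow: "continuous_map T T (\<lambda>x. x [^] (n::nat))"
proof (induction n)
  case 0
  then show ?case using one_closed topspace_eq by simp
next
  case (Suc n)
  then show ?case using continuous_map_group_mult[OF Suc continuous_map_id[unfolded id_def]] by simp
qed

lemma (in topological_group) closedin_left_translate:
  assumes "g \<in> carrier G" "closedin T D"
  shows "closedin T {v \<in> carrier G. g \<otimes> v \<in> D}"
proof -
  have "continuous_map T T (\<lambda>v. g \<otimes> v)"
    using assms(1) topspace_eq
    by (intro continuous_map_group_mult) (simp_all add: continuous_map_id[unfolded id_def])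
  from closedin_continuous_map_preimage[OF this assms(2)] show ?thesis by (simp add: topspace_eq)
qed

section \<open>Lattices with an action of a finite p-group\<close>

text \<open>Purely algebraic, since it is applied to the finite group \<open>P\<close>.\<close>

definition maximal_in :: "'a set \<Rightarrow> ('a, 'b) monoid_scheme \<Rightarrow> bool" where
  "maximal_in M G \<longleftrightarrow> subgroup M G \<and> M \<noteq> carrier G \<and>
     (\<forall>K. subgroup K G \<and> M \<subseteq> K \<longrightarrow> K = M \<or> K = carrier G)"

text \<open>Abstract form of a normal abelian subgroup \<open>A\<close> with quotient
  \<open>P\<close>. The axiom \<open>residual\<close> is what triviality of \<open>O^p\<close>
  leaves on \<open>A\<close>; \<open>irreducible\<close> combines just infiniteness of the group
  (\<open>M = carrier P\<close>) with that of its maximal subgroups.\<close>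

locale p_group_lattice = A: comm_group A + P: group P
  for A :: "('a, 'b) monoid_scheme" (structure) and P :: "('p, 'c) monoid_scheme" +
  fixes act :: "'p \<Rightarrow> 'a \<Rightarrow> 'a" and T :: "'a topology" and p r :: nat
  assumes p: "Factorial_Ring.prime p"
    and order_P: "order P = p ^ r"
    and act_hom: "g \<in> carrier P \<Longrightarrow> act g \<in> hom A A"
    and act_mult: "g \<in> carrier P \<Longrightarrow> h \<in> carrier P \<Longrightarrow> a \<in> carrier A \<Longrightarrow> act (g \<otimes>\<^bsub>P\<^esub> h) a = act g (act h a)"
    and act_one: "a \<in> carrier A \<Longrightarrow> act \<one>\<^bsub>P\<^esub> a = a"
    and faithful: "g \<in> carrier P \<Longrightarrow> (\<And>a. a \<in> carrier A \<Longrightarrow> act g a = a) \<Longrightarrow> g = \<one>\<^bsub>P\<^esub>"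
    and torsion_free: "a \<in> carrier A \<Longrightarrow> a [^] (m::int) = \<one> \<Longrightarrow> m \<noteq> 0 \<Longrightarrow> a = \<one>"
    and residual: "a \<in> carrier A \<Longrightarrow> (\<And>k. \<exists>c\<in>carrier A. a = c [^] (int p ^ k)) \<Longrightarrow> a = \<one>"
    and topological: "topological_group A T" and Hausdorff: "Hausdorff_space T"
    and compact_or_discrete: "compact_space T \<or> T = discrete_topology (carrier A)"
    and act_continuous: "g \<in> carrier P \<Longrightarrow> continuous_map T T (act g)"
    and irreducible: "M = carrier P \<or> maximal_in M P \<Longrightarrow> subgroup N A \<Longrightarrow> closedin T N \<Longrightarrow>
      (\<And>g v. g \<in> M \<Longrightarrow> v \<in> N \<Longrightarrow> act g v \<in> N) \<Longrightarrow> N \<noteq> {\<one>} \<Longrightarrow> finite_index N A"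
begin

sublocale topological_group A T by (rule topological)

lemma p_gt_1: "p > 1" by (rule prime_gt_1_nat[OF p])

lemma act_closed [simp]: "g \<in> carrier P \<Longrightarrow> a \<in> carrier A \<Longrightarrow> act g a \<in> carrier A"
  by (rule A.hom_endo_closed[OF act_hom])

lemma act_distrib: "g \<in> carrier P \<Longrightarrow> a \<in> carrier A \<Longrightarrow> b \<in> carrier A \<Longrightarrow> act g (a \<otimes> b) = act g a \<otimes> act g b"
  by (rule hom_mult[OF act_hom])

lemma act_one_right [simp]: "g \<in> carrier P \<Longrightarrow> act g \<one> = \<one>"
  by (rule A.hom_endo_one[OF act_hom])

lemma act_int_pow: "g \<in> carrier P \<Longrightarrow> a \<in> carrier A \<Longrightarrow> act g (a [^] (m::int)) = act g a [^] m"
  by (rule hom_int_pow[OF act_hom _ A.group_axioms A.group_axioms])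

lemma act_nat_pow_funpow:
  "g \<in> carrier P \<Longrightarrow> a \<in> carrier A \<Longrightarrow> act (g [^]\<^bsub>P\<^esub> (n::nat)) a = (act g ^^ n) a"
proof (induction n arbitrary: a)
  case (Suc n)
  then show ?case by (simp add: act_mult funpow_swap1)
qed (simp add: act_one)

lemma int_pow_cancel:
  assumes "a \<in> carrier A" "b \<in> carrier A" "(m::int) \<noteq> 0" "a [^] m = b [^] m"
  shows "a = b"
proof -
  have "(a \<otimes> inv b) [^] m = \<one>" using assms by (simp add: A.int_pow_distrib A.int_pow_inv)
  then have ab: "a \<otimes> inv b = \<one>"
    by (rule torsion_free[rotated]) (use assms in simp_all)
  have "a = (a \<otimes> inv b) \<otimes> b" using assms(1,2) by (simp add: A.m_assoc)
  then show ?thesis using ab assms(2) by simp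
qed

text \<open>A power of every \<open>a\<close> lies in \<open>N\<close>, and roots are unique in a
  torsion-free abelian group, so \<open>g\<close> fixes everything.\<close>

lemma fixed_by_finite_index:
  assumes N: "subgroup N A" "finite_index N A" and g: "g \<in> carrier P"
    and "\<And>v. v \<in> N \<Longrightarrow> act g v = v"
  shows "g = \<one>\<^bsub>P\<^esub>"
proof (rule faithful[OF g])
  fix a assume a: "a \<in> carrier A"
  obtain m :: nat where m: "m > 0" "a [^] m \<in> N" by (rule A.finite_index_power[OF N a])
  have "act g a [^] int m = a [^] int m"
    using assms(4)[OF m(2)] act_int_pow[OF g a, of "int m"] by (simp add: int_pow_int)
  then show "act g a = a" by (rule int_pow_cancel[rotated 3]) (use m(1) a g in simp_all)
qed

lemma act_inv: "g \<in> carrier P \<Longrightarrow> a \<in> carrier A \<Longrightarrow> act g (inv a) = inv (act g a)"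
  using act_int_pow[of g a "-1"] by (simp add: A.int_pow_neg)

lemma subgroup_fixed: "g \<in> carrier P \<Longrightarrow> subgroup {a \<in> carrier A. act g a = a} A"
  by (intro A.subgroupI) (auto simp: act_distrib act_inv intro!: exI[of _ \<one>])

lemma closedin_fixed: "g \<in> carrier P \<Longrightarrow> closedin T {a \<in> carrier A. act g a = a}"
  using closedin_continuous_maps_eq[OF Hausdorff act_continuous continuous_map_id] topspace_eq
  by simp

text \<open>The fixed points of a central element form a closed \<open>P\<close>-invariant subgroup.
  If it were nontrivial, it would have finite index and \<open>z\<close> would act
  trivially.\<close>

lemma central_fixed_point_free:
  assumes z: "z \<in> carrier P" "z \<noteq> \<one>\<^bsub>P\<^esub>" and central: "\<And>g. g \<in> carrier P \<Longrightarrow> P.conj_by g z = z"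
    and a: "a \<in> carrier A" "act z a = a"
  shows "a = \<one>"
proof (rule ccontr)
  assume "a \<noteq> \<one>"
  let ?N = "{a \<in> carrier A. act z a = a}"
  have "finite_index ?N A"
  proof (rule irreducible[of "carrier P"])
    fix g v assume g: "g \<in> carrier P" and v: "v \<in> ?N"
    have "z \<otimes>\<^bsub>P\<^esub> g = g \<otimes>\<^bsub>P\<^esub> z" using central[OF g] P.conj_by_eq_iff[OF g z(1) z(1)] by simp
    then have "act (z \<otimes>\<^bsub>P\<^esub> g) v = act (g \<otimes>\<^bsub>P\<^esub> z) v" by simp
    then have "act z (act g v) = act g v"
      using g v z by (simp add: act_mult)
    then show "act g v \<in> ?N" using g v by simp
  next
    show "?N \<noteq> {\<one>}" using a \<open>a \<noteq> \<one>\<close> by blast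
  qed (use subgroup_fixed closedin_fixed z in auto)
  then show False using fixed_by_finite_index[of ?N z] subgroup_fixed z by blast
qed

text \<open>In additive notation \<open>p^k A\<close>. Congruences modulo these subgroups for all
  \<open>k\<close> take the place of coefficients in the p-adic integers.\<close>

definition pmul :: "nat \<Rightarrow> 'a set" where
  "pmul k = (\<lambda>c. c [^] (int p ^ k)) ` carrier A"

lemma pmul_closed: "u \<in> pmul k \<Longrightarrow> u \<in> carrier A"
  by (auto simp: pmul_def)

lemma pmul_I: "c \<in> carrier A \<Longrightarrow> c [^] (int p ^ k) \<in> pmul k"
  by (auto simp: pmul_def)

lemma one_in_pmul: "\<one> \<in> pmul k"
  using pmul_I[of \<one> k] by simp

lemma pmul_mult: "u \<in> pmul k \<Longrightarrow> v \<in> pmul k \<Longrightarrow> u \<otimes> v \<in> pmul k"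
  by (auto simp: pmul_def A.int_pow_distrib[symmetric])

lemma pmul_inv: "u \<in> pmul k \<Longrightarrow> inv u \<in> pmul k"
  by (auto simp: pmul_def A.int_pow_inv[symmetric])

lemma pmul_hom: "h \<in> hom A A \<Longrightarrow> u \<in> pmul k \<Longrightarrow> h u \<in> pmul k"
  using hom_int_pow[OF _ _ A.group_axioms A.group_axioms, of h] A.hom_endo_closed[of h] by (auto simp: pmul_def)

lemma pmul_int_pow: "u \<in> pmul k \<Longrightarrow> u [^] (m::int) \<in> pmul k"
  by (auto simp: pmul_def A.int_pow_pow mult.commute[of _ m]) (auto simp: A.int_pow_pow[symmetric])

lemma pmul_mono: assumes "j \<le> k" "u \<in> pmul k" shows "u \<in> pmul j"
proof -
  obtain c where c: "c \<in> carrier A" "u = c [^] (int p ^ k)" using assms by (auto simp: pmul_def)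
  have "int p ^ k = int p ^ (k - j) * int p ^ j" using assms by (simp add: power_add[symmetric])
  then have "u = (c [^] (int p ^ (k - j))) [^] (int p ^ j)" using c by (simp add: A.int_pow_pow)
  then show ?thesis using c by (simp add: pmul_I)
qed

lemma subgroup_pmul: "subgroup (pmul k) A"
  using one_in_pmul by (intro A.subgroupI) (auto simp: pmul_closed pmul_mult pmul_inv)

lemma closedin_pmul: "closedin T (pmul k)"
proof -
  have eq: "pmul k = (\<lambda>c. c [^] (p ^ k)) ` topspace T"
    using int_pow_int[of A _ "p ^ k"] by (simp add: pmul_def topspace_eq)
  from compact_or_discrete show ?thesis
  proof
    assume "compact_space T"
    then have "compactin T (pmul k)" unfolding eq
      using image_compactin[OF _ continuous_map_nat_pow] by (simp add: compact_space_def)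
    then show ?thesis using Hausdorff by (rule compactin_imp_closedin[rotated])
  next
    assume "T = discrete_topology (carrier A)"
    then show ?thesis using pmul_closed by (auto simp: closedin_discrete_topology)
  qed
qed

lemma residual_pmul: "a \<in> carrier A \<Longrightarrow> (\<And>k. a \<in> pmul k) \<Longrightarrow> a = \<one>"
  by (rule residual) (auto simp: pmul_def)

text \<open>The closure of Z[h] w in the p-adic topology of \<open>A\<close>. It plays the role of
  the submodule that \<open>w\<close> generates over the p-adic integers together with
  \<open>h\<close>.\<close>

definition padic_span :: "('a \<Rightarrow> 'a) \<Rightarrow> 'a \<Rightarrow> 'a set" where
  "padic_span h w = {v \<in> carrier A. \<forall>k. \<exists>f. \<exists>u\<in>pmul k. v = A.poly_act h f w \<otimes> u}"

lemma self_in_padic_span: "h \<in> hom A A \<Longrightarrow> w \<in> carrier A \<Longrightarrow> w \<in> padic_span h w"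
  unfolding padic_span_def
  by (intro CollectI conjI allI exI[of _ 1] bexI[of _ \<one>] one_in_pmul) simp_all

lemma subgroup_padic_span:
  assumes h: "h \<in> hom A A" and w: "w \<in> carrier A"
  shows "subgroup (padic_span h w) A"
proof (rule A.subgroupI)
  show "padic_span h w \<noteq> {}" using self_in_padic_span[OF h w] by blast
next
  fix v assume v: "v \<in> padic_span h w"
  have "\<exists>f. \<exists>u\<in>pmul k. inv v = A.poly_act h f w \<otimes> u" for k
  proof -
    obtain f u where u: "u \<in> pmul k" "v = A.poly_act h f w \<otimes> u"
      using v unfolding padic_span_def by blast
    have "inv v = A.poly_act h (- f) w \<otimes> inv u"
      using u h w pmul_closed[OF u(1)] by (simp add: A.poly_act_uminus A.inv_mult)
    then show ?thesis using pmul_inv[OF u(1)] by blast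
  qed
  then show "inv v \<in> padic_span h w" using v by (simp add: padic_span_def)
next
  fix v v' assume v: "v \<in> padic_span h w" "v' \<in> padic_span h w"
  have "\<exists>f. \<exists>u\<in>pmul k. v \<otimes> v' = A.poly_act h f w \<otimes> u" for k
  proof -
    obtain f u where u: "u \<in> pmul k" "v = A.poly_act h f w \<otimes> u"
      using v unfolding padic_span_def by blast
    obtain f' u' where u': "u' \<in> pmul k" "v' = A.poly_act h f' w \<otimes> u'"
      using v unfolding padic_span_def by blast
    have "v \<otimes> v' = A.poly_act h (f + f') w \<otimes> (u \<otimes> u')"
      using u u' h w pmul_closed by (simp add: A.poly_act_add A.m_ac)
    then show ?thesis using pmul_mult[OF u(1) u'(1)] by blast
  qed
  then show "v \<otimes> v' \<in> padic_span h w" using v by (simp add: padic_span_def)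
qed (auto simp: padic_span_def)

text \<open>From \<open>g (f(h) w) = f(h^j) (g w)\<close> it is enough to know where
  \<open>g\<close> sends the generator. The exponent \<open>j\<close> admits maps \<open>g\<close>
  that do not commute with \<open>h\<close> but conjugate it to a power.\<close>

lemma padic_span_invariant:
  assumes h: "h \<in> hom A A" and w: "w \<in> carrier A" and g: "g \<in> hom A A"
    and semi: "\<And>v. v \<in> carrier A \<Longrightarrow> g (h v) = (h ^^ j) (g v)"
    and gw: "g w \<in> padic_span h w" and v: "v \<in> padic_span h w"
  shows "g v \<in> padic_span h w"
proof -
  have gwc: "g w \<in> carrier A" by (rule A.hom_endo_closed[OF g w])
  have "\<exists>f. \<exists>u\<in>pmul k. g v = A.poly_act h f w \<otimes> u" for k
  proof -
    obtain f u where u: "u \<in> pmul k" "v = A.poly_act h f w \<otimes> u"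
      using v unfolding padic_span_def by blast
    obtain f' u' where u': "u' \<in> pmul k" "g w = A.poly_act h f' w \<otimes> u'"
      using gw unfolding padic_span_def by blast
    let ?F = "pcompose f (monom 1 j)"
    have "g v = g (A.poly_act h f w) \<otimes> g u"
      using u(2) hom_mult[OF g _ pmul_closed[OF u(1)]] h w by simp
    also have "g (A.poly_act h f w) = A.poly_act h ?F (g w)"
      using A.hom_poly_act[OF h A.funpow_hom[OF h] g w semi]
      by (simp add: A.poly_act_funpow[OF h gwc])
    also have "\<dots> \<otimes> g u = A.poly_act h (?F * f') w \<otimes> (A.poly_act h ?F u' \<otimes> g u)"
      using u'(2) h w pmul_closed[OF u'(1)] A.hom_endo_closed[OF g pmul_closed[OF u(1)]]
      by (simp add: A.poly_act_distrib A.poly_act_mult A.m_assoc)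
    finally show ?thesis
      using pmul_mult[OF pmul_hom[OF A.poly_act_hom[OF h] u'(1)] pmul_hom[OF g u(1)]] by blast
  qed
  then show ?thesis using v A.hom_endo_closed[OF g] by (simp add: padic_span_def)
qed

lemma padic_span_self_invariant:
  assumes h: "h \<in> hom A A" and w: "w \<in> carrier A" and v: "v \<in> padic_span h w"
  shows "h v \<in> padic_span h w"
proof (rule padic_span_invariant[OF h w h, of 1])
  have "h w = A.poly_act h [:0, 1:] w \<otimes> \<one>"
    using h w A.hom_endo_closed[OF h w] by (simp add: A.poly_act_pCons A.hom_endo_one)
  then show "h w \<in> padic_span h w"
    unfolding padic_span_def using h w
    by (intro CollectI conjI allI exI[of _ "[:0, 1:]"] bexI[of _ \<one>] one_in_pmul) simp_all
qed (use v in simp_all)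

text \<open>Modulo \<open>X^N - 1\<close> and \<open>p^k\<close> only finitely many polynomials
  remain, so at each level \<open>k\<close> the span is a finite union of closed cosets of
  \<open>pmul k\<close>.\<close>

lemma closedin_padic_span:
  assumes h: "h \<in> hom A A" and w: "w \<in> carrier A"
    and N: "N > 0" "\<And>v. v \<in> carrier A \<Longrightarrow> (h ^^ N) v = v"
  shows "closedin T (padic_span h w)"
proof -
  define E where "E k = {v \<in> carrier A. \<exists>f. \<exists>u\<in>pmul k. v = A.poly_act h f w \<otimes> u}" for k
  define F where "F k = {f :: int poly. degree f < N \<and> (\<forall>i. coeff f i \<in> {0..<int p ^ k})}" for k
  have "E k = (\<Union>f\<in>F k. {v \<in> carrier A. inv (A.poly_act h f w) \<otimes> v \<in> pmul k})" for k
  proof (intro subset_antisym subsetI)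
    fix v assume "v \<in> E k"
    then obtain f u where u: "v \<in> carrier A" "u \<in> pmul k" "v = A.poly_act h f w \<otimes> u"
      by (auto simp: E_def)
    let ?g = "monom 1 N - 1 :: int poly"
    have deg: "degree ?g = N" "lead_coeff ?g = 1"
    proof -
      show 1: "degree ?g = N"
        using degree_add_eq_left[of "- 1" "monom (1::int) N"] N(1) by (simp add: degree_monom_eq)
      show "lead_coeff ?g = 1" unfolding 1 using N(1) by simp
    qed
    obtain s t where st: "f = ?g * s + t" "t = 0 \<or> degree t < N"
      using monic_division[OF deg(2), of f] unfolding deg(1) by blast
    have M: "int p ^ k > 0" using p_gt_1 by simp
    obtain r l where r: "t = r + [:int p ^ k:] * l" "degree r \<le> degree t" "\<And>i. coeff r i \<in> {0..<int p ^ k}"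
      using poly_mod_coeffs[OF M, of t] by blast
    have rF: "r \<in> F k" using st(2) r N(1) by (auto simp: F_def)
    have "A.poly_act h (?g * s) w = \<one>"
      using h w N(2) by (subst mult.commute) (simp add: A.poly_act_mult A.poly_act_diff A.poly_act_monom)
    moreover have "v = A.poly_act h (?g * s + (r + [:int p ^ k:] * l)) w \<otimes> u"
      using u(3) st(1) r(1) by (simp only:)
    ultimately have "v = A.poly_act h r w \<otimes> (A.poly_act h l w [^] (int p ^ k) \<otimes> u)"
      unfolding A.poly_act_add[OF h w] A.poly_act_const_mult[OF h w]
      using h w pmul_closed[OF u(2)] by (simp only: A.l_one A.poly_act_closed A.m_closed A.int_pow_closed A.m_assoc)
    then have "inv (A.poly_act h r w) \<otimes> v = A.poly_act h l w [^] (int p ^ k) \<otimes> u"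
      using h w pmul_closed[OF u(2)] by (simp add: A.m_assoc[symmetric])
    also have "\<dots> \<in> pmul k" using pmul_mult[OF pmul_I u(2)] h w by simp
    finally show "v \<in> (\<Union>f\<in>F k. {v \<in> carrier A. inv (A.poly_act h f w) \<otimes> v \<in> pmul k})"
      using rF u(1) by blast
  next
    fix v assume "v \<in> (\<Union>f\<in>F k. {v \<in> carrier A. inv (A.poly_act h f w) \<otimes> v \<in> pmul k})"
    then obtain f where f: "v \<in> carrier A" "inv (A.poly_act h f w) \<otimes> v \<in> pmul k" by blast
    have "v = A.poly_act h f w \<otimes> (inv (A.poly_act h f w) \<otimes> v)"
      using h w f(1) by (simp add: A.m_assoc[symmetric])
    then show "v \<in> E k" using f by (auto simp: E_def)
  qed
  moreover have "finite (F k)" for k unfolding F_def by (rule finite_bounded_int_polys)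
  moreover have "closedin T {v \<in> carrier A. inv (A.poly_act h f w) \<otimes> v \<in> pmul k}" for f k
    using h w by (intro closedin_left_translate closedin_pmul) auto
  ultimately have E: "closedin T (E k)" for k by (simp only:) (rule closedin_Union, auto)
  have "padic_span h w = (\<Inter>k. E k)" by (auto simp: padic_span_def E_def)
  moreover have "closedin T (\<Inter>k. E k)" by (rule closedin_INT) (simp_all add: E)
  ultimately show ?thesis by (simp only:)
qed

end

text \<open>The lattice is a module over \<open>\<int>[\<zeta>]\<close> for a primitive root of unity \<open>\<zeta>\<close> of order
  \<open>p\<^sup>n\<^sup>+\<^sup>1\<close>, which acts through \<open>b\<close>; \<open>Lam j\<close> is the multiple of \<open>A\<close> by \<open>(\<zeta> - 1)\<^sup>j\<close>.\<close>

locale cyclic_lattice = p_group_lattice +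
  fixes b n
  assumes b [simp]: "b \<in> carrier P" and ord_b: "P.ord b = p ^ Suc n"
    and fixed_point_free: "a \<in> carrier A \<Longrightarrow> act (b [^]\<^bsub>P\<^esub> (p ^ n)) a = a \<Longrightarrow> a = \<one>"
begin

abbreviation "cact \<equiv> A.poly_act (act b)"

text \<open>The degree of the cyclotomic polynomial of order \<open>p^(n+1)\<close> and at the same
  time the ramification index of \<open>p\<close>: \<open>p A\<close> equals
  \<open>Lam q\<close>.\<close>

definition "q = p ^ n * (p - 1)"

definition "Lam j = cact ([:-1, 1:] ^ j) ` carrier A"

lemma hb: "act b \<in> hom A A" by (rule act_hom[OF b])

lemma cact_closed [simp]: "a \<in> carrier A \<Longrightarrow> cact f a \<in> carrier A"
  by (rule A.poly_act_closed[OF hb])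

lemmas cact_mult = A.poly_act_mult[OF hb]
lemmas cact_add = A.poly_act_add[OF hb]
lemmas cact_diff = A.poly_act_diff[OF hb]
lemmas cact_const_mult = A.poly_act_const_mult[OF hb]
lemmas cact_distrib = A.poly_act_distrib[OF hb]
lemmas cact_int_pow = A.poly_act_int_pow[OF hb]

lemma cact_const: "a \<in> carrier A \<Longrightarrow> cact [:c:] a = a [^] c"
  by (rule A.poly_act_const[OF hb])

lemma cact_1 [simp]: "a \<in> carrier A \<Longrightarrow> cact 1 a = a"
  by (rule A.poly_act_1[OF hb])

lemma cact_one_right [simp]: "cact f \<one> = \<one>"
  by (rule A.poly_act_one_right[OF hb])

lemma cact_monom: "a \<in> carrier A \<Longrightarrow> cact (monom 1 i) a = act (b [^]\<^bsub>P\<^esub> i) a"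
  by (simp add: A.poly_act_monom[OF hb] act_nat_pow_funpow)

lemma cact_commute: "a \<in> carrier A \<Longrightarrow> cact f (cact g a) = cact g (cact f a)"
  by (simp add: cact_mult[symmetric] mult.commute)

lemma q_pos: "q > 0"
  using p_gt_1 by (simp add: q_def)

lemma b_pow: "b [^]\<^bsub>P\<^esub> (p * p ^ n) = \<one>\<^bsub>P\<^esub>"
  using P.pow_ord_eq_1[OF b] by (simp add: ord_b)

text \<open>The product of \<open>gap_poly p (p ^ n)\<close> with \<open>X^(p^n) - 1\<close> is
  \<open>X^(p^(n+1)) - 1\<close>, which annihilates \<open>A\<close>; so the image consists of fixed
  points of \<open>b^(p^n)\<close>.\<close>

lemma cact_gap_poly: "a \<in> carrier A \<Longrightarrow> cact (gap_poly p (p ^ n)) a = \<one>"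
proof -
  assume a: "a \<in> carrier A"
  let ?v = "cact (gap_poly p (p ^ n)) a"
  have v: "?v \<in> carrier A" using a by simp
  have "cact (monom 1 (p ^ n) - 1) ?v = \<one>"
    using a by (simp add: cact_mult[symmetric] gap_poly_mult cact_diff cact_monom b_pow act_one)
  then have "act (b [^]\<^bsub>P\<^esub> (p ^ n)) ?v \<otimes> inv ?v = \<one>"
    using v by (simp add: cact_diff cact_monom)
  then have "act (b [^]\<^bsub>P\<^esub> (p ^ n)) ?v = ?v"
    using v A.inv_equality A.inv_solve_right'[of \<one> "act (b [^]\<^bsub>P\<^esub> (p ^ n)) ?v" ?v] by simp
  then show ?thesis using fixed_point_free v by blast
qed

lemma cact_mod_gap_poly: "a \<in> carrier A \<Longrightarrow> cact (gap_poly p (p ^ n) * s + f) a = cact f a"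
  by (simp add: cact_add mult.commute[of _ s] cact_mult cact_gap_poly)

lemma cact_reduce:
  assumes "a \<in> carrier A"
  obtains g where "g = 0 \<or> degree g < q" "cact f a = cact g a"
proof -
  have pn: "p ^ n > 0" "p > 0" using p_gt_1 by auto
  obtain s t where "f = gap_poly p (p ^ n) * s + t" "t = 0 \<or> degree t < degree (gap_poly p (p ^ n))"
    by (rule monic_division[OF degree_gap_poly(2)[OF pn]])
  moreover from this have "cact f a = cact t a" using cact_mod_gap_poly[OF assms] by simp
  ultimately show ?thesis
    by (intro that[of t]) (simp_all add: degree_gap_poly(1)[OF pn] q_def mult.commute)
qed

lemma Lam_closed: "v \<in> Lam j \<Longrightarrow> v \<in> carrier A"
  by (auto simp: Lam_def)

lemma Lam_mult: "u \<in> Lam j \<Longrightarrow> v \<in> Lam j \<Longrightarrow> u \<otimes> v \<in> Lam j"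
  by (auto simp: Lam_def cact_distrib[symmetric])

lemma Lam_int_pow: "u \<in> Lam j \<Longrightarrow> u [^] (m::int) \<in> Lam j"
  by (auto simp: Lam_def cact_int_pow[symmetric])

lemma Lam_inv: "u \<in> Lam j \<Longrightarrow> inv u \<in> Lam j"
  using Lam_int_pow[of u j "-1"] by (simp add: A.int_pow_neg Lam_closed)

lemma Lam_Suc: "Lam (Suc j) = (\<lambda>v. cact [:-1, 1:] (cact ([:-1, 1:] ^ j) v)) ` carrier A"
  unfolding Lam_def power_Suc by (intro image_cong refl) (rule cact_mult)

lemma Lam_mono: assumes "i \<le> j" "v \<in> Lam j" shows "v \<in> Lam i"
proof -
  obtain c where c: "c \<in> carrier A" "v = cact ([:-1, 1:] ^ j) c" using assms by (auto simp: Lam_def)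
  have "[:-1, 1:] ^ j = ([:-1, 1:] ^ i * [:-1, 1:] ^ (j - i) :: int poly)"
    using assms(1) by (simp add: power_add[symmetric])
  then show ?thesis using c by (simp add: cact_mult Lam_def)
qed

text \<open>This and \<open>Lam_is_power\<close> are the two halves of
  \<open>p A = (zeta - 1)^q A\<close>, read off from the Eisenstein relations.\<close>

lemma power_in_Lam: assumes a: "a \<in> carrier A" shows "a [^] int p \<in> Lam q"
proof -
  obtain V W where "[:int p:] = [:-1, 1:] ^ q * V + gap_poly p (p ^ n) * W"
    unfolding q_def by (rule gap_poly_eisenstein[OF p, of n])
  then have "[:int p:] = gap_poly p (p ^ n) * W + [:-1, 1:] ^ q * V" by simp
  then have "a [^] int p = cact ([:-1, 1:] ^ q) (cact V a)"
    using a cact_const[OF a, of "int p"] by (simp add: cact_mod_gap_poly cact_mult)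
  then show ?thesis using a by (simp add: Lam_def)
qed

lemma Lam_is_power: assumes a: "a \<in> carrier A" obtains d where "d \<in> carrier A" "cact ([:-1, 1:] ^ q) a = d [^] int p"
proof -
  obtain U where "gap_poly p (p ^ n) = [:-1, 1:] ^ q + [:int p:] * U"
    unfolding q_def by (rule gap_poly_eisenstein[OF p, of n])
  then have "[:-1, 1:] ^ q = gap_poly p (p ^ n) * 1 + [:int p:] * (- U)" by (simp add: algebra_simps)
  then have "cact ([:-1, 1:] ^ q) a = cact (gap_poly p (p ^ n) * 1 + [:int p:] * (- U)) a"
    by (simp only:)
  also have "\<dots> = cact ([:int p:] * (- U)) a" by (rule cact_mod_gap_poly[OF a])
  also have "\<dots> = cact (- U) a [^] int p" by (rule cact_const_mult[OF a])
  finally show ?thesis by (rule that[rotated]) (use a in simp)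
qed

text \<open>An element killed by \<open>zeta - 1\<close> is fixed by \<open>b\<close>, hence by
  \<open>b^(p^n)\<close>, hence trivial.\<close>

lemma lam_inj:
  assumes "a \<in> carrier A" "c \<in> carrier A" "cact ([:-1, 1:] ^ j) a = cact ([:-1, 1:] ^ j) c"
  shows "a = c"
proof -
  have triv: "v = \<one>" if v: "v \<in> carrier A" "cact ([:-1, 1:] ^ j) v = \<one>" for v j
    using v(2)
  proof (induction j)
    case (Suc j)
    let ?u = "cact ([:-1, 1:] ^ j) v"
    have u: "?u \<in> carrier A" using v by simp
    have "[:-1, 1:] = (monom 1 1 - 1 :: int poly)" by (simp add: monom_altdef one_pCons)
    then have "cact (monom 1 1 - 1) ?u = \<one>"
      using Suc.prems v(1) by (simp add: cact_mult)
    then have "act b ?u \<otimes> inv ?u = \<one>"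
      using u by (simp add: cact_diff cact_monom)
    then have e: "act b ?u = ?u"
      using u A.inv_solve_right'[of \<one> "act b ?u" ?u] by simp
    have "(act b ^^ i) ?u = ?u" for i by (induction i) (simp_all add: e)
    then have "?u = \<one>" using u by (intro fixed_point_free) (simp_all add: act_nat_pow_funpow)
    then show ?case by (rule Suc.IH)
  qed (use v in simp)
  have "cact ([:-1, 1:] ^ j) (a \<otimes> inv c) = \<one>"
  proof -
    have "cact ([:-1, 1:] ^ j) (a \<otimes> c [^] (-1::int)) = \<one>"
      unfolding cact_distrib[OF assms(1) A.int_pow_closed[OF assms(2)]] cact_int_pow[OF assms(2)] assms(3)
      using assms by (simp add: A.int_pow_neg)
    then show ?thesis using assms by (simp add: A.int_pow_neg)
  qed
  then have ac: "a \<otimes> inv c = \<one>" by (rule triv[rotated]) (use assms in simp)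
  have "a = (a \<otimes> inv c) \<otimes> c" using assms by (simp add: A.m_assoc)
  then show ?thesis using ac assms by simp
qed

text \<open>The elements \<open>a, (zeta - 1) a, ..., (zeta - 1)^(q-1) a\<close> are independent
  modulo \<open>p\<close>. The value \<open>f(1)\<close> is divisible by \<open>p\<close>, since
  otherwise \<open>a\<close> itself would be a multiple of \<open>zeta - 1\<close>; the rest of
  \<open>f\<close> has the factor \<open>X - 1\<close>, which can be cancelled.\<close>

lemma dvd_if_in_Lam:
  assumes a: "a \<in> carrier A" "a \<notin> Lam 1"
  shows "d \<le> q \<Longrightarrow> f = 0 \<or> degree f < d \<Longrightarrow> cact f a \<in> Lam d \<Longrightarrow> [:int p:] dvd f"
proof (induction d arbitrary: f)
  case (Suc d)
  let ?l = "[:-1, 1:] :: int poly"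
  define s where "s = synthetic_div f 1"
  define c where "c = poly f 1"
  have f: "f = ?l * s + [:c:]" using synthetic_div_correct'[of 1 f] by (simp add: s_def c_def)
  have aq: "a [^] int p \<in> Lam q" by (rule power_in_Lam[OF a(1)])
  have fa: "cact f a = cact ?l (cact s a) \<otimes> a [^] c"
    unfolding f using a by (simp only: cact_add cact_mult cact_const)
  obtain w where w: "w \<in> carrier A" "cact f a = cact ?l (cact (?l ^ d) w)"
    using Suc.prems(3) by (auto simp only: Lam_Suc)
  have ac: "a [^] c = inv (cact ?l (cact s a)) \<otimes> cact f a"
    unfolding fa using a by (simp add: A.m_assoc[symmetric])
  have "a [^] c \<in> Lam 1"
  proof -
    have "cact ?l v \<in> Lam 1" if "v \<in> carrier A" for v using that by (simp add: Lam_def)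
    then show ?thesis unfolding ac w(2) using a w(1)
      by (intro Lam_mult Lam_inv) simp_all
  qed
  have "int p dvd c"
  proof (rule ccontr)
    assume "\<not> int p dvd c"
    then have "coprime (int p) c" using p by (simp add: prime_imp_coprime)
    then have "coprime c (int p)" by (simp add: coprime_commute)
    then obtain x y where xy: "x * c + y * int p = 1" using bezout_int[of c "int p"] by auto
    have "a = a [^] (c * x + int p * y)" using xy a by (simp add: mult.commute)
    also have "\<dots> = (a [^] c) [^] x \<otimes> (a [^] int p) [^] y"
      using a by (simp only: A.int_pow_mult A.int_pow_pow)
    also have "\<dots> \<in> Lam 1"
      using q_pos by (intro Lam_mult[OF Lam_int_pow[OF \<open>a [^] c \<in> Lam 1\<close>] Lam_int_pow[OF Lam_mono[OF _ aq]]]) simp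
    finally show False using a by simp
  qed
  then obtain t where t: "c = int p * t" by (auto simp: dvd_def)
  \<comment> \<open>The bound by \<open>q\<close> enters here: multiples of \<open>p\<close> lie in
    \<open>Lam q\<close>, and no deeper layer is available.\<close>
  have "a [^] c \<in> Lam (Suc d)"
    using Lam_int_pow[OF aq, of t] Lam_mono[OF Suc.prems(1)] a(1) by (simp add: t A.int_pow_pow)
  then have "cact f a \<otimes> inv (a [^] c) \<in> Lam (Suc d)"
    using Suc.prems(3) Lam_mult Lam_inv by simp
  moreover have "cact f a \<otimes> inv (a [^] c) = cact ?l (cact s a)"
    unfolding fa using a by (simp add: A.m_assoc)
  ultimately obtain v where v: "v \<in> carrier A" "cact ?l (cact s a) = cact ?l (cact (?l ^ d) v)"
    by (auto simp only: Lam_Suc)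
  have "cact s a = cact (?l ^ d) v"
    by (rule lam_inj[of _ _ 1]) (use a v in simp_all)
  then have "cact s a \<in> Lam d" using v(1) by (simp add: Lam_def)
  moreover have "s = 0 \<or> degree s < d"
  proof (cases "degree f = 0")
    case True
    then show ?thesis by (simp add: s_def synthetic_div_eq_0_iff)
  next
    case False
    then show ?thesis using Suc.prems(2) by (auto simp: s_def degree_synthetic_div)
  qed
  ultimately have "[:int p:] dvd s" using Suc.IH Suc.prems(1) by simp
  moreover have "[:c:] = [:int p:] * [:t:]" by (simp add: t)
  then have "[:int p:] dvd [:c:]" by (rule dvdI)
  ultimately show ?case unfolding f by (intro dvd_add dvd_mult)
qed simp

text \<open>One factor \<open>p\<close> is split off in each step; what remains stays in the right
  layer because roots are unique in a torsion-free group.\<close>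

lemma dvd_if_in_pmul:
  assumes a: "a \<in> carrier A" "a \<notin> Lam 1"
  shows "f = 0 \<or> degree f < q \<Longrightarrow> cact f a \<in> pmul k \<Longrightarrow> [:int p ^ k:] dvd f"
proof (induction k arbitrary: f)
  case (Suc k)
  obtain c where c: "c \<in> carrier A" "cact f a = c [^] (int p ^ Suc k)"
    using Suc.prems(2) by (auto simp: pmul_def)
  then have fa: "cact f a = (c [^] (int p ^ k)) [^] int p" by (simp add: A.int_pow_pow mult.commute)
  then have "cact f a \<in> Lam q" using power_in_Lam c by simp
  then have "[:int p:] dvd f" using dvd_if_in_Lam[OF a, of q f] Suc.prems(1) by simp
  then obtain f' where f': "f = [:int p:] * f'" by (rule dvdE)
  have "cact f' a [^] int p = (c [^] (int p ^ k)) [^] int p"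
    using fa cact_const_mult[OF a(1), of "int p" f'] by (simp only: f')
  then have "cact f' a = c [^] (int p ^ k)"
    using int_pow_cancel[of "cact f' a" "c [^] (int p ^ k)" "int p"] a c(1) p_gt_1 by simp
  then have "cact f' a \<in> pmul k" using c by (simp add: pmul_I)
  moreover have "f' = 0 \<or> degree f' < q" using Suc.prems(1) p_gt_1 unfolding f' by auto
  ultimately have "[:int p ^ k:] dvd f'" by (rule Suc.IH[rotated])
  then obtain g where "f' = [:int p ^ k:] * g" by (rule dvdE)
  then have "f = [:int p ^ Suc k:] * g" unfolding f' by (simp add: mult.commute)
  then show ?case by (rule dvdI)
qed (auto simp: one_pCons[symmetric])

lemma pmul_if_in_Lam: "v \<in> Lam (q * k) \<Longrightarrow> v \<in> pmul k"
proof -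
  assume "v \<in> Lam (q * k)"
  then obtain c where c: "c \<in> carrier A" "v = cact ([:-1, 1:] ^ (q * k)) c" by (auto simp: Lam_def)
  have "cact ([:-1, 1:] ^ (q * k)) c \<in> pmul k"
  proof (induction k)
    case 0
    then show ?case using pmul_I[OF c(1), of 0] c by simp
  next
    case (Suc k)
    then obtain u where u: "u \<in> carrier A" "cact ([:-1, 1:] ^ (q * k)) c = u [^] (int p ^ k)"
      by (auto simp: pmul_def)
    obtain d where d: "d \<in> carrier A" "cact ([:-1, 1:] ^ q) u = d [^] int p"
      by (rule Lam_is_power[OF u(1)])
    have "cact ([:-1, 1:] ^ (q * Suc k)) c = cact ([:-1, 1:] ^ q) (u [^] (int p ^ k))"
      using c(1) by (simp add: power_add cact_mult u(2))
    also have "\<dots> = d [^] (int p ^ Suc k)"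
      using u(1) d by (simp add: cact_int_pow A.int_pow_pow)
    finally show ?case using pmul_I[OF d(1), of "Suc k"] by simp
  qed
  then show ?thesis using c by simp
qed

text \<open>An element divisible by all powers of \<open>zeta - 1\<close> is divisible by all powers
  of \<open>p\<close>, hence trivial. So there is a last division.\<close>

lemma Lam_factor:
  assumes a: "a \<in> carrier A" "a \<noteq> \<one>"
  obtains j c where "c \<in> carrier A" "c \<notin> Lam 1" "a = cact ([:-1, 1:] ^ j) c"
proof (rule ccontr)
  assume neg: "\<not> thesis"
  have "a \<in> Lam j" for j
  proof (induction j)
    case 0
    show ?case unfolding Lam_def using a by (auto intro!: image_eqI[of _ _ a])
  next
    case (Suc j)
    then obtain c where c: "c \<in> carrier A" "a = cact ([:-1, 1:] ^ j) c" by (auto simp: Lam_def)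
    then have "c \<in> Lam 1" using neg that[OF c(1) _ c(2)] by argo
    then obtain d where d: "d \<in> carrier A" "c = cact [:-1, 1:] d" by (auto simp: Lam_def)
    have "a = cact ([:-1, 1:] ^ Suc j) d"
      unfolding c(2) d(2) power_Suc2 by (rule cact_mult[OF d(1), symmetric])
    then show ?case using d(1) by (simp add: Lam_def)
  qed
  then have "a = \<one>" using residual_pmul[OF a(1)] pmul_if_in_Lam by blast
  then show False using a by simp
qed

lemma ex_not_in_Lam:
  assumes "a \<in> carrier A" "a \<noteq> \<one>"
  obtains c where "c \<in> carrier A" "c \<notin> Lam 1"
  by (rule Lam_factor[OF assms]) (rule that)

text \<open>For \<open>w = (zeta - 1)^j a\<close> the loss of precision is \<open>k0 = j\<close>: an
  element of \<open>p^(k+j) A\<close> is \<open>(zeta - 1)^j\<close> times an element of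
  \<open>p^k A\<close>, and the factor \<open>(zeta - 1)^j\<close> is cancelled.\<close>

lemma coefficients_independent:
  assumes w: "w \<in> carrier A" "w \<noteq> \<one>"
  obtains k0 where
    "\<And>k f. f = 0 \<or> degree f < q \<Longrightarrow> cact f w \<in> pmul (k + k0) \<Longrightarrow> [:int p ^ k:] dvd f"
proof -
  obtain j a where a: "a \<in> carrier A" "a \<notin> Lam 1" "w = cact ([:-1, 1:] ^ j) a"
    by (rule Lam_factor[OF w])
  have pj: "c [^] (int p ^ j) \<in> Lam j" if c: "c \<in> carrier A" for c
  proof (induction j)
    case 0
    then show ?case using c unfolding Lam_def by (auto intro!: image_eqI[of _ _ c])
  next
    case (Suc j)
    then obtain d where d: "d \<in> carrier A" "c [^] (int p ^ j) = cact ([:-1, 1:] ^ j) d"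
      by (auto simp: Lam_def)
    have "d [^] int p \<in> Lam 1" using Lam_mono[OF _ power_in_Lam[OF d(1)], of 1] q_pos by simp
    then obtain e where e: "e \<in> carrier A" "d [^] int p = cact [:-1, 1:] e" by (auto simp: Lam_def)
    have "c [^] (int p ^ Suc j) = (c [^] (int p ^ j)) [^] int p"
      using c by (simp add: A.int_pow_pow mult.commute)
    also have "\<dots> = cact ([:-1, 1:] ^ j) (cact [:-1, 1:] e)"
      unfolding d(2) e(2)[symmetric] using d(1) by (simp add: cact_int_pow)
    also have "\<dots> = cact ([:-1, 1:] ^ Suc j) e"
      unfolding power_Suc2 by (rule cact_mult[OF e(1), symmetric])
    finally show ?case using e(1) by (simp add: Lam_def)
  qed
  show ?thesis
  proof (rule that[of j])
    fix k f assume f: "f = 0 \<or> degree f < q" "cact f w \<in> pmul (k + j)"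
    obtain c where c: "c \<in> carrier A" "cact f w = c [^] (int p ^ (k + j))"
      using f(2) by (auto simp: pmul_def)
    obtain d where d: "d \<in> carrier A" "c [^] (int p ^ j) = cact ([:-1, 1:] ^ j) d"
      using pj[OF c(1)] by (auto simp: Lam_def)
    have "cact ([:-1, 1:] ^ j) (cact f a) = cact f w"
      unfolding a(3) by (rule cact_commute[OF a(1)])
    also have "\<dots> = (c [^] (int p ^ j)) [^] (int p ^ k)"
      using c by (simp add: A.int_pow_pow power_add mult.commute)
    also have "\<dots> = cact ([:-1, 1:] ^ j) (d [^] (int p ^ k))"
      unfolding d(2) using d(1) by (simp add: cact_int_pow)
    finally have "cact f a = d [^] (int p ^ k)"
      using lam_inj[of "cact f a" "d [^] (int p ^ k)" j] a d by simp
    then have "cact f a \<in> pmul k" using d by (simp add: pmul_I)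
    then show "[:int p ^ k:] dvd f" by (rule dvd_if_in_pmul[OF a(1,2) f(1)])
  qed
qed

text \<open>Finite index would give one \<open>m > 0\<close> and, for every precision, a relation
  \<open>m b w = s(b^p) w\<close> with \<open>s\<close> reduced by the cyclotomic polynomial of
  \<open>b^p\<close>. Then \<open>m X - s(X^p)\<close> has degree below \<open>q\<close>, and by
  independence \<open>m\<close> is divisible by every power of \<open>p\<close>.\<close>

lemma infinite_index_padic_span:
  assumes n: "n > 0" and w: "w \<in> carrier A" "w \<noteq> \<one>"
  shows "\<not> finite_index (padic_span (act (b [^]\<^bsub>P\<^esub> p)) w) A"
proof
  let ?c = "b [^]\<^bsub>P\<^esub> p"
  have c: "?c \<in> carrier P" by simp
  have hc: "act ?c \<in> hom A A" by (rule act_hom[OF c])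
  assume fi: "finite_index (padic_span (act ?c) w) A"
  have aw: "act b w \<in> carrier A" using w by simp
  obtain m :: nat where m: "m > 0" "act b w [^] m \<in> padic_span (act ?c) w"
    by (rule A.finite_index_power[OF subgroup_padic_span[OF hc w(1)] fi aw])
  obtain n' where n': "n = Suc n'" using n by (cases n) auto
  \<comment> \<open>The element \<open>b^p\<close> generates a cyclic lattice structure one level
    lower, with \<open>q\<close> smaller by the factor \<open>p\<close>. That factor returns when
    \<open>X^p\<close> is substituted, so degrees stay below \<open>q\<close>.\<close>
  interpret C: cyclic_lattice A P act T p r ?c n'
  proof
    show "P.ord ?c = p ^ Suc n'"
      using P.ord_pow_gen[OF b, of p] p_gt_1 by (simp add: ord_b n' gcd_mult_left)
    fix a assume "a \<in> carrier A" "act (?c [^]\<^bsub>P\<^esub> (p ^ n')) a = a"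
    then show "a = \<one>" using fixed_point_free[of a] n' by (simp add: P.nat_pow_pow)
  qed (rule c)
  obtain k0 where k0: "\<And>k f. f = 0 \<or> degree f < q \<Longrightarrow> cact f w \<in> pmul (k + k0) \<Longrightarrow> [:int p ^ k:] dvd f"
    by (rule coefficients_independent[OF w]) (rule that)
  have dvd: "int p ^ k dvd int m" for k
  proof -
    obtain f u where fu: "u \<in> pmul (k + k0)" "act b w [^] m = A.poly_act (act ?c) f w \<otimes> u"
      using m(2) unfolding padic_span_def by blast
    obtain s where s: "s = 0 \<or> degree s < C.q" "A.poly_act (act ?c) f w = A.poly_act (act ?c) s w"
      by (rule C.cact_reduce[OF w(1)])
    let ?S = "pcompose s (monom 1 p)"
    have "A.poly_act (act ?c) s w = A.poly_act (act b ^^ p) s w"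
      using A.funpow_hom[OF hb] hc w(1) by (intro A.poly_act_cong) (simp_all add: act_nat_pow_funpow)
    also have "\<dots> = cact ?S w" by (rule A.poly_act_funpow[OF hb w(1)])
    finally have S: "act b w [^] m = cact ?S w \<otimes> u" using fu s by simp
    define g where "g = monom (int m) 1 - ?S"
    have "monom (int m) 1 = [:int m:] * monom 1 1" by (simp add: smult_monom)
    then have "cact (monom (int m) 1) w = act b w [^] m"
      using cact_const_mult[OF w(1), of "int m" "monom 1 1"] w(1)
      by (simp add: cact_monom int_pow_int)
    then have "cact g w = act b w [^] m \<otimes> inv (cact ?S w)"
      unfolding g_def using w(1) by (simp add: cact_diff)
    also have "\<dots> = u" unfolding S using w(1) pmul_closed[OF fu(1)]
      by (simp add: A.m_comm[of "cact ?S w"] A.m_assoc)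
    finally have gu: "cact g w \<in> pmul (k + k0)" using fu(1) by simp
    have q1: "1 < q"
    proof -
      have "p ^ n \<ge> p" using n p_gt_1 by (simp add: self_le_power)
      moreover have "q \<ge> p ^ n" using p_gt_1 by (simp add: q_def)
      ultimately show ?thesis using p_gt_1 by simp
    qed
    have "degree ?S < q"
    proof (cases "s = 0")
      case True
      then show ?thesis using q_pos by simp
    next
      case False
      then have "degree s < C.q" using s by simp
      then have "degree s * p < C.q * p" using p_gt_1 by simp
      then show ?thesis unfolding q_def C.q_def by (simp add: degree_pcompose degree_monom_eq n' mult_ac)
    qed
    moreover have "degree (monom (int m) 1) < q" using m(1) q1 by (simp add: degree_monom_eq)
    ultimately have "degree g < q" unfolding g_def by (rule degree_diff_less[rotated])
    then have "[:int p ^ k:] dvd g" using k0 gu by blast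
    then have "int p ^ k dvd coeff g 1" by (simp add: const_poly_dvd_iff)
    moreover have "coeff g 1 = int m"
      unfolding g_def using coeff_1_pcompose_monom[of p s] p_gt_1 by simp
    ultimately show ?thesis by simp
  qed
  have "p ^ m dvd m" using dvd[of m] of_nat_dvd_iff[of "p ^ m" m, where ?'a = int] by simp
  then have "p ^ m \<le> m" using m(1) by (rule dvd_imp_le)
  moreover have "m < p ^ m"
    using less_le_trans[OF less_exp[of m] power_mono[of 2 p m]] p_gt_1 by simp
  ultimately show False by simp
qed

text \<open>Some multiple \<open>m v\<close> lies in the span. The \<open>p\<close>-part of
  \<open>m\<close> is divided out with \<open>dvd_if_in_pmul\<close>, for which \<open>a\<close> has
  to lie outside \<open>Lam 1\<close>; the other part is invertible modulo
  \<open>p^k\<close>.\<close>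

lemma padic_span_eq_carrier:
  assumes a: "a \<in> carrier A" "a \<notin> Lam 1" and fi: "finite_index (padic_span (act b) a) A"
    and v: "v \<in> carrier A"
  obtains f u where "f = 0 \<or> degree f < q" "u \<in> pmul k" "v = cact f a \<otimes> u"
proof -
  obtain m :: nat where m: "m > 0" "v [^] m \<in> padic_span (act b) a"
    by (rule A.finite_index_power[OF subgroup_padic_span[OF hb a(1)] fi v])
  obtain j m' where j: "m = p ^ j * m'" "\<not> p dvd m'"
    by (rule multiplicity_decompose'[of m p]) (use m(1) p_gt_1 in \<open>auto intro: that\<close>)
  \<comment> \<open>The precision is \<open>k + j\<close> because \<open>j\<close> digits are lost
    in the division by \<open>p^j\<close>.\<close>
  obtain f u where fu: "u \<in> pmul (k + j)" "v [^] m = cact f a \<otimes> u"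
    using m(2) unfolding padic_span_def by blast
  obtain g where g: "g = 0 \<or> degree g < q" "cact f a = cact g a"
    by (rule cact_reduce[OF a(1)])
  have "v [^] m = (v [^] int m') [^] (int p ^ j)"
    using v int_pow_int[of A v m] by (simp add: A.int_pow_pow j(1) mult.commute)
  then have "v [^] m \<in> pmul j" using v by (simp add: pmul_I)
  moreover have "u \<in> pmul j" using pmul_mono[OF _ fu(1)] by simp
  moreover have "cact g a = v [^] m \<otimes> inv u"
    using fu g a(1) pmul_closed[OF fu(1)] by (simp add: A.m_assoc)
  ultimately have "cact g a \<in> pmul j" by (simp add: pmul_mult pmul_inv)
  then have "[:int p ^ j:] dvd g" by (rule dvd_if_in_pmul[OF a g(1)])
  then obtain g' where g': "g = [:int p ^ j:] * g'" by (rule dvdE)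
  obtain c where c: "c \<in> carrier A" "u = c [^] (int p ^ (k + j))" using fu(1) by (auto simp: pmul_def)
  have "(v [^] int m') [^] (int p ^ j) = (cact g' a \<otimes> c [^] (int p ^ k)) [^] (int p ^ j)"
    unfolding \<open>v [^] m = (v [^] int m') [^] (int p ^ j)\<close>[symmetric] fu(2) g(2) g' c(2)
      cact_const_mult[OF a(1)]
    using a(1) c(1) by (simp add: A.int_pow_distrib A.int_pow_pow power_add)
  then have vm: "v [^] int m' = cact g' a \<otimes> c [^] (int p ^ k)"
    using int_pow_cancel[of "v [^] int m'" "cact g' a \<otimes> c [^] (int p ^ k)" "int p ^ j"] v a(1) c(1) p_gt_1
    by simp
  have "\<not> int p dvd int m'" using j(2) by simp
  then have "coprime (int p) (int m')" using p by (intro prime_imp_coprime) auto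
  then have "coprime (int m') (int p ^ k)" by (simp add: coprime_commute)
  then obtain x where "int p ^ k dvd int m' * x - 1" by (rule coprime_inverse_int)
  then obtain t where t: "int m' * x - 1 = int p ^ k * t" by (rule dvdE)
  have "v = v [^] (int m' * x + int p ^ k * (- t))" using v t by (simp add: algebra_simps)
  also have "\<dots> = (v [^] int m') [^] x \<otimes> (v [^] (- t)) [^] (int p ^ k)"
    using v by (simp only: A.int_pow_mult A.int_pow_pow mult.commute A.int_pow_closed)
  also have "\<dots> = cact ([:x:] * g') a \<otimes> ((c [^] (int p ^ k)) [^] x \<otimes> (v [^] (- t)) [^] (int p ^ k))"
    unfolding vm cact_const_mult[OF a(1)] using a(1) c(1) v
    by (simp add: A.int_pow_distrib A.m_assoc)
  finally have eq: "v = cact ([:x:] * g') a \<otimes> ((c [^] (int p ^ k)) [^] x \<otimes> (v [^] (- t)) [^] (int p ^ k))" .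
  have "(c [^] (int p ^ k)) [^] x \<otimes> (v [^] (- t)) [^] (int p ^ k) \<in> pmul k"
    using c(1) v by (intro pmul_mult pmul_int_pow pmul_I) simp_all
  moreover have "[:x:] * g' = 0 \<or> degree ([:x:] * g') < q"
    using g(1) p_gt_1 unfolding g' by auto
  ultimately show ?thesis using eq that by blast
qed

end

section \<open>Norm elements, and exclusion of normal subgroups of type C_p x C_p\<close>

context comm_group
begin

primrec nprod :: "(nat \<Rightarrow> 'a) \<Rightarrow> nat \<Rightarrow> 'a" where
  "nprod f 0 = \<one>"
| "nprod f (Suc n) = nprod f n \<otimes> f n"

lemma nprod_closed [simp]: "(\<And>i. f i \<in> carrier G) \<Longrightarrow> nprod f n \<in> carrier G"
  by (induction n) auto

lemma nprod_mult:
  "(\<And>i. f i \<in> carrier G) \<Longrightarrow> (\<And>i. g i \<in> carrier G) \<Longrightarrow>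
    nprod (\<lambda>i. f i \<otimes> g i) n = nprod f n \<otimes> nprod g n"
  by (induction n) (simp_all add: m_ac)

lemma nprod_swap:
  assumes "\<And>i j. f i j \<in> carrier G"
  shows "nprod (\<lambda>i. nprod (f i) m) n = nprod (\<lambda>j. nprod (\<lambda>i. f i j) n) m"
proof (induction n)
  case 0
  show ?case by (induction m) simp_all
next
  case (Suc n)
  then show ?case using assms nprod_mult[of "\<lambda>j. nprod (\<lambda>i. f i j) n" "f n" m] by simp
qed

lemma nprod_shift: "(\<And>i. f i \<in> carrier G) \<Longrightarrow> nprod f (Suc n) = f 0 \<otimes> nprod (\<lambda>i. f (Suc i)) n"
  by (induction n) (simp_all add: m_assoc)

lemma nprod_const: "a \<in> carrier G \<Longrightarrow> nprod (\<lambda>i. a) n = a [^] n"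
  by (induction n) simp_all

lemma nprod_cong: "(\<And>i. i < n \<Longrightarrow> f i = g i) \<Longrightarrow> nprod f n = nprod g n"
  by (induction n) simp_all

lemma nprod_hom:
  assumes "h \<in> hom G G" "\<And>i. f i \<in> carrier G"
  shows "h (nprod f n) = nprod (\<lambda>i. h (f i)) n"
  using assms by (induction n) (simp_all add: hom_endo_one hom_mult[OF assms(1)])

lemma nprod_eq_first:
  assumes "\<And>i. f i \<in> carrier G" "\<And>i. 0 < i \<Longrightarrow> i < n \<Longrightarrow> f i = \<one>" "n > 0"
  shows "nprod f n = f 0"
proof -
  obtain m where m: "n = Suc m" using assms(3) by (cases n) auto
  have "nprod (\<lambda>i. f (Suc i)) m = nprod (\<lambda>i. \<one>) m" using assms(2) m by (intro nprod_cong) simp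
  then show ?thesis unfolding m using nprod_shift[of f m] assms(1) nprod_const[of \<one> m] by (simp del: nprod.simps)
qed

end

lemma (in group) cyc_nat_pow:
  assumes "finite (carrier G)" "c \<in> carrier G" "g \<in> cyc c"
  obtains m :: nat where "g = c [^] m"
proof -
  obtain i where i: "g = c [^] (i::int)" using assms(3) by (auto simp: cyc_def)
  have o: "ord c > 0" using ord_ge_1[OF assms(1,2)] by simp
  have "c [^] (i mod int (ord c)) = c [^] i"
    unfolding int_pow_eq[OF assms(2)] by (rule dvd_minus_mod)
  then have "c [^] i = c [^] (i mod int (ord c))" ..
  also have "\<dots> = c [^] nat (i mod int (ord c))" using o int_pow_int[of G c "nat (i mod int (ord c))"] by simp
  finally show ?thesis using i that by blast
qed

lemma (in group) finite_submonoid_subgroup: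
  assumes "finite (carrier G)" "M \<subseteq> carrier G" "\<one> \<in> M" "\<And>g h. g \<in> M \<Longrightarrow> h \<in> M \<Longrightarrow> g \<otimes> h \<in> M"
  shows "subgroup M G"
proof (rule subgroupI)
  fix g assume g: "g \<in> M"
  then have gG: "g \<in> carrier G" using assms(2) by blast
  have pow: "g [^] (n::nat) \<in> M" for n by (induction n) (use g assms in auto)
  have "ord g > 0" using ord_ge_1[OF assms(1) gG] by simp
  then have "g [^] (ord g - 1) \<otimes> g = \<one>"
    using pow_ord_eq_1[OF gG] nat_pow_Suc[of g "ord g - 1"] by simp
  then have "inv g = g [^] (ord g - 1)" using gG by (simp add: inv_equality)
  then show "inv g \<in> M" using pow by simp
qed (use assms in auto)

context p_group_lattice
begin

lemma finite_P: "finite (carrier P)"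
  using order_P p_gt_1 by (metis card.infinite order_def power_not_zero not_one_less_zero)

text \<open>Additively \<open>(1 + g + ... + g^(p-1)) a\<close>, which is the norm of
  \<open>a\<close> when \<open>g [^] p\<close> is trivial.\<close>

definition norm_by :: "'p \<Rightarrow> 'a \<Rightarrow> 'a" where
  "norm_by g a = A.nprod (\<lambda>j. act (g [^]\<^bsub>P\<^esub> j) a) p"

lemma act_norm_by:
  assumes g: "g \<in> carrier P" "g [^]\<^bsub>P\<^esub> p = \<one>\<^bsub>P\<^esub>" and a: "a \<in> carrier A"
  shows "act g (norm_by g a) = norm_by g a"
proof -
  let ?f = "\<lambda>j. act (g [^]\<^bsub>P\<^esub> (j::nat)) a"
  have f: "?f j \<in> carrier A" for j using g a by simp
  have "act g (?f j) = ?f (Suc j)" for j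
    using g a by (simp only: P.nat_pow_Suc2 act_mult P.nat_pow_closed)
  then have "act g (norm_by g a) = A.nprod (\<lambda>j. ?f (Suc j)) p"
    unfolding norm_by_def using A.nprod_hom[OF act_hom[OF g(1)], of ?f p] f by simp
  moreover have "?f 0 \<otimes> A.nprod (\<lambda>j. ?f (Suc j)) p = A.nprod ?f p \<otimes> ?f p"
    using A.nprod_shift[of ?f p] f by simp
  moreover have "?f 0 = a" "?f p = a" using g a by (simp_all add: act_one)
  ultimately show ?thesis
    unfolding norm_by_def using a A.m_comm[of "A.nprod ?f p" a] A.nprod_closed[of ?f p, OF f]
      A.nprod_closed[of "\<lambda>j. ?f (Suc j)" p, OF f] A.l_cancel[of a "A.nprod (\<lambda>j. ?f (Suc j)) p" "A.nprod ?f p"]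
    by simp
qed

text \<open>In the group ring, the norms of the elements \<open>e z^i\<close> with
  \<open>i < p\<close> add up to \<open>p\<close> plus multiples of the norms of \<open>z^j\<close>
  with \<open>0 < j < p\<close>. The latter vanish, because \<open>z^j\<close> is central and has no
  fixed points. So some \<open>e z^i\<close> has a nontrivial fixed point, and its fixed points are
  stable under the centraliser of \<open>e\<close>, which is \<open>P\<close> or a maximal
  subgroup.\<close>

lemma no_central_by_noncentral_pair:
  assumes z: "z \<in> carrier P" "z \<noteq> \<one>\<^bsub>P\<^esub>" "z [^]\<^bsub>P\<^esub> p = \<one>\<^bsub>P\<^esub>"
    and central: "\<And>g. g \<in> carrier P \<Longrightarrow> P.conj_by g z = z"
    and e: "e \<in> carrier P" "e [^]\<^bsub>P\<^esub> p = \<one>\<^bsub>P\<^esub>" "e \<notin> P.cyc z"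
    and conj_e: "\<And>g. g \<in> carrier P \<Longrightarrow> \<exists>i::int. P.conj_by g e = z [^]\<^bsub>P\<^esub> i \<otimes>\<^bsub>P\<^esub> e"
  shows "carrier A = {\<one>}"
proof (rule ccontr)
  assume "carrier A \<noteq> {\<one>}"
  then obtain a where a: "a \<in> carrier A" "a \<noteq> \<one>" using A.one_closed by blast
  have zcomm: "g \<otimes>\<^bsub>P\<^esub> z = z \<otimes>\<^bsub>P\<^esub> g" if "g \<in> carrier P" for g
    using central[OF that] P.conj_by_eq_iff[OF that z(1) z(1)] by simp
  have ord_z: "P.ord z = p"
  proof -
    have "P.ord z dvd p" using P.pow_eq_id[OF z(1), of p] z(3) by simp
    moreover have "P.ord z \<noteq> 1" using z P.ord_eq_1 by blast
    ultimately show ?thesis using p by (auto simp: prime_nat_iff)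
  qed
  have "\<exists>i c. c \<in> carrier A \<and> c \<noteq> \<one> \<and> act (e \<otimes>\<^bsub>P\<^esub> z [^]\<^bsub>P\<^esub> (i::nat)) c = c"
  proof (rule ccontr)
    assume neg: "\<not> ?thesis"
    \<comment> \<open>Entry \<open>(i, j)\<close> is \<open>(e z^i)^j a\<close>, written so that
      column \<open>j\<close> becomes \<open>e^j\<close> applied to the norm of \<open>z^j\<close>;
      the rows are the norms of \<open>e z^i\<close>.\<close>
    let ?F = "\<lambda>i j. act (e [^]\<^bsub>P\<^esub> (j::nat)) (act ((z [^]\<^bsub>P\<^esub> j) [^]\<^bsub>P\<^esub> (i::nat)) a)"
    have F: "?F i j \<in> carrier A" for i j using z e a by simp
    have "norm_by (e \<otimes>\<^bsub>P\<^esub> z [^]\<^bsub>P\<^esub> i) a = \<one>" for i :: nat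
    proof -
      let ?g = "e \<otimes>\<^bsub>P\<^esub> z [^]\<^bsub>P\<^esub> i"
      have "?g [^]\<^bsub>P\<^esub> p = e [^]\<^bsub>P\<^esub> p \<otimes>\<^bsub>P\<^esub> (z [^]\<^bsub>P\<^esub> i) [^]\<^bsub>P\<^esub> p"
        using zcomm[of e] e z by (intro P.pow_mult_distrib P.group_commutes_pow[symmetric]) simp_all
      also have "(z [^]\<^bsub>P\<^esub> i) [^]\<^bsub>P\<^esub> p = (z [^]\<^bsub>P\<^esub> p) [^]\<^bsub>P\<^esub> i"
        using z(1) by (simp add: P.nat_pow_pow mult.commute)
      finally have "?g [^]\<^bsub>P\<^esub> p = \<one>\<^bsub>P\<^esub>" using z e by simp
      then have "act ?g (norm_by ?g a) = norm_by ?g a" using act_norm_by z e a by simp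
      moreover have "norm_by ?g a \<in> carrier A"
        unfolding norm_by_def using z e a by (intro A.nprod_closed) simp
      ultimately show ?thesis using neg by blast
    qed
    moreover have "norm_by (e \<otimes>\<^bsub>P\<^esub> z [^]\<^bsub>P\<^esub> i) a = A.nprod (?F i) p" for i :: nat
      unfolding norm_by_def
    proof (rule A.nprod_cong)
      fix j :: nat
      have "(e \<otimes>\<^bsub>P\<^esub> z [^]\<^bsub>P\<^esub> i) [^]\<^bsub>P\<^esub> j = e [^]\<^bsub>P\<^esub> j \<otimes>\<^bsub>P\<^esub> (z [^]\<^bsub>P\<^esub> i) [^]\<^bsub>P\<^esub> j"
        using zcomm[of e] e z by (intro P.pow_mult_distrib P.group_commutes_pow[symmetric]) simp_all
      also have "(z [^]\<^bsub>P\<^esub> i) [^]\<^bsub>P\<^esub> j = (z [^]\<^bsub>P\<^esub> j) [^]\<^bsub>P\<^esub> i"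
        using z(1) by (simp add: P.nat_pow_pow mult.commute)
      finally show "act ((e \<otimes>\<^bsub>P\<^esub> z [^]\<^bsub>P\<^esub> i) [^]\<^bsub>P\<^esub> j) a = ?F i j"
        using z e a by (simp add: act_mult)
    qed
    ultimately have "A.nprod (\<lambda>i. A.nprod (?F i) p) p = A.nprod (\<lambda>i. \<one>) p"
      by (intro A.nprod_cong) simp
    then have "A.nprod (\<lambda>j. A.nprod (\<lambda>i. ?F i j) p) p = \<one>"
      using A.nprod_swap[of ?F p p] F A.nprod_const[of \<one> p] by simp
    moreover have "A.nprod (\<lambda>j. A.nprod (\<lambda>i. ?F i j) p) p = A.nprod (\<lambda>i. ?F i 0) p"
    proof (rule A.nprod_eq_first)
      show "A.nprod (\<lambda>i. ?F i j) p \<in> carrier A" for j using F by (intro A.nprod_closed)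
      show "p > 0" using p_gt_1 by simp
      fix j assume j: "0 < j" "j < p"
      let ?y = "z [^]\<^bsub>P\<^esub> j"
      have y: "?y \<in> carrier P" "?y [^]\<^bsub>P\<^esub> p = \<one>\<^bsub>P\<^esub>"
        using z P.nat_pow_pow[OF z(1), of j p] P.nat_pow_pow[OF z(1), of p j] by (simp_all add: mult.commute)
      have y1: "?y \<noteq> \<one>\<^bsub>P\<^esub>" using P.pow_eq_id[OF z(1), of j] ord_z j by (auto dest: dvd_imp_le)
      have "P.conj_by g ?y = ?y" if "g \<in> carrier P" for g
        using that z central by (simp add: P.conj_by_nat_pow)
      moreover have nyc: "norm_by ?y a \<in> carrier A"
        unfolding norm_by_def using y a by (intro A.nprod_closed) simp
      ultimately have "norm_by ?y a = \<one>"
        using central_fixed_point_free[OF y(1) y1] act_norm_by[OF y a(1)] by blast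
      moreover have "A.nprod (\<lambda>i. ?F i j) p = act (e [^]\<^bsub>P\<^esub> j) (norm_by ?y a)"
        unfolding norm_by_def using e y a
        by (subst A.nprod_hom[OF act_hom]) simp_all
      ultimately show "A.nprod (\<lambda>i. ?F i j) p = \<one>" using e by simp
    qed
    moreover have "A.nprod (\<lambda>i. ?F i 0) p = a [^] p"
      using a by (simp add: act_one A.nprod_const)
    ultimately have "a [^] int p = \<one>" by (simp add: int_pow_int)
    then show False using torsion_free[OF a(1), of "int p"] a(2) p_gt_1 by simp
  qed
  then obtain i c where c: "c \<in> carrier A" "c \<noteq> \<one>" "act (e \<otimes>\<^bsub>P\<^esub> z [^]\<^bsub>P\<^esub> (i::nat)) c = c" by blast
  define y where "y = e \<otimes>\<^bsub>P\<^esub> z [^]\<^bsub>P\<^esub> i"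
  have y: "y \<in> carrier P" using e z by (simp add: y_def)
  \<comment> \<open>The centraliser of \<open>e\<close> is the kernel of the homomorphism to the
    integers modulo \<open>p\<close> that sends \<open>g\<close> to the \<open>i\<close> with
    \<open>g e g^-1 = z^i e\<close>.\<close>
  define M where "M = {g \<in> carrier P. P.conj_by g e = e}"
  have sM: "subgroup M P"
  proof (rule P.finite_submonoid_subgroup[OF finite_P])
    fix g h assume "g \<in> M" "h \<in> M"
    then show "g \<otimes>\<^bsub>P\<^esub> h \<in> M" using e by (simp add: M_def P.conj_by_conj_by[symmetric])
  qed (use e in \<open>auto simp: M_def\<close>)
  have zpow: "z [^]\<^bsub>P\<^esub> (i::int) = z [^]\<^bsub>P\<^esub> j \<longleftrightarrow> int p dvd j - i" for i j
    using P.int_pow_eq[OF z(1)] ord_z by simp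
  have "M = carrier P \<or> maximal_in M P"
  proof (rule disjCI)
    assume nmax: "\<not> maximal_in M P"
    show "M = carrier P"
    proof (rule ccontr)
      assume "M \<noteq> carrier P"
      then obtain K where K: "subgroup K P" "M \<subseteq> K" "K \<noteq> M" "K \<noteq> carrier P"
        using nmax sM by (auto simp: maximal_in_def)
      have KP: "K \<subseteq> carrier P" using K(1) by (rule subgroup.subset)
      obtain g where g: "g \<in> K" "g \<notin> M" using K by blast
      then have gP: "g \<in> carrier P" using KP by blast
      obtain i where i: "P.conj_by g e = z [^]\<^bsub>P\<^esub> (i::int) \<otimes>\<^bsub>P\<^esub> e" using conj_e gP by blast
      have "\<not> int p dvd i"
      proof
        assume "int p dvd i"
        then have "z [^]\<^bsub>P\<^esub> i = \<one>\<^bsub>P\<^esub>" using zpow[of 0 i] by simp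
        then show False using g(2) gP i e by (simp add: M_def)
      qed
      then have "coprime (int p) i" using p by (intro prime_imp_coprime) auto
      then have "coprime i (int p)" by (simp add: coprime_commute)
      then obtain x where x: "int p dvd i * x - 1" by (rule coprime_inverse_int)
      have gl: "P.conj_by (g [^]\<^bsub>P\<^esub> (l::nat)) e = z [^]\<^bsub>P\<^esub> (i * int l) \<otimes>\<^bsub>P\<^esub> e" for l
      proof (induction l)
        case (Suc l)
        have "P.conj_by (g [^]\<^bsub>P\<^esub> Suc l) e = P.conj_by (g [^]\<^bsub>P\<^esub> l) (z [^]\<^bsub>P\<^esub> i \<otimes>\<^bsub>P\<^esub> e)"
          using gP e i by (simp add: P.conj_by_conj_by[symmetric])
        also have "\<dots> = z [^]\<^bsub>P\<^esub> i \<otimes>\<^bsub>P\<^esub> (z [^]\<^bsub>P\<^esub> (i * int l) \<otimes>\<^bsub>P\<^esub> e)"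
          using gP e z central Suc by (simp add: P.conj_by_mult P.conj_by_int_pow)
        also have "\<dots> = z [^]\<^bsub>P\<^esub> (i * int (Suc l)) \<otimes>\<^bsub>P\<^esub> e"
          using e z by (simp add: P.m_assoc[symmetric] P.int_pow_mult[symmetric] algebra_simps)
        finally show ?case .
      qed (use e in simp)
      have "carrier P \<subseteq> K"
      proof
        fix h assume h: "h \<in> carrier P"
        obtain j where j: "P.conj_by h e = z [^]\<^bsub>P\<^esub> (j::int) \<otimes>\<^bsub>P\<^esub> e" using conj_e h by blast
        \<comment> \<open>With \<open>x\<close> inverse to \<open>i\<close> modulo \<open>p\<close>,
          the power \<open>g^l\<close> moves \<open>e\<close> in the same way as \<open>h\<close>
          does.\<close>
        define l where "l = nat ((x * j) mod int p)"
        have l: "int l = (x * j) mod int p" using p_gt_1 by (simp add: l_def)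
        have "int p dvd j - i * int l"
        proof -
          have "int p dvd x * j - int l" unfolding l by (rule dvd_minus_mod)
          then have "int p dvd i * (x * j - int l)" by (rule dvd_mult)
          moreover have "int p dvd (i * x - 1) * j" using x by (rule dvd_mult2)
          ultimately have "int p dvd i * (x * j - int l) - (i * x - 1) * j" by (rule dvd_diff)
          then show ?thesis by (simp add: algebra_simps)
        qed
        then have "z [^]\<^bsub>P\<^esub> (i * int l) = z [^]\<^bsub>P\<^esub> j" using zpow by simp
        then have eq: "P.conj_by h e = P.conj_by (g [^]\<^bsub>P\<^esub> l) e" using gl[of l] j by simp
        let ?k = "inv\<^bsub>P\<^esub> (g [^]\<^bsub>P\<^esub> l) \<otimes>\<^bsub>P\<^esub> h"
        have gl: "g [^]\<^bsub>P\<^esub> l \<in> carrier P" using gP by simp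
        have "P.conj_by ?k e = e"
          using gl h e eq by (simp add: P.conj_by_conj_by[symmetric])
        then have "?k \<in> K" using K(2) gl h by (auto simp: M_def)
        moreover have "g [^]\<^bsub>P\<^esub> l \<in> K"
          using P.subgroup_int_pow_closed[OF K(1) g(1), of "int l"] by (simp add: int_pow_int)
        ultimately have "g [^]\<^bsub>P\<^esub> l \<otimes>\<^bsub>P\<^esub> ?k \<in> K" using K(1) by (simp add: subgroup.m_closed)
        then show "h \<in> K" using gl h by (simp add: P.m_assoc[symmetric])
      qed
      then show False using K KP by blast
    qed
  qed
  moreover have "act g v \<in> {a \<in> carrier A. act y a = a}" if "g \<in> M" "v \<in> {a \<in> carrier A. act y a = a}" for g v
  proof -
    have g: "g \<in> carrier P" "P.conj_by g e = e" using that by (auto simp: M_def)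
    have "P.conj_by g y = y" using g e z central by (simp add: y_def P.conj_by_mult P.conj_by_nat_pow)
    then have "g \<otimes>\<^bsub>P\<^esub> y = y \<otimes>\<^bsub>P\<^esub> g" using P.conj_by_eq_iff g y by simp
    then have "act (y \<otimes>\<^bsub>P\<^esub> g) v = act (g \<otimes>\<^bsub>P\<^esub> y) v" by simp
    then show ?thesis using that g y by (simp add: act_mult)
  qed
  moreover have "{a \<in> carrier A. act y a = a} \<noteq> {\<one>}" using c y_def by blast
  ultimately have "finite_index {a \<in> carrier A. act y a = a} A"
    using irreducible[of M "{a \<in> carrier A. act y a = a}"] subgroup_fixed[OF y] closedin_fixed[OF y] by blast
  then have "y = \<one>\<^bsub>P\<^esub>" using fixed_by_finite_index[OF subgroup_fixed[OF y] _ y] by blast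
  then have "e = inv\<^bsub>P\<^esub> (z [^]\<^bsub>P\<^esub> i)" unfolding y_def using e z by (simp add: P.inv_equality)
  also have "\<dots> = z [^]\<^bsub>P\<^esub> (- int i)" using z by (simp add: P.int_pow_neg int_pow_int)
  finally show False using e(3) P.cyc_I[of z "- int i"] by simp
qed

lemma cyclic_latticeI:
  assumes b: "b \<in> carrier P" "P.ord b = p ^ Suc n"
    and central: "\<And>g. g \<in> carrier P \<Longrightarrow> P.conj_by g (b [^]\<^bsub>P\<^esub> (p ^ n)) = b [^]\<^bsub>P\<^esub> (p ^ n)"
  shows "cyclic_lattice A P act T p r b n"
proof
  have "b [^]\<^bsub>P\<^esub> (p ^ n) \<noteq> \<one>\<^bsub>P\<^esub>"
    using P.pow_eq_id[OF b(1), of "p ^ n"] b(2) p_gt_1 by (auto dest: dvd_imp_le)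
  then show "a = \<one>" if "a \<in> carrier A" "act (b [^]\<^bsub>P\<^esub> (p ^ n)) a = a" for a
    using that central_fixed_point_free[OF _ _ central] b(1) by simp
qed (use b in simp_all)

end

context cyclic_lattice
begin

lemma act_pow_order: "g \<in> carrier P \<Longrightarrow> v \<in> carrier A \<Longrightarrow> (act g ^^ order P) v = v"
  by (simp add: act_nat_pow_funpow[symmetric] P.pow_order_eq_1 act_one)

lemma order_P_pos: "order P > 0"
  using order_P p_gt_1 by simp

text \<open>Irreducibility under \<open>M\<close> would give this span finite index, against
  \<open>infinite_index_padic_span\<close>. All exclusions of larger groups \<open>P\<close> end
  here.\<close>

lemma no_invariant_padic_span:
  assumes n: "n > 0" and w: "w \<in> carrier A" "w \<noteq> \<one>" and M: "maximal_in M P"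
    and inv: "\<And>g v. g \<in> M \<Longrightarrow> v \<in> padic_span (act (b [^]\<^bsub>P\<^esub> p)) w \<Longrightarrow> act g v \<in> padic_span (act (b [^]\<^bsub>P\<^esub> p)) w"
  shows False
proof -
  let ?c = "b [^]\<^bsub>P\<^esub> p"
  have hc: "act ?c \<in> hom A A" by (rule act_hom) simp
  have "padic_span (act ?c) w \<noteq> {\<one>}" using self_in_padic_span[OF hc w(1)] w(2) by blast
  then have "finite_index (padic_span (act ?c) w) A"
    using M inv hc w(1) order_P_pos act_pow_order
    by (intro irreducible[of M] subgroup_padic_span closedin_padic_span[of _ _ "order P"]) auto
  then show False using infinite_index_padic_span[OF n w] by blast
qed

lemma padic_span_invariant_cyc:
  assumes c: "c \<in> carrier P" and w: "w \<in> carrier A" and g: "g \<in> P.cyc c"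
    and v: "v \<in> padic_span (act c) w"
  shows "act g v \<in> padic_span (act c) w"
proof -
  obtain m :: nat where m: "g = c [^]\<^bsub>P\<^esub> m" by (rule P.cyc_nat_pow[OF finite_P c g])
  have "(act c ^^ m) v \<in> padic_span (act c) w"
    by (induction m) (use v padic_span_self_invariant[OF act_hom[OF c] w] in auto)
  moreover have "v \<in> carrier A" using v by (simp add: padic_span_def)
  ultimately show ?thesis using c by (simp add: m act_nat_pow_funpow)
qed

end

text \<open>If \<open>P\<close> has order at most \<open>p\<close>, the trivial subgroup is
  \<open>P\<close> or maximal in it, and invariance is no condition. For larger order the maximal
  subgroup generated by \<open>b^p\<close> stabilises a span of infinite index, a
  contradiction.\<close>

lemma (in p_group_lattice) cyclic_case:
  assumes b: "b \<in> carrier P" "P.ord b = p ^ n" and P: "carrier P = P.cyc b"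
    and N: "subgroup N A" "closedin T N" "N \<noteq> {\<one>}"
  shows "finite_index N A"
proof -
  have NA: "N \<subseteq> carrier A" using N(1) by (rule subgroup.subset)
  have one_inv: "act g v \<in> N" if "g \<in> {\<one>\<^bsub>P\<^esub>}" "v \<in> N" for g v
    using that NA act_one by auto
  have card: "card (carrier P) = p ^ n" using P.card_cyc[OF finite_P b(1)] b(2) P by simp
  consider "n = 0" | "n = 1" | "n \<ge> 2" by linarith
  then show ?thesis
  proof cases
    case 1
    then have "card (carrier P) = 1" using card by simp
    then obtain y where "carrier P = {y}" by (rule card_1_singletonE)
    then have "carrier P = {\<one>\<^bsub>P\<^esub>}" using P.one_closed by simp
    then show ?thesis using irreducible[of "{\<one>\<^bsub>P\<^esub>}" N] N one_inv by simp
  next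
    case 2
    have "maximal_in {\<one>\<^bsub>P\<^esub>} P"
      unfolding maximal_in_def
    proof (intro conjI allI impI)
      show "subgroup {\<one>\<^bsub>P\<^esub>} P" by (rule P.triv_subgroup)
      show "{\<one>\<^bsub>P\<^esub>} \<noteq> carrier P"
      proof
        assume "{\<one>\<^bsub>P\<^esub>} = carrier P"
        then have "card (carrier P) = card {\<one>\<^bsub>P\<^esub>}" by simp
        then show False using card 2 p_gt_1 by simp
      qed
      fix K assume K: "subgroup K P \<and> {\<one>\<^bsub>P\<^esub>} \<subseteq> K"
      have "card (rcosets\<^bsub>P\<^esub> K) * card K = p"
        using P.lagrange[of K] K card 2 by (simp add: order_def)
      then have "card K dvd p" by (intro dvdI[of _ _ "card (rcosets\<^bsub>P\<^esub> K)"]) (simp add: mult.commute)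
      then have "card K = 1 \<or> card K = p" using p by (simp add: prime_nat_iff)
      then show "K = {\<one>\<^bsub>P\<^esub>} \<or> K = carrier P"
      proof
        assume "card K = 1"
        then obtain y where "K = {y}" by (rule card_1_singletonE)
        then show ?thesis using K by simp
      next
        assume "card K = p"
        moreover have "K \<subseteq> carrier P" using K subgroup.subset by blast
        ultimately show ?thesis using card_subset_eq[OF finite_P] card 2 by simp
      qed
    qed
    then show ?thesis using irreducible[of "{\<one>\<^bsub>P\<^esub>}" N] N one_inv by simp
  next
    case 3
    then obtain m where m: "n = Suc m" "m > 0" by (cases n) auto
    have comm: "P.conj_by g (b [^]\<^bsub>P\<^esub> (p ^ m)) = b [^]\<^bsub>P\<^esub> (p ^ m)" if g: "g \<in> carrier P" for g
    proof -
      obtain i where i: "g = b [^]\<^bsub>P\<^esub> (i::nat)" by (rule P.cyc_nat_pow[OF finite_P b(1) g[unfolded P]])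
      then have "g \<otimes>\<^bsub>P\<^esub> b [^]\<^bsub>P\<^esub> (p ^ m) = b [^]\<^bsub>P\<^esub> (p ^ m) \<otimes>\<^bsub>P\<^esub> g"
        using b(1) by (simp add: P.nat_pow_mult add.commute)
      then show ?thesis using P.conj_by_eq_iff[of g "b [^]\<^bsub>P\<^esub> (p ^ m)" "b [^]\<^bsub>P\<^esub> (p ^ m)"] g b(1) by simp
    qed
    interpret C: cyclic_lattice A P act T p r b m
      by (rule cyclic_latticeI) (use b m comm in simp_all)
    let ?c = "b [^]\<^bsub>P\<^esub> p"
    have cP: "?c \<in> carrier P" using b by simp
    have cpow: "?c [^]\<^bsub>P\<^esub> (i::int) = b [^]\<^bsub>P\<^esub> (int p * i)" for i
      using b(1) P.int_pow_pow[of b "int p" i] by (simp add: int_pow_int)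
    have max: "maximal_in (P.cyc ?c) P"
      unfolding maximal_in_def
    proof (intro conjI allI impI)
      show "subgroup (P.cyc ?c) P" by (rule P.subgroup_cyc[OF cP])
      show "P.cyc ?c \<noteq> carrier P"
      proof
        assume "P.cyc ?c = carrier P"
        then have "b \<in> P.cyc ?c" using b(1) by simp
        then obtain i where "b = ?c [^]\<^bsub>P\<^esub> (i::int)" by (auto simp: P.cyc_def)
        then have eq: "b [^]\<^bsub>P\<^esub> (1::int) = b [^]\<^bsub>P\<^esub> (int p * i)" using b(1) cpow by simp
        have "int (p ^ n) dvd int p * i - 1"
          using eq unfolding P.int_pow_eq[OF b(1)] b(2) .
        then have "int p dvd int p * i - 1" using m by (auto intro: dvd_trans)
        then obtain k where "int p * i - 1 = int p * k" by (rule dvdE)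
        then have "1 = int p * (i - k)" by (simp add: algebra_simps)
        then have "int p dvd 1" by (rule dvdI)
        then show False using p_gt_1 by simp
      qed
      fix K assume K: "subgroup K P \<and> P.cyc ?c \<subseteq> K"
      show "K = P.cyc ?c \<or> K = carrier P"
      proof (rule disjCI)
        assume "K \<noteq> carrier P"
        show "K = P.cyc ?c"
        proof (rule ccontr)
          assume "K \<noteq> P.cyc ?c"
          then obtain g where g: "g \<in> K" "g \<notin> P.cyc ?c" using K by blast
          have "g \<in> carrier P" using g(1) K subgroup.subset by blast
          then obtain i where i: "g = b [^]\<^bsub>P\<^esub> (i::int)" using P by (auto simp: P.cyc_def)
          have "\<not> int p dvd i" using g(2) cpow P.cyc_I[of ?c] by (auto simp: i dvd_def)
          then have "coprime (int p) i" using p by (intro prime_imp_coprime) auto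
          then obtain x y where xy: "x * int p + y * i = 1" using bezout_int[of "int p" i] by auto
          have "b = b [^]\<^bsub>P\<^esub> (int p * x + i * y)" using xy b(1) by (simp add: mult.commute)
          also have "\<dots> = ?c [^]\<^bsub>P\<^esub> x \<otimes>\<^bsub>P\<^esub> g [^]\<^bsub>P\<^esub> y"
            using b(1) unfolding cpow i by (simp add: P.int_pow_mult P.int_pow_pow)
          also have "\<dots> \<in> K"
            using K g(1) P.cyc_I[of ?c x] P.subgroup_int_pow_closed[of K g y] by (blast intro: subgroup.m_closed)
          finally have "P.cyc b \<subseteq> K" using P.cyc_subset_iff[OF b(1)] K by simp
          then show False using \<open>K \<noteq> carrier P\<close> P K subgroup.subset by blast
        qed
      qed
    qed
    obtain w where w: "w \<in> carrier A" "w \<noteq> \<one>" using N(3) NA subgroup.one_closed[OF N(1)] by blast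
    show ?thesis
      using C.no_invariant_padic_span[OF m(2) w max] C.padic_span_invariant_cyc[OF cP w(1)] by blast
  qed
qed

section \<open>2-groups of maximal class\<close>

text \<open>Complex values supply the positivity that rules out the discrete quaternion
  case.\<close>

definition complex_eval :: "int poly \<Rightarrow> complex \<Rightarrow> complex" where
  "complex_eval f z = poly (map_poly of_int f) z"

lemma complex_eval_0 [simp]: "complex_eval 0 z = 0"
  by (simp add: complex_eval_def)

lemma complex_eval_pCons [simp]: "complex_eval (pCons c f) z = of_int c + z * complex_eval f z"
  by (simp add: complex_eval_def map_poly_pCons)

lemma complex_eval_add: "complex_eval (f + g) z = complex_eval f z + complex_eval g z"
  by (induction f g rule: poly_induct2) (simp_all add: algebra_simps)

lemma complex_eval_smult: "complex_eval (Polynomial.smult c f) z = of_int c * complex_eval f z"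
  by (induction f) (simp_all add: algebra_simps)

lemma complex_eval_mult: "complex_eval (f * g) z = complex_eval f z * complex_eval g z"
  by (induction f) (simp_all add: complex_eval_add complex_eval_smult algebra_simps)

lemma complex_eval_monom: "complex_eval (monom 1 k) z = z ^ k"
  by (induction k) (simp_all add: monom_Suc monom_0)

lemma complex_eval_pcompose: "complex_eval (pcompose f g) z = complex_eval f (complex_eval g z)"
  by (induction f) (simp_all add: pcompose_pCons complex_eval_add complex_eval_mult)

lemma complex_eval_cnj: "complex_eval f (cnj z) = cnj (complex_eval f z)"
  by (induction f) simp_all

text \<open>At \<open>z = exp(pi i / q)\<close> one has \<open>z^q = -1\<close>, and
  \<open>z^(2q-1)\<close> is the complex conjugate of \<open>z\<close>; divisibility would give
  \<open>|f(z)|^2 + m^2 = 0\<close>.\<close>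

lemma not_dvd_norm_form:
  assumes m: "m \<noteq> 0" and q: "q > 0"
  shows "\<not> (monom 1 q + 1 :: int poly) dvd pcompose f (monom 1 (2 * q - 1)) * f + [:m ^ 2:]"
proof
  assume "(monom 1 q + 1 :: int poly) dvd pcompose f (monom 1 (2 * q - 1)) * f + [:m ^ 2:]"
  then obtain g where g: "pcompose f (monom 1 (2 * q - 1)) * f + [:m ^ 2:] = (monom 1 q + 1) * g" by (rule dvdE)
  define z where "z = cis (pi / real q)"
  have zq: "z ^ q = - 1" unfolding z_def Complex.DeMoivre using q by (simp add: cis_pi)
  have "z * z ^ (2 * q - 1) = z ^ (2 * q)" using q by (simp add: power_eq_if)
  also have "\<dots> = (z ^ q)\<^sup>2" by (simp add: power_mult[symmetric] mult.commute)
  also have "\<dots> = 1" by (simp add: zq)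
  finally have "z ^ (2 * q - 1) = inverse z" by (simp add: inverse_unique)
  also have "\<dots> = cnj z" by (simp add: z_def cis_cnj)
  finally have zc: "z ^ (2 * q - 1) = cnj z" .
  have "complex_eval ((monom 1 q + 1) * g) z = 0"
    by (simp add: complex_eval_mult complex_eval_add complex_eval_monom zq one_pCons)
  then have "cnj (complex_eval f z) * complex_eval f z + of_int (m ^ 2) = 0"
    unfolding g[symmetric]
    by (simp add: complex_eval_mult complex_eval_add complex_eval_pcompose complex_eval_monom zc[unfolded One_nat_def] complex_eval_cnj)
  then have "complex_of_real ((cmod (complex_eval f z))\<^sup>2 + (of_int m)\<^sup>2) = 0"
    unfolding of_real_add complex_norm_square by (simp add: mult.commute)
  then have "(cmod (complex_eval f z))\<^sup>2 + (of_int m :: real)\<^sup>2 = 0" by (simp only: of_real_eq_0_iff)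
  then show False using m by (simp add: sum_power2_eq_zero_iff)
qed

text \<open>Hensel lifting from 1, possible because -15 is 1 modulo 8. The number 15 is the norm of
  the element \<open>U\<close> in \<open>large_impossible\<close>.\<close>

lemma ex_2adic_sqrt_minus_15:
  obtains s :: "nat \<Rightarrow> int" where "\<And>k. odd (s k)" "\<And>k. 2 ^ k dvd (s k)\<^sup>2 + 15" "\<And>k. 2 ^ k dvd s (Suc k) - s k"
proof -
  \<comment> \<open>Adding \<open>2^(k+2)\<close> to the odd \<open>x\<close> changes
    \<open>x^2 + 15\<close> by an odd multiple of \<open>2^(k+3)\<close> modulo
    \<open>2^(k+4)\<close>; this is why three extra digits are carried along.\<close>
  have step: "\<exists>y. (odd y \<and> 2 ^ (Suc k + 3) dvd y\<^sup>2 + 15) \<and> 2 ^ k dvd y - x"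
    if x: "odd x \<and> 2 ^ (k + 3) dvd x\<^sup>2 + 15" for x :: int and k
  proof -
    obtain c where c: "x\<^sup>2 + 15 = 2 ^ (k + 3) * c" using x by (auto elim: dvdE)
    show ?thesis
    proof (cases "even c")
      case True
      then obtain d where "c = 2 * d" by (auto elim: evenE)
      then have "x\<^sup>2 + 15 = 2 ^ (Suc k + 3) * d" using c by (simp add: power_add)
      then show ?thesis using x by (intro exI[of _ x]) auto
    next
      case False
      obtain e where e: "x = 2 * e + 1" using x by (auto elim: oddE)
      obtain d where d: "c = 2 * d + 1" using False by (auto elim: oddE)
      have pw: "(2::int) ^ (k + 2) * 2 ^ (k + 2) = 2 ^ (Suc k + 3) * 2 ^ k"
        by (simp add: power_add)
      have "(x + 2 ^ (k + 2))\<^sup>2 + 15 = (x\<^sup>2 + 15) + 2 ^ (k + 3) * x + 2 ^ (k + 2) * 2 ^ (k + 2)"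
        by (simp add: power2_eq_square power_add algebra_simps)
      also have "\<dots> = 2 ^ (Suc k + 3) * (d + e + 1 + 2 ^ k)"
        unfolding c pw by (simp add: d e power_add algebra_simps)
      finally have "2 ^ (Suc k + 3) dvd (x + 2 ^ (k + 2))\<^sup>2 + 15" by (rule dvdI)
      then show ?thesis using x by (intro exI[of _ "x + 2 ^ (k + 2)"]) (simp add: power_add)
    qed
  qed
  have "\<exists>s. \<forall>k. (odd (s k) \<and> (2::int) ^ (k + 3) dvd (s k)\<^sup>2 + 15) \<and> 2 ^ k dvd s (Suc k) - s k"
    by (rule dependent_nat_choice) (use step in \<open>auto intro: exI[of _ 1]\<close>)
  then obtain s where s: "\<And>k. odd (s k)" "\<And>k. (2::int) ^ (k + 3) dvd (s k)\<^sup>2 + 15" "\<And>k. 2 ^ k dvd s (Suc k) - s k"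
    by blast
  have "(2::int) ^ k dvd (s k)\<^sup>2 + 15" for k
    using s(2)[of k] by (rule dvd_trans[rotated]) (simp add: le_imp_power_dvd)
  then show ?thesis using that s by blast
qed

text \<open>Common setting for the dihedral, semidihedral and generalised quaternion groups. The
  axiom \<open>square_x\<close> makes \<open>M2\<close> closed under multiplication.\<close>

locale maximal_class_lattice = cyclic_lattice +
  fixes x l
  assumes p2: "p = 2" and n_pos: "n > 0" and x [simp]: "x \<in> carrier P" and x_notin: "x \<notin> P.cyc b"
    and cover: "carrier P = P.cyc b \<union> (\<lambda>c. c \<otimes>\<^bsub>P\<^esub> x) ` P.cyc b"
    and odd_l: "odd (l::int)" and conj_x: "P.conj_by x b = b [^]\<^bsub>P\<^esub> l"
    and square_x: "x \<otimes>\<^bsub>P\<^esub> x \<in> P.cyc (b [^]\<^bsub>P\<^esub> p)"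
begin

abbreviation "c2 \<equiv> b [^]\<^bsub>P\<^esub> p"

lemma c2 [simp]: "c2 \<in> carrier P" by simp

lemma b_int_pow_eq: "b [^]\<^bsub>P\<^esub> (i::int) = b [^]\<^bsub>P\<^esub> j \<longleftrightarrow> 2 ^ Suc n dvd j - i"
  using P.int_pow_eq[OF b] ord_b p2 by simp

lemma c2_pow: "c2 [^]\<^bsub>P\<^esub> (i::int) = b [^]\<^bsub>P\<^esub> (2 * i)"
  using P.int_pow_pow[OF b, of "int p" i] unfolding int_pow_int by (simp add: p2)

lemma even_in_cyc_c2: "even i \<Longrightarrow> b [^]\<^bsub>P\<^esub> (i::int) \<in> P.cyc c2"
  using c2_pow P.cyc_I[of c2] by (auto elim!: evenE)

lemma x_b_int_pow: "x \<otimes>\<^bsub>P\<^esub> b [^]\<^bsub>P\<^esub> (i::int) = b [^]\<^bsub>P\<^esub> (l * i) \<otimes>\<^bsub>P\<^esub> x"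
  using P.conj_by_eq_iff[of x "b [^]\<^bsub>P\<^esub> i" "b [^]\<^bsub>P\<^esub> (l * i)"]
  by (simp add: P.conj_by_int_pow conj_x P.int_pow_pow)

lemma maximal_cyc_b: "maximal_in (P.cyc b) P"
  unfolding maximal_in_def
proof (intro conjI allI impI)
  show "subgroup (P.cyc b) P" by (rule P.subgroup_cyc[OF b])
  show "P.cyc b \<noteq> carrier P" using x_notin x by blast
  fix K assume K: "subgroup K P \<and> P.cyc b \<subseteq> K"
  have KP: "K \<subseteq> carrier P" using K subgroup.subset by blast
  have "K = carrier P" if neq: "K \<noteq> P.cyc b"
  proof -
    obtain g where g: "g \<in> K" "g \<notin> P.cyc b" using K neq by blast
    then have "g \<in> (\<lambda>c. c \<otimes>\<^bsub>P\<^esub> x) ` P.cyc b" using KP cover by blast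
    then obtain c where c: "c \<in> P.cyc b" "g = c \<otimes>\<^bsub>P\<^esub> x" by blast
    have cP: "c \<in> carrier P" using c(1) P.cyc_closed[OF b] by blast
    have "inv\<^bsub>P\<^esub> c \<otimes>\<^bsub>P\<^esub> g \<in> K"
      using subgroup.m_closed[OF conjunct1[OF K] subgroup.m_inv_closed[OF conjunct1[OF K]] g(1)] K c(1) by blast
    then have "x \<in> K" using c(2) cP by (simp add: P.m_assoc[symmetric])
    then have "carrier P \<subseteq> K" unfolding cover using K subgroup.m_closed[OF conjunct1[OF K]] by blast
    then show ?thesis using KP by blast
  qed
  then show "K = P.cyc b \<or> K = carrier P" by blast
qed

definition "M2 = P.cyc c2 \<union> (\<lambda>c. c \<otimes>\<^bsub>P\<^esub> x) ` P.cyc c2"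

lemma maximal_M2: "maximal_in M2 P"
  unfolding maximal_in_def
proof (intro conjI allI impI)
  have s2: "subgroup (P.cyc c2) P" by (rule P.subgroup_cyc[OF c2])
  have mc: "u \<otimes>\<^bsub>P\<^esub> v \<in> P.cyc c2" if "u \<in> P.cyc c2" "v \<in> P.cyc c2" for u v
    using subgroup.m_closed[OF s2] that by blast
  have cl: "u \<in> carrier P" if "u \<in> P.cyc c2" for u using that P.cyc_closed[OF c2] by blast
  have xc: "\<exists>w\<in>P.cyc c2. x \<otimes>\<^bsub>P\<^esub> v = w \<otimes>\<^bsub>P\<^esub> x" if v: "v \<in> P.cyc c2" for v
  proof -
    obtain i where "v = b [^]\<^bsub>P\<^esub> (2 * i :: int)" using v c2_pow by (auto simp: P.cyc_def)
    then show ?thesis using x_b_int_pow[of "2 * i"] even_in_cyc_c2[of "l * (2 * i)"] by auto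
  qed
  show "subgroup M2 P"
  proof (rule P.finite_submonoid_subgroup[OF finite_P])
    show "M2 \<subseteq> carrier P" using cl by (auto simp: M2_def)
    show "\<one>\<^bsub>P\<^esub> \<in> M2" using subgroup.one_closed[OF s2] by (simp add: M2_def)
    fix g h assume g: "g \<in> M2" and h: "h \<in> M2"
    consider u v where "u \<in> P.cyc c2" "v \<in> P.cyc c2" "g = u" "h = v"
      | u v where "u \<in> P.cyc c2" "v \<in> P.cyc c2" "g = u" "h = v \<otimes>\<^bsub>P\<^esub> x"
      | u v where "u \<in> P.cyc c2" "v \<in> P.cyc c2" "g = u \<otimes>\<^bsub>P\<^esub> x" "h = v"
      | u v where "u \<in> P.cyc c2" "v \<in> P.cyc c2" "g = u \<otimes>\<^bsub>P\<^esub> x" "h = v \<otimes>\<^bsub>P\<^esub> x"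
      using g h unfolding M2_def by blast
    then show "g \<otimes>\<^bsub>P\<^esub> h \<in> M2"
    proof cases
      case 1
      then show ?thesis using mc by (simp add: M2_def)
    next
      case 2
      then have "g \<otimes>\<^bsub>P\<^esub> h = (u \<otimes>\<^bsub>P\<^esub> v) \<otimes>\<^bsub>P\<^esub> x" using cl by (simp add: P.m_assoc)
      then show ?thesis using mc 2 unfolding M2_def by blast
    next
      case 3
      obtain w where w: "w \<in> P.cyc c2" "x \<otimes>\<^bsub>P\<^esub> v = w \<otimes>\<^bsub>P\<^esub> x" using xc 3 by blast
      then have "g \<otimes>\<^bsub>P\<^esub> h = (u \<otimes>\<^bsub>P\<^esub> w) \<otimes>\<^bsub>P\<^esub> x" using cl 3 by (simp add: P.m_assoc)
      then show ?thesis using mc 3 w unfolding M2_def by blast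
    next
      case 4
      obtain w where w: "w \<in> P.cyc c2" "x \<otimes>\<^bsub>P\<^esub> v = w \<otimes>\<^bsub>P\<^esub> x" using xc 4 by blast
      have "g \<otimes>\<^bsub>P\<^esub> h = u \<otimes>\<^bsub>P\<^esub> ((x \<otimes>\<^bsub>P\<^esub> v) \<otimes>\<^bsub>P\<^esub> x)" using cl 4 by (simp add: P.m_assoc)
      also have "\<dots> = (u \<otimes>\<^bsub>P\<^esub> w) \<otimes>\<^bsub>P\<^esub> (x \<otimes>\<^bsub>P\<^esub> x)" using cl 4 w by (simp add: P.m_assoc)
      finally show ?thesis using mc 4 w square_x unfolding M2_def by simp
    qed
  qed
  have "b \<notin> M2"
  proof
    assume "b \<in> M2"
    then obtain c where c: "c \<in> P.cyc c2" "b = c \<or> b = c \<otimes>\<^bsub>P\<^esub> x" unfolding M2_def by blast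
    then obtain i where "c = c2 [^]\<^bsub>P\<^esub> (i::int)" unfolding P.cyc_def by blast
    then have i: "c = b [^]\<^bsub>P\<^esub> (2 * i)" by (simp only: c2_pow)
    from c(2) show False
    proof
      assume "b = c"
      then have "b [^]\<^bsub>P\<^esub> (1::int) = b [^]\<^bsub>P\<^esub> (2 * i)" using i by simp
      then have "2 ^ Suc n dvd 2 * i - 1" by (simp only: b_int_pow_eq)
      then have "2 dvd 2 * i - 1" using dvd_trans[of 2 "2 ^ Suc n" "2 * i - 1"] by simp
      then show False by presburger
    next
      assume bc: "b = c \<otimes>\<^bsub>P\<^esub> x"
      have cP: "c \<in> carrier P" using i by simp
      have "x = inv\<^bsub>P\<^esub> c \<otimes>\<^bsub>P\<^esub> (c \<otimes>\<^bsub>P\<^esub> x)" using cP by (simp add: P.m_assoc[symmetric])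
      also have "\<dots> = inv\<^bsub>P\<^esub> c \<otimes>\<^bsub>P\<^esub> b" using bc by (rule arg_cong[OF sym])
      also have "\<dots> = b [^]\<^bsub>P\<^esub> (- (2 * i)) \<otimes>\<^bsub>P\<^esub> b [^]\<^bsub>P\<^esub> (1::int)"
        unfolding i by (simp add: P.int_pow_neg)
      also have "\<dots> = b [^]\<^bsub>P\<^esub> (- (2 * i) + 1)" by (rule P.int_pow_mult[OF b, symmetric])
      finally show False using x_notin P.cyc_I[of b "- (2 * i) + 1"] by simp
    qed
  qed
  then show "M2 \<noteq> carrier P" using b by blast
  fix K assume K: "subgroup K P \<and> M2 \<subseteq> K"
  have KP: "K \<subseteq> carrier P" using K subgroup.subset by blast
  have xK: "x \<in> K"
  proof -
    have "\<one>\<^bsub>P\<^esub> \<otimes>\<^bsub>P\<^esub> x \<in> M2" using subgroup.one_closed[OF s2] unfolding M2_def by blast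
    then show ?thesis using K by auto
  qed
  have "K = carrier P" if KM: "K \<noteq> M2"
  proof -
    obtain g where g: "g \<in> K" "g \<notin> M2" using K KM by blast
    have gP: "g \<in> carrier P" using g KP by blast
    \<comment> \<open>An element outside \<open>M2\<close> involves an odd power of
      \<open>b\<close>; together with \<open>c2\<close> this yields \<open>b\<close> itself.\<close>
    have "\<exists>i::int. b [^]\<^bsub>P\<^esub> i \<in> K \<and> odd i"
    proof (cases "g \<in> P.cyc b")
      case True
      then obtain i where i: "g = b [^]\<^bsub>P\<^esub> (i::int)" by (auto simp: P.cyc_def)
      then have "odd i" using g(2) even_in_cyc_c2[of i] by (auto simp: M2_def)
      then show ?thesis using i g by blast
    next
      case False
      then have "g \<in> (\<lambda>c. c \<otimes>\<^bsub>P\<^esub> x) ` P.cyc b" using gP cover by blast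
      then obtain i where i: "g = b [^]\<^bsub>P\<^esub> (i::int) \<otimes>\<^bsub>P\<^esub> x" by (auto simp: P.cyc_def)
      then have "odd i" using g(2) even_in_cyc_c2[of i] by (auto simp: M2_def)
      moreover have "g \<otimes>\<^bsub>P\<^esub> inv\<^bsub>P\<^esub> x \<in> K"
        using subgroup.m_closed[OF conjunct1[OF K] g(1) subgroup.m_inv_closed[OF conjunct1[OF K] xK]] .
      then have "b [^]\<^bsub>P\<^esub> i \<in> K" using i by (simp add: P.m_assoc)
      ultimately show ?thesis by blast
    qed
    then obtain i :: int where i: "b [^]\<^bsub>P\<^esub> i \<in> K" "odd i" by blast
    have "b [^]\<^bsub>P\<^esub> (1 - i) \<in> K" using even_in_cyc_c2[of "1 - i"] i(2) K by (auto simp: M2_def)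
    then have "b [^]\<^bsub>P\<^esub> i \<otimes>\<^bsub>P\<^esub> b [^]\<^bsub>P\<^esub> (1 - i) \<in> K" using i K by (simp add: subgroup.m_closed)
    then have "b \<in> K" using P.int_pow_mult[OF b, of i "1 - i"] by simp
    then have "P.cyc b \<subseteq> K" using P.cyc_subset_iff[OF b] K by simp
    then have "carrier P \<subseteq> K" unfolding cover using xK subgroup.m_closed[OF conjunct1[OF K]] by blast
    then show ?thesis using KP by blast
  qed
  then show "K = M2 \<or> K = carrier P" by blast
qed

lemma act_x_c2:
  obtains j where "\<And>v. v \<in> carrier A \<Longrightarrow> act x (act c2 v) = (act c2 ^^ j) (act x v)"
proof -
  have "c2 [^]\<^bsub>P\<^esub> l \<in> P.cyc c2" by (rule P.cyc_I)
  then obtain j :: nat where j: "c2 [^]\<^bsub>P\<^esub> l = c2 [^]\<^bsub>P\<^esub> j" by (rule P.cyc_nat_pow[OF finite_P c2])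
  have "x \<otimes>\<^bsub>P\<^esub> c2 = c2 [^]\<^bsub>P\<^esub> l \<otimes>\<^bsub>P\<^esub> x"
    using x_b_int_pow[of 2] c2_pow[of 1] c2_pow[of l] by (simp add: mult.commute)
  then have "act (x \<otimes>\<^bsub>P\<^esub> c2) v = act (c2 [^]\<^bsub>P\<^esub> j \<otimes>\<^bsub>P\<^esub> x) v" for v by (simp only: j)
  then have "act x (act c2 v) = (act c2 ^^ j) (act x v)" if "v \<in> carrier A" for v
    using that by (simp only: act_mult[symmetric] x c2 P.nat_pow_closed act_closed act_nat_pow_funpow[symmetric])
  then show ?thesis by (rule that)
qed

text \<open>A vector whose span over \<open>\<int>[\<zeta>\<^sup>2]\<close> is stable under \<open>x\<close> gives a proper submodule for the maximal
  subgroup \<open>M2\<close>.\<close>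

lemma no_x_stable_span:
  assumes w: "w \<in> carrier A" "w \<noteq> \<one>"
  shows "act x w \<notin> padic_span (act c2) w"
proof
  assume xw: "act x w \<in> padic_span (act c2) w"
  obtain j where j: "\<And>v. v \<in> carrier A \<Longrightarrow> act x (act c2 v) = (act c2 ^^ j) (act x v)"
    by (rule act_x_c2) (rule that)
  have xs: "act x v \<in> padic_span (act c2) w" if "v \<in> padic_span (act c2) w" for v
    by (rule padic_span_invariant[OF act_hom[OF c2] w(1) act_hom[OF x] j xw that])
  show False
  proof (rule no_invariant_padic_span[OF n_pos w maximal_M2])
    fix g v assume g: "g \<in> M2" and v: "v \<in> padic_span (act c2) w"
    have vA: "v \<in> carrier A" using v by (simp add: padic_span_def)
    from g consider "g \<in> P.cyc c2" | c where "c \<in> P.cyc c2" "g = c \<otimes>\<^bsub>P\<^esub> x"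
      by (auto simp: M2_def)
    then show "act g v \<in> padic_span (act c2) w"
    proof cases
      case 1
      then show ?thesis by (rule padic_span_invariant_cyc[OF c2 w(1) _ v])
    next
      case 2
      have "c \<in> carrier P" using 2 P.cyc_closed[OF c2] by blast
      then show ?thesis
        using padic_span_invariant_cyc[OF c2 w(1) 2(1) xs[OF v]] vA by (simp add: 2(2) act_mult)
    qed
  qed
qed

abbreviation "z \<equiv> b [^]\<^bsub>P\<^esub> (p ^ n)"

text \<open>An involution without nontrivial fixed points is -1, because the sum of \<open>v\<close>
  and its image is fixed.\<close>

lemma act_z: "v \<in> carrier A \<Longrightarrow> act z v = inv v"
proof -
  assume v: "v \<in> carrier A"
  have zz: "act z (act z v) = v"
    using v b_pow by (simp add: act_mult[symmetric] P.nat_pow_mult p2 act_one mult_2[symmetric])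
  have "act z (v \<otimes> act z v) = v \<otimes> act z v"
    using v by (simp add: act_distrib zz A.m_comm)
  then have "v \<otimes> act z v = \<one>" using fixed_point_free v by simp
  then have "act z v \<otimes> v = \<one>" using v A.m_comm[of v "act z v"] by simp
  then show ?thesis using v A.inv_equality[of "act z v" v] by simp
qed

text \<open>A nonzero vector \<open>a + x a\<close> is fixed by \<open>x\<close> and contradicts
  \<open>no_x_stable_span\<close>. If all these vectors vanish, \<open>x\<close> acts as -1, that is
  as \<open>z\<close>, although it does not lie in \<open>cyc b\<close>.\<close>

lemma involution_impossible:
  assumes "x \<otimes>\<^bsub>P\<^esub> x = \<one>\<^bsub>P\<^esub>"
  shows False
proof -
  have "\<exists>a\<in>carrier A. a \<otimes> act x a \<noteq> \<one>"
  proof (rule ccontr)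
    assume neg: "\<not> ?thesis"
    have "act x a = act z a" if a: "a \<in> carrier A" for a
    proof -
      have "act x a \<otimes> a = \<one>" using neg a A.m_comm[of a "act x a"] by simp
      then show ?thesis using a by (simp add: act_z A.inv_equality)
    qed
    then have "act (inv\<^bsub>P\<^esub> z \<otimes>\<^bsub>P\<^esub> x) a = a" if "a \<in> carrier A" for a
      using that act_mult[of "inv\<^bsub>P\<^esub> z" x a] act_mult[of "inv\<^bsub>P\<^esub> z" z a] by (simp add: act_one)
    then have "inv\<^bsub>P\<^esub> z \<otimes>\<^bsub>P\<^esub> x = \<one>\<^bsub>P\<^esub>" by (intro faithful) simp_all
    moreover have "x = z \<otimes>\<^bsub>P\<^esub> (inv\<^bsub>P\<^esub> z \<otimes>\<^bsub>P\<^esub> x)" by (simp add: P.m_assoc[symmetric])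
    ultimately have "x = z" by simp
    moreover have "b [^]\<^bsub>P\<^esub> int (p ^ n) \<in> P.cyc b" by (rule P.cyc_I)
    ultimately show False using x_notin unfolding int_pow_int by simp
  qed
  then obtain a where a: "a \<in> carrier A" "a \<otimes> act x a \<noteq> \<one>" by blast
  let ?w = "a \<otimes> act x a"
  have xx: "act x (act x a) = a" using assms a by (simp add: act_mult[symmetric] act_one)
  have w: "?w \<in> carrier A" using a by simp
  have "act x ?w = ?w" using a xx by (simp add: act_distrib A.m_comm)
  then have "act x ?w \<in> padic_span (act c2) ?w"
    using self_in_padic_span[OF act_hom[OF c2] w] by simp
  then show False using no_x_stable_span[OF w a(2)] by blast
qed

end

section \<open>Generalised quaternion groups\<close>

lemma int_eq_0_if_powers_dvd: "(\<And>k. 2 ^ k dvd (c::int)) \<Longrightarrow> c = 0"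
proof (rule ccontr)
  assume dvd: "\<And>k. 2 ^ k dvd c" and "c \<noteq> 0"
  then have "2 ^ nat \<bar>c\<bar> \<le> \<bar>c\<bar>" using dvd_imp_le_int[of c "2 ^ nat \<bar>c\<bar>"] by simp
  moreover have "nat \<bar>c\<bar> < 2 ^ nat \<bar>c\<bar>" by (rule less_exp)
  then have "\<bar>c\<bar> < 2 ^ nat \<bar>c\<bar>" 
    using of_nat_less_iff[where 'a = int, of "nat \<bar>c\<bar>" "2 ^ nat \<bar>c\<bar>"] by simp
  ultimately show False by simp
qed

text \<open>Squares are 0 or 1 modulo 4. This is the obstruction that removes the quaternion group
  of order 8.\<close>

lemma not_4_dvd_sum_squares_plus_1: "\<not> 4 dvd c\<^sup>2 + d\<^sup>2 + (1::int)"
proof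
  have sq: "\<exists>e. y\<^sup>2 = 4 * e \<or> y\<^sup>2 = 4 * e + 1" for y :: int
  proof (cases "even y")
    case True
    then obtain e where "y = 2 * e" by (rule evenE)
    then have "y\<^sup>2 = 4 * e\<^sup>2" by (simp add: power2_eq_square)
    then show ?thesis by blast
  next
    case False
    then obtain e where "y = 2 * e + 1" by (rule oddE)
    then have "y\<^sup>2 = 4 * (e * e + e) + 1" by (simp add: power2_eq_square algebra_simps)
    then show ?thesis by blast
  qed
  assume "4 dvd c\<^sup>2 + d\<^sup>2 + 1"
  moreover obtain e e' where "c\<^sup>2 = 4 * e \<or> c\<^sup>2 = 4 * e + 1" "d\<^sup>2 = 4 * e' \<or> d\<^sup>2 = 4 * e' + 1"
    using sq by metis
  ultimately show False by presburger
qed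

context p_group_lattice
begin

text \<open>Since \<open>-15\<close> is a square in \<open>\<int>\<^sub>2\<close>, compactness yields an eigenvector of \<open>Y\<close>: the limit of
  \<open>Y v + s v\<close> for one of the two roots \<open>s\<close>.\<close>

lemma ex_eigenvector_sqrt_minus_15:
  assumes p2: "p = 2" and compact: "compact_space T" and Y: "Y \<in> hom A A"
    and YY: "\<And>v. v \<in> carrier A \<Longrightarrow> Y (Y v) = v [^] (- 15 :: int)"
    and v: "v \<in> carrier A" "v \<noteq> \<one>"
  obtains w s where "w \<in> carrier A" "w \<noteq> \<one>" "\<And>k. \<exists>u\<in>pmul k. Y w = w [^] (s k :: int) \<otimes> u"
proof -
  have Yc: "Y a \<in> carrier A" if "a \<in> carrier A" for a by (rule A.hom_endo_closed[OF Y that])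
  have Ym: "Y (a \<otimes> c) = Y a \<otimes> Y c" if "a \<in> carrier A" "c \<in> carrier A" for a c by (rule hom_mult[OF Y that])
  have Yp: "Y (a [^] (i::int)) = Y a [^] i" if "a \<in> carrier A" for a i
    by (rule hom_int_pow[OF Y that A.group_axioms A.group_axioms])
  obtain s where s: "\<And>k. odd (s k)" "\<And>k. 2 ^ k dvd (s k)\<^sup>2 + (15::int)" "\<And>k. 2 ^ k dvd s (Suc k) - s k"
    by (rule ex_2adic_sqrt_minus_15) (rule that; assumption)
  have pm: "a [^] i \<in> pmul k" if a: "a \<in> carrier A" and i: "2 ^ k dvd (i::int)" for a i k
  proof -
    obtain j where "i = 2 ^ k * j" using i by (rule dvdE)
    then have "a [^] i = (a [^] j) [^] (int p ^ k)" using a p2 by (simp add: A.int_pow_pow mult.commute)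
    then show ?thesis using a pmul_I by simp
  qed
  \<comment> \<open>The factor \<open>e\<close> will be 1 or -1 and selects the root. The elements
    \<open>y k\<close> are coherent modulo \<open>pmul k\<close>, so nested closed cosets have a
    common point.\<close>
  have lim: "\<exists>w\<in>carrier A. \<forall>k. \<exists>u\<in>pmul k. w = (Y v \<otimes> v [^] (e * s k)) \<otimes> u" for e :: int
  proof -
    define y where "y k = Y v \<otimes> v [^] (e * s k)" for k
    have y: "y k \<in> carrier A" for k using v Yc by (simp add: y_def)
    define C where "C k = {u \<in> carrier A. inv (y k) \<otimes> u \<in> pmul k}" for k
    have "(\<Inter>k. C k) \<noteq> {}"
    proof (rule compact_space_imp_nest[OF compact])
      show "closedin T (C k)" for k
        unfolding C_def using y by (intro closedin_left_translate closedin_pmul) simp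
      show "C k \<noteq> {}" for k using y[of k] one_in_pmul by (auto simp: C_def intro!: exI[of _ "y k"])
      show "decseq C"
      proof (rule decseq_SucI, rule subsetI)
        fix k u assume u: "u \<in> C (Suc k)"
        have "inv (y k) \<otimes> y (Suc k) = v [^] (e * s (Suc k) - e * s k)"
        proof -
          have "inv (y k) \<otimes> y (Suc k) = (inv (Y v) \<otimes> Y v) \<otimes> (inv (v [^] (e * s k)) \<otimes> v [^] (e * s (Suc k)))"
            using v Yc[OF v(1)] unfolding y_def by (simp only: A.inv_mult A.m_ac A.int_pow_closed A.inv_closed A.m_closed)
          also have "\<dots> = v [^] (- (e * s k)) \<otimes> v [^] (e * s (Suc k))"
            using v Yc[OF v(1)] by (simp add: A.int_pow_neg)
          finally show ?thesis using v by (simp add: A.int_pow_mult[symmetric])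
        qed
        also have "\<dots> \<in> pmul k"
        proof (rule pm[OF v(1)])
          have "2 ^ k dvd e * (s (Suc k) - s k)" using s(3) by (rule dvd_mult)
          then show "2 ^ k dvd e * s (Suc k) - e * s k" by (simp add: right_diff_distrib)
        qed
        finally have "inv (y k) \<otimes> y (Suc k) \<in> pmul k" .
        moreover have "inv (y (Suc k)) \<otimes> u \<in> pmul k" using u pmul_mono[of k "Suc k"] by (simp add: C_def)
        ultimately have "(inv (y k) \<otimes> y (Suc k)) \<otimes> (inv (y (Suc k)) \<otimes> u) \<in> pmul k"
          by (rule pmul_mult)
        moreover have uA: "u \<in> carrier A" using u by (simp add: C_def)
        then have "y (Suc k) \<otimes> (inv (y (Suc k)) \<otimes> u) = u" using y by (simp add: A.m_assoc[symmetric])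
        then have "(inv (y k) \<otimes> y (Suc k)) \<otimes> (inv (y (Suc k)) \<otimes> u) = inv (y k) \<otimes> u"
          using y uA by (simp add: A.m_assoc)
        ultimately show "u \<in> C k" using uA by (simp add: C_def)
      qed
    qed
    then obtain w where w: "\<And>k. w \<in> C k" by blast
    have "w = y k \<otimes> (inv (y k) \<otimes> w)" for k
      using w[of k] y by (simp add: C_def A.m_assoc[symmetric])
    then have "\<exists>u\<in>pmul k. w = y k \<otimes> u" for k using w[of k] by (auto simp: C_def)
    moreover have "w \<in> carrier A" using w[of 0] by (simp add: C_def)
    ultimately show ?thesis unfolding y_def by blast
  qed
  \<comment> \<open>Additively, \<open>Y (Y v + e s v) = e s (Y v + e s v) - (15 + s^2) v\<close>,
    and the last term vanishes modulo \<open>2^k\<close>.\<close>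
  have eig: "\<exists>u'\<in>pmul k. Y w = w [^] (e * s k) \<otimes> u'"
    if e: "e * e = 1" and w: "w \<in> carrier A" and u: "u \<in> pmul k" "w = (Y v \<otimes> v [^] (e * s k)) \<otimes> u" for e w u k
  proof -
    have uA: "u \<in> carrier A" by (rule pmul_closed[OF u(1)])
    have "Y w = v [^] (- 15 :: int) \<otimes> Y v [^] (e * s k) \<otimes> Y u"
      using v uA Yc by (simp add: u(2) Ym Yp YY)
    moreover have "w [^] (e * s k) = Y v [^] (e * s k) \<otimes> v [^] ((s k)\<^sup>2) \<otimes> u [^] (e * s k)"
    proof -
      have "e * s k * (e * s k) = (s k)\<^sup>2" 
      proof -
        have "e * s k * (e * s k) = (e * e) * (s k * s k)" by (simp only: mult_ac)
        then show ?thesis by (simp only: e mult_1 power2_eq_square)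
      qed
      then show ?thesis unfolding u(2) using v uA Yc by (simp add: A.int_pow_distrib A.int_pow_pow)
    qed
    moreover have "(Y v [^] (e * s k) \<otimes> v [^] ((s k)\<^sup>2) \<otimes> u [^] (e * s k)) \<otimes>
        (v [^] (- (15 + (s k)\<^sup>2)) \<otimes> (inv (u [^] (e * s k)) \<otimes> Y u)) =
        v [^] (- 15 :: int) \<otimes> Y v [^] (e * s k) \<otimes> Y u"
    proof -
      let ?a = "Y v [^] (e * s k)" and ?c = "u [^] (e * s k)"
      have cl: "?a \<in> carrier A" "?c \<in> carrier A" "Y u \<in> carrier A" using v uA Yc by simp_all
      have "(?a \<otimes> v [^] ((s k)\<^sup>2) \<otimes> ?c) \<otimes> (v [^] (- (15 + (s k)\<^sup>2)) \<otimes> (inv ?c \<otimes> Y u)) =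
          (v [^] ((s k)\<^sup>2) \<otimes> v [^] (- (15 + (s k)\<^sup>2))) \<otimes> ?a \<otimes> ((?c \<otimes> inv ?c) \<otimes> Y u)"
        using cl v by (simp only: A.m_ac A.m_closed A.int_pow_closed A.inv_closed)
      then show ?thesis using cl v by (simp add: A.int_pow_mult[symmetric])
    qed
    ultimately have "Y w = w [^] (e * s k) \<otimes> (v [^] (- (15 + (s k)\<^sup>2)) \<otimes> (inv (u [^] (e * s k)) \<otimes> Y u))"
      by simp
    moreover have "v [^] (- (15 + (s k)\<^sup>2)) \<otimes> (inv (u [^] (e * s k)) \<otimes> Y u) \<in> pmul k"
    proof (rule pmul_mult[OF pm[OF v(1)] pmul_mult[OF pmul_inv[OF pmul_int_pow[OF u(1)]] pmul_hom[OF Y u(1)]]])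
      show "2 ^ k dvd - (15 + (s k)\<^sup>2)" using s(2)[of k] by (simp only: dvd_minus_iff add.commute)
    qed
    ultimately show ?thesis by blast
  qed
  obtain w1 where w1: "w1 \<in> carrier A" "\<And>k. \<exists>u\<in>pmul k. w1 = (Y v \<otimes> v [^] (1 * s k)) \<otimes> u"
    using lim[of 1] by blast
  obtain w2 where w2: "w2 \<in> carrier A" "\<And>k. \<exists>u\<in>pmul k. w2 = (Y v \<otimes> v [^] (- 1 * s k)) \<otimes> u"
    using lim[of "- 1"] by blast
  \<comment> \<open>If both limits were trivial, so would be their difference \<open>2 s v\<close>
    at every precision; as \<open>s\<close> is odd, \<open>2 v\<close> would be trivial.\<close>
  have "w1 \<noteq> \<one> \<or> w2 \<noteq> \<one>"
  proof (rule ccontr)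
    assume "\<not> ?thesis"
    then have ww: "w1 = \<one>" "w2 = \<one>" by simp_all
    have "v [^] (2::int) \<in> pmul k" for k
    proof -
      let ?y = "Y v" and ?t = "v [^] s k"
      have cl: "?y \<in> carrier A" "?t \<in> carrier A" using v Yc by simp_all
      obtain u1 where u1: "u1 \<in> pmul k" "\<one> = (?y \<otimes> ?t) \<otimes> u1" using w1(2)[of k] ww by auto
      obtain u2 where u2: "u2 \<in> pmul k" "\<one> = (?y \<otimes> inv ?t) \<otimes> u2"
        using w2(2)[of k] ww v by (auto simp: A.int_pow_neg)
      have uA: "u1 \<in> carrier A" "u2 \<in> carrier A" using u1 u2 pmul_closed by auto
      have e1: "?y \<otimes> ?t = inv u1" using u1(2) cl uA by (simp add: A.inv_equality)
      have e2: "?y \<otimes> inv ?t = inv u2" using u2(2) cl uA by (simp add: A.inv_equality)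
      have "?t \<otimes> ?t = (?y \<otimes> ?t) \<otimes> inv (?y \<otimes> inv ?t)"
      proof -
        have "(?y \<otimes> ?t) \<otimes> inv (?y \<otimes> inv ?t) = (?y \<otimes> inv ?y) \<otimes> (?t \<otimes> ?t)"
          using cl by (simp only: A.inv_mult A.inv_inv A.m_ac A.m_closed A.inv_closed)
        then show ?thesis using cl by simp
      qed
      then have "?t \<otimes> ?t \<in> pmul k" unfolding e1 e2 using u1 u2 by (simp add: pmul_mult pmul_inv)
      moreover have "?t \<otimes> ?t = v [^] (2 * s k)" using v by (simp add: A.int_pow_mult[symmetric])
      ultimately have t2: "v [^] (2 * s k) \<in> pmul k" by simp
      have "coprime (s k) (2 ^ k)" using s(1) by simp
      then obtain y where "2 ^ k dvd s k * y - 1" by (rule coprime_inverse_int)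
      then obtain j where j: "s k * y - 1 = 2 ^ k * j" by (rule dvdE)
      have "v [^] (2::int) = v [^] (2 * s k * y + 2 ^ k * (- 2 * j))"
        using j by (intro arg_cong[where f = "\<lambda>i. v [^] i"]) (simp add: algebra_simps)
      also have "\<dots> = (v [^] (2 * s k)) [^] y \<otimes> v [^] (2 ^ k * (- 2 * j))"
        using v by (simp only: A.int_pow_mult A.int_pow_pow)
      also have "\<dots> \<in> pmul k" by (rule pmul_mult[OF pmul_int_pow[OF t2] pm[OF v(1)]]) simp
      finally show ?thesis .
    qed
    then have "v [^] (2::int) = \<one>" using residual_pmul[of "v [^] (2::int)"] v by simp
    then show False using torsion_free[OF v(1), of 2] v(2) by simp
  qed
  then show ?thesis
  proof
    assume "w1 \<noteq> \<one>"
    then show ?thesis using that[of w1 "\<lambda>k. 1 * s k"] w1 eig[of 1 w1] by (metis mult_1)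
  next
    assume "w2 \<noteq> \<one>"
    have "\<exists>u\<in>pmul k. Y w2 = w2 [^] (- 1 * s k) \<otimes> u" for k
      using w2(2)[of k] eig[of "- 1" w2 _ k] w2(1) by auto
    then show ?thesis by (rule that[OF w2(1) \<open>w2 \<noteq> \<one>\<close>])
  qed
qed

end

locale quaternion_lattice = maximal_class_lattice +
  assumes square_eq_z: "x \<otimes>\<^bsub>P\<^esub> x = b [^]\<^bsub>P\<^esub> (p ^ n)" and conj_x_inv: "P.conj_by x b = inv\<^bsub>P\<^esub> b"
begin

lemma q_eq: "q = 2 ^ n"
  unfolding q_def by (simp add: p2)

lemma gap_eq: "gap_poly p (p ^ n) = monom 1 (2 ^ n) + 1"
  by (simp add: gap_poly_def p2 numeral_2_eq_2 one_pCons monom_0 add.commute)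

lemma act_xx: "v \<in> carrier A \<Longrightarrow> act x (act x v) = inv v"
  by (simp add: act_mult[symmetric] square_eq_z act_z)

lemma act_x_conj:
  assumes "i = b [^]\<^bsub>P\<^esub> (m::nat)" "v \<in> carrier A"
  shows "act x (act i v) = act (inv\<^bsub>P\<^esub> i) (act x v)"
proof -
  have i: "i \<in> carrier P" using assms(1) by simp
  have "P.conj_by x i = inv\<^bsub>P\<^esub> i" unfolding assms(1) by (simp add: P.conj_by_nat_pow conj_x_inv P.nat_pow_inv)
  then have "x \<otimes>\<^bsub>P\<^esub> i = inv\<^bsub>P\<^esub> i \<otimes>\<^bsub>P\<^esub> x" using i P.conj_by_eq_iff[of x i "inv\<^bsub>P\<^esub> i"] by simp
  then have "act (x \<otimes>\<^bsub>P\<^esub> i) v = act (inv\<^bsub>P\<^esub> i \<otimes>\<^bsub>P\<^esub> x) v" by simp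
  then show ?thesis using i assms(2) by (simp add: act_mult)
qed

text \<open>Conjugation by \<open>x\<close> inverts \<open>i\<close>, so \<open>f(X)\<close> turns
  into \<open>f(1/X)\<close>; since \<open>i\<close> has order dividing \<open>N + 1\<close>, the
  inverse acts as \<open>X^N\<close>.\<close>

lemma act_x_poly_act:
  assumes i: "i = b [^]\<^bsub>P\<^esub> (m::nat)" "i [^]\<^bsub>P\<^esub> (Suc N) = \<one>\<^bsub>P\<^esub>" and v: "v \<in> carrier A"
  shows "act x (A.poly_act (act i) f v) = A.poly_act (act i) (pcompose f (monom 1 N)) (act x v)"
proof -
  have iP: "i \<in> carrier P" using i(1) by simp
  have hi: "act i \<in> hom A A" by (rule act_hom[OF iP])
  have "inv\<^bsub>P\<^esub> i = i [^]\<^bsub>P\<^esub> N" using i(2) iP by (simp add: P.inv_equality)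
  then have "act x (act i u) = (act i ^^ N) (act x u)" if "u \<in> carrier A" for u
    using act_x_conj[OF i(1) that] that iP by (simp add: act_nat_pow_funpow)
  then have "act x (A.poly_act (act i) f v) = A.poly_act (act i ^^ N) f (act x v)"
    by (intro A.hom_poly_act[OF hi A.funpow_hom[OF hi] act_hom[OF x] v])
  also have "\<dots> = A.poly_act (act i) (pcompose f (monom 1 N)) (act x v)"
    using v by (intro A.poly_act_funpow[OF hi]) simp
  finally show ?thesis .
qed

lemma act_x_cact: "v \<in> carrier A \<Longrightarrow> act x (cact f v) = cact (pcompose f (monom 1 (2 * 2 ^ n - 1))) (act x v)"
proof (rule act_x_poly_act[of b 1])
  have "Suc (2 * 2 ^ n - 1) = p * p ^ n" by (simp add: p2)
  then show "b [^]\<^bsub>P\<^esub> Suc (2 * 2 ^ n - 1) = \<one>\<^bsub>P\<^esub>" using b_pow by (simp only:)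
qed simp_all

lemma finite_index_span_b:
  assumes "a \<in> carrier A" "a \<noteq> \<one>"
  shows "finite_index (padic_span (act b) a) A"
proof (rule irreducible[OF disjI2[OF maximal_cyc_b]])
  show "subgroup (padic_span (act b) a) A" by (rule subgroup_padic_span[OF hb assms(1)])
  show "closedin T (padic_span (act b) a)"
    by (rule closedin_padic_span[OF hb assms(1) order_P_pos]) (simp add: act_pow_order)
  show "padic_span (act b) a \<noteq> {\<one>}" using self_in_padic_span[OF hb assms(1)] assms(2) by blast
  show "act g v \<in> padic_span (act b) a" if "g \<in> P.cyc b" "v \<in> padic_span (act b) a" for g v
    by (rule padic_span_invariant_cyc[OF b assms(1) that])
qed

text \<open>Modulo 4 the vector \<open>x a\<close> is \<open>f(b) a\<close> with
  \<open>f = c + d X\<close>. As \<open>x^2\<close> acts as -1, the product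
  \<open>f(1/X) f(X)\<close> must be -1 modulo 4 and \<open>X^2 + 1\<close>; but it equals
  \<open>c^2 + d^2\<close>.\<close>

lemma Q8_impossible:
  assumes n1: "n = 1"
  shows "carrier A = {\<one>}"
proof (rule ccontr)
  assume "carrier A \<noteq> {\<one>}"
  then obtain a0 where "a0 \<in> carrier A" "a0 \<noteq> \<one>" using A.one_closed by blast
  then obtain a where a: "a \<in> carrier A" "a \<notin> Lam 1" by (rule ex_not_in_Lam)
  have a1: "a \<noteq> \<one>" using a(2) Lam_def by (force intro: image_eqI[of _ _ \<one>])
  have xa: "act x a \<in> carrier A" using a by simp
  obtain f u where f: "f = 0 \<or> degree f < q" and u: "u \<in> pmul 2" "act x a = cact f a \<otimes> u"
    by (rule padic_span_eq_carrier[OF a finite_index_span_b[OF a(1) a1] xa])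
  have uA: "u \<in> carrier A" by (rule pmul_closed[OF u(1)])
  have "q = 2" by (subst q_eq) (simp add: n1)
  then have f2: "degree f < 2" using f by auto
  obtain c f' where f': "f = pCons c f'" by (cases f)
  obtain d f'' where f'': "f' = pCons d f''" by (cases f')
  have "f'' = 0" using f2 unfolding f' f'' by (auto split: if_splits)
  then have cd: "f = [:c, d:]" using f' f'' by simp
  define g where "g = pcompose f (monom 1 3)"
  have "inv a = act x (cact f a \<otimes> u)" using act_xx[OF a(1)] u(2) by simp
  also have "\<dots> = cact g (act x a) \<otimes> act x u"
    using a uA act_x_cact[OF a(1), of f] n1 by (simp add: act_distrib g_def numeral_3_eq_3)
  also have "cact g (act x a) = cact (g * f) a \<otimes> cact g u"
    unfolding u(2) using a uA by (simp add: cact_distrib cact_mult)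
  finally have eq: "inv a = cact (g * f) a \<otimes> (cact g u \<otimes> act x u)" using a uA by (simp add: A.m_assoc)
  have u': "cact g u \<otimes> act x u \<in> pmul 2"
    using pmul_hom[OF A.poly_act_hom[OF hb] u(1)] pmul_hom[OF act_hom[OF x] u(1)] by (rule pmul_mult)
  have "cact (g * f + 1) a = inv (cact g u \<otimes> act x u)"
  proof -
    let ?s = "cact (g * f) a" and ?u = "cact g u \<otimes> act x u"
    have cl: "?s \<in> carrier A" "?u \<in> carrier A" using a uA by simp_all
    have "(?s \<otimes> a) \<otimes> ?u = (?s \<otimes> ?u) \<otimes> a" using cl a by (simp add: A.m_ac)
    also have "\<dots> = \<one>" unfolding eq[symmetric] using a by simp
    finally have "?s \<otimes> a = inv ?u" using cl a by (simp add: A.inv_equality)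
    then show ?thesis using a by (simp add: cact_add)
  qed
  then have "cact (g * f + 1) a \<in> pmul 2" using pmul_inv[OF u'] by simp
  moreover have "gap_poly p (p ^ n) = [:1, 0, 1:]"
    by (subst gap_eq) (simp add: n1 monom_Suc monom_0 numeral_2_eq_2 one_pCons)
  \<comment> \<open>The inverse of \<open>X\<close> is \<open>X^3\<close>, so this is
    \<open>(c + d X^3) (c + d X) + 1\<close> divided by \<open>X^2 + 1\<close>.\<close>
  then have "g * f + 1 = gap_poly p (p ^ n) * [:- d\<^sup>2, c * d, d\<^sup>2:] + [:c\<^sup>2 + d\<^sup>2 + 1:]"
    unfolding g_def cd
    by (simp add: pcompose_pCons monom_Suc monom_0 numeral_3_eq_3 one_pCons power2_eq_square)
  then have "cact (g * f + 1) a = cact [:c\<^sup>2 + d\<^sup>2 + 1:] a"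
    using cact_mod_gap_poly[OF a(1), of "[:- d\<^sup>2, c * d, d\<^sup>2:]" "[:c\<^sup>2 + d\<^sup>2 + 1:]"] by (simp only:)
  ultimately have "cact [:c\<^sup>2 + d\<^sup>2 + 1:] a \<in> pmul 2" by (simp only:)
  then have "[:int p ^ 2:] dvd [:c\<^sup>2 + d\<^sup>2 + 1:]"
    using dvd_if_in_pmul[OF a, of "[:c\<^sup>2 + d\<^sup>2 + 1:]" 2] q_pos by simp
  then have "int p ^ 2 dvd coeff [:c\<^sup>2 + d\<^sup>2 + 1:] 0" unfolding const_poly_dvd_iff by (rule spec)
  then have "4 dvd c\<^sup>2 + d\<^sup>2 + 1" by (simp add: p2)
  then show False using not_4_dvd_sum_squares_plus_1 by blast
qed

text \<open>In the discrete topology the span with integer coefficients is already closed, so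
  \<open>m x a = f(b) a\<close> holds exactly for some \<open>m > 0\<close>. Then
  \<open>f(1/X) f(X) + m^2\<close> is a multiple of the cyclotomic polynomial, against
  \<open>not_dvd_norm_form\<close>.\<close>

lemma discrete_impossible:
  assumes discrete: "T = discrete_topology (carrier A)"
  shows "carrier A = {\<one>}"
proof (rule ccontr)
  assume "carrier A \<noteq> {\<one>}"
  then obtain a where a: "a \<in> carrier A" "a \<noteq> \<one>" using A.one_closed by blast
  have xa: "act x a \<in> carrier A" using a by simp
  define N where "N = range (\<lambda>f. cact f a)"
  have NA: "N \<subseteq> carrier A" using a by (auto simp: N_def)
  have bN: "act b v \<in> N" if v: "v \<in> N" for v
  proof -
    obtain f where f: "v = cact f a" using v by (auto simp: N_def)
    have "act b v = cact (monom 1 1) v" using v NA by (auto simp: cact_monom)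
    also have "\<dots> = cact (monom 1 1 * f) a" unfolding f using a by (simp add: cact_mult)
    finally show ?thesis by (simp add: N_def)
  qed
  have sN: "subgroup N A"
  proof (rule A.subgroupI[OF NA])
    show "N \<noteq> {}" by (auto simp: N_def)
    show "inv v \<in> N" if "v \<in> N" for v
      using that A.poly_act_uminus[OF hb a(1)] by (auto simp: N_def intro: range_eqI[OF sym])
    show "u \<otimes> v \<in> N" if "u \<in> N" "v \<in> N" for u v
      using that cact_add[OF a(1)] by (auto simp: N_def intro: range_eqI[OF sym])
  qed
  have "finite_index N A"
  proof (rule irreducible[OF disjI2[OF maximal_cyc_b] sN])
    show "closedin T N" using NA by (simp add: discrete closedin_discrete_topology)
    have "a \<in> N" using cact_1[OF a(1)] unfolding N_def by (metis rangeI)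
    then show "N \<noteq> {\<one>}" using a(2) by blast
    fix g v assume g: "g \<in> P.cyc b" and v: "v \<in> N"
    obtain m :: nat where m: "g = b [^]\<^bsub>P\<^esub> m" by (rule P.cyc_nat_pow[OF finite_P b g])
    have "(act b ^^ m) v \<in> N" by (induction m) (use v bN in auto)
    then show "act g v \<in> N" using v NA by (auto simp: m act_nat_pow_funpow)
  qed
  then obtain m :: nat where m: "m > 0" "act x a [^] m \<in> N" using A.finite_index_power[OF sN _ xa] by blast
  then obtain f where f: "act x a [^] int m = cact f a" by (auto simp: N_def int_pow_int)
  define g where "g = pcompose f (monom 1 (2 * 2 ^ n - 1))"
  have "(inv a) [^] int m = act x (act x a [^] int m)"
    using act_int_pow[OF x xa, of "int m"] act_xx[OF a(1)] by simp
  also have "\<dots> = cact g (act x a)" unfolding f g_def by (rule act_x_cact[OF a(1)])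
  finally have "((inv a) [^] int m) [^] int m = cact g (act x a [^] int m)"
    using xa by (simp add: cact_int_pow)
  also have "\<dots> = cact (g * f) a" unfolding f using a by (simp add: cact_mult)
  finally have "cact (g * f) a = inv (a [^] (int m * int m))"
    using a by (simp add: A.int_pow_pow A.int_pow_inv)
  then have one: "cact (g * f + [:(int m)\<^sup>2:]) a = \<one>"
    using a by (simp add: cact_add cact_const power2_eq_square)
  have pn: "p ^ n > 0" "p > 0" using p_gt_1 by auto
  \<comment> \<open>The remainder \<open>t\<close> has degree below \<open>q\<close> and annihilates
    \<open>a\<close>. By independence its coefficients are divisible by every power of 2, hence
    zero.\<close>
  obtain s t where st: "g * f + [:(int m)\<^sup>2:] = gap_poly p (p ^ n) * s + t" "t = 0 \<or> degree t < degree (gap_poly p (p ^ n))"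
    by (rule monic_division[OF degree_gap_poly(2)[OF pn]])
  have t: "t = 0 \<or> degree t < q" using st(2) degree_gap_poly(1)[OF pn] by (simp add: q_def mult.commute)
  have "cact t a = \<one>" using one cact_mod_gap_poly[OF a(1)] by (simp add: st(1))
  then have mem: "cact t a \<in> pmul k" for k using one_in_pmul by simp
  obtain k0 where k0: "\<And>k f. f = 0 \<or> degree f < q \<Longrightarrow> cact f a \<in> pmul (k + k0) \<Longrightarrow> [:int p ^ k:] dvd f"
    by (rule coefficients_independent[OF a]) (rule that)
  have "2 ^ k dvd coeff t i" for k i
    using k0[OF t mem, of k] by (simp add: const_poly_dvd_iff p2)
  then have "t = 0" using int_eq_0_if_powers_dvd by (intro poly_eqI) simp
  then have "(monom 1 (2 ^ n) + 1) dvd g * f + [:(int m)\<^sup>2:]"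
    unfolding st(1) gap_eq by simp
  then show False using not_dvd_norm_form[of "int m" "2 ^ n" f] m(1) unfolding g_def by simp
qed

text \<open>For \<open>n \<ge> 3\<close> the element \<open>t\<close> of order 8 is a power of
  \<open>b^2\<close>. With \<open>V\<close> the conjugate of \<open>U\<close> and
  \<open>U V = 15\<close>, the map \<open>Y = U x\<close> satisfies \<open>Y^2 = -15\<close>. For an
  eigenvector \<open>w\<close> of \<open>Y\<close>, the vector \<open>x w\<close> lies in the span
  of \<open>w\<close> over the powers of \<open>t\<close>, against
  \<open>no_x_stable_span\<close>.\<close>

lemma large_impossible:
  assumes compact: "compact_space T" and n3: "n \<ge> 3"
  shows "carrier A = {\<one>}"
proof (rule ccontr)
  assume "carrier A \<noteq> {\<one>}"
  then obtain v where v: "v \<in> carrier A" "v \<noteq> \<one>" using A.one_closed by blast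
  define t where "t = b [^]\<^bsub>P\<^esub> ((2::nat) ^ (n - 2))"
  define j where "j = (2::nat) ^ (n - 3)"
  define m where "m = n - 3"
  have nm: "n = m + 3" using n3 by (simp add: m_def)
  have tP [simp]: "t \<in> carrier P" by (simp add: t_def)
  have ht: "act t \<in> hom A A" by (rule act_hom[OF tP])
  have tj: "t = c2 [^]\<^bsub>P\<^esub> j"
  proof -
    have "2 ^ (n - 2) = 2 * (2::nat) ^ (n - 3)" by (simp add: nm power_add)
    then show ?thesis by (simp add: t_def j_def P.nat_pow_pow p2)
  qed
  have t4: "t [^]\<^bsub>P\<^esub> (4::nat) = z"
  proof -
    have "2 ^ (n - 2) * 4 = (2::nat) ^ n" by (simp add: nm power_add)
    then show ?thesis by (simp add: t_def P.nat_pow_pow p2)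
  qed
  have "z \<otimes>\<^bsub>P\<^esub> z = \<one>\<^bsub>P\<^esub>" using b_pow by (simp add: P.nat_pow_mult p2 mult_2)
  then have t8: "t [^]\<^bsub>P\<^esub> Suc 7 = \<one>\<^bsub>P\<^esub>"
    unfolding t4[symmetric] by (simp add: P.nat_pow_mult del: P.nat_pow_Suc)
  let ?pa = "A.poly_act (act t)"
  let ?X = "monom 1 1 :: int poly"
  have pac: "?pa f u \<in> carrier A" if "u \<in> carrier A" for f u by (rule A.poly_act_closed[OF ht that])
  have triv: "?pa (1 + ?X ^ 4) u = \<one>" if u: "u \<in> carrier A" for u
  proof -
    have "?pa (monom 1 4) u = inv u"
      using u t4 act_z by (simp add: A.poly_act_monom[OF ht] act_nat_pow_funpow[symmetric])
    moreover have "?X ^ 4 = monom 1 4" by (simp add: monom_power)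
    ultimately show ?thesis using u by (simp add: A.poly_act_add[OF ht] A.poly_act_1[OF ht])
  qed
  have mod: "?pa ((1 + ?X ^ 4) * S + f) u = ?pa f u" if u: "u \<in> carrier A" for S f u
    using u triv[OF u] by (simp add: A.poly_act_add[OF ht] mult.commute[of _ S] A.poly_act_mult[OF ht] A.poly_act_one_right[OF ht] pac)
  \<comment> \<open>The coefficients 2, 1, 1, 3 have square sum 15, and the sum 2 + 1 + 3 of the
    products of neighbours equals the product 2 * 3 of the outer ones; so the product of
    \<open>U\<close> with its conjugate has no irrational part. \<open>V\<close> is
    \<open>U(X^7)\<close> reduced by \<open>X^4 = -1\<close>.\<close>
  define U where "U = 2 + ?X + ?X ^ 2 + 3 * ?X ^ 3"
  define V where "V = 2 - 3 * ?X - ?X ^ 2 - ?X ^ 3"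
  have ring1: "U * V = (1 + ?X ^ 4) * (- 11 - 4 * ?X - 3 * ?X ^ 2) + 15"
  proof -
    have "(2 + y + y ^ 2 + 3 * y ^ 3) * (2 - 3 * y - y ^ 2 - y ^ 3) =
        (1 + y ^ 4) * (- 11 - 4 * y - 3 * y ^ 2) + 15" for y :: "int poly"
      by (simp add: eval_nat_numeral algebra_simps)
    then show ?thesis unfolding U_def V_def .
  qed
  have UV: "?pa (U * V) u = u [^] (15::int)" if u: "u \<in> carrier A" for u
  proof -
    show ?thesis unfolding ring1 mod[OF u] numeral_poly by (rule A.poly_act_const[OF ht u])
  qed
  have xU: "act x (?pa U u) = ?pa V (act x u)" if u: "u \<in> carrier A" for u
  proof -
    have U: "U = [:2, 1, 1, 3:]"
      by (simp add: U_def numeral_poly monom_altdef numeral_2_eq_2 numeral_3_eq_3)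
    have "pcompose U (monom 1 7) = 2 + ?X ^ 7 + ?X ^ 14 + 3 * ?X ^ 21"
    proof -
      have "pcompose U (monom 1 7) = 2 + monom 1 7 * (1 + monom 1 7 * (1 + monom 1 7 * 3))"
        unfolding U by (simp add: pcompose_pCons numeral_poly one_pCons)
      moreover have "monom 1 7 = ?X ^ 7" by (simp add: monom_power)
      ultimately show ?thesis by (simp add: algebra_simps power_add[symmetric])
    qed
    also have "\<dots> = (1 + ?X ^ 4) * (?X ^ 3 + (?X ^ 10 - ?X ^ 6 + ?X ^ 2)
        + 3 * (?X ^ 17 - ?X ^ 13 + ?X ^ 9 - ?X ^ 5 + ?X)) + V"
    proof -
      have "2 + y ^ 7 + y ^ 14 + 3 * y ^ 21 = (1 + y ^ 4) * (y ^ 3 + (y ^ 10 - y ^ 6 + y ^ 2)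
          + 3 * (y ^ 17 - y ^ 13 + y ^ 9 - y ^ 5 + y)) + (2 - 3 * y - y ^ 2 - y ^ 3)" for y :: "int poly"
        by (simp add: eval_nat_numeral algebra_simps)
      then show ?thesis unfolding V_def .
    qed
    finally have ring2: "pcompose U (monom 1 7) = (1 + ?X ^ 4) * (?X ^ 3 + (?X ^ 10 - ?X ^ 6 + ?X ^ 2)
        + 3 * (?X ^ 17 - ?X ^ 13 + ?X ^ 9 - ?X ^ 5 + ?X)) + V" .
    have "act x (?pa U u) = ?pa (pcompose U (monom 1 7)) (act x u)"
      by (rule act_x_poly_act[OF t_def t8 u])
    then show ?thesis unfolding ring2 using mod[of "act x u"] u by simp
  qed
  define Y where "Y u = ?pa U (act x u)" for u
  have Yhom: "Y \<in> hom A A"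
  proof (rule homI)
    show "Y u \<in> carrier A" if "u \<in> carrier A" for u using that by (simp add: Y_def pac)
    show "Y (u \<otimes> u') = Y u \<otimes> Y u'" if "u \<in> carrier A" "u' \<in> carrier A" for u u'
      using that by (simp add: Y_def act_distrib A.poly_act_distrib[OF ht])
  qed
  have YY: "Y (Y u) = u [^] (- 15 :: int)" if u: "u \<in> carrier A" for u
  proof -
    have "Y (Y u) = ?pa U (?pa V (inv u))" using u by (simp add: Y_def xU act_xx)
    also have "\<dots> = ?pa (U * V) (inv u)" using u by (simp add: A.poly_act_mult[OF ht])
    finally show ?thesis using u UV[of "inv u"] by (simp add: A.int_pow_inv A.int_pow_neg)
  qed
  obtain w s where w: "w \<in> carrier A" "w \<noteq> \<one>" and Yw: "\<And>k. \<exists>u\<in>pmul k. Y w = w [^] (s k :: int) \<otimes> u"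
    by (rule ex_eigenvector_sqrt_minus_15[OF p2 compact Yhom YY v]) (assumption, (rule that; assumption))
  have xw: "act x w \<in> carrier A" using w by simp
  have "act x w \<in> padic_span (act c2) w"
    unfolding padic_span_def
  proof (intro CollectI conjI allI xw)
    fix k
    obtain u where u: "u \<in> pmul k" "Y w = w [^] s k \<otimes> u" using Yw by blast
    have uA: "u \<in> carrier A" by (rule pmul_closed[OF u(1)])
    \<comment> \<open>Applying \<open>V\<close> to the eigenvector equation
      \<open>U x w = s w\<close> gives \<open>15 x w = s V w\<close>, and 15 is invertible modulo
      \<open>2^k\<close>.\<close>
    have "act x w [^] (15::int) = ?pa (V * U) (act x w)" using UV[OF xw] by (simp add: mult.commute)
    also have "\<dots> = ?pa V (Y w)" using xw by (simp add: A.poly_act_mult[OF ht] Y_def)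
    also have "\<dots> = ?pa V w [^] s k \<otimes> ?pa V u"
      unfolding u(2) using w uA by (simp add: A.poly_act_distrib[OF ht] A.poly_act_int_pow[OF ht])
    finally have e15: "act x w [^] (15::int) = ?pa V w [^] s k \<otimes> ?pa V u" .
    have "coprime (15::int) (2 ^ k)" by simp
    then obtain y where "2 ^ k dvd 15 * y - (1::int)" by (rule coprime_inverse_int)
    then obtain i where i: "15 * y - (1::int) = 2 ^ k * i" by (rule dvdE)
    have "act x w = act x w [^] (15 * y + 2 ^ k * (- i))" using i xw by (simp add: algebra_simps)
    also have "\<dots> = (act x w [^] (15::int)) [^] y \<otimes> act x w [^] (2 ^ k * (- i))"
      using xw by (simp only: A.int_pow_mult A.int_pow_pow)
    also have "act x w [^] (2 ^ k * (- i)) = (act x w [^] (- i)) [^] (int p ^ k)"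
      using xw by (simp only: A.int_pow_pow p2 mult.commute) simp
    also have "(act x w [^] (15::int)) [^] y = ?pa V w [^] (s k * y) \<otimes> ?pa V u [^] y"
      unfolding e15 using w uA by (simp add: A.int_pow_distrib A.int_pow_pow pac)
    also have "?pa V w [^] (s k * y) = ?pa ([:s k * y:] * V) w"
      by (rule A.poly_act_const_mult[OF ht w(1), symmetric])
    also have "\<dots> = A.poly_act (act c2 ^^ j) ([:s k * y:] * V) w"
      using w(1) by (intro A.poly_act_cong[OF ht A.funpow_hom[OF act_hom[OF c2]]])
        (simp_all add: tj act_nat_pow_funpow)
    also have "\<dots> = A.poly_act (act c2) (pcompose ([:s k * y:] * V) (monom 1 j)) w"
      by (rule A.poly_act_funpow[OF act_hom[OF c2] w(1)])
    finally have "act x w = A.poly_act (act c2) (pcompose ([:s k * y:] * V) (monom 1 j)) w \<otimes>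
        (?pa V u [^] y \<otimes> (act x w [^] (- i)) [^] (int p ^ k))"
      using w uA xw by (simp add: A.m_assoc pac A.poly_act_closed[OF act_hom[OF c2]])
    moreover have "?pa V u [^] y \<otimes> (act x w [^] (- i)) [^] (int p ^ k) \<in> pmul k"
      using pmul_hom[OF A.poly_act_hom[OF ht] u(1)] xw by (intro pmul_mult pmul_int_pow pmul_I) simp_all
    ultimately show "\<exists>f. \<exists>u\<in>pmul k. act x w = A.poly_act (act c2) f w \<otimes> u" by blast
  qed
  then show False using no_x_stable_span[OF w] by blast
qed

end

text \<open>The second alternative also returns a vector \<open>a\<close> for which
  \<open>a, b a, b^2 a, b^3 a\<close> behave like a basis over the 2-adic integers. From it the
  isomorphism of \<open>A\<close> with the lattice of rank 4 is built.\<close>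

theorem (in p_group_lattice) irreducible_lattice_cases:
  assumes nontrivial: "carrier A \<noteq> {\<one>}"
  obtains (rank_one) "\<And>N. subgroup N A \<Longrightarrow> closedin T N \<Longrightarrow> N \<noteq> {\<one>} \<Longrightarrow> finite_index N A"
  | (quaternion) b x a where "p = 2" "compact_space T" "b \<in> carrier P" "x \<in> carrier P" "P.ord b = 8"
      "carrier P = P.cyc b \<union> (\<lambda>c. c \<otimes>\<^bsub>P\<^esub> x) ` P.cyc b" "x \<notin> P.cyc b"
      "x \<otimes>\<^bsub>P\<^esub> x = b [^]\<^bsub>P\<^esub> (4::nat)" "P.conj_by x b = inv\<^bsub>P\<^esub> b" "a \<in> carrier A"
      "\<And>v k. v \<in> carrier A \<Longrightarrow> \<exists>f. \<exists>u\<in>pmul k. degree f < 4 \<and> v = A.poly_act (act b) f a \<otimes> u"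
      "\<And>f k. degree f < 4 \<Longrightarrow> A.poly_act (act b) f a \<in> pmul k \<Longrightarrow> [:int p ^ k:] dvd f"
proof (cases rule: P.finite_p_group_trichotomy[OF p order_P, case_names elementary cyclic maximal_class])
    case (elementary z e)
    then have "carrier A = {\<one>}" by (intro no_central_by_noncentral_pair[of z e])
    then show ?thesis using nontrivial by simp
  next
    case (cyclic b n)
    then show ?thesis using rank_one cyclic_case by blast
  next
    case (maximal_class b x n l)
    note mc = maximal_class
    define m where "m = n - 1"
    have nm: "n = Suc m" "m > 0" using mc(2) by (simp_all add: m_def)
    have zpow: "b [^]\<^bsub>P\<^esub> ((2::int) ^ m) = b [^]\<^bsub>P\<^esub> (p ^ m)"
      using int_pow_int[of P b "2 ^ m"] by (simp add: mc(1))
    have b_eq: "b [^]\<^bsub>P\<^esub> (i::int) = b [^]\<^bsub>P\<^esub> j \<longleftrightarrow> 2 ^ Suc m dvd j - i" for i j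
      using P.int_pow_eq[OF mc(3)] mc(5) nm by simp
    have cx: "P.conj_by x (b [^]\<^bsub>P\<^esub> (p ^ m)) = b [^]\<^bsub>P\<^esub> (p ^ m)"
    proof -
      obtain h where h: "l = 2 * h + 1" using mc(8) by (rule oddE)
      have "P.conj_by x (b [^]\<^bsub>P\<^esub> ((2::int) ^ m)) = b [^]\<^bsub>P\<^esub> (l * 2 ^ m)"
        using mc by (simp add: P.conj_by_int_pow P.int_pow_pow)
      also have "\<dots> = b [^]\<^bsub>P\<^esub> ((2::int) ^ m)"
      proof -
        have "2 ^ m - l * 2 ^ m = 2 ^ Suc m * (- h)" by (simp add: h algebra_simps)
        then show ?thesis unfolding b_eq by simp
      qed
      finally show ?thesis unfolding zpow .
    qed
    have central: "P.conj_by g (b [^]\<^bsub>P\<^esub> (p ^ m)) = b [^]\<^bsub>P\<^esub> (p ^ m)" if g: "g \<in> carrier P" for g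
    proof -
      have cb: "P.conj_by c (b [^]\<^bsub>P\<^esub> (p ^ m)) = b [^]\<^bsub>P\<^esub> (p ^ m)" if c: "c \<in> P.cyc b" for c
      proof -
        obtain i :: nat where i: "c = b [^]\<^bsub>P\<^esub> i" by (rule P.cyc_nat_pow[OF finite_P mc(3) c])
        then have "c \<otimes>\<^bsub>P\<^esub> b [^]\<^bsub>P\<^esub> (p ^ m) = b [^]\<^bsub>P\<^esub> (p ^ m) \<otimes>\<^bsub>P\<^esub> c"
          using mc(3) by (simp add: P.nat_pow_mult add.commute)
        then show ?thesis using P.conj_by_eq_iff[of c "b [^]\<^bsub>P\<^esub> (p ^ m)" "b [^]\<^bsub>P\<^esub> (p ^ m)"] i mc(3) by simp
      qed
      from g mc(7) consider "g \<in> P.cyc b" | c where "c \<in> P.cyc b" "g = c \<otimes>\<^bsub>P\<^esub> x" by blast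
      then show ?thesis
      proof cases
        case 1
        then show ?thesis by (rule cb)
      next
        case 2
        have "c \<in> carrier P" using 2(1) P.cyc_closed[OF mc(3)] by blast
        then show ?thesis using cb[OF 2(1)] cx mc(3,4) by (simp add: 2(2) P.conj_by_conj_by[symmetric])
      qed
    qed
    interpret C: cyclic_lattice A P act T p r b m
      by (rule cyclic_latticeI[OF mc(3) _ central]) (simp_all add: mc(1,5) nm)
    have zc2: "b [^]\<^bsub>P\<^esub> (p ^ m) \<in> P.cyc (b [^]\<^bsub>P\<^esub> p)"
    proof -
      have "p ^ m = p * p ^ (m - 1)" using nm(2) by (cases m) auto
      then have "b [^]\<^bsub>P\<^esub> (p ^ m) = (b [^]\<^bsub>P\<^esub> p) [^]\<^bsub>P\<^esub> int (p ^ (m - 1))"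
        unfolding int_pow_int using mc(3) by (simp add: P.nat_pow_pow)
      then show ?thesis using P.cyc_I by metis
    qed
    have xx: "x \<otimes>\<^bsub>P\<^esub> x = \<one>\<^bsub>P\<^esub> \<or> (x \<otimes>\<^bsub>P\<^esub> x = b [^]\<^bsub>P\<^esub> (p ^ m) \<and> P.conj_by x b = inv\<^bsub>P\<^esub> b)"
      using mc(10) zpow by (simp add: nm)
    have one_c2: "\<one>\<^bsub>P\<^esub> \<in> P.cyc (b [^]\<^bsub>P\<^esub> p)"
      using mc(3) by (intro subgroup.one_closed[OF P.subgroup_cyc]) simp
    interpret M: maximal_class_lattice A P act T p r b m x l
      by (unfold_locales) (use mc nm xx zc2 one_c2 in auto)
    have "x \<otimes>\<^bsub>P\<^esub> x \<noteq> \<one>\<^bsub>P\<^esub>" using M.involution_impossible by blast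
    then have sq: "x \<otimes>\<^bsub>P\<^esub> x = b [^]\<^bsub>P\<^esub> (p ^ m)" "P.conj_by x b = inv\<^bsub>P\<^esub> b" using xx by blast+
    interpret Q: quaternion_lattice A P act T p r b m x l
      by unfold_locales (rule sq)+
    have compact: "compact_space T"
      using compact_or_discrete Q.discrete_impossible nontrivial by blast
    \<comment> \<open>The group \<open>P\<close> has order \<open>2^(m+2)\<close>. Order 8 is
      excluded by \<open>Q8_impossible\<close>, order at least 32 by
      \<open>large_impossible\<close>.\<close>
    have m2: "m = 2"
      using Q.Q8_impossible Q.large_impossible[OF compact] nontrivial nm(2) by linarith
    have q4: "C.q = 4" by (subst Q.q_eq) (simp add: m2)
    obtain a0 where "a0 \<in> carrier A" "a0 \<noteq> \<one>" using nontrivial A.one_closed by blast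
    then obtain a where a: "a \<in> carrier A" "a \<notin> C.Lam 1" by (rule C.ex_not_in_Lam)
    have "\<one> \<in> C.Lam 1" unfolding C.Lam_def by (rule image_eqI[of _ _ \<one>]) simp_all
    then have a1: "a \<noteq> \<one>" using a(2) by blast
    show ?thesis
    proof (rule quaternion[OF mc(1) compact mc(3,4) _ mc(7,6) _ sq(2) a(1)])
      show "P.ord b = 8" by (simp add: mc(5) nm m2)
      show "x \<otimes>\<^bsub>P\<^esub> x = b [^]\<^bsub>P\<^esub> (4::nat)" using sq(1) by (simp add: mc(1) m2)
      show "\<exists>f. \<exists>u\<in>pmul k. degree f < 4 \<and> v = A.poly_act (act b) f a \<otimes> u" if v: "v \<in> carrier A" for v k
      proof -
        obtain f u where f: "f = 0 \<or> degree f < C.q" and u: "u \<in> pmul k" "v = A.poly_act (act b) f a \<otimes> u"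
          by (rule C.padic_span_eq_carrier[OF a Q.finite_index_span_b[OF a(1) a1] v])
        have "degree f < 4" using f q4 by auto
        then show ?thesis using u by blast
      qed
      show "[:int p ^ k:] dvd f" if "degree f < 4" "A.poly_act (act b) f a \<in> pmul k" for f k
        using C.dvd_if_in_pmul[OF a, of f k] that q4 by simp
    qed
qed

section \<open>Subgroups of finite index\<close>

lemma (in group) finite_index_iff:
  assumes L: "L \<subseteq> carrier G"
  shows "finite_index K (G\<lparr>carrier := L\<rparr>) \<longleftrightarrow> finite ((\<lambda>x. K #> x) ` L)"
proof -
  have "rcosets\<^bsub>G\<lparr>carrier := L\<rparr>\<^esub> K = (\<lambda>x. K #> x) ` L"
    by (auto simp: RCOSETS_def r_coset_def)
  then show ?thesis by (simp add: finite_index_def)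
qed

context group
begin

text \<open>\<open>K\<close> need not lie in \<open>L\<close>: for subgroups this says that
  \<open>K \<inter> L\<close> has finite index in \<open>L\<close>. Subgroups of subgroups can thus
  be handled as subsets of one ambient group.\<close>

definition fin_index :: "'a set \<Rightarrow> 'a set \<Rightarrow> bool" where
  "fin_index K L \<longleftrightarrow> finite ((\<lambda>x. K #> x) ` L)"

lemma r_coset_eq_iff:
  assumes "subgroup K G" "x \<in> carrier G" "y \<in> carrier G"
  shows "K #> x = K #> y \<longleftrightarrow> x \<otimes> inv y \<in> K"
proof
  assume "K #> x = K #> y"
  then have "x \<in> K #> y" using rcos_self[OF assms(2,1)] by simp
  then obtain k where k: "k \<in> K" "x = k \<otimes> y" by (auto simp: r_coset_def)
  then show "x \<otimes> inv y \<in> K" using assms subgroup.mem_carrier[OF assms(1)] by (simp add: m_assoc)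
next
  assume xy: "x \<otimes> inv y \<in> K"
  have "x = (x \<otimes> inv y) \<otimes> y" using assms by (simp add: m_assoc)
  then have "x \<in> K #> y" using xy by (auto simp: r_coset_def)
  then show "K #> x = K #> y" using repr_independence[OF _ assms(3,1)] by simp
qed

text \<open>Any map with finitely many values whose fibres lie in single cosets will do, so
  finiteness of an index is obtained without computing it.\<close>

lemma fin_indexI:
  assumes "subgroup K G" "L \<subseteq> carrier G" "finite (f ` L)"
    and "\<And>x y. x \<in> L \<Longrightarrow> y \<in> L \<Longrightarrow> f x = f y \<Longrightarrow> x \<otimes> inv y \<in> K"
  shows "fin_index K L"
proof -
  have "(\<lambda>x. K #> x) ` L \<subseteq> (\<lambda>c. K #> (SOME y. y \<in> L \<and> f y = c)) ` (f ` L)"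
  proof
    fix C assume "C \<in> (\<lambda>x. K #> x) ` L"
    then obtain x where x: "x \<in> L" "C = K #> x" by blast
    define y where "y = (SOME y. y \<in> L \<and> f y = f x)"
    have y: "y \<in> L \<and> f y = f x" unfolding y_def by (rule someI[of _ x]) (use x in simp)
    then have "K #> x = K #> y"
      using assms(2,4) x by (subst r_coset_eq_iff[OF assms(1)]) auto
    then show "C \<in> (\<lambda>c. K #> (SOME y. y \<in> L \<and> f y = c)) ` (f ` L)" using x unfolding y_def by blast
  qed
  then show ?thesis unfolding fin_index_def using assms(3) finite_subset by blast
qed

lemma fin_indexD:
  assumes "fin_index K L" "subgroup K G" "L \<subseteq> carrier G"
  obtains f :: "'a \<Rightarrow> 'a set" where "finite (f ` L)" "\<And>x y. x \<in> L \<Longrightarrow> y \<in> L \<Longrightarrow> f x = f y \<Longrightarrow> x \<otimes> inv y \<in> K"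
proof (rule that[of "\<lambda>x. K #> x"])
  show "finite ((\<lambda>x. K #> x) ` L)" using assms(1) by (simp add: fin_index_def)
  show "x \<otimes> inv y \<in> K" if "x \<in> L" "y \<in> L" "K #> x = K #> y" for x y
    using that assms r_coset_eq_iff[of K x y] by blast
qed

lemma fin_index_sub: "fin_index K L \<Longrightarrow> L' \<subseteq> L \<Longrightarrow> fin_index K L'"
  unfolding fin_index_def using finite_subset image_mono by metis

lemma fin_index_mono:
  assumes "fin_index K L" "subgroup K G" "subgroup K' G" "K \<subseteq> K'" "L \<subseteq> carrier G"
  shows "fin_index K' L"
proof -
  obtain f :: "'a \<Rightarrow> 'a set" where "finite (f ` L)" "\<And>x y. x \<in> L \<Longrightarrow> y \<in> L \<Longrightarrow> f x = f y \<Longrightarrow> x \<otimes> inv y \<in> K"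
    by (rule fin_indexD[OF assms(1,2,5)]) (rule that; assumption)
  then show ?thesis using assms by (intro fin_indexI[of K' L f]) auto
qed

lemma fin_index_Int:
  assumes "fin_index K L" "fin_index K' L" "subgroup K G" "subgroup K' G" "L \<subseteq> carrier G"
  shows "fin_index (K \<inter> K') L"
proof -
  obtain f :: "'a \<Rightarrow> 'a set" where f: "finite (f ` L)" "\<And>x y. x \<in> L \<Longrightarrow> y \<in> L \<Longrightarrow> f x = f y \<Longrightarrow> x \<otimes> inv y \<in> K"
    by (rule fin_indexD[OF assms(1,3,5)]) (rule that; assumption)
  obtain f' :: "'a \<Rightarrow> 'a set" where f': "finite (f' ` L)" "\<And>x y. x \<in> L \<Longrightarrow> y \<in> L \<Longrightarrow> f' x = f' y \<Longrightarrow> x \<otimes> inv y \<in> K'"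
    by (rule fin_indexD[OF assms(2,4,5)]) (rule that; assumption)
  show ?thesis
  proof (rule fin_indexI[OF subgroups_Inter_pair[OF assms(3,4)] assms(5), where f = "\<lambda>x. (f x, f' x)"])
    have "(\<lambda>x. (f x, f' x)) ` L \<subseteq> f ` L \<times> f' ` L" by auto
    then show "finite ((\<lambda>x. (f x, f' x)) ` L)" using f(1) f'(1) finite_subset by blast
  qed (use f f' in auto)
qed

text \<open>An element is located by its coset modulo \<open>M\<close> together with the coset
  modulo \<open>K\<close> of its quotient by a chosen representative.\<close>

lemma fin_index_trans:
  assumes "fin_index K M" "fin_index M L" "subgroup K G" "subgroup M G" "subgroup L G"
  shows "fin_index K L"
proof -
  have LG: "L \<subseteq> carrier G" and MG: "M \<subseteq> carrier G" using assms subgroup.subset by blast+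
  define r where "r C = (SOME y. y \<in> L \<and> M #> y = C)" for C
  have r: "r (M #> x) \<in> L \<and> M #> r (M #> x) = M #> x" if "x \<in> L" for x
    unfolding r_def by (rule someI[of _ x]) (use that in simp)
  define d where "d x = x \<otimes> inv (r (M #> x))" for x
  have d: "d x \<in> M" if "x \<in> L" for x
    unfolding d_def using r[OF that] that LG r_coset_eq_iff[OF assms(4), of x "r (M #> x)"] by blast
  show ?thesis
  proof (rule fin_indexI[OF assms(3) LG, where f = "\<lambda>x. (M #> x, K #> d x)"])
    have "(\<lambda>x. (M #> x, K #> d x)) ` L \<subseteq> (\<lambda>x. M #> x) ` L \<times> (\<lambda>x. K #> x) ` M" using d by auto
    then show "finite ((\<lambda>x. (M #> x, K #> d x)) ` L)"
      using assms(1,2) unfolding fin_index_def by (meson finite_SigmaI finite_subset)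
    fix x y assume xy: "x \<in> L" "y \<in> L" "(M #> x, K #> d x) = (M #> y, K #> d y)"
    let ?r = "r (M #> x)"
    have cl: "x \<in> carrier G" "y \<in> carrier G" "?r \<in> carrier G" using xy LG r[OF xy(1)] by auto
    have "d x \<otimes> inv (d y) \<in> K"
      using xy d[OF xy(1)] d[OF xy(2)] MG r_coset_eq_iff[OF assms(3), of "d x" "d y"] by auto
    moreover have "d x = x \<otimes> inv ?r" "d y = y \<otimes> inv ?r" using xy(3) by (simp_all add: d_def)
    moreover have "inv ?r \<otimes> (?r \<otimes> inv y) = inv y" using cl by (simp add: m_assoc[symmetric])
    ultimately have "x \<otimes> inv y \<in> K" using cl by (simp add: inv_mult_group m_assoc)
    then show "x \<otimes> inv y \<in> K" using cl by simp
  qed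
qed

lemma fin_index_finite:
  assumes "fin_index K L" "finite K" "subgroup K G" "L \<subseteq> carrier G"
  shows "finite L"
proof -
  have "L \<subseteq> (\<Union>C\<in>(\<lambda>x. K #> x) ` L. C)" using assms rcos_self by auto
  moreover have "finite (K #> x)" for x using assms(2) by (simp add: r_coset_def)
  then have "finite (\<Union>C\<in>(\<lambda>x. K #> x) ` L. C)"
    using assms(1) unfolding fin_index_def by (intro finite_UN_I) auto
  ultimately show ?thesis by (rule finite_subset)
qed

section \<open>Conjugates and normal cores of subgroups\<close>

definition conj_set :: "'a \<Rightarrow> 'a set \<Rightarrow> 'a set" where
  "conj_set g K = conj_by g ` K"

lemma conj_set_iff:
  assumes "g \<in> carrier G" "K \<subseteq> carrier G" "x \<in> carrier G"
  shows "x \<in> conj_set g K \<longleftrightarrow> conj_by (inv g) x \<in> K"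
proof
  assume "x \<in> conj_set g K"
  then obtain k where "k \<in> K" "x = conj_by g k" by (auto simp: conj_set_def)
  then show "conj_by (inv g) x \<in> K" using assms by auto
next
  assume "conj_by (inv g) x \<in> K"
  moreover have "x = conj_by g (conj_by (inv g) x)" using assms by simp
  ultimately show "x \<in> conj_set g K" unfolding conj_set_def by (rule rev_image_eqI)
qed

lemma conj_set_subset: "g \<in> carrier G \<Longrightarrow> K \<subseteq> carrier G \<Longrightarrow> conj_set g K \<subseteq> carrier G"
  by (auto simp: conj_set_def)

lemma conj_set_conj_set:
  "g \<in> carrier G \<Longrightarrow> h \<in> carrier G \<Longrightarrow> K \<subseteq> carrier G \<Longrightarrow> conj_set g (conj_set h K) = conj_set (g \<otimes> h) K"
  unfolding conj_set_def image_image by (intro image_cong refl) (auto simp: conj_by_conj_by)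

lemma conj_set_one: "K \<subseteq> carrier G \<Longrightarrow> conj_set \<one> K = K"
  unfolding conj_set_def by (auto simp: subset_iff)

lemma subgroup_conj_set:
  assumes g: "g \<in> carrier G" and K: "subgroup K G"
  shows "subgroup (conj_set g K) G"
proof -
  interpret h: group_hom G G "conj_by g"
    using conj_by_hom[OF g] by (simp add: group_hom_def group_hom_axioms_def)
  show ?thesis unfolding conj_set_def by (rule h.subgroup_img_is_subgroup[OF K])
qed

lemma fin_index_conj_set:
  assumes g: "g \<in> carrier G" and K: "subgroup K G" and fi: "fin_index K (carrier G)"
  shows "fin_index (conj_set g K) (carrier G)"
proof -
  have KG: "K \<subseteq> carrier G" using K by (rule subgroup.subset)
  obtain f :: "'a \<Rightarrow> 'a set" where f: "finite (f ` carrier G)"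
    "\<And>x y. x \<in> carrier G \<Longrightarrow> y \<in> carrier G \<Longrightarrow> f x = f y \<Longrightarrow> x \<otimes> inv y \<in> K"
    by (rule fin_indexD[OF fi K subset_refl]) (rule that; assumption)
  show ?thesis
  proof (rule fin_indexI[OF subgroup_conj_set[OF g K] subset_refl, where f = "\<lambda>x. f (conj_by (inv g) x)"])
    have "(\<lambda>x. f (conj_by (inv g) x)) ` carrier G \<subseteq> f ` carrier G" using g by auto
    then show "finite ((\<lambda>x. f (conj_by (inv g) x)) ` carrier G)" using f(1) by (rule finite_subset)
    fix x y assume xy: "x \<in> carrier G" "y \<in> carrier G" "f (conj_by (inv g) x) = f (conj_by (inv g) y)"
    then have "conj_by (inv g) x \<otimes> inv (conj_by (inv g) y) \<in> K" using g by (intro f(2)) simp_all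
    then have "conj_by (inv g) (x \<otimes> inv y) \<in> K" using g xy by (simp add: conj_by_mult conj_by_inv)
    then show "x \<otimes> inv y \<in> conj_set g K" using g xy KG conj_set_iff by simp
  qed
qed

definition core :: "'a set \<Rightarrow> 'a set" where
  "core K = (\<Inter>g\<in>carrier G. conj_set g K)"

text \<open>The conjugate by \<open>g\<close> depends only on the left coset of \<open>S\<close>
  that contains \<open>g\<close>. As \<open>f\<close> separates right cosets, it is applied to
  \<open>inv g\<close>.\<close>

lemma finite_conj_sets:
  assumes S: "subgroup S G" "fin_index S (carrier G)" and K: "K \<subseteq> carrier G"
    and inv: "\<And>s. s \<in> S \<Longrightarrow> conj_set s K = K"
  shows "finite ((\<lambda>g. conj_set g K) ` carrier G)"
proof -
  have SG: "S \<subseteq> carrier G" using S(1) by (rule subgroup.subset)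
  obtain f :: "'a \<Rightarrow> 'a set" where f: "finite (f ` carrier G)"
    "\<And>x y. x \<in> carrier G \<Longrightarrow> y \<in> carrier G \<Longrightarrow> f x = f y \<Longrightarrow> x \<otimes> inv y \<in> S"
    by (rule fin_indexD[OF S(2,1) subset_refl]) (rule that; assumption)
  have "(\<lambda>g. conj_set g K) ` carrier G \<subseteq> (\<lambda>c. conj_set (inv (SOME y. y \<in> carrier G \<and> f y = c)) K) ` (f ` carrier G)"
  proof
    fix C assume "C \<in> (\<lambda>g. conj_set g K) ` carrier G"
    then obtain g where g: "g \<in> carrier G" "C = conj_set g K" by blast
    define y where "y = (SOME y. y \<in> carrier G \<and> f y = f (inv g))"
    have y: "y \<in> carrier G \<and> f y = f (inv g)" unfolding y_def by (rule someI[of _ "inv g"]) (use g in simp)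
    then have "y \<otimes> inv (inv g) \<in> S" using g by (intro f(2)) simp_all
    then have s: "y \<otimes> g \<in> S" using g by simp
    have "conj_set (inv y) (conj_set (y \<otimes> g) K) = conj_set (inv y \<otimes> (y \<otimes> g)) K"
      using y g K by (intro conj_set_conj_set) simp_all
    also have "inv y \<otimes> (y \<otimes> g) = g" using y g by (simp add: m_assoc[symmetric])
    finally have "C = conj_set (inv y) K" using inv[OF s] g by simp
    then show "C \<in> (\<lambda>c. conj_set (inv (SOME y. y \<in> carrier G \<and> f y = c)) K) ` (f ` carrier G)"
      unfolding y_def using g by (intro image_eqI[of _ _ "f (inv g)"]) simp_all
  qed
  then show ?thesis using f(1) finite_subset by blast
qed

lemma conj_set_self:
  assumes K: "subgroup K G" and s: "s \<in> K"
  shows "conj_set s K = K"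
proof -
  have KG: "K \<subseteq> carrier G" using K by (rule subgroup.subset)
  have le: "conj_set t K \<subseteq> K" if "t \<in> K" for t
    using that K by (auto simp: conj_set_def conj_by_def subgroup.m_closed subgroup.m_inv_closed)
  have sG: "s \<in> carrier G" using s KG by blast
  have "K = conj_set s (conj_set (inv s) K)" using sG KG by (simp add: conj_set_conj_set conj_set_one)
  also have "\<dots> \<subseteq> conj_set s K"
    using le[of "inv s"] s K by (simp add: conj_set_def image_mono subgroup.m_inv_closed)
  finally show ?thesis using le[OF s] by blast
qed

lemma core_subset: "K \<subseteq> carrier G \<Longrightarrow> core K \<subseteq> K"
  unfolding core_def using conj_set_one one_closed by blast

lemma core_normal:
  assumes K: "subgroup K G"
  shows "core K \<lhd> G"
proof -
  have KG: "K \<subseteq> carrier G" using K by (rule subgroup.subset)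
  have sub: "subgroup (core K) G"
    unfolding core_def by (rule subgroups_Inter) (use subgroup_conj_set K in auto)
  have "g \<otimes> x \<otimes> inv g \<in> core K" if g: "g \<in> carrier G" and x: "x \<in> core K" for g x
    unfolding core_def
  proof
    fix h assume h: "h \<in> carrier G"
    have xG: "x \<in> carrier G" using x core_subset[OF KG] KG by blast
    have "x \<in> conj_set (inv g \<otimes> h) K" using x g h unfolding core_def by auto
    then have "conj_by g x \<in> conj_set g (conj_set (inv g \<otimes> h) K)" by (auto simp: conj_set_def)
    also have "\<dots> = conj_set (g \<otimes> (inv g \<otimes> h)) K" using g h KG by (intro conj_set_conj_set) simp_all
    also have "g \<otimes> (inv g \<otimes> h) = h" using g h by (simp add: m_assoc[symmetric])
    finally show "g \<otimes> x \<otimes> inv g \<in> conj_set h K" by (simp add: conj_by_def)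
  qed
  then show ?thesis using sub by (simp add: normal_inv_iff)
qed

lemma fin_index_core:
  assumes K: "subgroup K G" and fi: "fin_index K (carrier G)"
  shows "fin_index (core K) (carrier G)"
proof -
  have KG: "K \<subseteq> carrier G" using K by (rule subgroup.subset)
  have fin: "finite ((\<lambda>g. conj_set g K) ` carrier G)"
    by (rule finite_conj_sets[OF K fi KG]) (rule conj_set_self[OF K])
  have all: "\<forall>C\<in>(\<lambda>g. conj_set g K) ` carrier G. subgroup C G \<and> fin_index C (carrier G)"
    using subgroup_conj_set[OF _ K] fin_index_conj_set[OF _ K fi] by blast
  have "fin_index (\<Inter>S) (carrier G) \<and> subgroup (\<Inter>S) G"
    if "finite S" "S \<noteq> {}" "\<forall>C\<in>S. subgroup C G \<and> fin_index C (carrier G)" for S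
    using that
  proof (induction rule: finite_ne_induct)
    case (insert C S)
    then show ?case
      using fin_index_Int[of C "carrier G" "\<Inter>S"] subgroups_Inter_pair[of C "\<Inter>S"] by simp
  qed simp
  from this[OF fin _ all] show ?thesis unfolding core_def by (auto simp: image_constant_conv)
qed

end

section \<open>Just infinite groups\<close>

context group
begin

definition centralizer :: "'a set \<Rightarrow> 'a set" where
  "centralizer S = {g \<in> carrier G. \<forall>s\<in>S. g \<otimes> s = s \<otimes> g}"

lemma subgroup_centralizer: "S \<subseteq> carrier G \<Longrightarrow> subgroup (centralizer S) G"
proof (rule subgroupI)
  assume S: "S \<subseteq> carrier G"
  show "centralizer S \<subseteq> carrier G" by (auto simp: centralizer_def)
  show "centralizer S \<noteq> {}" using S by (auto simp: centralizer_def intro!: exI[of _ \<one>])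
  show "inv g \<in> centralizer S" if "g \<in> centralizer S" for g
  proof -
    have g: "g \<in> carrier G" "\<And>s. s \<in> S \<Longrightarrow> g \<otimes> s = s \<otimes> g" using that by (auto simp: centralizer_def)
    have "inv g \<otimes> s = s \<otimes> inv g" if "s \<in> S" for s
    proof -
      have s: "s \<in> carrier G" using that S by blast
      have "inv g \<otimes> s = inv g \<otimes> (s \<otimes> g) \<otimes> inv g" using g(1) s by (simp add: m_assoc)
      also have "\<dots> = s \<otimes> inv g" unfolding g(2)[OF that, symmetric] using g(1) s by (simp add: m_assoc[symmetric])
      finally show ?thesis .
    qed
    then show ?thesis using g(1) by (simp add: centralizer_def)
  qed
  show "g \<otimes> h \<in> centralizer S" if "g \<in> centralizer S" "h \<in> centralizer S" for g h
  proof -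
    have g: "g \<in> carrier G" "\<And>s. s \<in> S \<Longrightarrow> g \<otimes> s = s \<otimes> g" using that by (auto simp: centralizer_def)
    have h: "h \<in> carrier G" "\<And>s. s \<in> S \<Longrightarrow> h \<otimes> s = s \<otimes> h" using that by (auto simp: centralizer_def)
    have "g \<otimes> h \<otimes> s = s \<otimes> (g \<otimes> h)" if "s \<in> S" for s
    proof -
      have s: "s \<in> carrier G" using that S by blast
      have "g \<otimes> h \<otimes> s = g \<otimes> (s \<otimes> h)" using g(1) h s that by (simp add: m_assoc)
      also have "\<dots> = s \<otimes> g \<otimes> h" unfolding g(2)[OF that, symmetric] using g(1) h(1) s by (simp add: m_assoc)
      finally show ?thesis using g(1) h(1) s by (simp add: m_assoc)
    qed
    then show ?thesis using g(1) h(1) by (simp add: centralizer_def)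
  qed
qed

lemma conj_by_centralizer:
  assumes S: "S \<subseteq> carrier G" and g: "g \<in> carrier G" and inv: "\<And>s. s \<in> S \<Longrightarrow> conj_by (inv g) s \<in> S"
    and c: "c \<in> centralizer S"
  shows "conj_by g c \<in> centralizer S"
proof -
  have cG: "c \<in> carrier G" using c unfolding centralizer_def by blast
  have "conj_by g c \<otimes> s = s \<otimes> conj_by g c" if s: "s \<in> S" for s
  proof -
    let ?t = "conj_by (inv g) s"
    have sG: "s \<in> carrier G" using s S by blast
    have t: "?t \<in> carrier G" "s = conj_by g ?t" using sG g by simp_all
    have "c \<otimes> ?t = ?t \<otimes> c" using c inv[OF s] unfolding centralizer_def by blast
    then have "conj_by g (c \<otimes> ?t) = conj_by g (?t \<otimes> c)" by simp
    then have "conj_by g c \<otimes> conj_by g ?t = conj_by g ?t \<otimes> conj_by g c"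
      using g cG t(1) by (simp only: conj_by_mult)
    then show ?thesis using t(2) by simp
  qed
  then show ?thesis using conj_by_closed[OF g cG] unfolding centralizer_def by blast
qed

text \<open>The commutator of \<open>n\<close> and \<open>k\<close> lies in both subgroups.\<close>

lemma commute_if_disjoint:
  assumes N: "subgroup N G" and K: "subgroup K G" and NK: "N \<inter> K = {\<one>}"
    and norm: "\<And>k n. k \<in> K \<Longrightarrow> n \<in> N \<Longrightarrow> conj_by k n \<in> N" "\<And>k n. k \<in> K \<Longrightarrow> n \<in> N \<Longrightarrow> conj_by n k \<in> K"
    and nk: "n \<in> N" "k \<in> K"
  shows "n \<otimes> k = k \<otimes> n"
proof -
  have G: "n \<in> carrier G" "k \<in> carrier G" using subgroup.mem_carrier[OF N nk(1)] subgroup.mem_carrier[OF K nk(2)] by simp_all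
  have "conj_by n k \<otimes> inv k \<in> K"
    using norm(2)[OF nk(2,1)] nk(2) K by (simp add: subgroup.m_closed subgroup.m_inv_closed)
  moreover have "conj_by n k \<otimes> inv k = n \<otimes> conj_by k (inv n)"
    using G by (simp add: conj_by_def m_assoc)
  moreover have "n \<otimes> conj_by k (inv n) \<in> N"
    using norm(1)[OF nk(2), of "inv n"] nk(1) N by (simp add: subgroup.m_closed subgroup.m_inv_closed)
  ultimately have "conj_by n k \<otimes> inv k = \<one>" using NK by auto
  then have "conj_by n k = k" using G inv_solve_right'[of \<one> "conj_by n k" k] by simp
  then show ?thesis using conj_by_eq_iff[OF G(1,2,2)] by simp
qed

lemma normal_iff_conj_by:
  "N \<lhd> G \<longleftrightarrow> subgroup N G \<and> (\<forall>g\<in>carrier G. \<forall>x\<in>N. conj_by g x \<in> N)"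
  by (simp add: normal_inv_iff conj_by_def)

lemma fin_index_refl: "subgroup L G \<Longrightarrow> fin_index L L"
  by (rule fin_indexI[of _ _ "\<lambda>_. ()"]) (auto simp: subgroup.subset subgroup.m_closed subgroup.m_inv_closed)

lemma fin_index_restrict:
  assumes "fin_index K (carrier G)" "subgroup K G" "subgroup L G"
  shows "fin_index (K \<inter> L) L"
  using assms subgroup.subset[OF assms(3)]
  by (intro fin_index_Int fin_index_refl fin_index_sub[OF assms(1)])

lemma finite_if_trivial_Int:
  assumes "fin_index K (carrier G)" "subgroup K G" "subgroup L G" "L \<inter> K = {\<one>}"
  shows "finite L"
  using fin_index_finite[OF fin_index_restrict[OF assms(1-3)]] assms subgroup.subset[OF assms(3)]
    subgroups_Inter_pair[OF assms(2,3)] by (simp add: Int_commute)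

lemma subgroup_sub_iff:
  assumes L: "subgroup L G"
  shows "subgroup N (G\<lparr>carrier := L\<rparr>) \<longleftrightarrow> subgroup N G \<and> N \<subseteq> L"
proof
  assume N: "subgroup N (G\<lparr>carrier := L\<rparr>)"
  show "subgroup N G \<and> N \<subseteq> L" using incl_subgroup[OF L N] subgroup.subset[OF N] by simp
next
  assume "subgroup N G \<and> N \<subseteq> L"
  then show "subgroup N (G\<lparr>carrier := L\<rparr>)" using subgroup_incl[OF _ L] by blast
qed

lemma conj_by_sub:
  assumes L: "subgroup L G" and g: "g \<in> L"
  shows "group.conj_by (G\<lparr>carrier := L\<rparr>) g x = conj_by g x"
proof -
  interpret L: group "G\<lparr>carrier := L\<rparr>" by (rule subgroup_imp_group[OF L])
  show ?thesis using m_inv_consistent[OF L g] by (simp add: L.conj_by_def conj_by_def)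
qed

lemma normal_sub_iff:
  assumes L: "subgroup L G"
  shows "N \<lhd> G\<lparr>carrier := L\<rparr> \<longleftrightarrow> subgroup N G \<and> N \<subseteq> L \<and> (\<forall>g\<in>L. \<forall>x\<in>N. conj_by g x \<in> N)"
proof -
  interpret L: group "G\<lparr>carrier := L\<rparr>" by (rule subgroup_imp_group[OF L])
  show ?thesis using conj_by_sub[OF L] by (simp add: L.normal_iff_conj_by subgroup_sub_iff[OF L])
qed

end

locale hausdorff_group = topological_group +
  assumes Hausdorff: "Hausdorff_space T"
begin

lemma closedin_subset_carrier: "closedin T K \<Longrightarrow> K \<subseteq> carrier G"
  using closedin_subset topspace_eq by blast

lemma continuous_map_conj_by: "g \<in> carrier G \<Longrightarrow> continuous_map T T (conj_by g)"
  unfolding conj_by_def using topspace_eq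
  by (intro continuous_map_group_mult) (simp_all add: continuous_map_id[unfolded id_def])

lemma closedin_r_coset:
  assumes "x \<in> carrier G" "closedin T D"
  shows "closedin T (D #> x)"
proof -
  have DG: "D \<subseteq> carrier G" by (rule closedin_subset_carrier[OF assms(2)])
  have "continuous_map T T (\<lambda>v. v \<otimes> inv x)"
    using assms(1) topspace_eq
    by (intro continuous_map_group_mult) (simp_all add: continuous_map_id[unfolded id_def])
  from closedin_continuous_map_preimage[OF this assms(2)]
  have "closedin T {v \<in> carrier G. v \<otimes> inv x \<in> D}" by (simp add: topspace_eq)
  moreover have "D #> x = {v \<in> carrier G. v \<otimes> inv x \<in> D}"
  proof (intro subset_antisym subsetI)
    fix v assume "v \<in> D #> x"
    then obtain d where "d \<in> D" "v = d \<otimes> x" by (auto simp: r_coset_def)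
    then show "v \<in> {v \<in> carrier G. v \<otimes> inv x \<in> D}" using DG assms(1) by (auto simp: m_assoc)
  next
    fix v assume v: "v \<in> {v \<in> carrier G. v \<otimes> inv x \<in> D}"
    then have "v = (v \<otimes> inv x) \<otimes> x" using assms(1) by (simp add: m_assoc)
    then show "v \<in> D #> x" using v by (auto simp: r_coset_def)
  qed
  ultimately show ?thesis by simp
qed

lemma closedin_conj_set:
  assumes g: "g \<in> carrier G" and K: "closedin T K"
  shows "closedin T (conj_set g K)"
proof -
  have "closedin T {v \<in> topspace T. conj_by (inv g) v \<in> K}"
    using closedin_continuous_map_preimage[OF continuous_map_conj_by K, of "inv g"] g by simp
  moreover have "{v \<in> topspace T. conj_by (inv g) v \<in> K} = conj_set g K"
    using conj_set_iff[OF g closedin_subset_carrier[OF K]] conj_set_subset[OF g closedin_subset_carrier[OF K]]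
    by (auto simp: topspace_eq)
  ultimately show ?thesis by simp
qed

lemma closedin_core: "closedin T K \<Longrightarrow> closedin T (core K)"
  unfolding core_def using one_closed by (intro closedin_INT closedin_conj_set) auto

lemma closedin_if_finite: "finite K \<Longrightarrow> K \<subseteq> carrier G \<Longrightarrow> closedin T K"
  using Hausdorff_imp_t1_space[OF Hausdorff] t1_space_closedin_finite topspace_eq by metis

lemma closedin_centralizer: "S \<subseteq> carrier G \<Longrightarrow> closedin T (centralizer S)"
proof -
  assume S: "S \<subseteq> carrier G"
  have one: "closedin T {g \<in> carrier G. g \<otimes> s = s \<otimes> g}" if "s \<in> S" for s
  proof -
    have s: "s \<in> carrier G" using that S by blast
    have "continuous_map T T (\<lambda>g. g \<otimes> s)" "continuous_map T T (\<lambda>g. s \<otimes> g)"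
      using s topspace_eq by (intro continuous_map_group_mult, simp_all add: continuous_map_id[unfolded id_def])+
    from closedin_continuous_maps_eq[OF Hausdorff this] show ?thesis by (simp add: topspace_eq)
  qed
  show ?thesis
  proof (cases "S = {}")
    case True
    then show ?thesis using closedin_topspace[of T] by (simp add: centralizer_def topspace_eq)
  next
    case False
    have "centralizer S = (\<Inter>s\<in>S. {g \<in> carrier G. g \<otimes> s = s \<otimes> g})"
      using False by (auto simp: centralizer_def)
    then show ?thesis using one False by (simp only:) (rule closedin_INT)
  qed
qed

lemma closedin_overgroup:
  assumes N: "subgroup N G" "closedin T N" and K: "subgroup K G" "N \<subseteq> K" and fi: "fin_index N K"
  shows "closedin T K"
proof -
  have KG: "K \<subseteq> carrier G" using K(1) by (rule subgroup.subset)
  have "K = \<Union> ((\<lambda>x. N #> x) ` K)"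
  proof (intro subset_antisym subsetI)
    show "x \<in> \<Union> ((\<lambda>x. N #> x) ` K)" if "x \<in> K" for x using that rcos_self[OF _ N(1)] KG by blast
    show "y \<in> K" if "y \<in> \<Union> ((\<lambda>x. N #> x) ` K)" for y
      using that K by (auto simp: r_coset_def subgroup.m_closed)
  qed
  moreover have "closedin T (\<Union> ((\<lambda>x. N #> x) ` K))"
    using fi KG closedin_r_coset[OF _ N(2)] unfolding fin_index_def by (intro closedin_Union) auto
  ultimately show ?thesis by simp
qed

text \<open>Just infiniteness without residual finiteness. The latter is inherited by closed
  subgroups from \<open>residually_fin\<close>, and \<open>just_infinite_if_JI\<close> puts the two
  together.\<close>

definition JI :: "'a set \<Rightarrow> bool" where
  "JI L \<longleftrightarrow> infinite L \<and>
    (\<forall>N. subgroup N G \<and> N \<subseteq> L \<and> closedin T N \<and> (\<forall>g\<in>L. \<forall>x\<in>N. conj_by g x \<in> N) \<and> N \<noteq> {\<one>} \<longrightarrow> fin_index N L)"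

lemma JI_D:
  "JI L \<Longrightarrow> subgroup N G \<Longrightarrow> N \<subseteq> L \<Longrightarrow> closedin T N \<Longrightarrow> (\<And>g x. g \<in> L \<Longrightarrow> x \<in> N \<Longrightarrow> conj_by g x \<in> N) \<Longrightarrow>
    N \<noteq> {\<one>} \<Longrightarrow> fin_index N L"
  by (simp add: JI_def)

definition residually_fin :: bool where
  "residually_fin \<longleftrightarrow> (\<forall>x\<in>carrier G. x \<noteq> \<one> \<longrightarrow>
    (\<exists>N. N \<lhd> G \<and> closedin T N \<and> fin_index N (carrier G) \<and> x \<notin> N))"

lemma closed_normal_sub_iff:
  assumes L: "subgroup L G" "closedin T L"
  shows "closed_normal_subgroup N (G\<lparr>carrier := L\<rparr>) (subtopology T L) \<longleftrightarrow>
    subgroup N G \<and> N \<subseteq> L \<and> closedin T N \<and> (\<forall>g\<in>L. \<forall>x\<in>N. conj_by g x \<in> N)"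
  unfolding closed_normal_subgroup_def normal_sub_iff[OF L(1)] closedin_closed_subtopology[OF L(2)] by blast

lemma JI_if_just_infinite:
  assumes L: "subgroup L G" "closedin T L" and ji: "just_infinite (G\<lparr>carrier := L\<rparr>) (subtopology T L)"
  shows "JI L"
  using ji unfolding just_infinite_def JI_def closed_normal_sub_iff[OF L] fin_index_def
    finite_index_iff[OF subgroup.subset[OF L(1)]] by simp

lemma just_infinite_if_JI:
  assumes L: "subgroup L G" "closedin T L" and ji: "JI L" and rf: residually_fin
  shows "just_infinite (G\<lparr>carrier := L\<rparr>) (subtopology T L)"
proof -
  have LG: "L \<subseteq> carrier G" using L(1) by (rule subgroup.subset)
  let ?F = "{N. closed_normal_subgroup N (G\<lparr>carrier := L\<rparr>) (subtopology T L) \<and> finite_index N (G\<lparr>carrier := L\<rparr>)}"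
  have F: "N \<in> ?F \<longleftrightarrow> subgroup N G \<and> N \<subseteq> L \<and> closedin T N \<and> (\<forall>g\<in>L. \<forall>x\<in>N. conj_by g x \<in> N) \<and> fin_index N L" for N
    unfolding mem_Collect_eq closed_normal_sub_iff[OF L] fin_index_def finite_index_iff[OF LG] by blast
  have LF: "L \<in> ?F"
    unfolding F using L fin_index_refl[OF L(1)] by (auto simp: conj_by_def subgroup.m_closed subgroup.m_inv_closed)
  have "\<Inter> ?F = {\<one>}"
  proof (intro subset_antisym subsetI)
    fix x assume x: "x \<in> \<Inter> ?F"
    have xL: "x \<in> L" using x LF by blast
    show "x \<in> {\<one>}"
    proof (rule ccontr)
      assume "x \<notin> {\<one>}"
      then obtain N where N: "N \<lhd> G" "closedin T N" "fin_index N (carrier G)" "x \<notin> N"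
        using rf xL LG unfolding residually_fin_def by blast
      have sN: "subgroup N G" by (rule normal_imp_subgroup[OF N(1)])
      have conjN: "conj_by g x \<in> N \<inter> L" if "g \<in> L" "x \<in> N \<inter> L" for g x
      proof -
        have "conj_by g x \<in> N" using N(1) that LG unfolding normal_iff_conj_by by blast
        moreover have "conj_by g x \<in> L"
          using that L(1) by (simp add: conj_by_def subgroup.m_closed subgroup.m_inv_closed)
        ultimately show ?thesis by blast
      qed
      have "N \<inter> L \<in> ?F"
        unfolding F using N L LG fin_index_restrict[OF N(3) sN L(1)] subgroups_Inter_pair[OF sN L(1)]
        closedin_Int[OF N(2) L(2)] conjN by blast
      then show False using x N(4) by blast
    qed
  next
    fix x assume "x \<in> {\<one>}"
    then show "x \<in> \<Inter> ?F" using F by (auto intro: subgroup.one_closed)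
  qed
  then have "residually_finite (G\<lparr>carrier := L\<rparr>) (subtopology T L)" by (simp add: residually_finite_def)
  then show ?thesis
    using ji unfolding just_infinite_def JI_def closed_normal_sub_iff[OF L] fin_index_def
      finite_index_iff[OF LG] by simp
qed

definition max_fin :: "'a set \<Rightarrow> bool" where
  "max_fin M \<longleftrightarrow> maximal_subgroup M G T \<and> fin_index M (carrier G)"

lemma max_fin_D:
  assumes "max_fin M"
  shows "subgroup M G" "closedin T M" "M \<noteq> carrier G" "fin_index M (carrier G)"
  using assms by (auto simp: max_fin_def maximal_subgroup_def closed_subgroup_def)

text \<open>Subgroups above \<open>K\<close> are unions of its finitely many cosets, so there are
  only finitely many of them, and all are closed by \<open>closedin_overgroup\<close>.\<close>

lemma ex_max_fin:
  assumes K: "subgroup K G" "closedin T K" "fin_index K (carrier G)" "K \<noteq> carrier G"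
  obtains M where "max_fin M" "K \<subseteq> M"
proof -
  define F where "F = {M. subgroup M G \<and> K \<subseteq> M \<and> M \<noteq> carrier G}"
  have "M = \<Union> ((\<lambda>x. K #> x) ` M)" if M: "M \<in> F" for M
  proof (intro subset_antisym subsetI)
    have MG: "M \<subseteq> carrier G" using M subgroup.subset by (auto simp: F_def)
    show "x \<in> \<Union> ((\<lambda>x. K #> x) ` M)" if "x \<in> M" for x using that rcos_self[OF _ K(1)] MG by blast
    show "y \<in> M" if "y \<in> \<Union> ((\<lambda>x. K #> x) ` M)" for y
      using that M by (auto simp: F_def r_coset_def intro: subgroup.m_closed)
  qed
  moreover have "(\<lambda>x. K #> x) ` M \<in> Pow ((\<lambda>x. K #> x) ` carrier G)" if "M \<in> F" for M
    using that subgroup.subset[of M G] unfolding F_def by blast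
  ultimately have "F \<subseteq> Union ` Pow ((\<lambda>x. K #> x) ` carrier G)" by (intro subsetI image_eqI)
  then have "finite F" using K(3) unfolding fin_index_def by (intro finite_subset[of F "Union ` Pow ((\<lambda>x. K #> x) ` carrier G)"]) simp_all
  moreover have "K \<in> F" using K by (simp add: F_def)
  ultimately obtain M where M: "M \<in> F" "K \<subseteq> M" "\<And>M'. M' \<in> F \<Longrightarrow> M \<subseteq> M' \<Longrightarrow> M = M'"
    using finite_has_maximal2[of F K] by blast
  have sM: "subgroup M G" using M(1) by (simp add: F_def)
  have fiM: "fin_index M (carrier G)" by (rule fin_index_mono[OF K(3,1) sM M(2) subset_refl])
  have "closedin T M"
    by (rule closedin_overgroup[OF K(1,2) sM M(2) fin_index_sub[OF K(3) subgroup.subset[OF sM]]])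
  then have "max_fin M"
    unfolding max_fin_def maximal_subgroup_def closed_subgroup_def
    using M sM fiM unfolding F_def by blast
  then show ?thesis using M(2) that by blast
qed

text \<open>It suffices to find a maximal \<open>M\<close> of finite index with
  \<open>N \<inter> M\<close> nontrivial. An infinite \<open>N\<close> meets every such
  \<open>M\<close> nontrivially; a finite one is placed inside some \<open>M\<close>.\<close>

lemma JI_carrier_if_max_fin:
  assumes rf: residually_fin and inf: "infinite (carrier G)" and max: "\<And>M. max_fin M \<Longrightarrow> JI M"
  shows "JI (carrier G)"
  unfolding JI_def
proof (intro conjI allI impI inf)
  fix N assume "subgroup N G \<and> N \<subseteq> carrier G \<and> closedin T N \<and> (\<forall>g\<in>carrier G. \<forall>x\<in>N. conj_by g x \<in> N) \<and> N \<noteq> {\<one>}"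
  then have N: "subgroup N G" "closedin T N" "\<And>g x. g \<in> carrier G \<Longrightarrow> x \<in> N \<Longrightarrow> conj_by g x \<in> N" "N \<noteq> {\<one>}"
    by auto
  have NG: "N \<subseteq> carrier G" using N(1) by (rule subgroup.subset)
  have key: "fin_index N (carrier G)" if M: "max_fin M" and NM: "N \<inter> M \<noteq> {\<one>}" for M
  proof -
    note MD = max_fin_D[OF M]
    have MG: "M \<subseteq> carrier G" using MD(1) by (rule subgroup.subset)
    have sNM: "subgroup (N \<inter> M) G" by (rule subgroups_Inter_pair[OF N(1) MD(1)])
    have "fin_index (N \<inter> M) M"
    proof (rule JI_D[OF max[OF M] sNM])
      show "closedin T (N \<inter> M)" using N(2) MD(2) by (rule closedin_Int)
      show "conj_by g x \<in> N \<inter> M" if "g \<in> M" "x \<in> N \<inter> M" for g x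
        using that N(3)[of g x] MG MD(1) by (auto simp: conj_by_def subgroup.m_closed subgroup.m_inv_closed)
    qed (use NM in auto)
    then have "fin_index (N \<inter> M) (carrier G)" by (rule fin_index_trans[OF _ MD(4) sNM MD(1) subgroup_self])
    then show ?thesis by (rule fin_index_mono[OF _ sNM N(1) Int_lower1 subset_refl])
  qed
  obtain y where y: "y \<in> N" "y \<noteq> \<one>" using N(4) subgroup.one_closed[OF N(1)] by blast
  have yG: "y \<in> carrier G" using y NG by blast
  show "fin_index N (carrier G)"
  proof (cases "finite N")
    case False
    have "carrier G \<noteq> {\<one>}" using inf by auto
    then obtain x where "x \<in> carrier G" "x \<noteq> \<one>" using one_closed by blast
    then obtain Q where Q: "Q \<lhd> G" "closedin T Q" "fin_index Q (carrier G)" "x \<notin> Q"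
      using rf unfolding residually_fin_def by blast
    have sQ: "subgroup Q G" by (rule normal_imp_subgroup[OF Q(1)])
    have "Q \<noteq> carrier G" using Q(4) \<open>x \<in> carrier G\<close> by blast
    then obtain M where M: "max_fin M" by (rule ex_max_fin[OF sQ Q(2,3)])
    have "N \<inter> M \<noteq> {\<one>}"
    proof
      assume "N \<inter> M = {\<one>}"
      then have "finite N" by (rule finite_if_trivial_Int[OF max_fin_D(4,1)[OF M] N(1)])
      then show False using False by simp
    qed
    then show ?thesis by (rule key[OF M])
  next
    case True
    \<comment> \<open>For finite \<open>N\<close>, residual finiteness gives a normal subgroup
      \<open>R\<close> of finite index that contains none of the elements
      \<open>h \<otimes> inv n\<close>. Then \<open>h\<close> is not in \<open>R N\<close>, so
      \<open>R N\<close> is proper.\<close>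
    obtain h where h: "h \<in> carrier G" "h \<notin> N" using inf True finite_subset[of "carrier G" N] by blast
    have ex: "\<forall>n\<in>N. \<exists>Q. Q \<lhd> G \<and> closedin T Q \<and> fin_index Q (carrier G) \<and> h \<otimes> inv n \<notin> Q"
    proof
      fix n assume n: "n \<in> N"
      then have nG: "n \<in> carrier G" using NG by blast
      have "h \<otimes> inv n \<noteq> \<one>"
      proof
        assume "h \<otimes> inv n = \<one>"
        then have "h = n" using inv_solve_right'[of \<one> h n] h(1) nG by simp
        then show False using h(2) n by simp
      qed
      then show "\<exists>Q. Q \<lhd> G \<and> closedin T Q \<and> fin_index Q (carrier G) \<and> h \<otimes> inv n \<notin> Q"
        using rf h(1) nG unfolding residually_fin_def by simp
    qed
    then obtain Q where Q: "\<And>n. n \<in> N \<Longrightarrow> Q n \<lhd> G \<and> closedin T (Q n) \<and> fin_index (Q n) (carrier G) \<and> h \<otimes> inv n \<notin> Q n"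
      by metis
    define R where "R = (\<Inter>n\<in>N. Q n)"
    have R: "subgroup (\<Inter>n\<in>S. Q n) G \<and> closedin T (\<Inter>n\<in>S. Q n) \<and> fin_index (\<Inter>n\<in>S. Q n) (carrier G) \<and> (\<Inter>n\<in>S. Q n) \<lhd> G"
      if "finite S" "S \<noteq> {}" "S \<subseteq> N" for S
      using that
    proof (induction rule: finite_ne_induct)
      case (singleton n)
      then show ?case using Q[of n] normal_imp_subgroup[of "Q n" G] by simp
    next
      case (insert n S)
      then have n: "Q n \<lhd> G" "closedin T (Q n)" "fin_index (Q n) (carrier G)" and S: "subgroup (\<Inter>n\<in>S. Q n) G"
        "closedin T (\<Inter>n\<in>S. Q n)" "fin_index (\<Inter>n\<in>S. Q n) (carrier G)" "(\<Inter>n\<in>S. Q n) \<lhd> G"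
        using Q by auto
      have eq: "(\<Inter>n\<in>insert n S. Q n) = Q n \<inter> (\<Inter>n\<in>S. Q n)" by simp
      have s: "subgroup (Q n \<inter> (\<Inter>n\<in>S. Q n)) G"
        by (rule subgroups_Inter_pair[OF normal_imp_subgroup[OF n(1)] S(1)])
      have "Q n \<inter> (\<Inter>n\<in>S. Q n) \<lhd> G"
        using s n(1) S(4) unfolding normal_iff_conj_by by blast
      then show ?case unfolding eq
        using s closedin_Int[OF n(2) S(2)] fin_index_Int[OF n(3) S(3) normal_imp_subgroup[OF n(1)] S(1)] by simp
    qed
    have N0: "N \<noteq> {}" using y by blast
    have RR: "subgroup R G" "closedin T R" "fin_index R (carrier G)" "R \<lhd> G"
      using R[OF True N0 subset_refl] unfolding R_def by auto
    have RG: "R \<subseteq> carrier G" using RR(1) by (rule subgroup.subset)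
    define K where "K = {r \<otimes> n | r n. r \<in> R \<and> n \<in> N}"
    have sK: "subgroup K G"
    proof (rule subgroupI)
      show "K \<subseteq> carrier G" using RG NG by (auto simp: K_def)
      show "K \<noteq> {}" using N0 subgroup.one_closed[OF RR(1)] by (auto simp: K_def)
    next
      fix k assume "k \<in> K"
      then obtain r n where rn: "r \<in> R" "n \<in> N" "k = r \<otimes> n" by (auto simp: K_def)
      have cl: "r \<in> carrier G" "n \<in> carrier G" using rn RG NG by auto
      have "inv k = conj_by (inv n) (inv r) \<otimes> inv n"
        using cl by (simp add: rn(3) inv_mult_group conj_by_def m_assoc)
      moreover have "conj_by (inv n) (inv r) \<in> R" "inv n \<in> N"
        using RR(4) rn cl subgroup.m_inv_closed[OF RR(1) rn(1)] subgroup.m_inv_closed[OF N(1) rn(2)]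
        unfolding normal_iff_conj_by by simp_all
      ultimately show "inv k \<in> K" unfolding K_def by blast
    next
      fix k k' assume "k \<in> K" "k' \<in> K"
      then obtain r n r' n' where rn: "r \<in> R" "n \<in> N" "k = r \<otimes> n" "r' \<in> R" "n' \<in> N" "k' = r' \<otimes> n'"
        by (auto simp: K_def)
      have cl: "r \<in> carrier G" "n \<in> carrier G" "r' \<in> carrier G" "n' \<in> carrier G" using rn RG NG by auto
      have "k \<otimes> k' = (r \<otimes> conj_by n r') \<otimes> (n \<otimes> n')"
        using cl by (simp add: rn conj_by_def m_assoc) (simp add: m_assoc[symmetric])
      moreover have "r \<otimes> conj_by n r' \<in> R" "n \<otimes> n' \<in> N"
        using RR(1,4) N(1) rn cl unfolding normal_iff_conj_by by (simp_all add: subgroup.m_closed)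
      ultimately show "k \<otimes> k' \<in> K" unfolding K_def by blast
    qed
    have RK: "R \<subseteq> K"
    proof
      fix r assume r: "r \<in> R"
      then have "r = r \<otimes> \<one>" using RG by auto
      then show "r \<in> K" using r subgroup.one_closed[OF N(1)] unfolding K_def by blast
    qed
    have hK: "h \<notin> K"
    proof
      assume "h \<in> K"
      then obtain r n where rn: "r \<in> R" "n \<in> N" "h = r \<otimes> n" by (auto simp: K_def)
      moreover have "r \<in> carrier G" "n \<in> carrier G" using rn RG NG by auto
      ultimately have "h \<otimes> inv n = r" by (simp add: m_assoc)
      moreover have "r \<in> Q n" using rn by (auto simp: R_def)
      ultimately show False using Q[OF rn(2)] by simp
    qed
    have yK: "y \<in> K"
    proof -
      have "y = \<one> \<otimes> y" using yG by simp
      then show ?thesis using y(1) subgroup.one_closed[OF RR(1)] unfolding K_def by blast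
    qed
    have fiK: "fin_index K (carrier G)" by (rule fin_index_mono[OF RR(3,1) sK RK subset_refl])
    have cK: "closedin T K"
      by (rule closedin_overgroup[OF RR(1,2) sK RK fin_index_sub[OF RR(3) subgroup.subset[OF sK]]])
    obtain M where M: "max_fin M" "K \<subseteq> M" by (rule ex_max_fin[OF sK cK fiK]) (use hK h in blast)+
    have "N \<inter> M \<noteq> {\<one>}" using y yK M(2) by blast
    then show ?thesis by (rule key[OF M(1)])
  qed
qed

end

section \<open>Just infinite groups without abelian normal subgroups\<close>

locale ji_nonabelian = hausdorff_group +
  assumes ji: "JI (carrier G)"
    and no_abelian: "N \<lhd> G \<Longrightarrow> closedin T N \<Longrightarrow> (\<And>x y. x \<in> N \<Longrightarrow> y \<in> N \<Longrightarrow> x \<otimes> y = y \<otimes> x) \<Longrightarrow> N = {\<one>}"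
begin

lemma infinite_carrier: "infinite (carrier G)"
  using ji by (simp add: JI_def)

text \<open>The centraliser of the normal core of \<open>R\<close> meets that core in an abelian
  normal subgroup, hence trivially. So it is finite, and just infiniteness makes it trivial.\<close>

lemma centralizer_fin_index_trivial:
  assumes R: "subgroup R G" "closedin T R" "fin_index R (carrier G)"
  shows "centralizer R = {\<one>}"
proof -
  have RG: "R \<subseteq> carrier G" using R(1) by (rule subgroup.subset)
  define D where "D = centralizer (core R)"
  have cR: "core R \<lhd> G" "closedin T (core R)" "fin_index (core R) (carrier G)" "core R \<subseteq> R"
    using core_normal[OF R(1)] closedin_core[OF R(2)] fin_index_core[OF R(1,3)] core_subset[OF RG] by auto
  have scR: "subgroup (core R) G" by (rule normal_imp_subgroup[OF cR(1)])
  have cRG: "core R \<subseteq> carrier G" using scR by (rule subgroup.subset)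
  have sD: "subgroup D G" unfolding D_def by (rule subgroup_centralizer[OF cRG])
  have cD: "closedin T D" unfolding D_def by (rule closedin_centralizer[OF cRG])
  have nD: "conj_by g d \<in> D" if "g \<in> carrier G" "d \<in> D" for g d
    unfolding D_def
    using that cR(1) by (intro conj_by_centralizer[OF cRG]) (simp_all add: normal_iff_conj_by D_def)
  have "D \<inter> core R = {\<one>}"
  proof (rule no_abelian)
    show "D \<inter> core R \<lhd> G"
      using subgroups_Inter_pair[OF sD scR] nD cR(1) by (auto simp: normal_iff_conj_by)
    show "closedin T (D \<inter> core R)" using cD cR(2) by (rule closedin_Int)
    show "x \<otimes> y = y \<otimes> x" if "x \<in> D \<inter> core R" "y \<in> D \<inter> core R" for x y
      using that unfolding D_def centralizer_def by blast
  qed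
  then have fD: "finite D" by (rule finite_if_trivial_Int[OF cR(3) scR sD])
  have "D = {\<one>}"
  proof (rule ccontr)
    assume "D \<noteq> {\<one>}"
    then have "fin_index D (carrier G)"
      using JI_D[OF ji sD subgroup.subset[OF sD] cD] nD by blast
    then show False using fin_index_finite[OF _ fD sD subset_refl] infinite_carrier by blast
  qed
  moreover have "centralizer R \<subseteq> D" using cR(4) unfolding D_def centralizer_def by blast
  ultimately show ?thesis using subgroup.one_closed[OF subgroup_centralizer[OF RG]] by blast
qed

lemma JI_fin_index:
  assumes max: "\<And>M. max_fin M \<Longrightarrow> JI M"
    and K: "subgroup K G" "closedin T K" "fin_index K (carrier G)"
  shows "JI K"
  unfolding JI_def
proof (intro conjI allI impI)
  have KG: "K \<subseteq> carrier G" using K(1) by (rule subgroup.subset)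
  show "infinite K" using fin_index_finite[OF K(3) _ K(1) subset_refl] infinite_carrier by blast
  fix N assume "subgroup N G \<and> N \<subseteq> K \<and> closedin T N \<and> (\<forall>g\<in>K. \<forall>x\<in>N. conj_by g x \<in> N) \<and> N \<noteq> {\<one>}"
  then have N: "subgroup N G" "N \<subseteq> K" "closedin T N" "\<And>g x. g \<in> K \<Longrightarrow> x \<in> N \<Longrightarrow> conj_by g x \<in> N" "N \<noteq> {\<one>}"
    by auto
  have NG: "N \<subseteq> carrier G" using N(2) KG by blast
  show "fin_index N K"
  proof (rule ccontr)
    assume nfi: "\<not> fin_index N K"
    \<comment> \<open>Passing to the normal core of \<open>K\<close> places all conjugates of
      \<open>N0\<close> in a subgroup that normalises each of them.\<close>
    define K0 where "K0 = core K"
    have K0: "K0 \<lhd> G" "closedin T K0" "fin_index K0 (carrier G)" "K0 \<subseteq> K" "subgroup K0 G"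
      unfolding K0_def using core_normal[OF K(1)] closedin_core[OF K(2)] fin_index_core[OF K(1,3)] core_subset[OF KG]
        normal_imp_subgroup by auto
    have K0G: "K0 \<subseteq> carrier G" using K0(5) by (rule subgroup.subset)
    have nK0: "conj_by g x \<in> K0" if "g \<in> carrier G" "x \<in> K0" for g x
      using that K0(1) by (simp add: normal_iff_conj_by)
    define N0 where "N0 = N \<inter> K0"
    have sN0: "subgroup N0 G" unfolding N0_def by (rule subgroups_Inter_pair[OF N(1) K0(5)])
    have cN0: "closedin T N0" unfolding N0_def using N(3) K0(2) by (rule closedin_Int)
    have nN0: "conj_by k x \<in> N0" if "k \<in> K0" "x \<in> N0" for k x
      using that N(4)[of k x] nK0[of k x] K0(4) K0G by (auto simp: N0_def)
    have N0G: "N0 \<subseteq> carrier G" and N0K0: "N0 \<subseteq> K0" using NG by (auto simp: N0_def)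
    have N0_1: "N0 \<noteq> {\<one>}"
    proof
      assume triv: "N0 = {\<one>}"
      have "N \<subseteq> centralizer K0"
      proof
        fix n assume n: "n \<in> N"
        have "n \<otimes> k = k \<otimes> n" if k: "k \<in> K0" for k
        proof (rule commute_if_disjoint[OF N(1) K0(5) triv[unfolded N0_def] _ _ n k])
          show "conj_by k n \<in> N" if "k \<in> K0" "n \<in> N" for k n using that N(4) K0(4) by blast
          show "conj_by n k \<in> K0" if "k \<in> K0" "n \<in> N" for k n using that nK0 NG by blast
        qed
        then show "n \<in> centralizer K0" using n NG unfolding centralizer_def by blast
      qed
      then show False
        using centralizer_fin_index_trivial[OF K0(5,2,3)] N(5) subgroup.one_closed[OF N(1)] by blast
    qed
    define \<Omega> where "\<Omega> = (\<lambda>g. conj_set g N0) ` carrier G"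
    have stab_N0: "conj_set k N0 = N0" if k: "k \<in> K0" for k
    proof -
      have le: "conj_set k N0 \<subseteq> N0" if "k \<in> K0" for k using nN0 that by (auto simp: conj_set_def)
      have kG: "k \<in> carrier G" using k K0G by blast
      have "N0 = conj_set k (conj_set (inv k) N0)" using kG N0G by (simp add: conj_set_conj_set conj_set_one)
      also have "\<dots> \<subseteq> conj_set k N0"
        using le[OF subgroup.m_inv_closed[OF K0(5) k]] by (simp add: conj_set_def image_mono)
      finally show ?thesis using le[OF k] by blast
    qed
    have fin\<Omega>: "finite \<Omega>" unfolding \<Omega>_def by (rule finite_conj_sets[OF K0(5,3) N0G stab_N0])
    \<comment> \<open>Families of conjugates with nontrivial intersection; \<open>B\<close> will be
      the intersection of a family with the most members.\<close>
    define F where "F = {S. S \<subseteq> \<Omega> \<and> S \<noteq> {} \<and> \<Inter>S \<noteq> {\<one>}}"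
    have "F \<subseteq> Pow \<Omega>" by (auto simp: F_def)
    then have finF: "finite F" using fin\<Omega> finite_subset by blast
    have "conj_set \<one> N0 \<in> \<Omega>" unfolding \<Omega>_def using one_closed by blast
    then have "{N0} \<in> F" using N0_1 conj_set_one[OF N0G] by (simp add: F_def)
    then have "Max (card ` F) \<in> card ` F" using finF by (intro Max_in) auto
    then obtain S where S: "S \<in> F" "card S = Max (card ` F)" by auto
    have Smax: "card S' \<le> card S" if "S' \<in> F" for S' using that finF unfolding S(2) by (intro Max_ge) auto
    have S\<Omega>: "S \<subseteq> \<Omega>" "S \<noteq> {}" using S(1) by (auto simp: F_def)
    have finS: "finite S" using S\<Omega>(1) fin\<Omega> by (rule finite_subset)
    define B where "B = \<Inter>S"
    have \<Omega>D: "subgroup C G \<and> closedin T C \<and> C \<subseteq> K0 \<and> (\<forall>k\<in>K0. conj_set k C = C)" if C: "C \<in> \<Omega>" for C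
    proof -
      obtain g where g: "g \<in> carrier G" "C = conj_set g N0" using C by (auto simp: \<Omega>_def)
      have "conj_set k C = C" if k: "k \<in> K0" for k
      proof -
        have kG: "k \<in> carrier G" using k K0G by blast
        have "conj_set k C = conj_set (g \<otimes> conj_by (inv g) k) N0"
          unfolding g(2) using g(1) kG N0G by (subst conj_set_conj_set) (simp_all add: conj_by_def m_assoc[symmetric])
        also have "\<dots> = conj_set g (conj_set (conj_by (inv g) k) N0)"
          using g(1) kG N0G by (intro conj_set_conj_set[symmetric]) simp_all
        also have "\<dots> = C" unfolding g(2) using stab_N0 nK0[of "inv g" k] g(1) k by simp
        finally show ?thesis .
      qed
      then show ?thesis
        using subgroup_conj_set[OF g(1) sN0] closedin_conj_set[OF g(1) cN0] nK0[OF g(1)] N0K0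
        unfolding g(2) by (auto simp: conj_set_def)
    qed
    have sB: "subgroup B G" unfolding B_def using S\<Omega> \<Omega>D by (intro subgroups_Inter) auto
    have cB: "closedin T B" unfolding B_def using S\<Omega> \<Omega>D by (intro closedin_Inter) auto
    have BK0: "B \<subseteq> K0" unfolding B_def using S\<Omega> \<Omega>D by blast
    have BG: "B \<subseteq> carrier G" using BK0 K0G by blast
    have B1: "B \<noteq> {\<one>}" using S(1) by (simp add: F_def B_def)
    have SG: "C \<subseteq> carrier G" if "C \<in> S" for C using that S\<Omega>(1) \<Omega>D K0G by blast
    have conjB: "conj_set g B = \<Inter> (conj_set g ` S)" if g: "g \<in> carrier G" for g
    proof (intro subset_antisym subsetI)
      show "x \<in> \<Inter> (conj_set g ` S)" if "x \<in> conj_set g B" for x using that by (auto simp: conj_set_def B_def)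
      fix x assume x: "x \<in> \<Inter> (conj_set g ` S)"
      obtain C where C: "C \<in> S" using S\<Omega>(2) by blast
      then have "x \<in> conj_set g C" using x by blast
      then have xG: "x \<in> carrier G" using conj_set_subset[OF g SG[OF C]] by blast
      have "conj_by (inv g) x \<in> C" if "C \<in> S" for C
        using x that conj_set_iff[OF g SG[OF that] xG] by blast
      then show "x \<in> conj_set g B" using conj_set_iff[OF g BG xG] by (simp add: B_def)
    qed
    \<comment> \<open>If \<open>B\<close> meets its conjugate by \<open>g\<close>, the union of the
      two families still has nontrivial intersection. By maximality of the cardinality the families
      coincide.\<close>
    have dich: "conj_set g B = B" if g: "g \<in> carrier G" and meet: "conj_set g B \<inter> B \<noteq> {\<one>}" for g
    proof -
      let ?S' = "conj_set g ` S"
      have "?S' \<subseteq> \<Omega>"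
      proof
        fix C assume "C \<in> ?S'"
        then obtain h where h: "h \<in> carrier G" "C = conj_set g (conj_set h N0)" using S\<Omega>(1) by (auto simp: \<Omega>_def)
        then have "C = conj_set (g \<otimes> h) N0" using g N0G by (simp add: conj_set_conj_set)
        then show "C \<in> \<Omega>" unfolding \<Omega>_def using g h(1) by blast
      qed
      moreover have "\<Inter>(S \<union> ?S') = conj_set g B \<inter> B" 
        unfolding conjB[OF g] Inter_Un_distrib by (simp only: B_def Int_commute)
      ultimately have "S \<union> ?S' \<in> F" using S\<Omega> meet unfolding F_def by simp
      then have "card (S \<union> ?S') \<le> card S" by (rule Smax)
      then have "S = S \<union> ?S'" using finS by (intro card_seteq) auto
      then have sub: "?S' \<subseteq> S" by blast
      have "inj_on (conj_set g) S"
      proof (rule inj_onI)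
        fix C C' assume C: "C \<in> S" "C' \<in> S" "conj_set g C = conj_set g C'"
        then have "conj_set (inv g) (conj_set g C) = conj_set (inv g) (conj_set g C')" by simp
        moreover have "conj_set (inv g) (conj_set g D) = D" if "D \<in> S" for D
          using g SG[OF that] by (simp add: conj_set_conj_set conj_set_one)
        ultimately show "C = C'" using C(1,2) by simp
      qed
      then have "card ?S' = card S" by (rule card_image)
      then have "?S' = S" using sub finS by (intro card_subset_eq) auto
      then show ?thesis unfolding conjB[OF g] by (simp add: B_def)
    qed
    define L where "L = {g \<in> carrier G. conj_set g B = B}"
    have sL: "subgroup L G"
    proof (rule subgroupI)
      show "L \<subseteq> carrier G" by (auto simp: L_def)
      show "L \<noteq> {}" using conj_set_one[OF BG] by (auto simp: L_def)
      show "g \<otimes> h \<in> L" if "g \<in> L" "h \<in> L" for g h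
        using that BG by (simp add: L_def conj_set_conj_set[symmetric])
      fix g assume "g \<in> L"
      then have g: "g \<in> carrier G" "conj_set g B = B" by (auto simp: L_def)
      have "conj_set (inv g) (conj_set g B) = B" using g(1) BG by (simp add: conj_set_conj_set conj_set_one)
      then show "inv g \<in> L" using g by (simp add: L_def)
    qed
    have K0B: "conj_set k B = B" if k: "k \<in> K0" for k
    proof -
      have kG: "k \<in> carrier G" using k K0G by blast
      have "conj_set k C = C" if "C \<in> S" for C using that \<Omega>D S\<Omega>(1) k by blast
      then have "conj_set k ` S = S" by simp
      then show ?thesis unfolding conjB[OF kG] by (simp add: B_def)
    qed
    have K0L: "K0 \<subseteq> L" using K0B K0G by (auto simp: L_def)
    have fiL: "fin_index L (carrier G)" by (rule fin_index_mono[OF K0(3,5) sL K0L subset_refl])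
    have cL: "closedin T L"
      by (rule closedin_overgroup[OF K0(5,2) sL K0L fin_index_sub[OF K0(3) subgroup.subset[OF sL]]])
    \<comment> \<open>Otherwise \<open>B\<close> is normal in \<open>G\<close>, hence of finite
      index. It lies in a conjugate of \<open>N0\<close> and, being invariant, in \<open>N0\<close>
      itself, so \<open>N\<close> would have finite index.\<close>
    have "L \<noteq> carrier G"
    proof
      assume eq: "L = carrier G"
      have "conj_by g x \<in> B" if "g \<in> carrier G" "x \<in> B" for g x
        using that eq unfolding L_def conj_set_def by blast
      then have fiB: "fin_index B (carrier G)" by (intro JI_D[OF ji sB BG cB _ B1])
      obtain g where g: "g \<in> carrier G" "conj_set g N0 \<in> S" using S\<Omega> by (auto simp: \<Omega>_def)
      have "B = conj_set (inv g) B" using g(1) eq inv_closed[OF g(1)] unfolding L_def by blast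
      also have "\<dots> \<subseteq> conj_set (inv g) (conj_set g N0)" using g(2) by (auto simp: conj_set_def B_def)
      also have "\<dots> = N0" using g(1) N0G by (simp add: conj_set_conj_set conj_set_one)
      finally have BN: "B \<subseteq> N" by (simp add: N0_def)
      have "fin_index N (carrier G)" by (rule fin_index_mono[OF fiB sB N(1) BN subset_refl])
      then show False using nfi fin_index_sub[OF _ KG] by blast
    qed
    then obtain M where M: "max_fin M" "L \<subseteq> M" by (rule ex_max_fin[OF sL cL fiL])
    note MD = max_fin_D[OF M(1)]
    have MG: "M \<subseteq> carrier G" using MD(1) by (rule subgroup.subset)
    obtain g where g: "g \<in> carrier G" "g \<notin> M" using MD(3) MG by blast
    \<comment> \<open>\<open>R\<close> is the part of \<open>M\<close> that centralises all
      \<open>M\<close>-conjugates of \<open>B\<close>. It is normal in \<open>M\<close> and will be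
      seen to contain the conjugate of \<open>B\<close> by \<open>g\<close>.\<close>
    define U where "U = (\<Union>m\<in>M. conj_set m B)"
    have UG: "U \<subseteq> carrier G" unfolding U_def using conj_set_subset[OF _ BG] MG by blast
    define R where "R = M \<inter> centralizer U"
    have sR: "subgroup R G" unfolding R_def by (rule subgroups_Inter_pair[OF MD(1) subgroup_centralizer[OF UG]])
    have cR: "closedin T R" unfolding R_def using MD(2) closedin_centralizer[OF UG] by (rule closedin_Int)
    have nR: "conj_by m r \<in> R" if m: "m \<in> M" and r: "r \<in> R" for m r
    proof -
      have mG: "m \<in> carrier G" using m MG by blast
      have "conj_by (inv m) s \<in> U" if s: "s \<in> U" for s
      proof -
        obtain m' where m': "m' \<in> M" "s \<in> conj_set m' B" using s by (auto simp: U_def)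
        then have "conj_by (inv m) s \<in> conj_set (inv m) (conj_set m' B)" by (auto simp: conj_set_def)
        also have "\<dots> = conj_set (inv m \<otimes> m') B" using mG m' MG BG by (intro conj_set_conj_set) auto
        finally show ?thesis
          unfolding U_def using subgroup.m_closed[OF MD(1) subgroup.m_inv_closed[OF MD(1) m] m'(1)] by blast
      qed
      then have "conj_by m r \<in> centralizer U" using r by (intro conj_by_centralizer[OF UG mG]) (auto simp: R_def)
      moreover have "conj_by m r \<in> M"
        using m r MD(1) by (simp add: R_def conj_by_def subgroup.m_closed subgroup.m_inv_closed)
      ultimately show ?thesis by (simp add: R_def)
    qed
    have nconj: "conj_by k x \<in> conj_set h B" if k: "k \<in> K0" and h: "h \<in> carrier G" and x: "x \<in> conj_set h B" for k h x
    proof -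
      obtain y where y: "y \<in> B" "x = conj_by h y" using x by (auto simp: conj_set_def)
      have kG: "k \<in> carrier G" and yG: "y \<in> carrier G" using k K0G y BG by auto
      have "conj_by k x = conj_by h (conj_by (conj_by (inv h) k) y)"
        unfolding y(2) using kG yG h by (simp add: conj_by_conj_by) (simp add: conj_by_def m_assoc[symmetric])
      moreover have "conj_by (conj_by (inv h) k) y \<in> B"
        using K0B[OF nK0[OF inv_closed[OF h] k]] y(1) unfolding conj_set_def by blast
      ultimately show ?thesis by (auto simp: conj_set_def)
    qed
    have subK0: "conj_set h B \<subseteq> K0" if "h \<in> carrier G" for h using that BK0 nK0 by (auto simp: conj_set_def)
    have gR: "conj_set g B \<subseteq> R"
    proof
      fix y assume y: "y \<in> conj_set g B"
      have "y \<otimes> s = s \<otimes> y" if s: "s \<in> U" for s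
      proof -
        obtain m where m: "m \<in> M" "s \<in> conj_set m B" using s by (auto simp: U_def)
        have mG: "m \<in> carrier G" using m MG by blast
        \<comment> \<open>A nontrivial common element would put \<open>inv m \<otimes> g\<close>
          into the normaliser \<open>L\<close> of \<open>B\<close>, and therefore \<open>g\<close>
          into \<open>M\<close>.\<close>
        have "conj_set g B \<inter> conj_set m B = {\<one>}"
        proof (rule ccontr)
          assume "conj_set g B \<inter> conj_set m B \<noteq> {\<one>}"
          moreover have "\<one> \<in> conj_set g B \<inter> conj_set m B"
            using subgroup.one_closed[OF subgroup_conj_set[OF g(1) sB]] subgroup.one_closed[OF subgroup_conj_set[OF mG sB]] by blast
          ultimately obtain x where x: "x \<in> conj_set g B" "x \<in> conj_set m B" "x \<noteq> \<one>" by blast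
          have xG: "x \<in> carrier G" using x(1) conj_set_subset[OF g(1) BG] by blast
          have "conj_by (inv m) x \<in> conj_set (inv m) (conj_set g B)" using x(1) by (auto simp: conj_set_def)
          then have "conj_by (inv m) x \<in> conj_set (inv m \<otimes> g) B" using mG g(1) BG by (simp add: conj_set_conj_set)
          moreover have "conj_by (inv m) x \<in> B" using x(2) conj_set_iff[OF mG BG xG] by blast
          moreover have "conj_by (inv m) x \<noteq> \<one>"
          proof
            assume "conj_by (inv m) x = \<one>"
            then have "conj_by m (conj_by (inv m) x) = conj_by m \<one>" by simp
            then show False using x(3) xG mG by simp
          qed
          ultimately have meet: "conj_set (inv m \<otimes> g) B \<inter> B \<noteq> {\<one>}" by blast
          have "inv m \<otimes> g \<in> L" unfolding L_def using dich[OF _ meet] mG g(1) by simp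
          then have "inv m \<otimes> g \<in> M" using M(2) by blast
          then have "m \<otimes> (inv m \<otimes> g) \<in> M" using m(1) MD(1) by (simp add: subgroup.m_closed)
          moreover have "m \<otimes> (inv m \<otimes> g) = g" using mG g(1) by (simp add: m_assoc[symmetric])
          ultimately show False using g(2) by simp
        qed
        then show ?thesis
        proof (rule commute_if_disjoint[OF subgroup_conj_set[OF g(1) sB] subgroup_conj_set[OF mG sB] _ _ _ y m(2)])
          show "conj_by k n \<in> conj_set g B" if "k \<in> conj_set m B" "n \<in> conj_set g B" for k n
            using nconj[OF _ g(1) that(2)] that(1) subK0[OF mG] by blast
          show "conj_by n k \<in> conj_set m B" if "k \<in> conj_set m B" "n \<in> conj_set g B" for k n
            using nconj[OF _ mG that(1)] that(2) subK0[OF g(1)] by blast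
        qed
      qed
      moreover have "y \<in> M" using y subK0[OF g(1)] K0L M(2) by blast
      ultimately show "y \<in> R" using MG unfolding R_def centralizer_def by blast
    qed
    obtain x where x: "x \<in> B" "x \<noteq> \<one>" using B1 subgroup.one_closed[OF sB] by blast
    have xG: "x \<in> carrier G" using x(1) BG by blast
    have "R \<noteq> {\<one>}"
    proof
      assume "R = {\<one>}"
      moreover have "conj_by g x \<in> R" using gR x(1) by (auto simp: conj_set_def)
      ultimately have "conj_by g x = conj_by g \<one>" using g(1) by simp
      then show False using conj_by_inj[OF g(1) xG one_closed] x(2) by blast
    qed
    \<comment> \<open>Finite index makes the centraliser of \<open>R\<close> trivial, but
      \<open>B\<close> centralises \<open>R\<close>.\<close>
    then have "fin_index R M" using JI_D[OF max[OF M(1)] sR _ cR] nR by (auto simp: R_def)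
    then have "fin_index R (carrier G)" by (rule fin_index_trans[OF _ MD(4) sR MD(1) subgroup_self])
    then have "centralizer R = {\<one>}" by (rule centralizer_fin_index_trivial[OF sR cR])
    moreover have "x \<in> U" using x(1) conj_set_one[OF BG] subgroup.one_closed[OF MD(1)] unfolding U_def by blast
    have "x \<otimes> y = y \<otimes> x" if "y \<in> R" for y
      using that \<open>x \<in> U\<close> unfolding R_def centralizer_def by (blast intro: sym)
    then have "x \<in> centralizer R" using xG unfolding centralizer_def by blast
    ultimately show False using x(2) by blast
  qed
qed

end

section \<open>Central-by-finite groups\<close>

text \<open>The transfer into a torsion-free central subgroup \<open>C\<close> of finite index has the torsion elements as
  its kernel, and they are separated by the cosets of \<open>C\<close>.\<close>

lemma (in group) torsion_central_by_finite:
  fixes Tor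
  assumes D: "subgroup D G" and C: "subgroup C G" "C \<subseteq> D"
    and central: "\<And>c d. c \<in> C \<Longrightarrow> d \<in> D \<Longrightarrow> c \<otimes> d = d \<otimes> c"
    and fi: "fin_index C D"
    and tf: "\<And>c m. c \<in> C \<Longrightarrow> (m::nat) > 0 \<Longrightarrow> c [^] m = \<one> \<Longrightarrow> c = \<one>"
  defines "Tor \<equiv> {d \<in> D. \<exists>m>0. d [^] (m::nat) = \<one>}"
  shows "finite Tor" "subgroup Tor G" "\<And>x y. x \<in> D \<Longrightarrow> y \<in> D \<Longrightarrow> x \<otimes> y \<otimes> inv (y \<otimes> x) \<in> Tor"
proof -
  have DG: "D \<subseteq> carrier G" and CG: "C \<subseteq> carrier G" using subgroup.subset[OF D] subgroup.subset[OF C(1)] by simp_all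
  interpret C: comm_group "G\<lparr>carrier := C\<rparr>"
    by (rule group.group_comm_groupI[OF subgroup_imp_group[OF C(1)]]) (use central C(2) in auto)
  define Q where "Q = (\<lambda>x. C #> x) ` D"
  have finQ: "finite Q" using fi by (simp add: Q_def fin_index_def)
  define r where "r c = (SOME x. x \<in> D \<and> C #> x = c)" for c
  have r: "r c \<in> D" "C #> r c = c" if "c \<in> Q" for c
  proof -
    obtain x where "x \<in> D \<and> C #> x = c" using \<open>c \<in> Q\<close> by (auto simp: Q_def)
    then have "r c \<in> D \<and> C #> r c = c" unfolding r_def by (rule someI)
    then show "r c \<in> D" "C #> r c = c" by auto
  qed
  have rG: "r c \<in> carrier G" if "c \<in> Q" for c using r(1)[OF that] DG by blast
  have mv: "c #> d = C #> (r c \<otimes> d)" if "c \<in> Q" "d \<in> D" for c d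
    using coset_mult_assoc[OF CG rG[OF that(1)], of d] r(2)[OF that(1)] that(2) DG by auto
  have mvQ: "c #> d \<in> Q" if "c \<in> Q" "d \<in> D" for c d
    unfolding mv[OF that] Q_def using r(1)[OF that(1)] that(2) D by (intro imageI) (simp add: subgroup.m_closed)
  \<comment> \<open>Right multiplication by \<open>d\<close> permutes the cosets of
    \<open>C\<close>, and \<open>\<kappa> d c\<close> measures how far it is from permuting the
    representatives. The product of these cocycle values over all cosets is the transfer
    \<open>\<phi>\<close>.\<close>
  define \<kappa> where "\<kappa> d c = r c \<otimes> d \<otimes> inv (r (c #> d))" for d c
  have \<kappa>C: "\<kappa> d c \<in> C" if "c \<in> Q" "d \<in> D" for c d
  proof -
    have "C #> (r c \<otimes> d) = C #> r (c #> d)" using mv[OF that] r(2)[OF mvQ[OF that]] by simp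
    then show ?thesis
      unfolding \<kappa>_def using r_coset_eq_iff[OF C(1), of "r c \<otimes> d" "r (c #> d)"] rG[OF that(1)] rG[OF mvQ[OF that]] that(2) DG
      by blast
  qed
  define \<phi> where "\<phi> d = finprod (G\<lparr>carrier := C\<rparr>) (\<kappa> d) Q" for d
  have \<phi>C: "\<phi> d \<in> C" if "d \<in> D" for d
    unfolding \<phi>_def using C.finprod_closed[of "\<kappa> d" Q] \<kappa>C that by auto
  have \<phi>mult: "\<phi> (d \<otimes> e) = \<phi> d \<otimes> \<phi> e" if d: "d \<in> D" and e: "e \<in> D" for d e
  proof -
    have dG: "d \<in> carrier G" and eG: "e \<in> carrier G" using d e DG by auto
    have split: "\<kappa> (d \<otimes> e) c = \<kappa> d c \<otimes> \<kappa> e (c #> d)" if c: "c \<in> Q" for c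
    proof -
      have "c \<subseteq> carrier G" using c CG DG by (auto simp: Q_def r_coset_def)
      then have "c #> (d \<otimes> e) = c #> d #> e" using dG eG by (simp add: coset_mult_assoc)
      moreover have "inv (r (c #> d)) \<otimes> (r (c #> d) \<otimes> (e \<otimes> inv (r (c #> d #> e)))) = e \<otimes> inv (r (c #> d #> e))"
        using rG[OF mvQ[OF c d]] rG[OF mvQ[OF mvQ[OF c d] e]] eG by (simp add: m_assoc[symmetric])
      ultimately show ?thesis
        unfolding \<kappa>_def using rG[OF c] rG[OF mvQ[OF c d]] rG[OF mvQ[OF mvQ[OF c d] e]] dG eG by (simp add: m_assoc)
    qed
    have inj: "inj_on (\<lambda>c. c #> d) Q"
    proof (rule inj_onI)
      fix c c' assume c: "c \<in> Q" "c' \<in> Q" "c #> d = c' #> d"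
      have undo: "c #> d #> inv d = c" if "c \<in> Q" for c
      proof -
        have "c \<subseteq> carrier G" using that CG DG by (auto simp: Q_def r_coset_def)
        then show ?thesis using dG by (simp add: coset_mult_assoc)
      qed
      have "c #> d #> inv d = c' #> d #> inv d" by (rule arg_cong[OF c(3)])
      then show "c = c'" unfolding undo[OF c(1)] undo[OF c(2)] .
    qed
    have img: "(\<lambda>c. c #> d) ` Q = Q"
      using endo_inj_surj[OF finQ _ inj] mvQ d by blast
    have "\<phi> (d \<otimes> e) = finprod (G\<lparr>carrier := C\<rparr>) (\<lambda>c. \<kappa> d c \<otimes>\<^bsub>G\<lparr>carrier := C\<rparr>\<^esub> \<kappa> e (c #> d)) Q"
      unfolding \<phi>_def using split \<kappa>C mvQ d e C(1) by (intro C.finprod_cong') (auto simp: subgroup.m_closed)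
    also have "\<dots> = \<phi> d \<otimes> finprod (G\<lparr>carrier := C\<rparr>) (\<lambda>c. \<kappa> e (c #> d)) Q"
      unfolding \<phi>_def using \<kappa>C mvQ d e by (subst C.finprod_multf) auto
    also have "finprod (G\<lparr>carrier := C\<rparr>) (\<lambda>c. \<kappa> e (c #> d)) Q = \<phi> e"
      unfolding \<phi>_def using C.finprod_reindex[of "\<kappa> e" "\<lambda>c. c #> d" Q] \<kappa>C e inj unfolding img by auto
    finally show ?thesis .
  qed
  have \<phi>one: "\<phi> \<one> = \<one>"
  proof -
    have "\<phi> \<one> \<in> carrier G" using \<phi>C[OF subgroup.one_closed[OF D]] CG by blast
    then show ?thesis using \<phi>mult[OF subgroup.one_closed[OF D] subgroup.one_closed[OF D]] by simp
  qed
  have pow: "d [^] (m::nat) \<in> D" if "d \<in> D" for d m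
    by (induction m) (use that D in \<open>auto simp: subgroup.one_closed subgroup.m_closed\<close>)
  have \<phi>pow: "\<phi> (d [^] (m::nat)) = \<phi> d [^] m" if "d \<in> D" for d m
    by (induction m) (simp_all add: \<phi>one \<phi>mult pow that)
  \<comment> \<open>On the central subgroup \<open>C\<close> the transfer is raising to the power
    \<open>card Q\<close>, which has trivial kernel as \<open>C\<close> is torsion-free.\<close>
  have \<phi>inj: "c = \<one>" if c: "c \<in> C" "\<phi> c = \<one>" for c
  proof -
    have cD: "c \<in> D" using c C(2) by blast
    have "\<kappa> c q = c" if q: "q \<in> Q" for q
    proof -
      have "q #> c = C #> (c \<otimes> r q)" using mv[OF q cD] central[OF c(1) r(1)[OF q]] by simp
      also have "\<dots> = C #> c #> r q" using coset_mult_assoc[OF CG, of c "r q"] c(1) CG rG[OF q] by auto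
      also have "\<dots> = q" using coset_join2[OF _ C(1) c(1)] c(1) CG r(2)[OF q] by auto
      finally have "q #> c = q" .
      then have "\<kappa> c q = c \<otimes> r q \<otimes> inv (r q)" unfolding \<kappa>_def using central[OF c(1) r(1)[OF q]] by simp
      then show ?thesis using rG[OF q] c(1) CG by (auto simp: m_assoc)
    qed
    then have "\<phi> c = finprod (G\<lparr>carrier := C\<rparr>) (\<lambda>q. c) Q"
      unfolding \<phi>_def using c(1) by (intro C.finprod_cong') auto
    also have "\<dots> = c [^]\<^bsub>G\<lparr>carrier := C\<rparr>\<^esub> card Q" using c(1) by (intro C.finprod_const) simp
    also have "\<dots> = c [^] card Q" by (rule nat_pow_consistent[symmetric])
    finally have "c [^] card Q = \<one>" using c(2) by simp
    moreover have "Q \<noteq> {}" using subgroup.one_closed[OF D] by (auto simp: Q_def)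
    then have "card Q > 0" using finQ by (simp add: card_gt_0_iff)
    ultimately show ?thesis using tf[OF c(1)] by blast
  qed
  define Ker where "Ker = {d \<in> D. \<phi> d = \<one>}"
  have cancel: "x = \<one>" if "x \<in> D" "y \<in> D" "\<phi> (x \<otimes> y) = \<phi> y" "x \<in> C" for x y
  proof -
    have "\<phi> x \<in> carrier G" "\<phi> y \<in> carrier G" using \<phi>C that CG by auto
    then have "\<phi> x = \<one>" using \<phi>mult[OF that(1,2)] that(3) by simp
    then show ?thesis using \<phi>inj that by blast
  qed
  have "inj_on (\<lambda>x. C #> x) Ker"
  proof (rule inj_onI)
    fix x y assume xy: "x \<in> Ker" "y \<in> Ker" "C #> x = C #> y"
    have xyD: "x \<in> D" "y \<in> D" and xyG: "x \<in> carrier G" "y \<in> carrier G" using xy DG by (auto simp: Ker_def)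
    have "x \<otimes> inv y \<in> C" using r_coset_eq_iff[OF C(1) xyG] xy(3) by simp
    moreover have "(x \<otimes> inv y) \<otimes> y = x" using xyG by (simp add: m_assoc)
    moreover have "\<phi> x = \<phi> y" using xy by (simp add: Ker_def)
    ultimately have "x \<otimes> inv y = \<one>" using cancel[of "x \<otimes> inv y" y] xyD C(2) by auto
    then show "x = y" using inv_solve_right'[of \<one> x y] xyG by simp
  qed
  moreover have "finite ((\<lambda>x. C #> x) ` Ker)"
    using finQ by (rule finite_subset[rotated]) (auto simp: Q_def Ker_def)
  ultimately have finK: "finite Ker" using finite_imageD by blast
  have KerD: "x \<otimes> y \<in> Ker" if "x \<in> Ker" "y \<in> Ker" for x y
    using that D by (simp add: Ker_def \<phi>mult subgroup.m_closed)
  \<comment> \<open>A torsion element has a torsion image in \<open>C\<close>, hence a trivial one;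
    conversely the kernel is finite, so its elements are torsion.\<close>
  have eq: "Tor = Ker"
  proof (intro subset_antisym subsetI)
    fix d assume "d \<in> Tor"
    then obtain m :: nat where d: "d \<in> D" "m > 0" "d [^] m = \<one>" by (auto simp: Tor_def)
    then have "\<phi> d [^] m = \<one>" using \<phi>pow[OF d(1), of m] \<phi>one by simp
    then have "\<phi> d = \<one>" using tf[OF \<phi>C[OF d(1)] d(2)] by simp
    then show "d \<in> Ker" using d by (simp add: Ker_def)
  next
    fix d assume d: "d \<in> Ker"
    then have dD: "d \<in> D" and dG: "d \<in> carrier G" using DG by (auto simp: Ker_def)
    have "range (\<lambda>m::nat. d [^] m) \<subseteq> Ker"
      using d by (auto simp: Ker_def pow \<phi>pow)
    then have "finite (range (\<lambda>m::nat. d [^] m))" using finK by (rule finite_subset)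
    then have "\<not> inj (\<lambda>m::nat. d [^] m)" using finite_imageD infinite_UNIV_nat by blast
    then obtain i j :: nat where ij: "i < j" "d [^] i = d [^] j"
      unfolding inj_def by (metis linorder_neqE_nat)
    have "d [^] (j - i) \<otimes> d [^] i = d [^] j" using ij(1) dG by (simp add: nat_pow_mult)
    then have "d [^] (j - i) \<otimes> d [^] i = \<one> \<otimes> d [^] i" using ij(2) dG by simp
    then have "d [^] (j - i) = \<one>" using dG by (simp only: right_cancel nat_pow_closed one_closed)
    then show "d \<in> Tor" using dD ij(1) by (auto simp: Tor_def intro!: exI[of _ "j - i"])
  qed
  show "finite Tor" using finK eq by simp
  show "subgroup Tor G"
    unfolding eq
  proof (rule subgroupI)
    show "Ker \<subseteq> carrier G" using DG by (auto simp: Ker_def)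
    show "Ker \<noteq> {}" using \<phi>one subgroup.one_closed[OF D] by (auto simp: Ker_def)
    fix x assume x: "x \<in> Ker"
    then have xD: "x \<in> D" "\<phi> x = \<one>" and xG: "x \<in> carrier G" using DG by (auto simp: Ker_def)
    have ixD: "inv x \<in> D" using subgroup.m_inv_closed[OF D xD(1)] .
    have "\<phi> (inv x) \<in> carrier G" using \<phi>C[OF ixD] CG by blast
    moreover have "\<phi> (x \<otimes> inv x) = \<phi> x \<otimes> \<phi> (inv x)" by (rule \<phi>mult[OF xD(1) ixD])
    ultimately have "\<phi> (inv x) = \<one>" using xG xD(2) \<phi>one by simp
    then show "inv x \<in> Ker" using ixD by (simp add: Ker_def)
  qed (rule KerD)
  fix x y assume xy: "x \<in> D" "y \<in> D"
  have xyG: "x \<in> carrier G" "y \<in> carrier G" using xy DG by auto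
  have xyD: "x \<otimes> y \<in> D" "y \<otimes> x \<in> D" using xy D by (auto simp: subgroup.m_closed)
  let ?w = "x \<otimes> y \<otimes> inv (y \<otimes> x)"
  have wD: "?w \<in> D" using xyD D by (simp add: subgroup.m_closed subgroup.m_inv_closed)
  have "\<phi> (x \<otimes> y) = \<phi> (y \<otimes> x)"
    using \<phi>mult[OF xy] \<phi>mult[OF xy(2,1)] central[OF \<phi>C[OF xy(1)], of "\<phi> y"] \<phi>C[OF xy(2)] C(2) by auto
  moreover have "?w \<otimes> (y \<otimes> x) = x \<otimes> y" using xyG by (simp add: m_assoc)
  ultimately have "\<phi> ?w \<otimes> \<phi> (y \<otimes> x) = \<phi> (y \<otimes> x)" using \<phi>mult[OF wD xyD(2)] by simp
  moreover have "\<phi> ?w \<in> carrier G" "\<phi> (y \<otimes> x) \<in> carrier G" using \<phi>C wD xyD CG by auto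
  ultimately have "\<phi> ?w = \<one>" by simp
  then show "?w \<in> Tor" unfolding eq using wD by (simp add: Ker_def)
qed

text \<open>The elements of \<open>S\<close> are adjoined one at a time: in an abelian group the
  product of a finite subgroup and a finite cyclic subgroup is again a finite subgroup.\<close>

lemma (in group) finite_abelian_torsion_hull:
  assumes N: "subgroup N G" and ab: "\<And>x y. x \<in> N \<Longrightarrow> y \<in> N \<Longrightarrow> x \<otimes> y = y \<otimes> x"
    and S: "finite S" "S \<subseteq> N" "\<And>s. s \<in> S \<Longrightarrow> s [^] (m::nat) = \<one>" and m: "m > 0"
  shows "\<exists>F. finite F \<and> subgroup F G \<and> S \<subseteq> F \<and> F \<subseteq> N"
  using S
proof (induction S rule: finite_induct)
  case empty
  then show ?case using triv_subgroup subgroup.one_closed[OF N] by (intro exI[of _ "{\<one>}"]) auto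
next
  case (insert s S)
  then obtain F where F: "finite F" "subgroup F G" "S \<subseteq> F" "F \<subseteq> N" by auto
  have NG: "N \<subseteq> carrier G" and FG: "F \<subseteq> carrier G" using subgroup.subset[OF N] subgroup.subset[OF F(2)] by simp_all
  have sN: "s \<in> N" and sG: "s \<in> carrier G" using insert.prems(1) NG by auto
  have cN: "c \<in> N" if "c \<in> cyc s" for c using that cyc_subset_iff[OF sG N] sN by blast
  have sC: "subgroup (cyc s) G" by (rule subgroup_cyc[OF sG])
  have CG: "cyc s \<subseteq> carrier G" by (rule cyc_closed[OF sG])
  define F' where "F' = (\<lambda>(f, c). f \<otimes> c) ` (F \<times> cyc s)"
  have "ord s dvd m" using pow_eq_id[OF sG, of m] insert.prems(2)[of s] by simp
  then have o: "ord s > 0" using m by (cases "ord s") auto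
  have "cyc s \<subseteq> (\<lambda>i. s [^] i) ` {0..<int (ord s)}"
  proof
    fix c assume "c \<in> cyc s"
    then obtain i where i: "c = s [^] (i::int)" by (auto simp: cyc_def)
    have "s [^] (i mod int (ord s)) = s [^] i" unfolding int_pow_eq[OF sG] by (rule dvd_minus_mod)
    then show "c \<in> (\<lambda>i. s [^] i) ` {0..<int (ord s)}"
      unfolding i using o by (intro image_eqI[of _ _ "i mod int (ord s)"]) simp_all
  qed
  then have "finite (cyc s)" using finite_subset by blast
  then have "finite F'" unfolding F'_def using F(1) by simp
  moreover have "subgroup F' G"
  proof (rule subgroupI)
    show "F' \<subseteq> carrier G" using FG CG by (auto simp: F'_def)
    show "F' \<noteq> {}" using subgroup.one_closed[OF F(2)] self_in_cyc[OF sG] by (auto simp: F'_def)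
  next
    fix x assume "x \<in> F'"
    then obtain f c where fc: "f \<in> F" "c \<in> cyc s" "x = f \<otimes> c" by (auto simp: F'_def)
    have "inv x = inv (c \<otimes> f)" using ab[of f c] fc F(4) cN by auto
    also have "\<dots> = inv f \<otimes> inv c" using fc FG CG by (intro inv_mult_group) auto
    finally show "inv x \<in> F'"
      using subgroup.m_inv_closed[OF F(2) fc(1)] subgroup.m_inv_closed[OF sC fc(2)]
      unfolding F'_def by (intro image_eqI[of _ _ "(inv f, inv c)"]) simp_all
  next
    fix x y assume "x \<in> F'" "y \<in> F'"
    then obtain f c f' c' where fc: "f \<in> F" "c \<in> cyc s" "x = f \<otimes> c" "f' \<in> F" "c' \<in> cyc s" "y = f' \<otimes> c'"
      by (auto simp: F'_def)
    have cl: "f \<in> carrier G" "c \<in> carrier G" "f' \<in> carrier G" "c' \<in> carrier G" using fc FG CG by auto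
    have "x \<otimes> y = f \<otimes> (c \<otimes> f') \<otimes> c'" using cl by (simp add: fc m_assoc)
    also have "c \<otimes> f' = f' \<otimes> c" using ab[of c f'] fc cN F(4) by auto
    also have "f \<otimes> (f' \<otimes> c) \<otimes> c' = (f \<otimes> f') \<otimes> (c \<otimes> c')" using cl by (simp add: m_assoc)
    finally show "x \<otimes> y \<in> F'"
      using subgroup.m_closed[OF F(2) fc(1,4)] subgroup.m_closed[OF sC fc(2,5)]
      unfolding F'_def by (intro image_eqI[of _ _ "(f \<otimes> f', c \<otimes> c')"]) simp_all
  qed
  moreover have "insert s S \<subseteq> F'"
  proof
    fix x assume "x \<in> insert s S"
    then consider "x = s" | "x \<in> F" using F(3) by blast
    then show "x \<in> F'"
    proof cases
      case 1
      then show ?thesis unfolding F'_def using subgroup.one_closed[OF F(2)] self_in_cyc[OF sG] sG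
        by (intro image_eqI[of _ _ "(\<one>, s)"]) simp_all
    next
      case 2
      then show ?thesis unfolding F'_def using subgroup.one_closed[OF sC] FG
        by (intro image_eqI[of _ _ "(x, \<one>)"]) auto
    qed
  qed
  moreover have "F' \<subseteq> N" using F(4) cN N by (auto simp: F'_def subgroup.m_closed subset_iff)
  ultimately show ?case by blast
qed

text \<open>A nontrivial torsion element has only finitely many conjugates, since the abelian group
  \<open>N\<close> centralises it and has finite index. They generate a finite normal subgroup of
  the infinite group \<open>L\<close>, which cannot have finite index.\<close>

lemma (in hausdorff_group) JI_abelian_torsion_free:
  assumes L: "subgroup L G" "JI L"
    and N: "subgroup N G" "N \<subseteq> L" "closedin T N" "\<And>g x. g \<in> L \<Longrightarrow> x \<in> N \<Longrightarrow> conj_by g x \<in> N"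
    and ab: "\<And>x y. x \<in> N \<Longrightarrow> y \<in> N \<Longrightarrow> x \<otimes> y = y \<otimes> x"
    and a: "a \<in> N" "(m::nat) > 0" "a [^] m = \<one>"
  shows "a = \<one>"
proof (rule ccontr)
  assume a1: "a \<noteq> \<one>"
  have LG: "L \<subseteq> carrier G" using L(1) by (rule subgroup.subset)
  have NG: "N \<subseteq> carrier G" using N(2) LG by blast
  have aG: "a \<in> carrier G" using a NG by blast
  have fi: "fin_index N L" by (rule JI_D[OF L(2) N(1,2,3,4)]) (use a a1 in auto)
  define S where "S = (\<lambda>l. conj_by l a) ` L"
  have "S \<subseteq> (\<lambda>C. conj_by (SOME x. x \<in> C) a) ` ((\<lambda>l. N #> l) ` L)"
  proof
    fix s assume "s \<in> S"
    then obtain l where l: "l \<in> L" "s = conj_by l a" by (auto simp: S_def)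
    have lG: "l \<in> carrier G" using l LG by blast
    have "(SOME x. x \<in> N #> l) \<in> N #> l" using rcos_self[OF lG N(1)] by (rule someI)
    then obtain n where n: "n \<in> N" "(SOME x. x \<in> N #> l) = n \<otimes> l" by (auto simp: r_coset_def)
    have nG: "n \<in> carrier G" using n NG by blast
    have sN: "s \<in> N" using l N(4) a(1) by simp
    have "conj_by (n \<otimes> l) a = conj_by n s" using nG lG aG l by (simp add: conj_by_conj_by)
    also have "\<dots> = s" using ab[OF n(1) sN] conj_by_eq_iff[OF nG, of s s] sN NG by auto
    finally have "s = conj_by (SOME x. x \<in> N #> l) a" using n by simp
    then show "s \<in> (\<lambda>C. conj_by (SOME x. x \<in> C) a) ` ((\<lambda>l. N #> l) ` L)" using l by blast
  qed
  then have finS: "finite S" using fi unfolding fin_index_def by (rule finite_subset[OF _ finite_imageI])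
  have SN: "S \<subseteq> N" using N(4) a(1) by (auto simp: S_def)
  have Sm: "s [^] m = \<one>" if "s \<in> S" for s
    using that a(3) aG LG by (auto simp: S_def conj_by_nat_pow[symmetric] subset_iff)
  obtain F where F: "finite F" "subgroup F G" "S \<subseteq> F" "F \<subseteq> N"
    using finite_abelian_torsion_hull[OF N(1) ab finS SN Sm a(2)] by blast
  \<comment> \<open>As the smallest subgroup above the class \<open>S\<close> it is invariant under
    conjugation; the hull \<open>F\<close> shows that it is finite.\<close>
  define E where "E = \<Inter>{K. subgroup K G \<and> S \<subseteq> K}"
  have EF: "E \<subseteq> F" unfolding E_def using F by blast
  have finE: "finite E" using EF F(1) by (rule finite_subset)
  have sE: "subgroup E G" unfolding E_def by (rule subgroups_Inter) (use F in auto)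
  have nE: "conj_by l x \<in> E" if l: "l \<in> L" and x: "x \<in> E" for l x
    unfolding E_def
  proof (rule InterI)
    fix K assume "K \<in> {K. subgroup K G \<and> S \<subseteq> K}"
    then have K: "subgroup K G" "S \<subseteq> K" by auto
    have KG: "K \<subseteq> carrier G" using K(1) by (rule subgroup.subset)
    have lG: "l \<in> carrier G" using l LG by blast
    have xG: "x \<in> carrier G" using x EF subgroup.subset[OF F(2)] by blast
    have "S \<subseteq> conj_set (inv l) K"
    proof
      fix s assume s: "s \<in> S"
      then obtain l' where l': "l' \<in> L" "s = conj_by l' a" by (auto simp: S_def)
      have "conj_by l s = conj_by (l \<otimes> l') a" using lG l' LG aG by (auto simp: conj_by_conj_by)
      then have "conj_by l s \<in> K" using K(2) subgroup.m_closed[OF L(1) l l'(1)] unfolding S_def by blast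
      then show "s \<in> conj_set (inv l) K" using conj_set_iff[of "inv l" K s] lG KG s SN NG by auto
    qed
    then have "x \<in> conj_set (inv l) K" using x subgroup_conj_set[OF _ K(1), of "inv l"] lG unfolding E_def by simp
    then show "conj_by l x \<in> K" using conj_set_iff[of "inv l" K x] lG KG xG by simp
  qed
  have EL: "E \<subseteq> L" using EF F(4) N(2) by blast
  have aE: "a \<in> E"
  proof -
    have "a \<in> S" using conj_by_one_left[OF aG] subgroup.one_closed[OF L(1)] unfolding S_def by (intro image_eqI[of _ _ \<one>]) simp_all
    then show ?thesis by (auto simp: E_def)
  qed
  have "fin_index E L"
    by (rule JI_D[OF L(2) sE EL closedin_if_finite[OF finE subgroup.subset[OF sE]] nE]) (use aE a1 in auto)
  then have "finite L" by (rule fin_index_finite[OF _ finE sE LG])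
  then show False using L(2) by (simp add: JI_def)
qed

text \<open>For another prime divisor \<open>s\<close> of the order, Sylow's theorem yields a
  subgroup of order \<open>s\<close>, whose nontrivial elements have no trivial power with exponent
  \<open>p^j\<close>.\<close>

lemma (in group) order_prime_power:
  assumes fin: "finite (carrier G)" and p: "Factorial_Ring.prime (p::nat)"
    and pow: "\<And>x. x \<in> carrier G \<Longrightarrow> \<exists>j::nat. x [^] (p ^ j) = \<one>"
  obtains r where "order G = p ^ r"
proof -
  have pos: "order G > 0" using fin by (simp add: order_gt_0_iff_finite)
  have only_p: "s = p" if s: "Factorial_Ring.prime s" "s dvd order G" for s
  proof (rule ccontr)
    assume ne: "s \<noteq> p"
    obtain m where "order G = s ^ 1 * m" using s(2) by (auto simp: dvd_def)
    then obtain K where K: "subgroup K G" "card K = s ^ 1" using sylow_thm[OF s(1) is_group _ fin] by blast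
    have s1: "s > 1" using s(1) by (rule prime_gt_1_nat)
    then obtain x where x: "x \<in> K" "x \<noteq> \<one>"
    proof -
      have "K \<noteq> {\<one>}" using K(2) s1 by auto
      then show ?thesis using that subgroup.one_closed[OF K(1)] by blast
    qed
    have xG: "x \<in> carrier G" by (rule subgroup.mem_carrier[OF K(1) x(1)])
    interpret K: group "G\<lparr>carrier := K\<rparr>" by (rule subgroup_imp_group[OF K(1)])
    have "x [^]\<^bsub>G\<lparr>carrier := K\<rparr>\<^esub> order (G\<lparr>carrier := K\<rparr>) = \<one>\<^bsub>G\<lparr>carrier := K\<rparr>\<^esub>"
      using x(1) by (intro K.pow_order_eq_1) simp
    then have "x [^] s = \<one>" using K(2) by (simp add: order_def nat_pow_consistent[symmetric])
    then have "ord x dvd s" using pow_eq_id[OF xG] by simp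
    moreover obtain j where "x [^] (p ^ j) = \<one>" using pow[OF xG] by blast
    then have "ord x dvd p ^ j" using pow_eq_id[OF xG] by simp
    moreover have "coprime s (p ^ j)" using s(1) p ne by (simp add: primes_coprime)
    ultimately have "is_unit (ord x)" by (intro coprime_common_divisor[of s "p ^ j" "ord x"])
    then show False using x(2) ord_eq_1[OF xG] by simp
  qed
  obtain y where y: "order G = p ^ multiplicity p (order G) * y" "\<not> p dvd y"
    by (rule multiplicity_decompose'[of "order G" p]) (use pos p in \<open>auto intro: that\<close>)
  have "y = 1"
  proof (rule ccontr)
    assume "y \<noteq> 1"
    then obtain s where "Factorial_Ring.prime s" "s dvd y" using prime_factor_nat by blast
    moreover from this have "s dvd order G" by (subst y(1)) simp
    ultimately show False using only_p[of s] y(2) by simp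
  qed
  then show ?thesis using y(1) that by simp
qed

lemma (in group) power_card_rcosets_in:
  assumes N: "N \<lhd> G" "card (rcosets N) = m" "m > 0" and x: "x \<in> carrier G"
  shows "x [^] m \<in> N"
proof -
  interpret N: normal N G by (rule N(1))
  interpret Q: group "G Mod N" by (rule N.factorgroup_is_group)
  have "N #> x \<in> carrier (G Mod N)" using x by (auto simp: FactGroup_def RCOSETS_def)
  then have "(N #> x) [^]\<^bsub>G Mod N\<^esub> order (G Mod N) = \<one>\<^bsub>G Mod N\<^esub>" by (rule Q.pow_order_eq_1)
  moreover have "order (G Mod N) = m" "\<one>\<^bsub>G Mod N\<^esub> = N" using N(2) by (simp_all add: order_def FactGroup_def)
  ultimately have "N #> (x [^] m) = N" using x by (simp add: N.FactGroup_pow)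
  then show ?thesis using coset_join1[OF _ _ N.subgroup_axioms] x by simp
qed

section \<open>Virtually abelian just infinite groups\<close>

lemma (in topological_group) topological_group_sub:
  assumes H: "subgroup H G"
  shows "topological_group (G\<lparr>carrier := H\<rparr>) (subtopology T H)"
proof -
  have HG: "H \<subseteq> carrier G" using H by (rule subgroup.subset)
  have mult: "continuous_map (subtopology (prod_topology T T) (H \<times> H)) (subtopology T H) (\<lambda>(x, y). x \<otimes> y)"
    using continuous_map_from_subtopology[OF continuous_mult] H
    by (intro continuous_map_into_subtopology) (auto simp: subgroup.m_closed)
  have "continuous_map (subtopology T H) (subtopology T H) (\<lambda>x. inv x)"
    using continuous_map_from_subtopology[OF continuous_inv] H
    by (intro continuous_map_into_subtopology) (auto simp: subgroup.m_inv_closed)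
  then have "continuous_map (subtopology T H) (subtopology T H) (\<lambda>x. inv\<^bsub>G\<lparr>carrier := H\<rparr>\<^esub> x)"
    by (rule continuous_map_eq) (use m_inv_consistent[OF H] HG in \<open>auto simp: topspace_eq\<close>)
  then show ?thesis
    using subgroup_imp_group[OF H] mult HG topspace_eq
    by (simp add: topological_group_def topological_group_axioms_def subtopology_Times Int_absorb1)
qed

context hausdorff_group
begin

text \<open>For the centraliser \<open>D\<close> of \<open>N\<close>, the transfer puts all
  commutators into the finite torsion subgroup of \<open>D\<close>. That subgroup is normal in
  \<open>G\<close>, hence trivial, and \<open>D\<close> is abelian. Since
  \<open>N \<subseteq> D\<close>, whatever centralises \<open>D\<close> centralises \<open>N\<close>
  and so belongs to \<open>D\<close>.\<close>

lemma ex_self_centralizing: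
  assumes ji: "JI (carrier G)"
    and N: "N \<lhd> G" "closedin T N" "N \<noteq> {\<one>}" "\<And>x y. x \<in> N \<Longrightarrow> y \<in> N \<Longrightarrow> x \<otimes> y = y \<otimes> x"
  obtains A where "A \<lhd> G" "closedin T A" "fin_index A (carrier G)"
    "\<And>x y. x \<in> A \<Longrightarrow> y \<in> A \<Longrightarrow> x \<otimes> y = y \<otimes> x" "centralizer A \<subseteq> A"
proof -
  have sN: "subgroup N G" and cN: "\<And>g x. g \<in> carrier G \<Longrightarrow> x \<in> N \<Longrightarrow> conj_by g x \<in> N"
    using N(1) by (auto simp: normal_iff_conj_by)
  have NG: "N \<subseteq> carrier G" using sN by (rule subgroup.subset)
  define D where "D = centralizer N"
  have sD: "subgroup D G" unfolding D_def by (rule subgroup_centralizer[OF NG])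
  have DG: "D \<subseteq> carrier G" using sD by (rule subgroup.subset)
  have cD: "conj_by g x \<in> D" if "g \<in> carrier G" "x \<in> D" for g x
    using that cN unfolding D_def by (intro conj_by_centralizer[OF NG]) simp_all
  have ND: "N \<subseteq> D" using N(4) NG unfolding D_def centralizer_def by blast
  have fiN: "fin_index N (carrier G)" by (rule JI_D[OF ji sN NG N(2) cN N(3)])
  have tf: "c = \<one>" if "c \<in> N" "m > 0" "c [^] (m::nat) = \<one>" for c m
    by (rule JI_abelian_torsion_free[OF subgroup_self ji sN NG N(2) cN N(4) that])
  define Tor where "Tor = {d \<in> D. \<exists>m>0. d [^] (m::nat) = \<one>}"
  have central: "c \<otimes> d = d \<otimes> c" if "c \<in> N" "d \<in> D" for c d
    using that unfolding D_def centralizer_def by (blast intro: sym)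
  note tor = torsion_central_by_finite[OF sD sN ND central fin_index_sub[OF fiN DG] tf]
  have finT: "finite Tor" unfolding Tor_def by (rule tor(1); assumption)
  have sT: "subgroup Tor G" unfolding Tor_def by (rule tor(2); assumption)
  have commT: "x \<otimes> y \<otimes> inv (y \<otimes> x) \<in> Tor" if "x \<in> D" "y \<in> D" for x y
    unfolding Tor_def by (rule tor(3); (assumption | rule that))
  have TorG: "Tor \<subseteq> carrier G" using DG by (auto simp: Tor_def)
  have "Tor = {\<one>}"
  proof (rule ccontr)
    assume ne: "Tor \<noteq> {\<one>}"
    have conjT: "conj_by g x \<in> Tor" if "g \<in> carrier G" "x \<in> Tor" for g x
      using that cD DG by (auto simp: Tor_def conj_by_nat_pow[symmetric] subset_iff)
    have "fin_index Tor (carrier G)"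
      by (rule JI_D[OF ji sT TorG closedin_if_finite[OF finT TorG] conjT ne])
    then have "finite (carrier G)" using fin_index_finite[OF _ finT sT subset_refl] by blast
    then show False using ji by (simp add: JI_def)
  qed
  then have ab: "x \<otimes> y = y \<otimes> x" if "x \<in> D" "y \<in> D" for x y
  proof -
    have G: "x \<in> carrier G" "y \<in> carrier G" using that DG by auto
    have "x \<otimes> y \<otimes> inv (y \<otimes> x) = \<one>" using commT[OF that] \<open>Tor = {\<one>}\<close> by simp
    then show ?thesis using inv_solve_right'[of \<one> "x \<otimes> y" "y \<otimes> x"] G by simp
  qed
  show ?thesis
  proof (rule that[OF _ _ _ ab])
    show "D \<lhd> G" using sD cD by (simp add: normal_iff_conj_by)
    show "closedin T D" unfolding D_def by (rule closedin_centralizer[OF NG])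
    show "fin_index D (carrier G)" by (rule fin_index_mono[OF fiN sN sD ND subset_refl])
    show "centralizer D \<subseteq> D" using ND unfolding D_def centralizer_def by blast
  qed
qed

end

text \<open>In the application \<open>G\<close> is the group \<open>H\<close> of the theorem, and
  \<open>max\<close> is hypothesis (ii).\<close>

locale ji_virtually_abelian = hausdorff_group +
  fixes A :: "'a set" and p :: nat
  assumes ji: "JI (carrier G)"
    and normal_A: "A \<lhd> G" and closed_A: "closedin T A" and fin_index_A: "fin_index A (carrier G)"
    and commute_A: "x \<in> A \<Longrightarrow> y \<in> A \<Longrightarrow> x \<otimes> y = y \<otimes> x"
    and self_centralizing: "centralizer A \<subseteq> A"
    and p: "Factorial_Ring.prime p"
    and p_residual_trivial: "x \<in> carrier G \<Longrightarrow>
      (\<And>N k. N \<lhd> G \<Longrightarrow> closedin T N \<Longrightarrow> card (rcosets N) = p ^ k \<Longrightarrow> x \<in> N) \<Longrightarrow> x = \<one>"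
    and compact_or_discrete: "compact_space T \<or> T = discrete_topology (carrier G)"
    and max: "max_fin M \<Longrightarrow> JI M"
begin

lemma subgroup_A: "subgroup A G" using normal_A by (rule normal_imp_subgroup)

lemma A_subset: "A \<subseteq> carrier G" using subgroup_A by (rule subgroup.subset)

lemma A_carrier [simp]: "a \<in> A \<Longrightarrow> a \<in> carrier G" using A_subset by blast

lemma conj_A: "g \<in> carrier G \<Longrightarrow> a \<in> A \<Longrightarrow> conj_by g a \<in> A"
  using normal_A by (simp add: normal_iff_conj_by)

lemma conj_A_trivial: "c \<in> A \<Longrightarrow> a \<in> A \<Longrightarrow> conj_by c a = a"
  using commute_A[of c a] conj_by_eq_iff[of c a a] by simp

lemma torsion_free_A: "a \<in> A \<Longrightarrow> (m::nat) > 0 \<Longrightarrow> a [^] m = \<one> \<Longrightarrow> a = \<one>"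
  by (rule JI_abelian_torsion_free[OF subgroup_self ji subgroup_A A_subset closed_A conj_A commute_A])

lemma finite_index_if_fin_index: "fin_index K (carrier G) \<Longrightarrow> finite_index K G"
  using finite_index_iff[of "carrier G" K] by (simp add: fin_index_def)

lemma centralizes_A:
  assumes "g \<in> carrier G" "\<And>a. a \<in> A \<Longrightarrow> conj_by g a = a"
  shows "g \<in> A"
proof -
  have "g \<otimes> a = a \<otimes> g" if "a \<in> A" for a using assms(2)[OF that] conj_by_eq_iff[OF assms(1), of a a] that by simp
  then show ?thesis using assms(1) self_centralizing unfolding centralizer_def by blast
qed

text \<open>Some \<open>y = x^(p^j)\<close> has \<open>y^l\<close> in \<open>A\<close> with
  \<open>l\<close> prime to \<open>p\<close>. Modulo a normal subgroup of index \<open>p^k\<close>,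
  \<open>y\<close> itself then lies in \<open>A\<close>, so it centralises \<open>A\<close> modulo
  all these subgroups. They intersect trivially, and \<open>A\<close> is self-centralising.\<close>

lemma prime_power_in_A:
  assumes x: "x \<in> carrier G"
  shows "\<exists>j::nat. x [^] (p ^ j) \<in> A"
proof -
  obtain m :: nat where m: "m > 0" "x [^] m \<in> A"
    by (rule finite_index_power[OF subgroup_A finite_index_if_fin_index[OF fin_index_A] x])
  obtain l where l: "m = p ^ multiplicity p m * l" "\<not> p dvd l"
    by (rule multiplicity_decompose'[of m p]) (use m p in \<open>auto intro: that\<close>)
  define y where "y = x [^] (p ^ multiplicity p m)"
  have yG: "y \<in> carrier G" using x by (simp add: y_def)
  have yl: "y [^] l \<in> A" using m(2) l(1) x by (simp add: y_def nat_pow_pow)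
  have "conj_by y a = a" if a: "a \<in> A" for a
  proof -
    have "conj_by y a \<otimes> inv a = \<one>"
    proof (rule p_residual_trivial)
      show "conj_by y a \<otimes> inv a \<in> carrier G" using yG a by simp
      fix N k assume N: "N \<lhd> G" "closedin T N" "card (rcosets N) = p ^ k"
      have sN: "subgroup N G" and conjN: "\<And>g x. g \<in> carrier G \<Longrightarrow> x \<in> N \<Longrightarrow> conj_by g x \<in> N"
        using N(1) by (auto simp: normal_iff_conj_by)
      have yN: "y [^] (p ^ k) \<in> N"
        by (rule power_card_rcosets_in[OF N(1,3) _ yG]) (use p prime_gt_0_nat in simp)
      have "coprime (int l) (int (p ^ k))"
        using prime_imp_coprime[OF p l(2)] by (simp add: coprime_commute)
      then obtain u v where uv: "u * int l + v * int (p ^ k) = 1"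
        using bezout_int[of "int l" "int (p ^ k)"] by auto
      define c where "c = y [^] (int l * u)"
      define n where "n = y [^] (int (p ^ k) * v)"
      have cA: "c \<in> A" using subgroup_int_pow_closed[OF subgroup_A yl, of u] yG
        by (simp add: c_def int_pow_pow[symmetric] int_pow_int)
      have nN: "n \<in> N" using subgroup_int_pow_closed[OF sN yN, of v] yG
        by (simp add: n_def int_pow_pow[symmetric] int_pow_int del: of_nat_power)
      have nG: "n \<in> carrier G" using nN subgroup.subset[OF sN] by blast
      have "c \<otimes> n = y [^] (int l * u + int (p ^ k) * v)" using yG by (simp add: c_def n_def int_pow_mult)
      also have "int l * u + int (p ^ k) * v = 1" using uv by (simp add: mult.commute)
      finally have y: "c \<otimes> n = y" using yG by simp
      define n' where "n' = n \<otimes> conj_by a (inv n)"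
      have n'N: "n' \<in> N" using nN conjN a sN by (simp add: n'_def subgroup.m_closed subgroup.m_inv_closed)
      have n'G: "n' \<in> carrier G" using n'N subgroup.subset[OF sN] by blast
      have "conj_by n a = n' \<otimes> a" using nG a by (simp add: conj_by_def n'_def m_assoc)
      then have "conj_by y a = conj_by c (n' \<otimes> a)" using y cA nG a conj_by_conj_by[of c n a] by simp
      also have "\<dots> = conj_by c n' \<otimes> a" using cA a n'G by (simp add: conj_by_mult conj_A_trivial)
      finally have "conj_by y a \<otimes> inv a = conj_by c n'" using cA a n'G by (simp add: m_assoc)
      then show "conj_by y a \<otimes> inv a \<in> N" using conjN n'N cA by simp
    qed
    then show ?thesis using inv_solve_right'[of \<one> "conj_by y a" a] yG a by simp
  qed
  then have "y \<in> A" by (rule centralizes_A[OF yG])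
  then show ?thesis unfolding y_def by blast
qed

sublocale Q: group "G Mod A" by (rule normal.factorgroup_is_group[OF normal_A])

lemma carrier_Mod: "carrier (G Mod A) = (\<lambda>x. A #> x) ` carrier G"
  by (auto simp: FactGroup_def RCOSETS_def)

lemma hom_Mod: "group_hom G (G Mod A) (\<lambda>x. A #> x)"
  using normal.r_coset_hom_Mod[OF normal_A] by (simp add: group_hom_def group_hom_axioms_def Q.is_group)

lemma coset_one_iff: "x \<in> carrier G \<Longrightarrow> A #> x = \<one>\<^bsub>G Mod A\<^esub> \<longleftrightarrow> x \<in> A"
  using coset_join1[OF _ _ subgroup_A, of x] coset_join2[OF _ subgroup_A, of x] by (auto simp: FactGroup_def)

lemma order_Mod: obtains r where "order (G Mod A) = p ^ r"
proof (rule Q.order_prime_power[OF _ p])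
  show "finite (carrier (G Mod A))" using fin_index_A by (simp add: carrier_Mod fin_index_def)
  fix C assume "C \<in> carrier (G Mod A)"
  then obtain x where x: "x \<in> carrier G" "C = A #> x" by (auto simp: carrier_Mod)
  obtain j :: nat where j: "x [^] (p ^ j) \<in> A" using prime_power_in_A[OF x(1)] by blast
  have "C [^]\<^bsub>G Mod A\<^esub> (p ^ j) = A #> (x [^] (p ^ j))"
    unfolding x(2) by (rule normal.FactGroup_pow[OF normal_A x(1)])
  then have "C [^]\<^bsub>G Mod A\<^esub> (p ^ j) = \<one>\<^bsub>G Mod A\<^esub>" using j x(1) coset_one_iff by simp
  then show "\<exists>j::nat. C [^]\<^bsub>G Mod A\<^esub> (p ^ j) = \<one>\<^bsub>G Mod A\<^esub>" by blast
qed (rule that)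

text \<open>The choice of the representative does not matter because \<open>A\<close> is abelian,
  see \<open>act_coset\<close>.\<close>

definition act :: "'a set \<Rightarrow> 'a \<Rightarrow> 'a" where
  "act C a = conj_by (SOME g. g \<in> C) a"

lemma act_coset:
  assumes g: "g \<in> carrier G" and a: "a \<in> A"
  shows "act (A #> g) a = conj_by g a"
proof -
  have "(SOME h. h \<in> A #> g) \<in> A #> g" using rcos_self[OF g subgroup_A] by (rule someI)
  then obtain c where c: "c \<in> A" "(SOME h. h \<in> A #> g) = c \<otimes> g" by (auto simp: r_coset_def)
  then have "act (A #> g) a = conj_by c (conj_by g a)" using g a by (simp add: act_def conj_by_conj_by)
  then show ?thesis using conj_A_trivial[OF c(1) conj_A[OF g a]] by simp
qed

text \<open>The cases of the proof follow the axioms of \<open>p_group_lattice\<close>. The decisive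
  one is the last: an invariant subgroup of \<open>A\<close> is normal in the preimage of
  \<open>M\<close>, and this preimage is \<open>G\<close> or a maximal subgroup of finite index,
  hence just infinite.\<close>

lemma p_group_lattice_A:
  assumes r: "order (G Mod A) = p ^ r"
  shows "p_group_lattice (G\<lparr>carrier := A\<rparr>) (G Mod A) act (subtopology T A) p r"
proof -
  interpret h: group_hom G "G Mod A" "\<lambda>x. A #> x" by (rule hom_Mod)
  interpret A: comm_group "G\<lparr>carrier := A\<rparr>"
    by (rule group.group_comm_groupI[OF subgroup_imp_group[OF subgroup_A]]) (use commute_A in auto)
  show ?thesis
  proof (rule p_group_lattice.intro[OF A.comm_group_axioms Q.is_group], rule p_group_lattice_axioms.intro, goal_cases)
    case 1
    then show ?case by (rule p)
  next
    case 2
    then show ?case by (rule r)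
  next
    case (3 C)
    then show ?case by (auto simp: carrier_Mod act_coset hom_def conj_by_mult conj_A subgroup.m_closed[OF subgroup_A])
  next
    case (4 C D a)
    then obtain g h where g: "g \<in> carrier G" "C = A #> g" "h \<in> carrier G" "D = A #> h" by (auto simp: carrier_Mod)
    have "C \<otimes>\<^bsub>G Mod A\<^esub> D = A #> (g \<otimes> h)" using g h.hom_mult[of g h] by simp
    then have "act (C \<otimes>\<^bsub>G Mod A\<^esub> D) a = act (A #> (g \<otimes> h)) a" by (simp only:)
    then show ?case using 4(3) g by (simp del: mult_FactGroup h.hom_mult add: act_coset conj_A conj_by_conj_by)
  next
    case (5 a)
    then show ?case using act_coset[of \<one> a] h.hom_one by simp
  next
    case (6 C)
    then obtain g where g: "g \<in> carrier G" "C = A #> g" by (auto simp: carrier_Mod)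
    then have "g \<in> A" using 6(2) by (intro centralizes_A) (auto simp: act_coset)
    then show ?case using g coset_one_iff by simp
  next
    case (7 a m)
    then have a: "a \<in> A" and am: "a [^] m = \<one>"
      using int_pow_consistent[OF subgroup_A, of a m] by simp_all
    have "a [^] nat \<bar>m\<bar> = \<one>"
    proof (cases "m \<ge> 0")
      case True
      then show ?thesis using am int_pow_int[of G a "nat m"] by simp
    next
      case False
      then have "inv (a [^] nat (- m)) = \<one>" using am a int_pow_neg[of a "int (nat (- m))"] int_pow_int[of G a "nat (- m)"] by simp
      then show ?thesis using False a by simp
    qed
    then show ?case using torsion_free_A[OF a, of "nat \<bar>m\<bar>"] 7(3) by simp
  next
    case (8 a)
    then have a: "a \<in> A" by simp
    \<comment> \<open>Powers with exponent \<open>p^k\<close> lie in every normal subgroup of index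
      \<open>p^k\<close>, so an element with roots of all these orders survives in none of the
      quotients.\<close>
    have "a = \<one>"
    proof (rule p_residual_trivial)
      fix N k assume N: "N \<lhd> G" "closedin T N" "card (rcosets N) = p ^ k"
      obtain c where c: "c \<in> A" "a = c [^]\<^bsub>G\<lparr>carrier := A\<rparr>\<^esub> (int p ^ k)" using 8(2)[of k] by auto
      have "a = c [^] (p ^ k)"
        using c int_pow_consistent[OF subgroup_A, of c "int p ^ k"] int_pow_int[of G c "p ^ k"] by simp
      then show "a \<in> N"
        using power_card_rcosets_in[OF N(1,3) _ A_carrier[OF c(1)]] p prime_gt_0_nat by simp
    qed (use a in simp)
    then show ?case by simp
  next
    case 9
    then show ?case by (rule topological_group_sub[OF subgroup_A])
  next
    case 10
    then show ?case by (rule Hausdorff_space_subtopology[OF Hausdorff])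
  next
    case 11
    from compact_or_discrete show ?case
    proof
      assume "compact_space T"
      then show ?thesis using closedin_compact_space[OF _ closed_A] compact_space_subtopology by blast
    next
      assume "T = discrete_topology (carrier G)"
      then show ?thesis using A_subset by (simp add: Int_absorb1)
    qed
  next
    case (12 C)
    then obtain g where g: "g \<in> carrier G" "C = A #> g" by (auto simp: carrier_Mod)
    have "continuous_map (subtopology T A) (subtopology T A) (conj_by g)"
      using continuous_map_from_subtopology[OF continuous_map_conj_by[OF g(1)]] conj_A[OF g(1)]
      by (intro continuous_map_into_subtopology) auto
    then show ?case by (rule continuous_map_eq) (use g act_coset A_subset in \<open>auto simp: topspace_eq\<close>)
  next
    case (13 M N)
    have N: "subgroup N G" "N \<subseteq> A" using 13(2) subgroup_sub_iff[OF subgroup_A] by auto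
    have cN: "closedin T N" using 13(3) closedin_closed_subtopology[OF closed_A] by blast
    define K where "K = {g \<in> carrier G. A #> g \<in> M}"
    have sM: "subgroup M (G Mod A)" using 13(1) Q.subgroup_self by (auto simp: maximal_in_def)
    have sK: "subgroup K G"
    proof (rule subgroupI)
      show "K \<noteq> {}"
        using subgroup.one_closed[OF sM] coset_one_iff[of \<one>] subgroup.one_closed[OF subgroup_A] by (auto simp: K_def)
      fix g h assume gh: "g \<in> K" "h \<in> K"
      have "(A #> g) \<otimes>\<^bsub>G Mod A\<^esub> (A #> h) \<in> M" using gh subgroup.m_closed[OF sM] by (simp only: K_def mem_Collect_eq)
      then show "g \<otimes> h \<in> K" using gh h.hom_mult[of g h] by (simp add: K_def)
    qed (auto simp: K_def h.hom_inv subgroup.m_inv_closed[OF sM])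
    have KG: "K \<subseteq> carrier G" by (auto simp: K_def)
    have AK: "A \<subseteq> K"
    proof
      fix a assume a: "a \<in> A"
      then have "A #> a = \<one>\<^bsub>G Mod A\<^esub>" using coset_one_iff by simp
      then show "a \<in> K" using a subgroup.one_closed[OF sM] by (simp add: K_def)
    qed
    have "JI K"
    proof (cases "M = carrier (G Mod A)")
      case True
      then have "K = carrier G" by (auto simp: K_def carrier_Mod)
      then show ?thesis using ji by simp
    next
      case False
      then have M: "maximal_in M (G Mod A)" using 13(1) by blast
      have MK: "M = (\<lambda>x. A #> x) ` K"
        using subgroup.subset[OF sM] by (auto simp: K_def carrier_Mod)
      have KL: "K = carrier G" if "M = carrier (G Mod A)" using that by (auto simp: K_def carrier_Mod)
      have "max_fin K"
        unfolding max_fin_def maximal_subgroup_def closed_subgroup_def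
      proof (intro conjI allI impI)
        show fiK: "fin_index K (carrier G)" by (rule fin_index_mono[OF fin_index_A subgroup_A sK AK subset_refl])
        show "subgroup K G" by (rule sK)
        show "closedin T K"
          by (rule closedin_overgroup[OF subgroup_A closed_A sK AK fin_index_sub[OF fin_index_A KG]])
        show "K \<noteq> carrier G" using False MK by (auto simp: carrier_Mod)
        fix L assume L: "(subgroup L G \<and> closedin T L) \<and> K \<subseteq> L"
        then have LG: "L \<subseteq> carrier G" and sL: "subgroup L G" using subgroup.subset by auto
        have sub: "subgroup ((\<lambda>x. A #> x) ` L) (G Mod A)" using sL by (rule h.subgroup_img_is_subgroup)
        have inL: "x \<in> L" if x: "x \<in> carrier G" "A #> x \<in> (\<lambda>x. A #> x) ` L" for x
        proof -
          obtain l where l: "l \<in> L" "A #> x = A #> l" using x(2) by blast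
          then have "x \<otimes> inv l \<in> A" using x(1) LG r_coset_eq_iff[OF subgroup_A, of x l] by blast
          then have "x \<otimes> inv l \<in> L" using AK L by blast
          then have "x \<otimes> inv l \<otimes> l \<in> L" using l(1) subgroup.m_closed[OF sL] by blast
          moreover have "x \<otimes> inv l \<otimes> l = x" using x(1) l(1) LG by (auto simp: m_assoc)
          ultimately show ?thesis by simp
        qed
        have "M \<subseteq> (\<lambda>x. A #> x) ` L" using MK L by blast
        then have "(\<lambda>x. A #> x) ` L = M \<or> (\<lambda>x. A #> x) ` L = carrier (G Mod A)"
          using M sub unfolding maximal_in_def by blast
        then show "L = K \<or> L = carrier G"
        proof
          assume "(\<lambda>x. A #> x) ` L = M"
          then have "L \<subseteq> K" using LG by (auto simp: K_def)
          then show ?thesis using L by blast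
        next
          assume "(\<lambda>x. A #> x) ` L = carrier (G Mod A)"
          then have "carrier G \<subseteq> L" using inL by (auto simp: carrier_Mod)
          then show ?thesis using LG by blast
        qed
      qed
      then show ?thesis by (rule max)
    qed
    moreover have "conj_by g x \<in> N" if "g \<in> K" "x \<in> N" for g x
      using 13(4)[of "A #> g" x] that N(2) act_coset[of g x] by (auto simp: K_def)
    ultimately have "fin_index N K"
      using 13(5) N AK by (intro JI_D[OF _ N(1) _ cN]) auto
    then have "fin_index N A" using AK by (rule fin_index_sub)
    then show ?case using finite_index_iff[OF A_subset] by (simp add: fin_index_def)
  qed
qed

text \<open>A normal subgroup that meets \<open>A\<close> trivially commutes with
  \<open>A \<inter> K\<close>. This contains a power of each element of \<open>A\<close>, and roots
  are unique, so the subgroup centralises \<open>A\<close> and therefore lies in it.\<close>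

lemma JI_if_rank_one:
  assumes rank: "\<And>N. subgroup N G \<Longrightarrow> N \<subseteq> A \<Longrightarrow> closedin T N \<Longrightarrow> N \<noteq> {\<one>} \<Longrightarrow> fin_index N A"
    and K: "subgroup K G" "closedin T K" "fin_index K (carrier G)"
  shows "JI K"
  unfolding JI_def
proof (intro conjI allI impI)
  show "infinite K" using fin_index_finite[OF K(3) _ K(1) subset_refl] ji by (auto simp: JI_def)
  fix N assume "subgroup N G \<and> N \<subseteq> K \<and> closedin T N \<and> (\<forall>g\<in>K. \<forall>x\<in>N. conj_by g x \<in> N) \<and> N \<noteq> {\<one>}"
  then have N: "subgroup N G" "N \<subseteq> K" "closedin T N" "\<And>g x. g \<in> K \<Longrightarrow> x \<in> N \<Longrightarrow> conj_by g x \<in> N" "N \<noteq> {\<one>}"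
    by auto
  have KG: "K \<subseteq> carrier G" using K(1) by (rule subgroup.subset)
  have sNA: "subgroup (N \<inter> A) G" by (rule subgroups_Inter_pair[OF N(1) subgroup_A])
  have "N \<inter> A \<noteq> {\<one>}"
  proof
    assume NA: "N \<inter> A = {\<one>}"
    have "n = \<one>" if n: "n \<in> N" for n
    proof -
      have nG: "n \<in> carrier G" using n N(2) KG by blast
      have comm: "n \<otimes> b = b \<otimes> n" if "b \<in> A \<inter> K" for b
      proof (rule commute_if_disjoint[OF N(1) subgroups_Inter_pair[OF subgroup_A K(1)] _ _ _ n that])
        show "N \<inter> (A \<inter> K) = {\<one>}" using NA N(2) by blast
        show "conj_by k n' \<in> N" if "k \<in> A \<inter> K" "n' \<in> N" for k n' using that N(4) by blast
        show "conj_by n' k \<in> A \<inter> K" if "k \<in> A \<inter> K" "n' \<in> N" for k n'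
        proof -
          have "n' \<in> K" "k \<in> K" "k \<in> A" using that N(2) by auto
          moreover have "conj_by n' k \<in> K"
            using calculation K(1) by (simp add: conj_by_def subgroup.m_closed subgroup.m_inv_closed)
          ultimately show ?thesis using conj_A KG by blast
        qed
      qed
      have "conj_by n a = a" if a: "a \<in> A" for a
      proof -
        obtain m :: nat where m: "m > 0" "a [^] m \<in> K"
          by (rule finite_index_power[OF K(1) finite_index_if_fin_index[OF K(3)] A_carrier[OF a]])
        have am: "a [^] m \<in> A"
          using subgroup_int_pow_closed[OF subgroup_A a, of "int m"] by (simp add: int_pow_int)
        have c: "conj_by n a \<in> A" by (rule conj_A[OF nG a])
        have "conj_by n (a [^] m) = a [^] m" using comm[of "a [^] m"] am m(2) nG a conj_by_eq_iff[of n "a [^] m" "a [^] m"] by simp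
        then have eq: "conj_by n a [^] m = a [^] m" using nG a by (simp add: conj_by_nat_pow)
        have iA: "inv a \<in> A" using a by (rule subgroup.m_inv_closed[OF subgroup_A])
        have "(conj_by n a \<otimes> inv a) [^] m = conj_by n a [^] m \<otimes> inv a [^] m"
          by (rule pow_mult_distrib) (use commute_A[OF c iA] c iA in simp_all)
        then have "(conj_by n a \<otimes> inv a) [^] m = \<one>" using eq a by (simp add: nat_pow_inv)
        then have "conj_by n a \<otimes> inv a = \<one>"
          using torsion_free_A[OF subgroup.m_closed[OF subgroup_A c iA] m(1)] by blast
        then show ?thesis using inv_solve_right'[of \<one> "conj_by n a" a] nG a by simp
      qed
      then have "n \<in> A" by (rule centralizes_A[OF nG])
      then show ?thesis using n NA by blast
    qed
    then show False using N(5) subgroup.one_closed[OF N(1)] by blast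
  qed
  then have "fin_index (N \<inter> A) A" by (intro rank sNA closedin_Int[OF N(3) closed_A]) auto
  then have "fin_index (N \<inter> A) (carrier G)" by (rule fin_index_trans[OF _ fin_index_A sNA subgroup_A subgroup_self])
  then have "fin_index N (carrier G)" by (rule fin_index_mono[OF _ sNA N(1) _ subset_refl]) blast
  then show "fin_index N K" using KG by (rule fin_index_sub)
qed

end

section \<open>Coordinates of a p-adic lattice\<close>

lemma const_dvd_iff_coeffs:
  fixes f :: "int poly"
  assumes "degree f < q"
  shows "[:m:] dvd f \<longleftrightarrow> (\<forall>i<q. m dvd coeff f i)"
proof -
  have "coeff f i = 0" if "\<not> i < q" for i using that assms by (simp add: coeff_eq_0)
  then show ?thesis unfolding const_poly_dvd_iff by (metis dvd_0_right)
qed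

text \<open>The vectors \<open>a, h a, ..., h^(q-1) a\<close> behave as a basis over the p-adic
  integers, with generation and independence both stated modulo every \<open>p^k\<close>.\<close>

locale padic_basis = p_group_lattice +
  fixes h :: "'a \<Rightarrow> 'a" and a :: 'a and q :: nat
  assumes hom_h: "h \<in> hom A A" and a: "a \<in> carrier A" and q: "q > 0"
    and generating: "v \<in> carrier A \<Longrightarrow> \<exists>f. \<exists>u\<in>pmul k. degree f < q \<and> v = A.poly_act h f a \<otimes> u"
    and independent: "degree f < q \<Longrightarrow> A.poly_act h f a \<in> pmul k \<Longrightarrow> [:int p ^ k:] dvd f"
begin

definition approx :: "'a \<Rightarrow> nat \<Rightarrow> int poly \<Rightarrow> bool" where
  "approx v k f \<longleftrightarrow> degree f < q \<and> inv (A.poly_act h f a) \<otimes> v \<in> pmul k"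

text \<open>The chosen polynomial is determined only modulo \<open>p^k\<close>; reducing its
  coefficient removes the ambiguity, see \<open>coord_eq\<close>.\<close>

definition coord :: "'a \<Rightarrow> nat \<Rightarrow> nat \<Rightarrow> int" where
  "coord v i k = coeff (SOME f. approx v k f) i mod int p ^ k"

definition poly_of :: "(nat \<Rightarrow> int) \<Rightarrow> int poly" where
  "poly_of c = (\<Sum>i<q. monom (c i) i)"

lemma pa [simp]: "A.poly_act h f a \<in> carrier A" using hom_h a by simp

lemma coeff_poly_of: "coeff (poly_of c) i = (if i < q then c i else 0)"
  by (simp add: poly_of_def coeff_sum)

lemma degree_poly_of: "degree (poly_of c) < q"
proof -
  have "degree (poly_of c) \<le> q - 1" by (rule degree_le) (use q in \<open>auto simp: coeff_poly_of\<close>)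
  then show ?thesis using q by simp
qed

lemma pmul_if_dvd: "[:int p ^ k:] dvd f \<Longrightarrow> A.poly_act h f a \<in> pmul k"
  using hom_h a by (auto elim!: dvdE simp: A.poly_act_const_mult pmul_I simp del: mult_pCons_left)

lemma ex_approx: "v \<in> carrier A \<Longrightarrow> \<exists>f. approx v k f"
proof -
  assume v: "v \<in> carrier A"
  obtain f u where f: "u \<in> pmul k" "degree f < q" "v = A.poly_act h f a \<otimes> u" using generating[OF v] by blast
  have "inv (A.poly_act h f a) \<otimes> v = u" using pmul_closed[OF f(1)] by (simp add: f(3) A.m_assoc[symmetric])
  then have "approx v k f" using f by (simp add: approx_def)
  then show ?thesis by blast
qed

text \<open>For \<open>v = w\<close> this is uniqueness of approximations modulo \<open>p^k\<close>;
  in general it makes coordinates detect congruence modulo \<open>pmul k\<close>.\<close>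

lemma approx_diff:
  assumes "v \<in> carrier A" "w \<in> carrier A" "approx v k f" "approx w k g"
  shows "v \<otimes> inv w \<in> pmul k \<longleftrightarrow> [:int p ^ k:] dvd f - g"
proof -
  let ?f = "A.poly_act h f a" and ?g = "A.poly_act h g a"
  have u: "inv ?f \<otimes> v \<in> pmul k" "inv ?g \<otimes> w \<in> pmul k" using assms(3,4) by (simp_all add: approx_def)
  have deg: "degree (f - g) < q" using assms(3,4) by (auto simp: approx_def intro: degree_diff_less)
  let ?e = "(inv ?f \<otimes> v) \<otimes> inv (inv ?g \<otimes> w)"
  have e: "?e \<in> pmul k" using u pmul_mult pmul_inv by blast
  have cl: "?f \<in> carrier A" "?g \<in> carrier A" by simp_all
  have "v \<otimes> inv w = (?f \<otimes> inv ?g) \<otimes> ?e"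
  proof -
    have "(?f \<otimes> inv ?g) \<otimes> ?e = (?f \<otimes> inv ?f) \<otimes> (inv ?g \<otimes> ?g) \<otimes> (v \<otimes> inv w)"
      using cl assms(1,2) by (simp only: A.inv_mult A.inv_closed A.m_closed A.inv_inv A.m_ac)
    then show ?thesis using cl assms(1,2) by simp
  qed
  then have eq: "v \<otimes> inv w = A.poly_act h (f - g) a \<otimes> ?e" using hom_h a by (simp add: A.poly_act_diff)
  show ?thesis
  proof
    assume "v \<otimes> inv w \<in> pmul k"
    then have "A.poly_act h (f - g) a \<otimes> ?e \<otimes> inv ?e \<in> pmul k" using eq e pmul_mult pmul_inv by metis
    moreover have "A.poly_act h (f - g) a \<otimes> ?e \<otimes> inv ?e = A.poly_act h (f - g) a"
      using pmul_closed[OF e] by (simp only: A.m_assoc A.r_inv A.inv_closed pa A.r_one)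
    ultimately show "[:int p ^ k:] dvd f - g" using independent[OF deg] by simp
  next
    assume "[:int p ^ k:] dvd f - g"
    then show "v \<otimes> inv w \<in> pmul k" unfolding eq by (intro pmul_mult pmul_if_dvd e)
  qed
qed

lemma coord_eq:
  assumes v: "v \<in> carrier A" and f: "approx v k f" and i: "i < q"
  shows "coord v i k = coeff f i mod int p ^ k"
proof -
  let ?g = "SOME f. approx v k f"
  have g: "approx v k ?g" using f by (rule someI)
  have "[:int p ^ k:] dvd ?g - f" using approx_diff[OF v v g f] one_in_pmul v by simp
  then have "int p ^ k dvd coeff (?g - f) i" unfolding const_poly_dvd_iff by blast
  then show ?thesis unfolding coord_def by (simp add: mod_eq_dvd_iff)
qed

lemma coord_eq_iff:
  assumes v: "v \<in> carrier A" "w \<in> carrier A"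
  shows "(\<forall>i<q. coord v i k = coord w i k) \<longleftrightarrow> v \<otimes> inv w \<in> pmul k"
proof -
  obtain f g where fg: "approx v k f" "approx w k g" using ex_approx v by blast
  have deg: "degree (f - g) < q" using fg by (auto simp: approx_def intro: degree_diff_less)
  have "(\<forall>i<q. coord v i k = coord w i k) \<longleftrightarrow> (\<forall>i<q. int p ^ k dvd coeff (f - g) i)"
    using coord_eq[OF v(1) fg(1)] coord_eq[OF v(2) fg(2)] by (simp add: mod_eq_dvd_iff)
  then show ?thesis unfolding approx_diff[OF v fg] const_dvd_iff_coeffs[OF deg] .
qed

lemma coord_range: "coord v i k \<in> {0..<int p ^ k}"
  using p_gt_1 by (simp add: coord_def)

lemma coord_mult:
  assumes v: "v \<in> carrier A" "w \<in> carrier A" and i: "i < q"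
  shows "coord (v \<otimes> w) i k = (coord v i k + coord w i k) mod int p ^ k"
proof -
  obtain f g where fg: "approx v k f" "approx w k g" using ex_approx v by blast
  let ?f = "A.poly_act h f a" and ?g = "A.poly_act h g a"
  have "(inv ?f \<otimes> v) \<otimes> (inv ?g \<otimes> w) \<in> pmul k" using fg pmul_mult by (simp add: approx_def)
  moreover have "(inv ?f \<otimes> v) \<otimes> (inv ?g \<otimes> w) = inv (A.poly_act h (f + g) a) \<otimes> (v \<otimes> w)"
    unfolding A.poly_act_add[OF hom_h a] using v by (simp add: A.inv_mult A.m_ac)
  ultimately have "approx (v \<otimes> w) k (f + g)" using fg by (simp add: approx_def degree_add_less)
  then show ?thesis using coord_eq[OF _ _ i] fg v by (simp add: mod_add_eq)
qed

lemma coord_coherent: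
  assumes v: "v \<in> carrier A" and i: "i < q"
  shows "coord v i (Suc k) mod int p ^ k = coord v i k"
proof -
  obtain f where f: "approx v (Suc k) f" using ex_approx v by blast
  have "approx v k f" using f pmul_mono[of k "Suc k"] by (simp add: approx_def)
  then have "coord v i k = coeff f i mod int p ^ k" by (rule coord_eq[OF v _ i])
  moreover have "coord v i (Suc k) = coeff f i mod int p ^ Suc k" by (rule coord_eq[OF v f i])
  moreover have "(coeff f i mod int p ^ Suc k) mod int p ^ k = coeff f i mod int p ^ k"
    by (rule mod_mod_cancel) simp
  ultimately show ?thesis by simp
qed

lemma approx_cong:
  assumes v: "v \<in> carrier A" and f: "approx v k f" and g: "degree g < q" "[:int p ^ k:] dvd f - g"
  shows "approx v k g"
proof -
  let ?f = "A.poly_act h f a" and ?g = "A.poly_act h g a"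
  have "A.poly_act h (f - g) a \<otimes> (inv ?f \<otimes> v) \<in> pmul k"
    using f pmul_if_dvd[OF g(2)] pmul_mult by (simp add: approx_def)
  moreover have "A.poly_act h (f - g) a \<otimes> (inv ?f \<otimes> v) = inv ?g \<otimes> v"
  proof -
    have "A.poly_act h (f - g) a \<otimes> (inv ?f \<otimes> v) = (?f \<otimes> inv ?f) \<otimes> (inv ?g \<otimes> v)"
      unfolding A.poly_act_diff[OF hom_h a] using v by (simp only: A.m_ac A.inv_closed A.m_closed pa)
    then show ?thesis using v by simp
  qed
  ultimately show ?thesis using g(1) by (simp add: approx_def)
qed

lemma approx_poly_of:
  assumes v: "v \<in> carrier A" and c: "\<And>i. i < q \<Longrightarrow> c i = coord v i k"
  shows "approx v k (poly_of c)"
proof -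
  obtain f where f: "approx v k f" using ex_approx v by blast
  have deg: "degree (f - poly_of c) < q" using f degree_poly_of by (auto simp: approx_def intro: degree_diff_less)
  have "[:int p ^ k:] dvd f - poly_of c"
    unfolding const_dvd_iff_coeffs[OF deg] using coord_eq[OF v f] c
    by (simp add: coeff_poly_of)
  then show ?thesis by (rule approx_cong[OF v f degree_poly_of])
qed

lemma closedin_approx: "closedin T {v \<in> carrier A. approx v k f}"
  using closedin_left_translate[OF _ closedin_pmul, of "inv (A.poly_act h f a)" k]
  by (cases "degree f < q") (simp_all add: approx_def)

text \<open>Every subset of the discrete target is closed, and its preimage is a finite union of the
  closed sets from \<open>closedin_approx\<close>, one for each tuple of residues.\<close>

lemma continuous_coord:
  assumes i: "i < q"
  shows "continuous_map T (discrete_topology {0..<int p ^ k}) (\<lambda>v. coord v i k)"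
  unfolding continuous_map_closedin
proof (intro conjI allI impI)
  show "(\<lambda>v. coord v i k) \<in> topspace T \<rightarrow> topspace (discrete_topology {0..<int p ^ k})"
    using coord_range by (auto simp del: atLeastLessThan_iff)
  fix S
  let ?Z = "{c \<in> PiE {..<q} (\<lambda>_. {0..<int p ^ k}). c i \<in> S}"
  have "{v \<in> topspace T. coord v i k \<in> S} = (\<Union>c\<in>?Z. {v \<in> carrier A. approx v k (poly_of c)})"
  proof (intro subset_antisym subsetI)
    fix v assume v: "v \<in> {v \<in> topspace T. coord v i k \<in> S}"
    then have vA: "v \<in> carrier A" by (simp add: topspace_eq)
    let ?c = "\<lambda>j\<in>{..<q}. coord v j k"
    have "approx v k (poly_of ?c)" by (rule approx_poly_of[OF vA]) simp
    moreover have "?c \<in> ?Z" using v i coord_range by (simp del: atLeastLessThan_iff)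
    ultimately show "v \<in> (\<Union>c\<in>?Z. {v \<in> carrier A. approx v k (poly_of c)})" using vA by blast
  next
    fix v assume "v \<in> (\<Union>c\<in>?Z. {v \<in> carrier A. approx v k (poly_of c)})"
    then obtain c where c: "c \<in> ?Z" and v: "v \<in> carrier A" "approx v k (poly_of c)" by blast
    have "c i \<in> {0..<int p ^ k}" using c i by blast
    then have "coord v i k = c i" using coord_eq[OF v i] i by (simp add: coeff_poly_of)
    then show "v \<in> {v \<in> topspace T. coord v i k \<in> S}" using c v by (simp add: topspace_eq)
  qed
  moreover have "finite ?Z" by (simp add: finite_PiE)
  ultimately show "closedin T {v \<in> topspace T. coord v i k \<in> S}"
    using closedin_approx by (simp only:) (intro closedin_Union, auto)
qed

lemma finite_index_pmul: "finite_index (pmul k) A"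
proof -
  have "A.fin_index (pmul k) (carrier A)"
  proof (rule A.fin_indexI[OF subgroup_pmul subset_refl, where f = "\<lambda>v. \<lambda>i\<in>{..<q}. coord v i k"])
    have "(\<lambda>v. \<lambda>i\<in>{..<q}. coord v i k) ` carrier A \<subseteq> PiE {..<q} (\<lambda>_. {0..<int p ^ k})"
      using coord_range by (auto simp del: atLeastLessThan_iff)
    then show "finite ((\<lambda>v. \<lambda>i\<in>{..<q}. coord v i k) ` carrier A)"
      by (rule finite_subset) (simp add: finite_PiE)
    fix v w assume vw: "v \<in> carrier A" "w \<in> carrier A"
      and eq: "(\<lambda>i\<in>{..<q}. coord v i k) = (\<lambda>i\<in>{..<q}. coord w i k)"
    have "coord v i k = coord w i k" if "i < q" for i using fun_cong[OF eq, of i] that by simp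
    then show "v \<otimes> inv w \<in> pmul k" using coord_eq_iff[OF vw] by blast
  qed
  then show ?thesis using A.finite_index_iff[of "carrier A" "pmul k"] by (simp add: A.fin_index_def)
qed

text \<open>The closed sets \<open>pmul k - N\<close> decrease and have empty intersection, because
  only the identity lies in all \<open>pmul k\<close>. By compactness one of them is empty.\<close>

lemma pmul_subset_if_open:
  assumes compact: "compact_space T" and N: "openin T N" "\<one> \<in> N"
  obtains k where "pmul k \<subseteq> N"
proof -
  have "\<exists>k. pmul k - N = {}"
  proof (rule ccontr)
    assume ne: "\<nexists>k. pmul k - N = {}"
    have "(\<Inter>k. pmul k - N) \<noteq> {}"
    proof (rule compact_space_imp_nest[OF compact])
      show "closedin T (pmul k - N)" for k by (rule closedin_diff[OF closedin_pmul N(1)])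
      show "pmul k - N \<noteq> {}" for k using ne by blast
      show "decseq (\<lambda>k. pmul k - N)" using pmul_mono by (auto simp: decseq_def)
    qed
    then obtain v where v: "\<And>k. v \<in> pmul k - N" by blast
    then have "v = \<one>" using pmul_closed by (intro residual_pmul) blast+
    then show False using v N(2) by blast
  qed
  then show ?thesis using that by blast
qed

definition coords :: "'a \<Rightarrow> nat \<Rightarrow> nat \<Rightarrow> int" where
  "coords v = (\<lambda>i\<in>{..<q}. coord v i)"

lemma carrier_product: "carrier (product_group {..<q} (\<lambda>_. padic_int_group p)) = PiE {..<q} (\<lambda>_. padic_int_carrier p)"
  by (simp add: padic_int_group_def)

lemma coord_in_padic_int: "v \<in> carrier A \<Longrightarrow> i < q \<Longrightarrow> coord v i \<in> padic_int_carrier p"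
  using coord_range p_gt_1 by (simp add: padic_int_carrier_def carrier_integer_mod_group coord_coherent del: atLeastLessThan_iff)

text \<open>Surjectivity is completeness: a coherent family of residues prescribes nested closed
  sets, which have a common point by compactness.\<close>

lemma bij_coords:
  assumes compact: "compact_space T"
  shows "bij_betw coords (carrier A) (PiE {..<q} (\<lambda>_. padic_int_carrier p))"
  unfolding bij_betw_def
proof (intro conjI inj_onI subset_antisym subsetI)
  fix v w assume vw: "v \<in> carrier A" "w \<in> carrier A" and eq: "coords v = coords w"
  have "coord v i k = coord w i k" if "i < q" for i k
    using fun_cong[OF fun_cong[OF eq, of i], of k] that by (simp add: coords_def)
  then have "v \<otimes> inv w \<in> pmul k" for k using coord_eq_iff[OF vw] by blast
  then have "v \<otimes> inv w = \<one>" using vw by (intro residual_pmul) simp_all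
  then show "v = w" using vw A.inv_solve_right'[of \<one> v w] by simp
next
  fix z assume "z \<in> coords ` carrier A"
  then show "z \<in> PiE {..<q} (\<lambda>_. padic_int_carrier p)" using coord_in_padic_int by (auto simp: coords_def)
next
  fix z assume z: "z \<in> PiE {..<q} (\<lambda>_. padic_int_carrier p)"
  have zi: "z i k \<in> {0..<int p ^ k}" "z i (Suc k) mod int p ^ k = z i k" if "i < q" for i k
    using PiE_mem[OF z, of i] that p_gt_1
    by (simp_all add: padic_int_carrier_def carrier_integer_mod_group del: atLeastLessThan_iff)
  define C where "C k = {v \<in> carrier A. approx v k (poly_of (\<lambda>i. z i k))}" for k
  have "(\<Inter>k. C k) \<noteq> {}"
  proof (rule compact_space_imp_nest[OF compact])
    show "closedin T (C k)" for k unfolding C_def by (rule closedin_approx)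
    have "A.poly_act h (poly_of (\<lambda>i. z i k)) a \<in> C k" for k
      using one_in_pmul degree_poly_of by (simp add: C_def approx_def)
    then show "C k \<noteq> {}" for k by blast
    show "decseq C"
    proof (rule decseq_SucI, rule subsetI)
      fix k v assume v: "v \<in> C (Suc k)"
      let ?f = "poly_of (\<lambda>i. z i (Suc k))" and ?g = "poly_of (\<lambda>i. z i k)"
      have "approx v k ?f" using v pmul_mono[of k "Suc k"] by (simp add: C_def approx_def)
      moreover have deg: "degree (?f - ?g) < q" by (intro degree_diff_less degree_poly_of)
      have "[:int p ^ k:] dvd ?f - ?g"
        unfolding const_dvd_iff_coeffs[OF deg] using zi(2)
        by (simp add: coeff_poly_of) (metis mod_eq_dvd_iff mod_mod_trivial)
      ultimately show "v \<in> C k" using v approx_cong[of v k ?f ?g] degree_poly_of by (simp add: C_def)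
    qed
  qed
  then obtain v where v: "\<And>k. v \<in> C k" by blast
  then have vA: "v \<in> carrier A" by (auto simp: C_def)
  have "coord v i = z i" if i: "i < q" for i
  proof
    fix k
    have "coord v i k = coeff (poly_of (\<lambda>i. z i k)) i mod int p ^ k"
      using v[of k] by (intro coord_eq[OF vA _ i]) (simp add: C_def)
    then show "coord v i k = z i k" using zi(1)[OF i, of k] i by (simp add: coeff_poly_of)
  qed
  then have "coords v = z" using z by (auto simp: coords_def PiE_iff extensional_def fun_eq_iff)
  then show "z \<in> coords ` carrier A" using vA by blast
qed

lemma coords_iso:
  assumes "compact_space T"
  shows "coords \<in> iso A (product_group {..<q} (\<lambda>_. padic_int_group p))"
proof (rule isoI)
  show "coords \<in> hom A (product_group {..<q} (\<lambda>_. padic_int_group p))"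
  proof (rule homI)
    fix v w assume vw: "v \<in> carrier A" "w \<in> carrier A"
    then show "coords v \<in> carrier (product_group {..<q} (\<lambda>_. padic_int_group p))"
      unfolding carrier_product using coord_in_padic_int by (auto simp: coords_def)
    show "coords (v \<otimes> w) = coords v \<otimes>\<^bsub>product_group {..<q} (\<lambda>_. padic_int_group p)\<^esub> coords w"
      using coord_mult[OF vw] by (auto simp: coords_def padic_int_group_def fun_eq_iff product_group_def)
  qed
  show "bij_betw coords (carrier A) (carrier (product_group {..<q} (\<lambda>_. padic_int_group p)))"
    unfolding carrier_product by (rule bij_coords[OF assms])
qed

lemma coords_homeomorphic:
  assumes compact: "compact_space T"
  shows "homeomorphic_map T (product_topology (\<lambda>_. padic_int_topology p) {..<q}) coords"
proof (rule continuous_imp_homeomorphic_map[OF _ compact])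
  have top: "topspace (product_topology (\<lambda>_. padic_int_topology p) {..<q}) = PiE {..<q} (\<lambda>_. padic_int_carrier p)"
    by (simp add: topspace_padic_int_topology padic_int_group_def)
  have mod: "carrier (integer_mod_group (p ^ k)) = {0..<int p ^ k}" for k
    using p_gt_1 by (simp add: carrier_integer_mod_group)
  have one: "continuous_map T (padic_int_topology p) (\<lambda>v. coords v i)" if "i < q" for i
    unfolding padic_int_topology_def continuous_map_in_subtopology continuous_map_componentwise_UNIV mod
    using that coord_in_padic_int continuous_coord by (auto simp: coords_def topspace_eq)
  show "continuous_map T (product_topology (\<lambda>_. padic_int_topology p) {..<q}) coords"
    unfolding continuous_map_componentwise using one by (auto simp: coords_def)
  have "Hausdorff_space (padic_int_topology p)"
    unfolding padic_int_topology_def by (intro Hausdorff_space_subtopology) (simp add: Hausdorff_space_product_topology)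
  then show "Hausdorff_space (product_topology (\<lambda>_. padic_int_topology p) {..<q})"
    by (simp add: Hausdorff_space_product_topology)
  show "coords ` topspace T = topspace (product_topology (\<lambda>_. padic_int_topology p) {..<q})"
    unfolding top topspace_eq using bij_coords[OF compact] by (simp add: bij_betw_def)
  show "inj_on coords (topspace T)"
    unfolding topspace_eq using bij_coords[OF compact] by (simp add: bij_betw_def)
qed

end

section \<open>Recognition of the quaternionic type\<close>

lemma (in group) iso_Q16:
  assumes b: "b \<in> carrier G" "ord b = 8" and x: "x \<in> carrier G" "x \<notin> cyc b"
    and gen: "carrier G = cyc b \<union> (\<lambda>c. c \<otimes> x) ` cyc b"
    and xx: "x \<otimes> x = b [^] (4::nat)" and inv: "conj_by x b = inv b"
  shows "G \<cong> Q16"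
proof -
  define \<phi> where "\<phi> = (\<lambda>(i::int, j::int). if j = 0 then b [^] i else b [^] i \<otimes> x)"
  have pow_eq: "b [^] i = b [^] j \<longleftrightarrow> 8 dvd j - i" for i j :: int
    using int_pow_eq[OF b(1), of i j] b(2) by simp
  have pow_mod: "b [^] (i mod 8) = b [^] (i::int)" for i
    unfolding pow_eq by (rule dvd_minus_mod)
  have xb: "x \<otimes> b [^] i = b [^] (- i) \<otimes> x" for i :: int
  proof -
    have "conj_by x (b [^] i) = b [^] (- i)" using b x inv by (simp add: conj_by_int_pow int_pow_neg int_pow_inv)
    then show ?thesis using b x conj_by_eq_iff[of x "b [^] i" "b [^] (- i)"] by simp
  qed
  have xx': "x \<otimes> x = b [^] (4::int)" using xx int_pow_int[of G b 4] by simp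
  have pc: "b [^] i \<in> carrier G" for i :: int using b by simp
  have padd: "b [^] i \<otimes> b [^] j = b [^] (i + j)" for i j :: int using b by (simp add: int_pow_mult)
  have "\<phi> \<in> iso Q16 G"
  proof (rule isoI)
    show "\<phi> \<in> hom Q16 G"
    proof (rule homI)
      show "\<phi> u \<in> carrier G" for u using b x by (auto simp: \<phi>_def split: prod.split)
      fix u v assume "u \<in> carrier Q16" "v \<in> carrier Q16"
      then obtain i j k l where uv: "u = (i, j)" "v = (k, l)" "j = 0 \<or> j = 1" "l = 0 \<or> l = 1"
        by (auto simp: carrier_Q16)
      consider "j = 0" "l = 0" | "j = 0" "l = 1" | "j = 1" "l = 0" | "j = 1" "l = 1" using uv by blast
      then show "\<phi> (u \<otimes>\<^bsub>Q16\<^esub> v) = \<phi> u \<otimes> \<phi> v"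
      proof cases
        case 1
        then show ?thesis by (simp add: uv(1,2) \<phi>_def Q16_def pow_mod padd)
      next
        case 2
        then show ?thesis using m_assoc[OF pc pc x(1), of i k] by (simp add: uv(1,2) \<phi>_def Q16_def pow_mod padd)
      next
        case 3
        have "b [^] i \<otimes> x \<otimes> b [^] k = b [^] i \<otimes> b [^] (- k) \<otimes> x"
          unfolding m_assoc[OF pc x(1) pc] xb m_assoc[OF pc pc x(1)] ..
        then show ?thesis using 3 by (simp add: uv(1,2) \<phi>_def Q16_def pow_mod padd)
      next
        case 4
        have "b [^] i \<otimes> x \<otimes> (b [^] k \<otimes> x) = b [^] i \<otimes> (x \<otimes> b [^] k) \<otimes> x"
          using pc x(1) by (simp add: m_assoc)
        also have "\<dots> = b [^] i \<otimes> b [^] (- k) \<otimes> (x \<otimes> x)" unfolding xb using pc x(1) by (simp add: m_assoc)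
        also have "\<dots> = b [^] (i - k + 4)" unfolding xx' by (simp add: padd)
        finally show ?thesis using 4 by (simp add: uv(1,2) \<phi>_def Q16_def pow_mod)
      qed
    qed
    show "bij_betw \<phi> (carrier Q16) (carrier G)"
      unfolding bij_betw_def
    proof (intro conjI inj_onI subset_antisym subsetI)
      fix u v assume u: "u \<in> carrier Q16" and v: "v \<in> carrier Q16" and eq: "\<phi> u = \<phi> v"
      obtain i j k l where uv: "u = (i, j)" "v = (k, l)" "j = 0 \<or> j = 1" "l = 0 \<or> l = 1"
        "0 \<le> i" "i < 8" "0 \<le> k" "k < 8"
        using u v by (auto simp: carrier_Q16)
      have nx: "b [^] m \<noteq> b [^] n \<otimes> x" for m n :: int
      proof
        assume "b [^] m = b [^] n \<otimes> x"
        then have "b [^] (- n) \<otimes> b [^] m = b [^] (- n) \<otimes> b [^] n \<otimes> x" using m_assoc[OF pc pc x(1), of "- n" n] by simp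
        then have "b [^] (- n + m) = x" using x(1) by (simp add: padd)
        then show False using x(2) cyc_I by metis
      qed
      have "j = l" using eq uv(3,4) nx nx[symmetric] by (auto simp: uv(1,2) \<phi>_def)
      then have "b [^] i = b [^] k" using eq uv(3) x(1) pc right_cancel[OF x(1) pc pc] by (auto simp: uv(1,2) \<phi>_def split: if_splits)
      then have "i = k" unfolding pow_eq using uv by presburger
      then show "u = v" using \<open>j = l\<close> uv by simp
    next
      fix g assume "g \<in> \<phi> ` carrier Q16"
      then show "g \<in> carrier G" using b x by (auto simp: \<phi>_def split: prod.splits)
    next
      fix g assume "g \<in> carrier G"
      then obtain i :: int where "g = b [^] i \<or> g = b [^] i \<otimes> x" unfolding gen by (auto simp: cyc_def)
      then have "g = \<phi> (i mod 8, 0) \<or> g = \<phi> (i mod 8, 1)" by (simp add: \<phi>_def pow_mod)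
      moreover have "(i mod 8, 0) \<in> carrier Q16" "(i mod 8, 1) \<in> carrier Q16" by (simp_all add: carrier_Q16)
      ultimately show "g \<in> \<phi> ` carrier Q16" by blast
    qed
  qed
  then have "Q16 \<cong> G" by (rule is_isoI)
  then show ?thesis by (rule group.iso_sym[OF group_Q16])
qed

text \<open>The complement is a finite union of closed cosets.\<close>

lemma (in hausdorff_group) openin_if_fin_index:
  assumes K: "subgroup K G" "closedin T K" "fin_index K (carrier G)"
  shows "openin T K"
proof -
  have KG: "K \<subseteq> carrier G" using K(1) by (rule subgroup.subset)
  let ?C = "(\<lambda>x. K #> x) ` (carrier G - K)"
  have "finite ?C" using K(3) unfolding fin_index_def by (rule finite_subset[rotated]) blast
  then have "closedin T (\<Union>?C)" by (intro closedin_Union) (use closedin_r_coset[OF _ K(2)] in auto)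
  moreover have "carrier G - K = \<Union>?C"
  proof (intro subset_antisym subsetI)
    fix y assume "y \<in> carrier G - K"
    then show "y \<in> \<Union>?C" using rcos_self[OF _ K(1)] by blast
  next
    fix y assume "y \<in> \<Union>?C"
    then obtain x k where x: "x \<in> carrier G" "x \<notin> K" "k \<in> K" "y = k \<otimes> x" by (auto simp: r_coset_def)
    have "x = inv k \<otimes> y" using x KG by (auto simp: m_assoc[symmetric])
    then have "y \<notin> K" using x(2,3) subgroup.m_closed[OF K(1) subgroup.m_inv_closed[OF K(1) x(3)]] by metis
    then show "y \<in> carrier G - K" using x KG by auto
  qed
  ultimately show ?thesis using KG topspace_eq openin_closedin_eq[of T K] by simp
qed

context ji_virtually_abelian
begin

lemma residually_fin: residually_fin
  unfolding residually_fin_def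
proof (intro ballI impI)
  fix x assume x: "x \<in> carrier G" "x \<noteq> \<one>"
  then obtain N k where N: "N \<lhd> G" "closedin T N" "card (rcosets N) = p ^ k" "x \<notin> N"
    using p_residual_trivial[OF x(1)] by blast
  have "card (rcosets N) > 0" using N(3) p prime_gt_0_nat by simp
  then have "finite_index N G" unfolding finite_index_def by (simp add: card_gt_0_iff)
  then have "fin_index N (carrier G)" using finite_index_iff[of "carrier G" N] by (simp add: fin_index_def)
  then show "\<exists>N. N \<lhd> G \<and> closedin T N \<and> fin_index N (carrier G) \<and> x \<notin> N" using N by blast
qed

lemma infinite_A: "infinite A"
  using fin_index_finite[OF fin_index_A _ subgroup_A subset_refl] ji by (auto simp: JI_def)

text \<open>The quaternionic alternative for \<open>A\<close> extends to the whole group: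
  \<open>A\<close> is open, and every open normal subgroup contains some \<open>p^k A\<close>,
  whence its index is a power of 2.\<close>

theorem quaternionic_type_or_JI:
  assumes prof: "compact_space T \<Longrightarrow> profinite_group G T"
    and K: "subgroup K G" "closedin T K" "fin_index K (carrier G)"
  shows "quaternionic_type G T \<or> JI K"
proof -
  obtain r where r: "order (G Mod A) = p ^ r" by (rule order_Mod)
  interpret L: p_group_lattice "G\<lparr>carrier := A\<rparr>" "G Mod A" act "subtopology T A" p r
    by (rule p_group_lattice_A[OF r])
  have A1: "A \<noteq> {\<one>}" using infinite_A by auto
  have nontrivial: "carrier (G\<lparr>carrier := A\<rparr>) \<noteq> {\<one>\<^bsub>G\<lparr>carrier := A\<rparr>\<^esub>}" using A1 by simp
  show ?thesis
  proof (rule L.irreducible_lattice_cases[OF nontrivial], goal_cases)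
    case 1
    have "JI K"
    proof (rule JI_if_rank_one[OF _ K])
      fix N assume N: "subgroup N G" "N \<subseteq> A" "closedin T N" "N \<noteq> {\<one>}"
      then have "finite_index N (G\<lparr>carrier := A\<rparr>)"
        using subgroup_sub_iff[OF subgroup_A] closedin_closed_subtopology[OF closed_A] by (intro 1) simp_all
      then show "fin_index N A" using finite_index_iff[OF A_subset] by (simp add: fin_index_def)
    qed
    then show ?case ..
  next
    case (2 b x a)
    note p2 = 2(1) and compact_A = 2(2)
    have compact: "compact_space T"
      using compact_or_discrete
    proof
      \<comment> \<open>The infinite group \<open>A\<close> is compact, so it cannot be
        discrete.\<close>
      assume "T = discrete_topology (carrier G)"
      then show ?thesis using compact_A infinite_A A_subset by (simp add: Int_absorb1 compact_space_discrete_topology)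
    qed
    have hom_b: "act b \<in> hom (G\<lparr>carrier := A\<rparr>) (G\<lparr>carrier := A\<rparr>)" by (rule L.act_hom[OF 2(3)])
    interpret B: padic_basis "G\<lparr>carrier := A\<rparr>" "G Mod A" act "subtopology T A" p r "act b" a 4
      by unfold_locales (use hom_b 2(10) 2(11) 2(12) in auto)
    have Q: "(G Mod A) \<cong> Q16" by (rule Q.iso_Q16[OF 2(3,5,4,7,6,8,9)])
    have open_A: "openin T A" by (rule openin_if_fin_index[OF subgroup_A closed_A fin_index_A])
    have pro: "pro_p_group 2 G T"
      unfolding pro_p_group_def
    proof (intro conjI allI impI)
      show "profinite_group G T" by (rule prof[OF compact])
      fix N assume N: "N \<lhd> G \<and> openin T N"
      then have sN: "subgroup N G" by (simp add: normal_imp_subgroup)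
      have "openin (subtopology T A) (A \<inter> N)" using N by (simp add: openin_subtopology_Int2)
      then obtain k where k: "L.pmul k \<subseteq> A \<inter> N"
        by (rule B.pmul_subset_if_open[OF compact_A]) (use subgroup.one_closed[OF sN] subgroup.one_closed[OF subgroup_A] in auto)
      have spm: "subgroup (L.pmul k) G" using L.subgroup_pmul subgroup_sub_iff[OF subgroup_A] by blast
      have "fin_index (L.pmul k) A"
        using B.finite_index_pmul finite_index_iff[OF A_subset] by (simp add: fin_index_def)
      then have "fin_index (L.pmul k) (carrier G)" by (rule fin_index_trans[OF _ fin_index_A spm subgroup_A subgroup_self])
      then have fiN: "fin_index N (carrier G)" by (rule fin_index_mono[OF _ spm sN _ subset_refl]) (use k in blast)
      interpret N: normal N G using N by blast
      interpret NQ: group "G Mod N" by (rule N.factorgroup_is_group)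
      have car: "carrier (G Mod N) = (\<lambda>x. N #> x) ` carrier G" by (auto simp: FactGroup_def RCOSETS_def)
      obtain s where "order (G Mod N) = p ^ s"
      proof (rule NQ.order_prime_power[OF _ p])
        show "finite (carrier (G Mod N))" using fiN by (simp add: car fin_index_def)
        fix C assume "C \<in> carrier (G Mod N)"
        then obtain y where y: "y \<in> carrier G" "C = N #> y" by (auto simp: car)
        \<comment> \<open>One power of \<open>p\<close> leads from \<open>y\<close> into
          \<open>A\<close>, a second one from \<open>A\<close> into \<open>p^k A\<close> and thus
          into \<open>N\<close>.\<close>
        obtain j :: nat where j: "y [^] (p ^ j) \<in> A" using prime_power_in_A[OF y(1)] by blast
        have "(y [^] (p ^ j)) [^]\<^bsub>G\<lparr>carrier := A\<rparr>\<^esub> (int p ^ k) \<in> L.pmul k" using j by (intro L.pmul_I) simp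
        moreover have "(y [^] (p ^ j)) [^]\<^bsub>G\<lparr>carrier := A\<rparr>\<^esub> (int p ^ k) = y [^] (p ^ (j + k))"
          using int_pow_consistent[OF subgroup_A j, of "int p ^ k"] int_pow_int[of G "y [^] (p ^ j)" "p ^ k"] y(1)
          by (simp add: nat_pow_pow power_add)
        ultimately have "y [^] (p ^ (j + k)) \<in> N" using k by auto
        then have "N #> (y [^] (p ^ (j + k))) = N" using coset_join2[OF _ sN] y(1) by simp
        then have "C [^]\<^bsub>G Mod N\<^esub> (p ^ (j + k)) = \<one>\<^bsub>G Mod N\<^esub>" using N.FactGroup_pow[OF y(1)] y(2) by (simp add: FactGroup_def)
        then show "\<exists>j::nat. C [^]\<^bsub>G Mod N\<^esub> (p ^ j) = \<one>\<^bsub>G Mod N\<^esub>" by blast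
      qed (rule that)
      then show "\<exists>k. card (rcosets N) = 2 ^ k" by (auto simp: order_def FactGroup_def p2)
    qed
    have "just_infinite (G\<lparr>carrier := carrier G\<rparr>) (subtopology T (carrier G))"
      using closedin_topspace[of T] topspace_eq
      by (intro just_infinite_if_JI subgroup_self ji residually_fin) simp
    moreover have "subtopology T (carrier G) = T" using subtopology_topspace[of T] topspace_eq by simp
    ultimately have jiG: "just_infinite G T" by simp
    have faithful: "g \<in> A" if "g \<in> carrier G" "\<forall>a\<in>A. g \<otimes> a \<otimes> inv g = a" for g
      using centralizes_A[OF that(1)] that(2) by (simp add: conj_by_def)
    have iso: "B.coords \<in> iso (G\<lparr>carrier := A\<rparr>) (product_group {..<4} (\<lambda>_. padic_int_group 2))"
      using B.coords_iso[OF compact_A] by (simp add: p2)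
    have homeo: "homeomorphic_map (subtopology T A) (product_topology (\<lambda>_. padic_int_topology 2) {..<4}) B.coords"
      using B.coords_homeomorphic[OF compact_A] by (simp add: p2)
    have "quaternionic_type G T"
      unfolding quaternionic_type_def using jiG pro normal_A open_A iso homeo Q faithful by blast
    then show ?case ..
  qed
qed

end

section \<open>Passing to a group containing the given one with finite index\<close>

context hausdorff_group
begin

text \<open>Elements outside \<open>H\<close> are separated by \<open>H\<close> itself, the others
  by a subgroup of \<open>H\<close>; the core makes the separating subgroup normal in
  \<open>G\<close>.\<close>

lemma residually_fin_if_sub:
  assumes H: "subgroup H G" "closedin T H" "fin_index H (carrier G)"
    and rf: "\<And>x. x \<in> H \<Longrightarrow> x \<noteq> \<one> \<Longrightarrow> \<exists>N. subgroup N G \<and> N \<subseteq> H \<and> closedin T N \<and> fin_index N H \<and> x \<notin> N"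
  shows residually_fin
  unfolding residually_fin_def
proof (intro ballI impI)
  fix x assume x: "x \<in> carrier G" "x \<noteq> \<one>"
  obtain N where N: "subgroup N G" "closedin T N" "fin_index N (carrier G)" "x \<notin> N"
  proof (cases "x \<in> H")
    case True
    then obtain N where N: "subgroup N G" "N \<subseteq> H" "closedin T N" "fin_index N H" "x \<notin> N" using rf x(2) by blast
    moreover have "fin_index N (carrier G)" by (rule fin_index_trans[OF N(4) H(3) N(1) H(1) subgroup_self])
    ultimately show ?thesis using that by blast
  next
    case False
    then show ?thesis using that H by blast
  qed
  moreover have "x \<notin> core N" using core_subset[OF subgroup.subset[OF N(1)]] N(4) by blast
  ultimately show "\<exists>N. N \<lhd> G \<and> closedin T N \<and> fin_index N (carrier G) \<and> x \<notin> N"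
    using core_normal closedin_core fin_index_core by blast
qed

text \<open>If \<open>N\<close> meets \<open>K \<inter> H\<close> trivially, it is finite and
  centralises the normal core \<open>C\<close> of \<open>K \<inter> H\<close>. The centraliser
  \<open>D\<close> of \<open>C\<close> is normal in \<open>G\<close>, and
  \<open>D \<inter> C\<close> is a torsion-free central subgroup of finite index in it. The torsion
  elements of \<open>D\<close> therefore form a finite normal subgroup of \<open>G\<close>, and it
  contains \<open>N\<close>.\<close>

lemma JI_overgroup:
  assumes no_finite: "\<And>N. N \<lhd> G \<Longrightarrow> closedin T N \<Longrightarrow> finite N \<Longrightarrow> N = {\<one>}"
    and H: "subgroup H G" "closedin T H" "fin_index H (carrier G)"
    and hji: "\<And>K. subgroup K G \<Longrightarrow> K \<subseteq> H \<Longrightarrow> closedin T K \<Longrightarrow> fin_index K H \<Longrightarrow> JI K"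
    and K: "subgroup K G" "closedin T K" "fin_index K (carrier G)"
  shows "JI K"
  unfolding JI_def
proof (intro conjI allI impI)
  have hji': "JI L" if "subgroup L G" "L \<subseteq> H" "closedin T L" "fin_index L (carrier G)" for L
    using that fin_index_sub[OF that(4) subgroup.subset[OF H(1)]] by (intro hji) simp_all
  have KG: "K \<subseteq> carrier G" using K(1) by (rule subgroup.subset)
  have sKH: "subgroup (K \<inter> H) G" by (rule subgroups_Inter_pair[OF K(1) H(1)])
  have cKH: "closedin T (K \<inter> H)" by (rule closedin_Int[OF K(2) H(2)])
  have fKH: "fin_index (K \<inter> H) (carrier G)" by (rule fin_index_Int[OF K(3) H(3) K(1) H(1) subset_refl])
  have KH: "JI (K \<inter> H)" by (rule hji'[OF sKH _ cKH fKH]) blast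
  show "infinite K" using KH finite_subset[of "K \<inter> H" K] by (auto simp: JI_def)
  fix N assume "subgroup N G \<and> N \<subseteq> K \<and> closedin T N \<and> (\<forall>g\<in>K. \<forall>x\<in>N. conj_by g x \<in> N) \<and> N \<noteq> {\<one>}"
  then have N: "subgroup N G" "N \<subseteq> K" "closedin T N" "\<And>g x. g \<in> K \<Longrightarrow> x \<in> N \<Longrightarrow> conj_by g x \<in> N" "N \<noteq> {\<one>}"
    by auto
  have conjH: "conj_by g x \<in> H" if "g \<in> H" "x \<in> H" for g x
    using that H(1) by (simp add: conj_by_def subgroup.m_closed subgroup.m_inv_closed)
  let ?M = "N \<inter> (K \<inter> H)"
  have sM: "subgroup ?M G" by (rule subgroups_Inter_pair[OF N(1) sKH])
  have conjK: "conj_by g x \<in> K" if "g \<in> K" "x \<in> K" for g x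
    using that K(1) by (simp add: conj_by_def subgroup.m_closed subgroup.m_inv_closed)
  show "fin_index N K"
  proof (cases "?M = {\<one>}")
    case False
    have "fin_index ?M (K \<inter> H)"
      by (rule JI_D[OF KH sM _ closedin_Int[OF N(3) cKH] _ False]) (use N(4) conjH conjK in auto)
    then have "fin_index ?M (carrier G)" by (rule fin_index_trans[OF _ fKH sM sKH subgroup_self])
    then have "fin_index N (carrier G)" by (rule fin_index_mono[OF _ sM N(1) _ subset_refl]) blast
    then show ?thesis using KG by (rule fin_index_sub)
  next
    case True
    define C where "C = core (K \<inter> H)"
    have nC: "C \<lhd> G" unfolding C_def by (rule core_normal[OF sKH])
    have sC: "subgroup C G" by (rule normal_imp_subgroup[OF nC])
    have CG: "C \<subseteq> carrier G" using sC by (rule subgroup.subset)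
    have CKH: "C \<subseteq> K \<inter> H" unfolding C_def by (rule core_subset[OF subgroup.subset[OF sKH]])
    have fC: "fin_index C (carrier G)" unfolding C_def by (rule fin_index_core[OF sKH fKH])
    have cC: "closedin T C" unfolding C_def by (rule closedin_core[OF cKH])
    have jC: "JI C" by (rule hji'[OF sC _ cC fC]) (use CKH in blast)
    have conjC: "conj_by g x \<in> C" if "g \<in> carrier G" "x \<in> C" for g x
      using that nC by (simp add: normal_iff_conj_by)
    have NC: "N \<inter> C = {\<one>}" using True CKH subgroup.one_closed[OF N(1)] subgroup.one_closed[OF sC] by blast
    define D where "D = centralizer C"
    have sD: "subgroup D G" unfolding D_def by (rule subgroup_centralizer[OF CG])
    have DG: "D \<subseteq> carrier G" using sD by (rule subgroup.subset)
    have conjD: "conj_by g x \<in> D" if "g \<in> carrier G" "x \<in> D" for g x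
      using that conjC unfolding D_def by (intro conj_by_centralizer[OF CG]) simp_all
    have ND: "N \<subseteq> D"
    proof
      fix n assume n: "n \<in> N"
      have "n \<otimes> c = c \<otimes> n" if c: "c \<in> C" for c
      proof (rule commute_if_disjoint[OF N(1) sC NC _ _ n c])
        show "conj_by k m \<in> N" if "k \<in> C" "m \<in> N" for k m using that N(4) CKH by blast
        show "conj_by m k \<in> C" if "k \<in> C" "m \<in> N" for k m using that conjC N(2) KG by blast
      qed
      then show "n \<in> D" using n N(2) KG unfolding D_def centralizer_def by blast
    qed
    let ?Z = "D \<inter> C"
    have sZ: "subgroup ?Z G" by (rule subgroups_Inter_pair[OF sD sC])
    have cZ: "closedin T ?Z" unfolding D_def by (rule closedin_Int[OF closedin_centralizer[OF CG] cC])
    have central: "c \<otimes> d = d \<otimes> c" if "c \<in> ?Z" "d \<in> D" for c d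
      using that unfolding D_def centralizer_def by (blast intro: sym)
    have tf: "c = \<one>" if "c \<in> ?Z" "m > 0" "c [^] (m::nat) = \<one>" for c m
    proof (rule JI_abelian_torsion_free[OF sC jC sZ _ cZ _ _ that])
      show "conj_by g y \<in> ?Z" if "g \<in> C" "y \<in> ?Z" for g y using that conjD conjC CG by blast
      show "y \<otimes> z = z \<otimes> y" if "y \<in> ?Z" "z \<in> ?Z" for y z using that central by blast
    qed blast
    have fZ: "fin_index ?Z D"
      using fin_index_restrict[OF fC sC sD] by (simp add: Int_commute)
    define Tor where "Tor = {d \<in> D. \<exists>m>0. d [^] (m::nat) = \<one>}"
    note tor = torsion_central_by_finite[OF sD sZ Int_lower1 central fZ tf]
    have finT: "finite Tor" unfolding Tor_def by (rule tor(1); assumption)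
    have sT: "subgroup Tor G" unfolding Tor_def by (rule tor(2); assumption)
    have TG: "Tor \<subseteq> carrier G" using sT by (rule subgroup.subset)
    have conjT: "conj_by g x \<in> Tor" if "g \<in> carrier G" "x \<in> Tor" for g x
      using that conjD DG by (auto simp: Tor_def conj_by_nat_pow[symmetric] subset_iff)
    have T1: "Tor = {\<one>}"
      by (rule no_finite[OF _ closedin_if_finite[OF finT TG] finT]) (use sT conjT in \<open>simp add: normal_iff_conj_by\<close>)
    have finN: "finite N"
      by (rule finite_if_trivial_Int[OF fC sC N(1) NC])
    have "n \<in> Tor" if n: "n \<in> N" for n
    proof -
      interpret N: group "G\<lparr>carrier := N\<rparr>" by (rule subgroup_imp_group[OF N(1)])
      have "n [^]\<^bsub>G\<lparr>carrier := N\<rparr>\<^esub> order (G\<lparr>carrier := N\<rparr>) = \<one>\<^bsub>G\<lparr>carrier := N\<rparr>\<^esub>"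
        using n by (intro N.pow_order_eq_1) simp
      then have "n [^] card N = \<one>" by (simp add: order_def nat_pow_consistent[symmetric])
      moreover have "card N > 0" using finN n by (auto simp: card_gt_0_iff)
      ultimately show ?thesis using n ND by (auto simp: Tor_def)
    qed
    then have "N \<subseteq> {\<one>}" using T1 by blast
    then show ?thesis using N(5) subgroup.one_closed[OF N(1)] by blast
  qed
qed

end

theorem theorem2:
  fixes G :: "('a, 'b) monoid_scheme" and T :: "'a topology" and p :: nat and H :: "'a set"
  assumes "profinite_group G T \<or> discrete_group G T"
    and "carrier G \<noteq> {\<one>\<^bsub>G\<^esub>}"
    and "\<And>N. closed_normal_subgroup N G T \<Longrightarrow> finite N \<Longrightarrow> N = {\<one>\<^bsub>G\<^esub>}"
    and "Factorial_Ring.prime p"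
    and "closed_subgroup H G T" and "finite_index H G"
    and "p_residual p (G\<lparr>carrier := H\<rparr>) (subtopology T H) = {\<one>\<^bsub>G\<^esub>}"
    and "\<And>M. maximal_subgroup M (G\<lparr>carrier := H\<rparr>) (subtopology T H) \<Longrightarrow>
           finite_index M (G\<lparr>carrier := H\<rparr>) \<Longrightarrow>
           just_infinite (G\<lparr>carrier := M\<rparr>) (subtopology T M)"
    and "\<not> quaternionic_type (G\<lparr>carrier := H\<rparr>) (subtopology T H)"
  shows "hereditarily_just_infinite G T"
proof -
  interpret hausdorff_group G T
    using assms(1)
    by (auto simp: hausdorff_group_def hausdorff_group_axioms_def profinite_group_def discrete_group_def)
  have H: "subgroup H G" "closedin T H" using assms(5) by (simp_all add: closed_subgroup_def)
  have HG: "H \<subseteq> carrier G" using H(1) by (rule subgroup.subset)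
  have fH: "fin_index H (carrier G)"
    using assms(6) finite_index_iff[of "carrier G" H] by (simp add: fin_index_def)
  have no_finite: "N = {\<one>\<^bsub>G\<^esub>}" if "N \<lhd> G" "closedin T N" "finite N" for N
    using assms(3) that by (simp add: closed_normal_subgroup_def)
  \<comment> \<open>If \<open>H\<close> were finite, so would be \<open>G\<close>, a finite normal
    subgroup of itself; it would be trivial, which is excluded.\<close>
  have infH: "infinite H"
  proof
    assume "finite H"
    then have "finite (carrier G)" by (rule fin_index_finite[OF fH _ H(1) subset_refl])
    moreover have "carrier G \<lhd> G" by (simp add: normal_iff_conj_by subgroup_self)
    moreover have "closedin T (carrier G)" using closedin_topspace[of T] topspace_eq by simp
    ultimately show False using no_finite assms(2) by blast
  qed
  let ?H = "G\<lparr>carrier := H\<rparr>" and ?T = "subtopology T H"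
  interpret H: hausdorff_group ?H ?T
    using topological_group_sub[OF H(1)] Hausdorff_space_subtopology[OF Hausdorff]
    by (simp add: hausdorff_group_def hausdorff_group_axioms_def)
  have fin_index_H: "H.fin_index K L \<longleftrightarrow> fin_index K L" for K L
    by (simp add: H.fin_index_def fin_index_def r_coset_def)
  have finite_index_H: "finite_index K ?H \<longleftrightarrow> fin_index K H" for K
    using finite_index_iff[OF HG] by (simp add: fin_index_def)
  have residual: "x = \<one>\<^bsub>G\<^esub>" if x: "x \<in> H"
    and all: "\<And>N k. N \<lhd> ?H \<Longrightarrow> closedin ?T N \<Longrightarrow> card (rcosets\<^bsub>?H\<^esub> N) = p ^ k \<Longrightarrow> x \<in> N" for x
  proof -
    have "x \<in> p_residual p ?H ?T"
      unfolding p_residual_def closed_normal_subgroup_def using all by blast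
    then show ?thesis using assms(7) by simp
  qed
  have rfH: "H.residually_fin"
    unfolding H.residually_fin_def
  proof (intro ballI impI)
    fix x assume x: "x \<in> carrier ?H" "x \<noteq> \<one>\<^bsub>?H\<^esub>"
    then obtain N k where N: "N \<lhd> ?H" "closedin ?T N" "card (rcosets\<^bsub>?H\<^esub> N) = p ^ k" "x \<notin> N"
      using residual[of x] by auto
    have "card (rcosets\<^bsub>?H\<^esub> N) > 0" using N(3) assms(4) prime_gt_0_nat by simp
    then have "finite_index N ?H" unfolding finite_index_def by (simp add: card_gt_0_iff)
    then have "H.fin_index N (carrier ?H)" by (simp add: finite_index_H fin_index_H)
    then show "\<exists>N. N \<lhd> ?H \<and> closedin ?T N \<and> H.fin_index N (carrier ?H) \<and> x \<notin> N" using N by blast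
  qed
  have max: "H.JI M" if M: "H.max_fin M" for M
  proof (rule H.JI_if_just_infinite[OF H.max_fin_D(1,2)[OF M]])
    have "M \<subseteq> H" using subgroup.subset[OF H.max_fin_D(1)[OF M]] by simp
    then have "subtopology ?T M = subtopology T M" by (simp add: subtopology_subtopology Int_absorb1)
    moreover have "just_infinite (G\<lparr>carrier := M\<rparr>) (subtopology T M)"
      using M by (intro assms(8)) (simp_all add: H.max_fin_def finite_index_H fin_index_H)
    ultimately show "just_infinite (?H\<lparr>carrier := M\<rparr>) (subtopology ?T M)" by simp
  qed
  have jiH: "H.JI (carrier ?H)"
    by (rule H.JI_carrier_if_max_fin[OF rfH _ max]) (use infH in simp_all)
  have compact_or_discrete: "compact_space ?T \<or> ?T = discrete_topology (carrier ?H)"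
    using assms(1)
  proof
    assume "profinite_group G T"
    then have "compactin T H" using closedin_compact_space[OF _ H(2)] by (simp add: profinite_group_def)
    then show ?thesis using compact_space_subtopology by blast
  next
    assume "discrete_group G T"
    then show ?thesis using HG by (simp add: discrete_group_def Int_absorb1)
  qed
  have profinite: "profinite_group ?H ?T" if compact: "compact_space ?T"
  proof -
    have "profinite_group G T"
      using assms(1)
    proof
      assume "discrete_group G T"
      then have "?T = discrete_topology H" using HG by (simp add: discrete_group_def Int_absorb1)
      then show ?thesis using compact infH by (simp add: compact_space_discrete_topology)
    qed
    then have td: "connected_component_of_set T x = {x}" if "x \<in> carrier G" for x
      using that by (simp add: profinite_group_def totally_disconnected_space_def topspace_eq)
    have "connected_component_of_set ?T x = {x}" if x: "x \<in> topspace ?T" for x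
    proof -
      have xH: "x \<in> H" using x by simp
      have "connected_component_of_set ?T x \<subseteq> connected_component_of_set T x"
        by (auto simp: connected_component_of_def connectedin_subtopology)
      moreover have "x \<in> connected_component_of_set ?T x" using x by (simp add: connected_component_of_refl)
      ultimately show ?thesis using td xH HG by blast
    qed
    then have "totally_disconnected_space ?T" by (simp add: totally_disconnected_space_def)
    then show ?thesis
      using compact H.topological_group_axioms H.Hausdorff by (simp add: profinite_group_def)
  qed
  \<comment> \<open>The two locales share out the cases according to whether \<open>H\<close> has a
    nontrivial closed abelian normal subgroup.\<close>
  have HJI: "H.JI K" if K: "subgroup K ?H" "closedin ?T K" "H.fin_index K (carrier ?H)" for K
  proof (cases "\<exists>N. N \<lhd> ?H \<and> closedin ?T N \<and> N \<noteq> {\<one>\<^bsub>?H\<^esub>} \<and>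
      (\<forall>x\<in>N. \<forall>y\<in>N. x \<otimes>\<^bsub>?H\<^esub> y = y \<otimes>\<^bsub>?H\<^esub> x)")
    case True
    then obtain N where N: "N \<lhd> ?H" "closedin ?T N" "N \<noteq> {\<one>\<^bsub>?H\<^esub>}"
      "\<And>x y. x \<in> N \<Longrightarrow> y \<in> N \<Longrightarrow> x \<otimes>\<^bsub>?H\<^esub> y = y \<otimes>\<^bsub>?H\<^esub> x" by blast
    obtain A where A: "A \<lhd> ?H" "closedin ?T A" "H.fin_index A (carrier ?H)"
      "\<And>x y. x \<in> A \<Longrightarrow> y \<in> A \<Longrightarrow> x \<otimes>\<^bsub>?H\<^esub> y = y \<otimes>\<^bsub>?H\<^esub> x" "H.centralizer A \<subseteq> A"
      by (rule H.ex_self_centralizing[OF jiH N]) (assumption | rule that; assumption)+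
    interpret ji_virtually_abelian ?H ?T A p
    proof (rule ji_virtually_abelian.intro[OF H.hausdorff_group_axioms], rule ji_virtually_abelian_axioms.intro)
      show "x = \<one>\<^bsub>?H\<^esub>" if "x \<in> carrier ?H"
        "\<And>N k. N \<lhd> ?H \<Longrightarrow> closedin ?T N \<Longrightarrow> card (rcosets\<^bsub>?H\<^esub> N) = p ^ k \<Longrightarrow> x \<in> N" for x
        using residual[of x] that by simp
    qed (use jiH A assms(4) compact_or_discrete max in simp_all)
    show ?thesis using quaternionic_type_or_JI[OF profinite K] assms(9) by blast
  next
    case False
    interpret ji_nonabelian ?H ?T
      by unfold_locales (use jiH False in blast)+
    show ?thesis by (rule JI_fin_index[OF max K])
  qed
  \<comment> \<open>The same property read in \<open>G\<close> instead of \<open>H\<close>: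
    conjugation, closedness and index agree for subgroups of \<open>H\<close>.\<close>
  have hji: "JI K" if K: "subgroup K G" "K \<subseteq> H" "closedin T K" "fin_index K H" for K
    unfolding JI_def
  proof (intro conjI allI impI)
    have "H.JI K"
      using K by (intro HJI) (simp_all add: subgroup_sub_iff[OF H(1)] closedin_closed_subtopology[OF H(2)] fin_index_H)
    then show "infinite K" by (simp add: H.JI_def)
    fix N assume N: "subgroup N G \<and> N \<subseteq> K \<and> closedin T N \<and> (\<forall>g\<in>K. \<forall>x\<in>N. conj_by g x \<in> N) \<and> N \<noteq> {\<one>\<^bsub>G\<^esub>}"
    have "H.fin_index N K"
    proof (rule H.JI_D[OF \<open>H.JI K\<close>])
      show "subgroup N ?H" using N K(2) by (auto simp: subgroup_sub_iff[OF H(1)])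
      show "closedin ?T N" using N K(2) by (auto simp: closedin_closed_subtopology[OF H(2)])
      show "H.conj_by g x \<in> N" if "g \<in> K" "x \<in> N" for g x
        using N that K(2) conj_by_sub[OF H(1), of g x] by auto
    qed (use N in simp_all)
    then show "fin_index N K" by (simp add: fin_index_H)
  qed
  have rf: residually_fin
  proof (rule residually_fin_if_sub[OF H fH])
    fix x assume "x \<in> H" "x \<noteq> \<one>\<^bsub>G\<^esub>"
    then obtain N where N: "N \<lhd> ?H" "closedin ?T N" "H.fin_index N (carrier ?H)" "x \<notin> N"
      using rfH unfolding H.residually_fin_def by auto
    then show "\<exists>N. subgroup N G \<and> N \<subseteq> H \<and> closedin T N \<and> fin_index N H \<and> x \<notin> N"
      using normal_sub_iff[OF H(1)] closedin_closed_subtopology[OF H(2)] fin_index_H by auto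
  qed
  show ?thesis
    unfolding hereditarily_just_infinite_def
  proof (intro allI impI)
    fix K assume "closed_subgroup K G T \<and> finite_index K G"
    then have K: "subgroup K G" "closedin T K" "fin_index K (carrier G)"
      using finite_index_iff[of "carrier G" K] by (simp_all add: closed_subgroup_def fin_index_def)
    show "just_infinite (G\<lparr>carrier := K\<rparr>) (subtopology T K)"
      by (rule just_infinite_if_JI[OF K(1,2) JI_overgroup[OF no_finite H fH hji K] rf])
  qed
qed

end
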